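(* There is a polynomial-time randomized algorithm for checking for generic global rigidity in $\mathbb{E}^d$, i.e. for checking, given a graph $\Gamma$, whether $\Gamma$ is generically globally rigid in $\mathbb{E}^d$.
   Context: A graph $\Gamma$ has a finite vertex set $\mathcal V$ of size $v$ and an edge set $\mathcal E$ of two-element subsets of $\mathcal V$. A framework $\rho$ of $\Gamma$ in $d$-dimensional Euclidean space $\mathbb{E}^d$ is the graph together with a map $\mathcal V\to\mathbb{E}^d$; $C^d(\Gamma)$ is the space of all frameworks of $\Gamma$ in $\mathbb{E}^d$. A framework $\rho\in C^d(\Gamma)$ is globally rigid if every framework $\sigma\in C^d(\Gamma)$ with $|\sigma(u)-\sigma(w)|=|\rho(u)-\rho(w)|$ for all edges $\{u,w\}\in\mathcal E$ is congruent to $\rho$, i.e. is related to $\rho$ by a rigid motion of $\mathbb{E}^d$ (rotations, reflections and translations). A framework $\rho$ is generic if its $vd$ coordinates satisfy no non-trivial algebraic equation with rational coefficients. It is known that either all generic frameworks in $C^d(\Gamma)$ are globally rigid or none of them are; $\Gamma$ is called generically globally rigid in $\mathbb{E}^d$ in the former case. *)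

theory Defs
  imports
    "HOL-Probability.Probability"
    "HOL-Library.Poly_Mapping"
    "HOL-Library.FuncSet"
    "HOL-Library.Log_Nat"
    "HOL-Computational_Algebra.Polynomial"
begin

section \<open>Frameworks and generic global rigidity\<close>

definition graph :: "'a set \<Rightarrow> 'a set set \<Rightarrow> bool" where
  "graph V E \<longleftrightarrow> finite V \<and> (\<forall>e\<in>E. e \<subseteq> V \<and> card e = 2)"

definition frameworks :: "'a set \<Rightarrow> ('a \<Rightarrow> real ^ 'd) set" where
  "frameworks V = (V \<rightarrow>\<^sub>E UNIV)"

definition rigid_motion :: "(real ^ 'd \<Rightarrow> real ^ 'd) \<Rightarrow> bool" where
  "rigid_motion T \<longleftrightarrow> (\<exists>f b. orthogonal_transformation f \<and> T = (\<lambda>x. f x + b))"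

definition congruent_frameworks ::
    "'a set \<Rightarrow> ('a \<Rightarrow> real ^ 'd) \<Rightarrow> ('a \<Rightarrow> real ^ 'd) \<Rightarrow> bool" where
  "congruent_frameworks V \<rho> \<sigma> \<longleftrightarrow> (\<exists>T. rigid_motion T \<and> (\<forall>u\<in>V. \<sigma> u = T (\<rho> u)))"

definition globally_rigid :: "'a set \<Rightarrow> 'a set set \<Rightarrow> ('a \<Rightarrow> real ^ 'd) \<Rightarrow> bool" where
  "globally_rigid V E \<rho> \<longleftrightarrow>
     (\<forall>\<sigma>\<in>frameworks V.
        (\<forall>u w. {u, w} \<in> E \<longrightarrow> norm (\<sigma> u - \<sigma> w) = norm (\<rho> u - \<rho> w)) \<longrightarrow>
        congruent_frameworks V \<rho> \<sigma>)"

text \<open>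
  Multivariate polynomials over the rationals with variables of type \<open>'x\<close> are finitely
  supported maps from monomials to coefficients; a monomial is a finitely supported map
  from variables to exponents.
\<close>

type_synonym 'x rat_mpoly = "('x \<Rightarrow>\<^sub>0 nat) \<Rightarrow>\<^sub>0 rat"

definition mpoly_vars :: "'x rat_mpoly \<Rightarrow> 'x set" where
  "mpoly_vars p = (\<Union>m\<in>Poly_Mapping.keys p. Poly_Mapping.keys m)"

definition mpoly_eval :: "('x \<Rightarrow> real) \<Rightarrow> 'x rat_mpoly \<Rightarrow> real" where
  "mpoly_eval a p =
     (\<Sum>m\<in>Poly_Mapping.keys p. of_rat (Poly_Mapping.lookup p m) *
        (\<Prod>x\<in>Poly_Mapping.keys m. a x ^ Poly_Mapping.lookup m x))"

definition generic :: "'a set \<Rightarrow> ('a \<Rightarrow> real ^ 'd) \<Rightarrow> bool" where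
  "generic V \<rho> \<longleftrightarrow>
     (\<forall>p :: ('a \<times> 'd) rat_mpoly.
        mpoly_vars p \<subseteq> V \<times> UNIV \<and> mpoly_eval (\<lambda>(u, i). \<rho> u $ i) p = 0 \<longrightarrow> p = 0)"

text \<open>The dimension \<open>d\<close> is \<open>CARD('d)\<close>.\<close>

definition generically_globally_rigid ::
    "'d::finite itself \<Rightarrow> 'a set \<Rightarrow> 'a set set \<Rightarrow> bool" where
  "generically_globally_rigid (D :: 'd itself) V E \<longleftrightarrow>
     (\<forall>\<rho> :: 'a \<Rightarrow> real ^ 'd. \<rho> \<in> frameworks V \<and> generic V \<rho> \<longrightarrow> globally_rigid V E \<rho>)"


section \<open>Randomized polynomial time\<close>

text \<open>
  Algorithms are programs of a random access machine with indirect addressing and a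
  coin-tossing instruction. Memory cells hold natural numbers of arbitrary size, and time is
  measured by the logarithmic cost criterion: every number that is read, written, used as an
  address or used as an operand is charged its binary length. Under this criterion the machine
  is polynomially equivalent to a probabilistic multitape Turing machine, in spite of
  the multiplication instruction.
\<close>

datatype expr =
    Const nat
  | Mem expr
  | Add expr expr
  | Sub expr expr
  | Mul expr expr
  | Div expr expr
  | Mod expr expr

datatype prog =
    Skip
  | Store expr expr
  | Toss expr
  | Seq prog prog
  | IfNZ expr prog prog
  | WhileNZ expr prog

type_synonym store = "nat \<Rightarrow> nat"

definition bits :: "nat \<Rightarrow> nat" where
  "bits n = max 1 (floorlog 2 n)"

text \<open>\<open>Sub\<close> is truncated, and division by zero follows the conventions of type \<^typ>\<open>nat\<close>.\<close>

fun eval_expr :: "expr \<Rightarrow> store \<Rightarrow> nat" where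
  "eval_expr (Const n) s = n"
| "eval_expr (Mem a) s = s (eval_expr a s)"
| "eval_expr (Add a b) s = eval_expr a s + eval_expr b s"
| "eval_expr (Sub a b) s = eval_expr a s - eval_expr b s"
| "eval_expr (Mul a b) s = eval_expr a s * eval_expr b s"
| "eval_expr (Div a b) s = eval_expr a s div eval_expr b s"
| "eval_expr (Mod a b) s = eval_expr a s mod eval_expr b s"

fun cost_expr :: "expr \<Rightarrow> store \<Rightarrow> nat" where
  "cost_expr (Const n) s = bits n"
| "cost_expr (Mem a) s = cost_expr a s + bits (eval_expr a s) + bits (s (eval_expr a s))"
| "cost_expr (Add a b) s = cost_expr a s + cost_expr b s + bits (eval_expr a s) + bits (eval_expr b s)"
| "cost_expr (Sub a b) s = cost_expr a s + cost_expr b s + bits (eval_expr a s) + bits (eval_expr b s)"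
| "cost_expr (Mul a b) s = cost_expr a s + cost_expr b s + bits (eval_expr a s) + bits (eval_expr b s)"
| "cost_expr (Div a b) s = cost_expr a s + cost_expr b s + bits (eval_expr a s) + bits (eval_expr b s)"
| "cost_expr (Mod a b) s = cost_expr a s + cost_expr b s + bits (eval_expr a s) + bits (eval_expr b s)"

text \<open>
  \<open>exec c s r t s' r'\<close>: started in store \<open>s\<close> with the coin tosses \<open>r\<close> to come, \<open>c\<close> halts
  after time \<open>t\<close> in store \<open>s'\<close>, and \<open>r'\<close> are the unused tosses. A \<open>Toss\<close> with no coins
  left does not halt.
\<close>

inductive exec ::
    "prog \<Rightarrow> store \<Rightarrow> bool list \<Rightarrow> nat \<Rightarrow> store \<Rightarrow> bool list \<Rightarrow> bool" where
  exec_Skip: "exec Skip s r 1 s r"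
| exec_Store: "exec (Store a b) s r
     (1 + cost_expr a s + cost_expr b s + bits (eval_expr a s) + bits (eval_expr b s))
     (s(eval_expr a s := eval_expr b s)) r"
| exec_Toss: "exec (Toss a) s (x # r) (1 + cost_expr a s + bits (eval_expr a s))
     (s(eval_expr a s := of_bool x)) r"
| exec_Seq: "exec c1 s r t1 s1 r1 \<Longrightarrow> exec c2 s1 r1 t2 s2 r2 \<Longrightarrow>
     exec (Seq c1 c2) s r (t1 + t2) s2 r2"
| exec_IfTrue: "eval_expr a s \<noteq> 0 \<Longrightarrow> exec c1 s r t s1 r1 \<Longrightarrow>
     exec (IfNZ a c1 c2) s r (1 + cost_expr a s + t) s1 r1"
| exec_IfFalse: "eval_expr a s = 0 \<Longrightarrow> exec c2 s r t s1 r1 \<Longrightarrow>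
     exec (IfNZ a c1 c2) s r (1 + cost_expr a s + t) s1 r1"
| exec_WhileFalse: "eval_expr a s = 0 \<Longrightarrow> exec (WhileNZ a c) s r (1 + cost_expr a s) s r"
| exec_WhileTrue: "eval_expr a s \<noteq> 0 \<Longrightarrow> exec c s r t1 s1 r1 \<Longrightarrow>
     exec (WhileNZ a c) s1 r1 t2 s2 r2 \<Longrightarrow>
     exec (WhileNZ a c) s r (1 + cost_expr a s + t1 + t2) s2 r2"

inductive_cases exec_SkipE: "exec Skip s r t s' r'"
inductive_cases exec_StoreE: "exec (Store a b) s r t s' r'"
inductive_cases exec_TossE: "exec (Toss a) s r t s' r'"
inductive_cases exec_SeqE: "exec (Seq c1 c2) s r t s' r'"
inductive_cases exec_IfE: "exec (IfNZ a c1 c2) s r t s' r'"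
inductive_cases exec_WhileE: "exec (WhileNZ a c) s r t s' r'"

lemma exec_deterministic:
  assumes "exec c s r t s1 r1" and "exec c s r t' s1' r1'"
  shows "t' = t \<and> s1' = s1 \<and> r1' = r1"
  using assms
proof (induction arbitrary: t' s1' r1' rule: exec.induct)
  case (exec_Skip s r)
  then show ?case by (auto elim: exec_SkipE)
next
  case (exec_Store a b s r)
  then show ?case by (auto elim: exec_StoreE)
next
  case (exec_Toss a s x r)
  from exec_Toss.prems show ?case
    by (rule exec_TossE) simp
next
  case (exec_Seq c1 s r t1 s1 r1 c2 t2 s2 r2)
  from exec_Seq.prems obtain u1 v1 q1 u2 where
    "exec c1 s r u1 v1 q1" "exec c2 v1 q1 u2 s1' r1'" "t' = u1 + u2"
    by (rule exec_SeqE)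
  with exec_Seq.IH(1)[of u1 v1 q1] exec_Seq.IH(2)[of u2 s1' r1'] show ?case by simp
next
  case (exec_IfTrue a s c1 r t s1 r1 c2)
  from exec_IfTrue.prems obtain u where "exec c1 s r u s1' r1'" "t' = 1 + cost_expr a s + u"
    by (rule exec_IfE) (use exec_IfTrue.hyps(1) in simp_all)
  with exec_IfTrue.IH[of u s1' r1'] show ?case by simp
next
  case (exec_IfFalse a s c2 r t s1 r1 c1)
  from exec_IfFalse.prems obtain u where "exec c2 s r u s1' r1'" "t' = 1 + cost_expr a s + u"
    by (rule exec_IfE) (use exec_IfFalse.hyps(1) in simp_all)
  with exec_IfFalse.IH[of u s1' r1'] show ?case by simp
next
  case (exec_WhileFalse a s c r)
  from exec_WhileFalse.prems show ?case
    by (rule exec_WhileE) (use exec_WhileFalse.hyps in simp_all)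
next
  case (exec_WhileTrue a s c r t1 s1 r1 t2 s2 r2)
  from exec_WhileTrue.prems obtain u1 v1 q1 u2 where
    "exec c s r u1 v1 q1" "exec (WhileNZ a c) v1 q1 u2 s1' r1'"
    "t' = 1 + cost_expr a s + u1 + u2"
    by (rule exec_WhileE) (use exec_WhileTrue.hyps(1) in simp_all)
  with exec_WhileTrue.IH(1)[of u1 v1 q1] exec_WhileTrue.IH(2)[of u2 s1' r1'] show ?case by simp
qed

lemma exec_tosses_le_time:
  assumes "exec c s r t s' r'"
  shows "length r \<le> length r' + t"
  using assms by induction auto

text \<open>
  The input is presented in memory: cell 0 holds its length, cells \<open>1, 2, \<dots>\<close> its bits, and all
  other cells are 0. The answer is read off from cell 0.
\<close>

definition input_store :: "bool list \<Rightarrow> store" where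
  "input_store x i =
     (if i = 0 then length x else if i \<le> length x then of_bool (x ! (i - 1)) else 0)"

definition halts_within :: "nat \<Rightarrow> prog \<Rightarrow> bool list \<Rightarrow> bool list \<Rightarrow> bool" where
  "halts_within n c x r \<longleftrightarrow> (\<exists>t s' r'. exec c (input_store x) r t s' r' \<and> t \<le> n)"

definition answers :: "prog \<Rightarrow> bool list \<Rightarrow> bool list \<Rightarrow> bool \<Rightarrow> bool" where
  "answers c x r b \<longleftrightarrow>
     (\<exists>t s' r'. exec c (input_store x) r t s' r' \<and> (b \<longleftrightarrow> s' 0 \<noteq> 0))"

text \<open>
  A program decides, with bounded error and in polynomial time, between the inputs in \<open>Y\<close>
  (answer yes) and those in \<open>N\<close> (answer no). The time bound holds for every outcome of the coin
  tosses. Since each toss takes at least one unit of time, fair tosses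
  in the number of the time bound are all the randomness that can be used.
\<close>

definition randomized_poly_time_decides :: "prog \<Rightarrow> bool list set \<Rightarrow> bool list set \<Rightarrow> bool" where
  "randomized_poly_time_decides c Y N \<longleftrightarrow>
     (\<exists>p :: nat poly. \<forall>x\<in>Y \<union> N.
        (let n = poly p (length x); tosses = {r :: bool list. length r = n} in
           (\<forall>r\<in>tosses. halts_within n c x r) \<and>
           (x \<in> Y \<longrightarrow> measure_pmf.prob (pmf_of_set tosses) {r. answers c x r True} \<ge> 2 / 3) \<and>
           (x \<in> N \<longrightarrow> measure_pmf.prob (pmf_of_set tosses) {r. answers c x r False} \<ge> 2 / 3)))"

text \<open>
  A graph is given to a program by its adjacency matrix, row by row, with respect to an
  enumeration \<open>vs\<close> of its vertices.
\<close>

definition adjacency_bits :: "'a list \<Rightarrow> 'a set set \<Rightarrow> bool list" where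
  "adjacency_bits vs E = concat (map (\<lambda>u. map (\<lambda>w. {u, w} \<in> E) vs) vs)"

definition graph_encodings :: "(nat set \<Rightarrow> nat set set \<Rightarrow> bool) \<Rightarrow> bool list set" where
  "graph_encodings P =
     {adjacency_bits vs E | V E vs. graph V E \<and> distinct vs \<and> set vs = V \<and> P V E}"

end

theory Submission
  imports Defs
begin

text \<open>
  By the theorem of Gortler, Healy and Thurston, on at least \<open>d + 2\<close> vertices generic global rigidity
  is the existence of an infinitesimally rigid framework with an equilibrium stress whose stress matrix has only the
  affine functions in its kernel. Such a stress forces equivalent frameworks to be affine images
  of a generic one, because it is a stress of all of them; conversely, if all kernels are too large, the map from
  frameworks in the kernel of a stress to their edge lengths has a fold at a regular value,
  which yields equivalent frameworks that are not congruent. Genericity is exploited throughout by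
  derivations of the reals: the values at a generic point of a derivation over a countable field are arbitrary.

  Both rank conditions are nonvanishing of coefficients of characteristic polynomials, namely of the
  Gram matrix of the rows of the rigidity matrix and of the stress matrix. A stress is obtained
  polynomially from arbitrary edge weights by applying the adjugate-like matrix of the
  Faddeev--LeVerrier recursion, which annihilates the rigidity matrix when its rank is as expected. This recursion needs
  no division, so it can be run modulo a power of two that exceeds the certificates, on random integers
  that by the lemma of Schwartz and Zippel rarely annihilate a nonzero certificate. On fewer than
  \<open>d + 2\<close> vertices only complete graphs are generically globally rigid.
\<close>

text \<open>The hard direction is to flip a generic framework when all stress kernels are too large.
  In place of a count of preimages modulo 2, a ray is followed. On the kernel of a stress that is
  generic among the stresses of \<open>x\<close>, squared lengths are quadratic forms. From the
  lengths of \<open>x\<close> the ray runs in a generic direction in which some squared length would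
  become negative; properness yields a last realizable point. There the differential of the lengths
  is singular, and the length of a further pair \<open>e0\<close> serves as local parameter: the ray
  parameter drops on both sides of its maximum, so slightly earlier points are realized twice.
  Rotations would make every differential singular. They are removed by making a \<open>d\<close> by
  \<open>d\<close> block of the configuration triangular, which needs a nonsingular block; on a
  generic ray a configuration of lower rank has too few unknowns, so such a block exists. The
  algorithm errs on one side only: a certificate that is nonzero modulo the power of two is nonzero,
  hence nonzero at every generic framework.\<close>

abbreviation kr :: "'a => 'a => 'b::zero_neq_one" where "kr i j == if i = j then 1 else 0"

abbreviation sum_univ :: "('a => 'b) => 'b::comm_monoid_add" (binder "SU " 10) where "sum_univ f == sum f UNIV"

abbreviation (input) "ggr == generically_globally_rigid"
abbreviation "keys == Poly_Mapping.keys"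
abbreviation "lookup == Poly_Mapping.lookup"
abbreviation "sg == Poly_Mapping.single"

notation iff (infixr "<->" 25) and LIMSEQ (infix "---->" 60)

lemmas sum_left = sum_distrib_left and sum_right = sum_distrib_right

lemma if_mult: "(if b then y else z) * x = (if b then y * x else z * x :: 'a::times)"
  and mult_if: "x * (if b then y else z) = (if b then x * y else x * z :: 'a::times)"
  by simp_all

text \<open>Associativity of products of matrices and vectors, for the orders of factors that
  occur.\<close>

lemma sum_assoc:
 fixes x :: "'j => 'c::comm_semiring_0"
 shows "(SUM j:J. (SUM k:K. c k * s k j) * x j) = (SUM k:K. c k * (SUM j:J. s k j * x j))"
  and "(SUM j:J. x j * (SUM k:K. c k * s k j)) = (SUM k:K. c k * (SUM j:J. x j * s k j))"
  and "(SUM j:J. (SUM k:K. s k j * c k) * x j) = (SUM k:K. c k * (SUM j:J. s k j * x j))"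
  and "(SUM j:J. (SUM k:K. s k j * c k) * x j) = (SUM k:K. (SUM j:J. s k j * x j) * c k)"
 unfolding sum_left sum_right by (subst sum.swap, simp add: mult_ac)+

section \<open>Derivations of the reals\<close>

definition derivation :: "(real => real) => bool" where
 "derivation D <-> (ALL x y. D (x + y) = D x + D y) & (ALL x y. D (x * y) = x * D y + D x * y)"

text \<open>The graph of a derivation from a subring of the reals into the reals. Being closed under
  differences, it is single-valued as soon as only 0 lies over 0.\<close>

definition der_graph :: "(real * real) set => bool" where
 "der_graph G <-> (1, 0) : G &
   (ALL x a y b. (x, a) : G --> (y, b) : G --> (x + y, a + b) : G & (x * y, x * b + a * y) : G) &
   (ALL x a. (x, a) : G --> (- x, - a) : G) & (ALL a. (0, a) : G --> a = 0)"

lemma der_graph_Union_chain: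
 assumes "C : chains {G. der_graph G & G0 <= G}" "C ~= {}"
 shows "der_graph (\<Union>C)"
proof -
 have dg: "der_graph G" if "G : C" for G
  using assms(1) that unfolding chains_def by auto
 have ch: "EX Z:C. X <= Z & Y <= Z" if "X : C" "Y : C" for X Y
 proof -
  have "chain\<^sub>\<subseteq> C" using assms(1) unfolding chains_def by simp
  hence "X <= Y | Y <= X" using that unfolding chain_subset_def by simp
  thus ?thesis using that by auto
 qed
 show ?thesis
  unfolding der_graph_def
 proof (intro conjI allI impI)
  show "(1, 0) : \<Union>C" using assms(2) dg unfolding der_graph_def by auto
 next
  fix x a y b assume "(x, a) : \<Union>C" "(y, b) : \<Union>C"
  then obtain Z where "Z : C" "(x, a) : Z" "(y, b) : Z" using ch by blast
  thus "(x + y, a + b) : \<Union>C" "(x * y, x * b + a * y) : \<Union>C"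
   using dg[of Z] unfolding der_graph_def by blast+
 next
  fix x a assume "(x, a) : \<Union>C"
  thus "(- x, - a) : \<Union>C" using dg unfolding der_graph_def by auto
 next
  fix a assume "(0, a) : \<Union>C"
  thus "a = 0" using dg unfolding der_graph_def by auto
 qed
qed

text \<open>With domain \<open>A\<close>, a derivation on \<open>A[z]\<close> is fixed by its value
  \<open>w\<close> at \<open>z\<close>, and it is well defined iff \<open>w\<close> respects every
  relation \<open>q(z) = 0\<close> over \<open>A\<close>. A transcendental \<open>z\<close> leaves
  \<open>w\<close> free; for an algebraic \<open>z\<close> a relation of least degree determines
  it.\<close>

lemma der_graph_adjoin:
 assumes G: "der_graph G"
 shows "EX G'. der_graph G' & G <= G' & z : fst ` G'"
proof -
 define A where "A = fst ` G"
 define dl where "dl x = (THE a. (x, a) : G)" for x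
 have one: "(1, 0) : G" and neg: "!!x a. (x, a) : G ==> (- x, - a) : G"
  and z0: "!!a. (0, a) : G ==> a = 0"
  and plus: "!!x a y b. (x, a) : G ==> (y, b) : G ==> (x + y, a + b) : G"
  and times: "!!x a y b. (x, a) : G ==> (y, b) : G ==> (x * y, x * b + a * y) : G"
  using G unfolding der_graph_def by blast+
 have uniq: "a = b" if "(x, a) : G" "(x, b) : G" for x a b
  using z0[of "a - b"] plus[OF that(1) neg[OF that(2)]] by simp
 have dlI: "dl x = a" if "(x, a) : G" for x a
  unfolding dl_def using that uniq by (intro the_equality) auto
 have dl: "(x, dl x) : G" if "x : A" for x
  using that dlI unfolding A_def by auto
 have zero: "(0, 0) : G" using plus[OF one neg[OF one]] by simp
 have dl0 [simp]: "dl 0 = 0" using dlI[OF zero] .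
 have A0 [simp]: "0 : A" and A1 [simp]: "1 : A" using zero one unfolding A_def by force+
 have Aplus: "x + y : A" and dlplus: "dl (x + y) = dl x + dl y" if "x : A" "y : A" for x y
  using plus[OF dl[OF that(1)] dl[OF that(2)]] dlI unfolding A_def by (force, blast)
 have Atimes: "x * y : A" and dltimes: "dl (x * y) = x * dl y + dl x * y" if "x : A" "y : A" for x y
  using times[OF dl[OF that(1)] dl[OF that(2)]] dlI unfolding A_def by (force, blast)
 have Aneg: "- x : A" and dlneg: "dl (- x) = - dl x" if "x : A" for x
  using neg[OF dl[OF that(1)]] dlI unfolding A_def by (force, blast)
 have Asum: "sum f S : A & dl (sum f S) = (SUM i:S. dl (f i))" if "!!i. i : S ==> f i : A" for f :: "nat => real" and S
  using that by (induction S rule: infinite_finite_induct) (auto simp: Aplus dlplus)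
 define P where "P = {p :: real poly. ALL i. coeff p i : A}"
 define m where "m = map_poly dl"
 have cm [simp]: "coeff (m p) i = dl (coeff p i)" for p i by (simp add: m_def coeff_map_poly)
 have Pplus: "p + q : P" and mplus: "m (p + q) = m p + m q" if "p : P" "q : P" for p q
  using that by (auto simp: P_def Aplus dlplus intro!: poly_eqI)
 have Pneg: "- p : P" and mneg: "m (- p) = - m p" if "p : P" for p
  using that by (auto simp: P_def Aneg dlneg intro!: poly_eqI)
 have Ptimes: "p * q : P" and mtimes: "m (p * q) = p * m q + m p * q" if "p : P" "q : P" for p q
 proof -
  have c: "coeff p i * coeff q j : A" for i j using that by (auto simp: P_def Atimes)
  have S: "(SUM i<=n. coeff p i * coeff q (n - i)) : A &
    dl (SUM i<=n. coeff p i * coeff q (n - i)) = (SUM i<=n. dl (coeff p i * coeff q (n - i)))" for n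
   by (rule Asum) (rule c)
  show "p * q : P" unfolding P_def using S by (simp add: coeff_mult)
  show "m (p * q) = p * m q + m p * q"
  proof (rule poly_eqI)
   fix n
   have "dl (SUM i<=n. coeff p i * coeff q (n - i)) = (SUM i<=n. dl (coeff p i * coeff q (n - i)))"
    using S by simp
   also have "... = (SUM i<=n. coeff p i * dl (coeff q (n - i)) + dl (coeff p i) * coeff q (n - i))"
    using that by (intro sum.cong) (auto simp: P_def dltimes)
   finally show "coeff (m (p * q)) n = coeff (p * m q + m p * q) n"
    by (simp add: coeff_mult sum.distrib)
  qed
 qed
 have Pmonom: "monom c n : P" if "c : A" for c n using that by (auto simp: P_def)
 \<comment> \<open>The derivative of \<open>q(z)\<close> has to be this expression, where
   \<open>m\<close> differentiates the coefficients; so it must vanish whenever \<open>q(z)\<close>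
   does.\<close>
 have "EX w. ALL q:P. poly q z = 0 --> poly (m q) z + poly (pderiv q) z * w = 0"
 proof (cases "EX p:P. p ~= 0 & poly p z = 0")
  case False
  thus ?thesis by (metis add.right_neutral lambda_zero m_def map_poly_0 mult_zero_left pderiv_0 poly_0)
 next
  case True
  define p where "p = (ARG_MIN degree p. p : P & p ~= 0 & poly p z = 0)"
  obtain p0 where p0: "p0 : P & p0 ~= 0 & poly p0 z = 0" using True by blast
  have p: "p : P" "p ~= 0" "poly p z = 0"
    using arg_min_natI[where P = "%p. p : P & p ~= 0 & poly p z = 0" and m = degree, OF p0]
    unfolding p_def by auto
  have pmin: "degree p <= degree q" if "q : P" "q ~= 0" "poly q z = 0" for q
    unfolding p_def using arg_min_nat_le[where P = "%p. p : P & p ~= 0 & poly p z = 0" and m = degree] that by blast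
  have pd_in: "pderiv p : P"
  proof -
   have "of_nat k * c : A" if "c : A" for k c using that by (induction k) (auto simp: Aplus distrib_right)
   thus ?thesis using p(1) unfolding P_def by (auto simp: coeff_pderiv simp del: of_nat_Suc)
  qed
  have "degree p > 0"
  proof (rule ccontr)
   assume "~ degree p > 0"
   then obtain c where "p = [:c:]" by (metis degree_eq_zeroE gr0I)
   thus False using p by auto
  qed
  \<comment> \<open>\<open>pderiv p\<close> is nonzero, has coefficients in \<open>A\<close> and
    smaller degree, so minimality of \<open>p\<close> forbids a zero at \<open>z\<close>.\<close>
  hence "poly (pderiv p) z ~= 0"
   using pmin[OF pd_in] p by (metis degree_pderiv diff_less leD pderiv_eq_0_iff not_gr0 zero_less_one)
  then obtain w where w: "poly (m p) z + poly (pderiv p) z * w = 0"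
   by (metis add.commute add.right_inverse nonzero_mult_div_cancel_left times_divide_eq_right)
  define D where "D q = poly (m q) z + poly (pderiv q) z * w" for q
  have Dplus: "D (q + r) = D q + D r" if "q : P" "r : P" for q r
   unfolding D_def using that by (simp add: mplus pderiv_add algebra_simps)
  have Dneg: "D (- q) = - D q" if "q : P" for q
   unfolding D_def using that by (simp add: mneg pderiv_minus algebra_simps)
  have Dtimes: "D (q * r) = poly q z * D r + D q * poly r z" if "q : P" "r : P" for q r
   unfolding D_def using that by (simp add: mtimes pderiv_mult algebra_simps)
  have Dp: "D p = 0" using w D_def by simp
  have "D q = 0" if "q : P" "poly q z = 0" for q
   using that
  proof (induction "degree q" arbitrary: q rule: less_induct)
   case less
   show ?case
   proof (cases "q = 0")
    case True thus ?thesis by (simp add: D_def m_def)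
   next
    case False
    hence le: "degree p <= degree q" using pmin less.prems by blast
    \<comment> \<open>Pseudo-division, since \<open>A\<close> is only a ring: scaling
      \<open>q\<close> by the leading coefficient of \<open>p\<close> avoids a quotient of
      coefficients.\<close>
    define c where "c = monom (lead_coeff p) 0"
    define r where "r = monom (lead_coeff q) (degree q - degree p)"
    define s where "s = c * q + - (r * p)"
    have cP: "c : P" "r : P" using p(1) less.prems(1) by (auto simp: c_def r_def P_def)
    have sP: "s : P" unfolding s_def using cP p(1) less.prems(1) by (intro Pplus Ptimes Pneg)
    have sz: "poly s z = 0" by (simp add: s_def less.prems p)
    have dcq: "degree (c * q) = degree q" using p(2) False
     by (simp add: c_def degree_mult_eq degree_monom_eq)
    have drp: "degree (r * p) = degree q" using p(2) False le
     by (simp add: r_def degree_mult_eq degree_monom_eq)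
    have lc: "coeff s (degree q) = 0"
    proof -
     have "coeff (c * q) (degree q) = lead_coeff p * lead_coeff q"
      by (metis dcq lead_coeff_mult c_def lead_coeff_monom)
     moreover have "coeff (r * p) (degree q) = lead_coeff q * lead_coeff p"
      by (metis drp lead_coeff_mult r_def lead_coeff_monom)
     ultimately show ?thesis by (simp add: s_def)
    qed
    have "degree s <= degree q" unfolding s_def using dcq drp
     by (metis degree_add_le degree_minus order_refl)
    hence "s = 0 | degree s < degree q"
     using lc False by (metis le_neq_implies_less leading_coeff_0_iff)
    hence "D s = 0" using less.hyps[of s] sP sz by (auto simp: D_def m_def)
    moreover have "D s = poly c z * D q"
     using Dplus[OF Ptimes[OF cP(1) less.prems(1)] Pneg[OF Ptimes[OF cP(2) p(1)]]]
      Dneg[OF Ptimes[OF cP(2) p(1)]] Dtimes[OF cP(1) less.prems(1)] Dtimes[OF cP(2) p(1)]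
      p(3) less.prems(2) Dp unfolding s_def by simp
    moreover have "poly c z ~= 0" using p(2) by (simp add: c_def poly_monom)
    ultimately show ?thesis by simp
   qed
  qed
  thus ?thesis unfolding D_def by blast
 qed
 then obtain w where w: "!!q. q : P ==> poly q z = 0 ==> poly (m q) z + poly (pderiv q) z * w = 0"
  by blast
 define D where "D q = poly (m q) z + poly (pderiv q) z * w" for q
 define G' where "G' = (%q. (poly q z, D q)) ` P"
 have in': "(poly q z, D q) : G'" if "q : P" for q using that unfolding G'_def by blast
 have "der_graph G'"
  unfolding der_graph_def
 proof (intro conjI allI impI)
  have "dl 1 = 0" using dlI[OF one] .
  hence "D (monom 1 0) = 0" by (simp add: D_def m_def monom_0 map_poly_pCons)
  thus "(1, 0) : G'" using in'[OF Pmonom[OF A1, of 0]] by (simp add: monom_0)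
 next
  fix x a y b assume "(x, a) : G'" "(y, b) : G'"
  then obtain p q where pq: "p : P" "q : P" "x = poly p z" "a = D p" "y = poly q z" "b = D q"
   unfolding G'_def by blast
  have "D (p + q) = D p + D q" "D (p * q) = poly p z * D q + D p * poly q z"
   unfolding D_def using pq by (simp_all add: mplus mtimes pderiv_add pderiv_mult algebra_simps)
  thus "(x + y, a + b) : G'" "(x * y, x * b + a * y) : G'"
   using in'[OF Pplus[OF pq(1,2)]] in'[OF Ptimes[OF pq(1,2)]] pq by auto
 next
  fix x a assume "(x, a) : G'"
  then obtain p where pq: "p : P" "x = poly p z" "a = D p" unfolding G'_def by blast
  have "D (- p) = - D p" unfolding D_def using pq by (simp add: mneg pderiv_minus)
  thus "(- x, - a) : G'" using in'[OF Pneg[OF pq(1)]] pq by auto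
 next
  fix a assume "(0, a) : G'"
  thus "a = 0" using w unfolding G'_def D_def by auto
 qed
 moreover have "G <= G'"
 proof
  fix g assume g: "g : G"
  obtain x a where xa: "g = (x, a)" by fastforce
  hence "x : A" "a = dl x" using g dlI unfolding A_def by force+
  thus "g : G'" using in'[OF Pmonom[of x 0]] xa
   by (simp add: monom_0 D_def m_def map_poly_pCons pderiv_pCons)
 qed
 moreover have "z : fst ` G'" using in'[OF Pmonom[OF A1, of 1]] by (force simp: poly_monom)
 ultimately show ?thesis by blast
qed

text \<open>By Zorn's lemma there is a maximal graph; its domain is everything because every real
  number can be adjoined.\<close>

theorem der_graph_extend:
 assumes "der_graph G"
 shows "EX D. derivation D & (ALL x a. (x, a) : G --> D x = a)"
proof -
 have "EX M:{G'. der_graph G' & G <= G'}. ALL X:{G'. der_graph G' & G <= G'}. M <= X --> X = M"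
 proof (rule Zorn_Lemma2, intro ballI)
  fix C assume C: "C : chains {G'. der_graph G' & G <= G'}"
  show "EX U:{G'. der_graph G' & G <= G'}. ALL X:C. X <= U"
  proof (cases "C = {}")
   case True thus ?thesis using assms by auto
  next
   case False
   hence "der_graph (\<Union>C)" using der_graph_Union_chain C by blast
   moreover have "G <= \<Union>C" using C False unfolding chains_def by auto
   ultimately show ?thesis by blast
  qed
 qed
 then obtain M where M: "der_graph M" "G <= M"
  and max: "!!X. der_graph X ==> M <= X ==> X = M" by auto
 have dom: "EX a. (x, a) : M" for x
  using der_graph_adjoin[OF M(1), of x] max by force
 have uniq: "a = b" if "(x, a) : M" "(x, b) : M" for x a b
 using that M(1) by (fastforce simp: der_graph_def)
 define D where "D x = (THE a. (x, a) : M)" for x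
 have D: "(x, a) : M <-> D x = a" for x a
 by (metis dom uniq the_equality D_def)
 have "derivation D"
  using M(1) unfolding derivation_def der_graph_def by (auto simp: D)
 thus ?thesis using D M(2) by blast
qed

lemma derivation_0 [simp]: "derivation D ==> D 0 = 0"
 by (metis derivation_def add_cancel_right_left)

lemma derivation_1 [simp]: "derivation D ==> D 1 = 0"
proof -
 assume "derivation D"
 hence "D (1 * 1) = 1 * D 1 + D 1 * 1" unfolding derivation_def by blast
 thus ?thesis by simp
qed

lemma derivation_add: "derivation D ==> D (x + y) = D x + D y"
 and derivation_mult: "derivation D ==> D (x * y) = x * D y + D x * y"
 by (auto simp: derivation_def)

lemma derivation_minus: "derivation D ==> D (- x) = - D x"
 by (metis add.right_inverse add_eq_0_iff derivation_0 derivation_add)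

lemma derivation_diff: "derivation D ==> D (x - y) = D x - D y"
 by (metis derivation_add derivation_minus diff_conv_add_uminus)

lemma derivation_sum: "derivation D ==> D (sum f S) = (SUM i:S. D (f i))"
 by (induction S rule: infinite_finite_induct) (auto simp: derivation_add)

lemma derivation_Rats:
 assumes "derivation D" "q : \<rat>"
 shows "D q = 0"
proof -
 have nat: "D (of_nat n) = 0" for n
  by (induction n) (auto simp: derivation_add assms)
 have int: "D (of_int n) = 0" for n
  using nat[of "nat n"] nat[of "nat (- n)"] derivation_minus[OF assms(1), of "of_int n"] by (cases "n >= 0") auto
 obtain a b where q: "q = of_int a / of_int b" and "b ~= 0"
  using assms(2) by (metis Rats_cases' not_less_iff_gr_or_eq)
 hence "of_int a = of_int b * q" by simp
 hence "D (of_int a) = of_int b * D q + D (of_int b) * q" using derivation_mult[OF assms(1)] by metis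
 thus ?thesis using int \<open>b ~= 0\<close> by simp
qed

lemma derivation_comb:
 assumes "derivation D" "derivation D'"
 shows "derivation (%x. a * D x + b * D' x)"
 using assms unfolding derivation_def by (simp add: algebra_simps)

section \<open>Polynomial functions and generic points\<close>

text \<open>Polynomials as functions, so that substitution is composition. \<open>F\<close> is an
  arbitrary set of constants; once it contains the rationals, the coefficients run through the ring
  that it generates.\<close>

inductive_set polyfun :: "real set => 'i set => (('i => real) => real) set"
 for F :: "real set" and J :: "'i set" where
 polyfun_const: "c : F ==> (%_. c) : polyfun F J"
| polyfun_coord: "i : J ==> (%x. x i) : polyfun F J"
| polyfun_add: "P : polyfun F J ==> Q : polyfun F J ==> (%x. P x + Q x) : polyfun F J"
| polyfun_mult: "P : polyfun F J ==> Q : polyfun F J ==> (%x. P x * Q x) : polyfun F J"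

text \<open>Algebraic independence of the coordinates over \<open>F\<close>; for functions,
  vanishing identically takes the place of being the zero polynomial.\<close>

definition Generic :: "real set => 'i set => ('i => real) => bool" where
 "Generic F J z <-> (ALL P:polyfun F J. P z = 0 --> (ALL x. P x = 0))"

lemma polyfun_cong:
 assumes "P : polyfun F J" "!!i. i : J ==> x i = y i"
 shows "P x = P y"
 using assms by induction auto

lemma polyfun_comp:
 assumes "P : polyfun F J" "F <= F'" "!!i. i : J ==> h i : polyfun F' J'"
 shows "(%x. P (%i. h i x)) : polyfun F' J'"
 using assms by induction (auto intro: polyfun.intros)

lemma polyfun_mono:
 assumes "P : polyfun F J" "F <= F'" "J <= J'"
 shows "P : polyfun F' J'"
 using assms by induction (auto intro: polyfun.intros)

lemma polyfun_rat: "\<rat> <= F ==> c : \<rat> ==> (%_. c) : polyfun F J"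
 by (rule polyfun_const) auto

lemma polyfun_minus: "\<rat> <= F ==> P : polyfun F J ==> (%x. - P x) : polyfun F J"
 using polyfun_mult[OF polyfun_rat[of F "-1"], of P J] by simp

lemma polyfun_diff:
 "\<rat> <= F ==> P : polyfun F J ==> Q : polyfun F J ==> (%x. P x - Q x) : polyfun F J"
 using polyfun_add[OF _ polyfun_minus, of P F J Q] by simp

lemma polyfun_sum:
 assumes "\<rat> <= F" "!!i. i : S ==> P i : polyfun F J"
 shows "(%x. SUM i:S. P i x) : polyfun F J"
 using assms(2)
 by (induction S rule: infinite_finite_induct) (auto intro: polyfun_rat[OF assms(1)] polyfun_add)

lemma polyfun_prod:
 assumes "\<rat> <= F" "!!i. i : S ==> P i : polyfun F J"
 shows "(%x. PROD i:S. P i x) : polyfun F J"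
 using assms(2)
 by (induction S rule: infinite_finite_induct) (auto intro: polyfun_rat[OF assms(1)] polyfun_mult)

lemma polyfun_power:
 assumes "\<rat> <= F" "P : polyfun F J"
 shows "(%x. P x ^ n) : polyfun F J"
 by (induction n) (auto intro: polyfun_rat[OF assms(1)] polyfun_mult assms)

lemma polyfun_line:
 assumes "P : polyfun F J"
 shows "EX p. ALL t. poly p t = P (%i. x i + t * w i)"
 using assms
proof induction
 case (polyfun_const c)
 show ?case by (rule exI[of _ "[:c:]"]) simp
next
 case (polyfun_coord i)
 show ?case by (rule exI[of _ "[:x i, w i:]"]) (simp add: algebra_simps)
next
 case (polyfun_add P Q)
 thus ?case by (metis poly_add)
next
 case (polyfun_mult P Q)
 thus ?case by (metis poly_mult)
qed

text \<open>One family of partial derivatives serves both the analytic directional derivative and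
  the chain rule for derivations that kill \<open>F\<close>; \<open>derivation_Generic\<close>
  relies on both descriptions of the same family.\<close>

lemma polyfun_partial:
 assumes "P : polyfun F J" "finite J" "\<rat> <= F"
 shows "EX D. (ALL i:J. D i : polyfun F J) &
  (ALL x w. ((%t. P (%i. x i + t * w i)) has_real_derivative (SUM i:J. D i x * w i)) (at 0)) &
  (ALL d x. derivation d --> (ALL c:F. d c = 0) --> d (P x) = (SUM i:J. D i x * d (x i)))"
proof -
 define pd where "pd P D <-> (ALL i:J. D i : polyfun F J) &
  (ALL x w. ((%t. P (%i. x i + t * w i)) has_real_derivative (SUM i:J. D i x * w i)) (at 0)) &
  (ALL d x. derivation d --> (ALL c:F. d c = 0) --> d (P x) = (SUM i:J. D i x * d (x i)))" for P D
 have pd1: "D i : polyfun F J" if "pd P D" "i : J" for P D i using that unfolding pd_def by simp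
 have pd2: "((%t. P (%i. x i + t * w i)) has_real_derivative (SUM i:J. D i x * w i)) (at 0)"
  if "pd P D" for P D x w using that unfolding pd_def by simp
 have pd3: "d (P x) = (SUM i:J. D i x * d (x i))"
  if "pd P D" "derivation d" "ALL c:F. d c = 0" for P D d x using that unfolding pd_def by simp
 have "EX D. pd P D"
  using assms(1)
 proof induction
  case (polyfun_const c)
  hence "pd (%_. c) (%_ _. 0)"
   unfolding pd_def using polyfun_rat[OF assms(3), of 0 J] by auto
  thus ?case by blast
 next
  case (polyfun_coord i)
  have s: "(SUM j:J. (kr j i) * w j) = w i" for w :: "'a => real"
   using polyfun_coord assms(2) by (simp add: if_distrib[where f="%a. a * _"] cong: if_cong)
  have "((%t. x i + t * w i) has_real_derivative w i) (at 0)" for x w :: "'a => real"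
   by (auto intro!: derivative_eq_intros)
  hence "pd (%x. x i) (%j _. if j = i then 1 else 0)"
   unfolding pd_def s using polyfun_rat[OF assms(3), of 0 J] polyfun_rat[OF assms(3), of 1 J] by simp
  thus ?case by blast
 next
  case (polyfun_add P Q)
  then obtain D E where DE: "pd P D" "pd Q E" by auto
  have "pd (%x. P x + Q x) (%i x. D i x + E i x)"
   unfolding pd_def
  proof (intro conjI ballI allI impI)
   show "(%x. D i x + E i x) : polyfun F J" if "i : J" for i
    by (rule polyfun.polyfun_add[OF pd1[OF DE(1) that] pd1[OF DE(2) that]])
   show "((%t. P (%i. x i + t * w i) + Q (%i. x i + t * w i)) has_real_derivative
     (SUM i:J. (D i x + E i x) * w i)) (at 0)" for x w
    using DERIV_add[OF pd2[OF DE(1), of x w] pd2[OF DE(2), of x w]]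
    by (simp add: sum.distrib distrib_right)
   show "d (P x + Q x) = (SUM i:J. (D i x + E i x) * d (x i))"
    if "derivation d" "ALL c:F. d c = 0" for d x
    using pd3[OF DE(1) that, of x] pd3[OF DE(2) that, of x] that
    by (simp add: derivation_add sum.distrib distrib_right)
  qed
  thus ?case by blast
 next
  case (polyfun_mult P Q)
  then obtain D E where DE: "pd P D" "pd Q E" by auto
  have "pd (%x. P x * Q x) (%i x. D i x * Q x + P x * E i x)"
   unfolding pd_def
  proof (intro conjI ballI allI impI)
   show "(%x. D i x * Q x + P x * E i x) : polyfun F J" if "i : J" for i
    by (intro polyfun.polyfun_add polyfun.polyfun_mult pd1[OF DE(1) that] pd1[OF DE(2) that] polyfun_mult.hyps)
   show "((%t. P (%i. x i + t * w i) * Q (%i. x i + t * w i)) has_real_derivative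
     (SUM i:J. (D i x * Q x + P x * E i x) * w i)) (at 0)" for x w
    using DERIV_mult[OF pd2[OF DE(1), of x w] pd2[OF DE(2), of x w]]
    by (simp add: sum.distrib sum_left sum_right algebra_simps)
   show "d (P x * Q x) = (SUM i:J. (D i x * Q x + P x * E i x) * d (x i))"
    if "derivation d" "ALL c:F. d c = 0" for d x
    using pd3[OF DE(1) that, of x] pd3[OF DE(2) that, of x] that
    by (simp add: derivation_mult sum.distrib sum_left sum_right algebra_simps)
  qed
  thus ?case by blast
 qed
 thus ?thesis unfolding pd_def .
qed

lemma polyfun_partialE:
 assumes "P : polyfun F J" "finite J" "\<rat> <= F"
 obtains D where "!!i. i : J ==> D i : polyfun F J"
  "!!x w. ((%t. P (%i. x i + t * w i)) has_real_derivative (SUM i:J. D i x * w i)) (at 0)"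
  "!!d x. derivation d ==> ALL c:F. d c = 0 ==> d (P x) = (SUM i:J. D i x * d (x i))"
proof -
 from polyfun_partial[OF assms] obtain D where "(ALL i:J. D i : polyfun F J) &
  (ALL x w. ((%t. P (%i. x i + t * w i)) has_real_derivative (SUM i:J. D i x * w i)) (at 0)) &
  (ALL d x. derivation d --> (ALL c:F. d c = 0) --> d (P x) = (SUM i:J. D i x * d (x i)))"
  by (elim exE)
 thus thesis by (intro that[of D]) simp_all
qed

section \<open>Generic points: derivations at them, and their density\<close>

lemma countable_polyfun:
 assumes "countable F" "countable J"
 shows "countable (polyfun F J)"
proof -
 define step where "step S = S Un (%(P, Q) x. P x + Q x) ` (S \<times> S) Un (%(P, Q) x. P x * Q x) ` (S \<times> S)"
  for S :: "(('a => real) => real) set"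
 define L where "L n = (step ^^ n) ((%c _. c) ` F Un (%i x. x i) ` J)" for n
 have LS: "L (Suc n) = step (L n)" for n by (simp add: L_def)
 have mono: "L m <= L n" if "m <= n" for m n
  using that by (induction n rule: dec_induct) (auto simp: LS step_def)
 have cnt: "countable (L n)" for n
 proof (induction n)
  case 0 thus ?case using assms by (simp add: L_def)
 next
  case (Suc n) thus ?case unfolding LS step_def by (intro countable_Un countable_image countable_SIGMA) auto
 qed
 have "P : (UN n. L n)" if "P : polyfun F J" for P
  using that
 proof induction
  case (polyfun_const c)
  hence "(%_. c) : L 0" by (auto simp: L_def)
  thus ?case by blast
 next
  case (polyfun_coord i)
  hence "(%x. x i) : L 0" by (auto simp: L_def)
  thus ?case by blast
 next
  case (polyfun_add P Q)
  then obtain m n where "P : L m" "Q : L n" by blast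
  hence "P : L (max m n)" "Q : L (max m n)" using mono[of m "max m n"] mono[of n "max m n"] by auto
  hence "(%(P, Q) x. P x + Q x) (P, Q) : L (Suc (max m n))"
   unfolding LS step_def by (intro UnI1 UnI2 imageI) simp
  hence "(%x. P x + Q x) : L (Suc (max m n))" by simp
  thus ?case by blast
 next
  case (polyfun_mult P Q)
  then obtain m n where "P : L m" "Q : L n" by blast
  hence "P : L (max m n)" "Q : L (max m n)" using mono[of m "max m n"] mono[of n "max m n"] by auto
  hence "(%(P, Q) x. P x * Q x) (P, Q) : L (Suc (max m n))"
   unfolding LS step_def by (intro UnI2 imageI) simp
  hence "(%x. P x * Q x) : L (Suc (max m n))" by simp
  thus ?case by blast
 qed
 hence "polyfun F J <= (UN n. L n)" by (rule subsetI)
 thus ?thesis by (rule countable_subset) (simp add: cnt)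
qed

lemma Generic_subset: "Generic F J z ==> F' <= F ==> J' <= J ==> Generic F' J' z"
 unfolding Generic_def by (simp add: polyfun_mono)

lemma Generic_cong: "(!!i. i : J ==> z i = z' i) ==> Generic F J z <-> Generic F J z'"
 unfolding Generic_def by (intro ball_cong refl) (simp add: polyfun_cong[of _ F J z z'])

text \<open>At a generic point the value \<open>P z\<close> determines the function
  \<open>P\<close>, hence also its derivative in the direction \<open>w\<close>. Sending the value
  to the derivative is thus a derivation on the ring of values, and it extends to the reals.\<close>

lemma Generic_derivation:
 assumes "Generic F J z" "\<rat> <= F" "finite J"
 shows "EX d. derivation d & (ALL c:F. d c = 0) & (ALL i:J. d (z i) = w i)"
proof -
 define dz where "dz P a <-> ((%t. P (%i. z i + t * w i)) has_real_derivative a) (at 0)" for P a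
 define G where "G = (UN P:polyfun F J. {(P z, a) | a. dz P a})"
 have GI: "(P z, a) : G" if "P : polyfun F J" "dz P a" for P a
  unfolding G_def using that by (intro UN_I[of P]) auto
 have GE: thesis if "(x, a) : G" "!!P. P : polyfun F J ==> x = P z ==> dz P a ==> thesis" for x a thesis
  using that unfolding G_def by auto
 have "der_graph G"
  unfolding der_graph_def
 proof (intro conjI allI impI)
  show "(1, 0) : G"
   using GI[OF polyfun_rat[OF assms(2), of 1 J], of 0] by (simp add: dz_def)
 next
  fix x a y b assume xa: "(x, a) : G" and yb: "(y, b) : G"
  obtain P where P: "P : polyfun F J" "x = P z" "dz P a" using xa by (rule GE)
  obtain Q where Q: "Q : polyfun F J" "y = Q z" "dz Q b" using yb by (rule GE)
  have "dz (%x. P x + Q x) (a + b)"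
   unfolding dz_def by (rule DERIV_add[OF P(3)[unfolded dz_def] Q(3)[unfolded dz_def]])
  from GI[OF polyfun_add[OF P(1) Q(1)] this] show "(x + y, a + b) : G" using P(2) Q(2) by simp
  have "dz (%x. P x * Q x) (x * b + a * y)"
   using DERIV_mult[OF P(3)[unfolded dz_def] Q(3)[unfolded dz_def]] P(2) Q(2)
   unfolding dz_def by (simp add: algebra_simps)
  from GI[OF polyfun_mult[OF P(1) Q(1)] this] show "(x * y, x * b + a * y) : G" using P(2) Q(2) by simp
 next
  fix x a assume "(x, a) : G"
  then obtain P where P: "P : polyfun F J" "x = P z" "dz P a" by (rule GE)
  have "dz (%x. - P x) (- a)"
   unfolding dz_def by (rule DERIV_minus[OF P(3)[unfolded dz_def]])
  from GI[OF polyfun_minus[OF assms(2) P(1)] this] show "(- x, - a) : G" using P(2) by simp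
 next
  fix a assume "(0, a) : G"
  then obtain P where P: "P : polyfun F J" "0 = P z" "dz P a" by (rule GE)
  hence "P x = 0" for x using assms(1) unfolding Generic_def by metis
  hence "((%_. 0) has_real_derivative a) (at 0)" using P(3) unfolding dz_def by simp
  thus "a = 0" using DERIV_unique[OF _ DERIV_const] by blast
 qed
 then obtain d where d: "derivation d" "!!x a. (x, a) : G ==> d x = a"
  using der_graph_extend by blast
 have "(c, 0) : G" if "c : F" for c
  using GI[OF polyfun_const[OF that, of J], of 0] by (simp add: dz_def)
 moreover have "(z i, w i) : G" if "i : J" for i
 proof -
  have "((%t. z i + t * w i) has_real_derivative w i) (at 0)" by (auto intro!: derivative_eq_intros)
  thus ?thesis using GI[OF polyfun_coord[OF that, of F], of "w i"] by (simp add: dz_def)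
 qed
 ultimately show ?thesis using d by blast
qed

text \<open>If \<open>P z = 0\<close>, derivations dual to the coordinates show that all partial
  derivatives of \<open>P\<close> vanish at \<open>z\<close> too. Iterating this kills every Taylor
  coefficient along every line through \<open>z\<close>.\<close>

lemma derivation_Generic:
 assumes ex: "!!w. EX d. derivation d & (ALL c:F. d c = 0) & (ALL i:J. d (z i) = w i)"
  and "\<rat> <= F" "finite J"
 shows "Generic F J z"
 unfolding Generic_def
proof (intro ballI impI allI)
 fix P x assume P: "P : polyfun F J" "P z = 0"
 define w where "w i = x i - z i" for i
 define ln where "ln P = (SOME p. ALL t. poly p t = P (%i. z i + t * w i))" for P
 have ln: "poly (ln P) t = P (%i. z i + t * w i)" if "P : polyfun F J" for P t
  using someI_ex[OF polyfun_line[OF that, of z w]] unfolding ln_def by blast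
 \<comment> \<open>The induction runs over all \<open>P\<close> at once: up to a factor, coefficient
   \<open>n + 1\<close> of \<open>P\<close> along the line is a combination of the coefficients
   \<open>n\<close> of its partial derivatives.\<close>
 have "coeff (ln P) n = 0" if "P : polyfun F J" "P z = 0" for P n
  using that
 proof (induction n arbitrary: P)
  case 0
  thus ?case using ln[of P 0] by (simp add: poly_0_coeff_0)
 next
  case (Suc n)
  obtain D where D: "!!i. i : J ==> D i : polyfun F J"
   "!!x w. ((%t. P (%i. x i + t * w i)) has_real_derivative (SUM i:J. D i x * w i)) (at 0)"
   "!!d x. derivation d ==> ALL c:F. d c = 0 ==> d (P x) = (SUM i:J. D i x * d (x i))"
   by (rule polyfun_partialE[OF Suc.prems(1) assms(3,2)]) (rule that)
  have D0: "D i z = 0" if "i : J" for i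
  proof -
   obtain d where d: "derivation d" "ALL c:F. d c = 0" "ALL j:J. d (z j) = (kr j i)"
    using ex[of "%j. if j = i then 1 else 0"] by blast
   have "0 = (SUM j:J. D j z * d (z j))" using D(3)[OF d(1,2), of z] Suc.prems(2) d(1) by simp
   also have "... = (SUM j:J. if j = i then D j z else 0)" by (intro sum.cong) (auto simp: d(3))
   finally show ?thesis using that assms(3) by simp
  qed
  have "poly (pderiv (ln P)) t = poly (SUM i:J. smult (w i) (ln (D i))) t" for t
  using D(2)[of "%i. z i + t * w i" w] ln[OF Suc.prems(1)] DERIV_shift[of "poly (ln P)" "poly (pderiv (ln P)) t" 0 t] poly_DERIV[of "ln P" t] by (auto simp: algebra_simps add.commute poly_sum ln[OF D(1)] mult.commute intro: DERIV_unique[symmetric])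
  hence "pderiv (ln P) = (SUM i:J. smult (w i) (ln (D i)))"
   by (intro poly_eq_poly_eq_iff[THEN iffD1] ext)
  hence "coeff (pderiv (ln P)) n = 0"
   using Suc.IH[OF D(1) D0] by (simp add: coeff_sum)
  thus ?case by (simp add: coeff_pderiv del: of_nat_Suc)
 qed
 hence "ln P = 0" using P by (simp add: poly_eqI)
 thus "P x = 0" using ln[OF P(1), of 1] by (simp add: w_def)
qed

lemma finite_zeros_line:
 assumes "P : polyfun F J" "P (%i. x i + t0 * w i) ~= 0"
 shows "finite {t. P (%i. x i + t * w i) = 0}"
proof -
 obtain p where p: "!!t. poly p t = P (%i. x i + t * w i)" using polyfun_line[OF assms(1)] by metis
 hence "p ~= 0" using assms(2) by (metis poly_0)
 thus ?thesis using poly_roots_finite[of p] p by simp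
qed

lemma countable_avoid:
 fixes a :: real
 assumes "countable C" "e > 0"
 shows "EX t. t ~: C & abs (t - a) < e"
proof -
 have "uncountable ({a - e<..<a + e} - C)"
  using uncountable_minus_countable[of "{a - e<..<a + e}" C] uncountable_open_interval[of "a - e" "a + e"] assms by simp
 hence "{a - e<..<a + e} - C ~= {}" by force
 then obtain t where "t : {a - e<..<a + e}" "t ~: C" by blast
 thus ?thesis by (intro exI[of _ t]) (auto simp: abs_less_iff)
qed

text \<open>Each of the countably many polynomials that are nonzero at \<open>z\<close> vanishes at
  finitely many points of the line only, so countably many parameters are lost.\<close>

lemma Generic_line:
 assumes "Generic F J z" "countable F" "countable J" "e > 0"
 shows "EX t. abs (t - a) < e & Generic F J (%i. y i + t * (z i - y i))"
proof -
 define N where "N = {P:polyfun F J. P z ~= 0}"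
 have N: "countable N" unfolding N_def
   by (rule countable_subset[OF _ countable_polyfun[OF assms(2,3)]]) auto
 have "countable (UN P:N. {t. P (%i. y i + t * (z i - y i)) = 0})"
 proof (rule countable_UN[OF N])
  show "countable {t. P (%i. y i + t * (z i - y i)) = 0}" if "P : N" for P
   using finite_zeros_line[of P F J y 1 "%i. z i - y i"] that by (simp add: N_def countable_finite)
 qed
 then obtain t where t: "t ~: (UN P:N. {t. P (%i. y i + t * (z i - y i)) = 0})" "abs (t - a) < e"
  using countable_avoid assms(4) by blast
 hence "Generic F J (%i. y i + t * (z i - y i))"
  using assms(1) unfolding Generic_def N_def by simp blast
 thus ?thesis using t(2) by (intro exI[of _ t]) simp
qed

text \<open>Coordinates are chosen one at a time; the invariant is that no polynomial that is not
  identically zero becomes so when the chosen coordinates are frozen.\<close>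

lemma Generic_dense:
 assumes "countable F" "finite J" "e > 0"
 shows "EX z. Generic F J z & (ALL i:J. abs (z i - a i) < e)"
proof -
 define N where "N = {P:polyfun F J. EX x. P x ~= 0}"
 have N: "countable N" unfolding N_def
  by (rule countable_subset[OF _ countable_polyfun[OF assms(1) countable_finite[OF assms(2)]]]) auto
 have "EX z. (ALL i:K. abs (z i - a i) < e) & (ALL P:N. EX x. P x ~= 0 & (ALL i:K. x i = z i))" if "finite K" for K
  using that
 proof (induction K rule: finite_induct)
  case empty
  thus ?case by (auto simp: N_def)
 next
  case (insert k K)
  then obtain z w where z: "ALL i:K. abs (z i - a i) < e"
   and w: "!!P. P : N ==> P (w P) ~= 0 & (ALL i:K. w P i = z i)" by metis
  have eq: "(%i. ((w P)(k := 0)) i + t * (kr i k)) = (w P)(k := t)" for P t by auto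
  have "countable (UN P:N. {t. P ((w P)(k := t)) = 0})"
  proof (rule countable_UN[OF N])
   fix P assume P: "P : N"
   have "P (%i. ((w P)(k := 0)) i + w P k * (kr i k)) ~= 0"
    using w[OF P] unfolding eq by simp
   moreover have "P : polyfun F J" using P by (simp add: N_def)
   ultimately have "finite {t. P (%i. ((w P)(k := 0)) i + t * (kr i k)) = 0}"
    by (rule finite_zeros_line[rotated])
   thus "countable {t. P ((w P)(k := t)) = 0}" unfolding eq by (rule countable_finite)
  qed
  then obtain t where t: "t ~: (UN P:N. {t. P ((w P)(k := t)) = 0})" "abs (t - a k) < e"
   using countable_avoid assms(3) by blast
  show ?case
  proof (rule exI[of _ "z(k := t)"], intro conjI ballI)
   fix i assume "i : insert k K" thus "abs ((z(k := t)) i - a i) < e" using t z by auto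
  next
   fix P assume "P : N"
   thus "EX x. P x ~= 0 & (ALL i:insert k K. x i = (z(k := t)) i)"
    using t w insert.hyps by (intro exI[of _ "(w P)(k := t)"]) auto
  qed
 qed
 from this[OF assms(2)] obtain z where z: "ALL i:J. abs (z i - a i) < e"
  "ALL P:N. EX x. P x ~= 0 & (ALL i:J. x i = z i)" by (elim exE conjE)
 have "Generic F J z"
  unfolding Generic_def
 proof (intro ballI impI allI, rule ccontr)
  fix P x assume P: "P : polyfun F J" "P z = 0" "P x ~= 0"
  hence "P : N" unfolding N_def by auto
  then obtain y where "P y ~= 0" "ALL i:J. y i = z i" using z(2) by auto
  thus False using P polyfun_cong[of P F J y z] by simp
 qed
 thus ?thesis using z by blast
qed

subsection \<open>Genericity in terms of rational polynomials\<close>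

definition mono_eval :: "('x => real) => ('x \<Rightarrow>\<^sub>0 nat) => real" where
 "mono_eval a m = (PROD x:keys m. a x ^ lookup m x)"

lemma mono_eval_superset:
 assumes "finite A" "keys m <= A"
 shows "mono_eval a m = (PROD x:A. a x ^ lookup m x)"
 unfolding mono_eval_def using assms by (intro prod.mono_neutral_left) (auto simp: in_keys_iff)

lemma mono_eval_add: "mono_eval a (m + n) = mono_eval a m * mono_eval a n"
proof -
 let ?A = "keys m Un keys n"
 show ?thesis
  using keys_add[of m n] mono_eval_superset[of ?A m a] mono_eval_superset[of ?A n a]
   mono_eval_superset[of ?A "m + n" a]
  by (simp add: lookup_add power_add prod.distrib)
qed

lemma mpoly_eval_superset:
 assumes "finite A" "keys p <= A"
 shows "mpoly_eval a p = (SUM m:A. of_rat (lookup p m) * mono_eval a m)"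
 unfolding mpoly_eval_def mono_eval_def
 using assms by (intro sum.mono_neutral_left) (auto simp: in_keys_iff)

lemma mpoly_eval_add: "mpoly_eval a (p + q) = mpoly_eval a p + mpoly_eval a q"
proof -
 let ?A = "keys p Un keys q"
 show ?thesis
  using keys_add[of p q] mpoly_eval_superset[of ?A p a] mpoly_eval_superset[of ?A q a]
   mpoly_eval_superset[of ?A "p + q" a]
  by (simp add: lookup_add of_rat_add distrib_right sum.distrib)
qed

lemma mpoly_eval_0 [simp]: "mpoly_eval a 0 = 0"
 by (simp add: mpoly_eval_def)

lemma mpoly_eval_sum: "mpoly_eval a (sum f S) = (SUM i:S. mpoly_eval a (f i))"
 by (induction S rule: infinite_finite_induct) (auto simp: mpoly_eval_add)

lemma mpoly_eval_single: "mpoly_eval a (sg m c) = of_rat c * mono_eval a m"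
 by (subst mpoly_eval_superset[of "{m}"]) auto

lemma poly_mapping_sum_single: "p = (SUM m:keys p. sg m (lookup p m))"
proof (rule poly_mapping_eqI)
 fix k
 show "lookup p k =
  lookup (SUM m:keys p. sg m (lookup p m)) k"
  by (simp add: lookup_sum lookup_single when_def in_keys_iff)
qed

lemma mpoly_eval_mult: "mpoly_eval a (p * q) = mpoly_eval a p * mpoly_eval a q"
proof -
 have "p * q = (SUM m:keys p. sg m (lookup p m)) *
   (SUM n:keys q. sg n (lookup q n))"
  using poly_mapping_sum_single[of p] poly_mapping_sum_single[of q] by simp
 also have "... = (SUM m:keys p. SUM n:keys q.
   sg (m + n) (lookup p m * lookup q n))"
  by (simp add: sum_product mult_single)
 finally show ?thesis
  by (simp add: mpoly_eval_sum mpoly_eval_single mono_eval_add of_rat_mult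
    mpoly_eval_superset[of "keys p" p] mpoly_eval_superset[of "keys q" q]
    sum_product mult_ac)
qed

lemma mpoly_polyfun:
 assumes "mpoly_vars p <= J"
 shows "(%a. mpoly_eval a p) : polyfun \<rat> J"
 unfolding mpoly_eval_def
proof (intro polyfun_sum polyfun_mult polyfun_prod polyfun_power)
 fix m x assume "m : keys p" "x : keys m"
 thus "(%a. a x) : polyfun \<rat> J" using assms unfolding mpoly_vars_def by (intro polyfun_coord) auto
qed (auto intro: polyfun_rat)

lemma polyfun_mpoly:
 assumes "P : polyfun \<rat> J"
 shows "EX p. mpoly_vars p <= J & (ALL a. mpoly_eval a p = P a)"
 using assms
proof induction
 case (polyfun_const c)
 then obtain r where r: "c = of_rat r" by (auto elim: Rats_cases)
 show ?case
  by (rule exI[of _ "sg 0 r"]) (auto simp: mpoly_vars_def mpoly_eval_single mono_eval_def r)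
next
 case (polyfun_coord i)
 thus ?case
  by (intro exI[of _ "sg (sg i 1) 1"])
   (auto simp: mpoly_vars_def mpoly_eval_single mono_eval_def)
next
 case (polyfun_add P Q)
 then obtain p q where pq: "mpoly_vars p <= J" "ALL a. mpoly_eval a p = P a" "mpoly_vars q <= J" "ALL a. mpoly_eval a q = Q a" by auto
 have "mpoly_vars (p + q) <= J" using pq(1,3) keys_add[of p q] unfolding mpoly_vars_def by blast
 thus ?case using pq by (intro exI[of _ "p + q"]) (simp add: mpoly_eval_add)
next
 case (polyfun_mult P Q)
 then obtain p q where pq: "mpoly_vars p <= J" "ALL a. mpoly_eval a p = P a" "mpoly_vars q <= J" "ALL a. mpoly_eval a q = Q a" by auto
 have "keys m <= J" if mk: "m : keys (p * q)" for m
 proof -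
  obtain a b where ab: "m = a + b" "a : keys p" "b : keys q"
   using keys_mult[of p q] mk by blast
  hence "keys a <= J" "keys b <= J" using pq(1,3) unfolding mpoly_vars_def by auto
  thus ?thesis using keys_add[of a b] ab by blast
 qed
 hence "mpoly_vars (p * q) <= J" unfolding mpoly_vars_def by blast
 thus ?case using pq by (intro exI[of _ "p * q"]) (simp add: mpoly_eval_mult)
qed

text \<open>For fixed values of the other variables the sum is a polynomial in the variable
  \<open>k\<close>, so the monomials of each exponent \<open>e\<close> of \<open>k\<close> cancel
  among themselves.\<close>

lemma monomials_independent:
 fixes c :: "('x => nat) => real"
 assumes "finite J" "finite M" "!!m i. m : M ==> i ~: J ==> m i = 0"
  and "!!x :: 'x => real. (SUM m:M. c m * (PROD i:J. x i ^ m i)) = 0" and "m : M"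
 shows "c m = 0"
 using assms
proof (induction J arbitrary: M c m rule: finite_induct)
 case empty
 hence "M <= {%_. 0}" by auto
 hence "M = {%_. 0}" using empty.prems(4) by auto
 thus ?case using empty.prems(3,4) by simp
next
 case (insert k J)
 define Mk where "Mk e = {m : M. m k = e}" for e
 have in0: "(SUM m:Mk e. c m * (PROD i:J. x i ^ m i)) = 0" for e and x :: "'x => real"
 proof -
  define p where "p = (SUM m:M. monom (c m * (PROD i:J. x i ^ m i)) (m k))"
  have "poly p t = 0" for t
  proof -
   have "poly p t = (SUM m:M. c m * (PROD i:insert k J. (x(k := t)) i ^ m i))"
    unfolding p_def poly_sum poly_monom
   proof (rule sum.cong[OF refl])
    fix m assume "m : M"
    have "(PROD i:J. (x(k := t)) i ^ m i) = (PROD i:J. x i ^ m i)"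
     using insert.hyps by (intro prod.cong) auto
    thus "c m * (PROD i:J. x i ^ m i) * t ^ m k = c m * (PROD i:insert k J. (x(k := t)) i ^ m i)"
     using insert.hyps by simp
   qed
   thus ?thesis using insert.prems(3) by simp
  qed
  hence "p = 0" using poly_eq_poly_eq_iff[of p 0] by auto
  hence "0 = coeff p e" by simp
  also have "... = (SUM m:Mk e. c m * (PROD i:J. x i ^ m i))" using insert.prems(1) unfolding p_def coeff_sum Mk_def by (simp add: sum.inter_filter)
  finally show ?thesis by simp
 qed
 define e where "e = m k"
 \<comment> \<open>Resetting the exponent of \<open>k\<close> to 0 turns the monomials of exponent
   \<open>e\<close> into monomials over \<open>J\<close> without merging any two of them.\<close>
 define h where "h m' = (m' :: 'x => nat)(k := 0)" for m'
 have inj: "inj_on h (Mk e)"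
  unfolding inj_on_def Mk_def h_def by (metis (mono_tags, lifting) fun_upd_triv fun_upd_upd mem_Collect_eq)
 have bk: "(h m')(k := e) = m'" if "m' : Mk e" for m' using that by (auto simp: Mk_def h_def)
 have "c ((h m)(k := e)) = 0"
 proof (rule insert.IH[where M = "h ` Mk e" and c = "%m. c (m(k := e))" and m = "h m"])
  show "finite (h ` Mk e)" using insert.prems(1) by (simp add: Mk_def)
  show "m i = 0" if "m : h ` Mk e" "i ~: J" for m i
   using that insert.prems(2) by (auto simp: h_def Mk_def)
  show "h m : h ` Mk e" using insert.prems(4) by (simp add: Mk_def e_def)
  fix x :: "'x => real"
  have "(SUM m:h ` Mk e. c (m(k := e)) * (PROD i:J. x i ^ m i)) = (SUM m:Mk e. c m * (PROD i:J. x i ^ m i))"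
   unfolding sum.reindex[OF inj] o_def
  proof (rule sum.cong[OF refl])
   fix m' assume m': "m' : Mk e"
   have "(PROD i:J. x i ^ h m' i) = (PROD i:J. x i ^ m' i)"
    using insert.hyps by (intro prod.cong) (auto simp: h_def)
   thus "c ((h m')(k := e)) * (PROD i:J. x i ^ h m' i) = c m' * (PROD i:J. x i ^ m' i)"
    using bk[OF m'] by simp
  qed
  thus "(SUM m:h ` Mk e. c (m(k := e)) * (PROD i:J. x i ^ m i)) = 0" using in0 by simp
 qed
 thus ?case using bk[of m] insert.prems(4) by (simp add: Mk_def e_def)
qed

lemma mpoly_eval_eq_0:
 assumes "finite J" "mpoly_vars p <= J" "!!a. mpoly_eval a p = 0"
 shows "p = 0"
proof -
 have sub: "keys m <= J" if "m : keys p" for m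
  using that assms(2) unfolding mpoly_vars_def by blast
 let ?M = "lookup ` keys p"
 define c where "c f = real_of_rat (lookup p (THE m. lookup m = f))" for f :: "'a => nat"
 have inj: "inj_on lookup (keys p)" by (auto simp: inj_on_def poly_mapping_eqI)
 have c: "c (lookup m) = (of_rat (lookup p m) :: real)" for m
 by (auto simp: poly_mapping_eqI c_def)
 have "c (lookup m) = (0 :: real)" if "m : keys p" for m
 proof (rule monomials_independent[OF assms(1), of ?M])
  show "m i = 0" if mM: "m : ?M" and iJ: "i ~: J" for m i
  using mM sub iJ by (fastforce simp: in_keys_iff)
  show "(SUM m:?M. c m * (PROD i:J. x i ^ m i)) = 0" for x
  proof -
   have "(SUM m:?M. c m * (PROD i:J. x i ^ m i)) = mpoly_eval x p"
    unfolding sum.reindex[OF inj] o_def c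
    by (subst mpoly_eval_superset[OF _ order_refl])
     (auto intro!: sum.cong simp: mono_eval_superset[OF assms(1) sub])
   thus ?thesis using assms(3) by simp
  qed
 qed (use that in auto)
 hence "m ~: keys p" for m unfolding c using in_keys_iff[of m p] by fastforce
 hence "keys p = {}" by blast
 thus ?thesis by simp
qed

text \<open>Passes from formal rational polynomials to polynomial functions; the two notions meet
  because a formal polynomial all of whose values are 0 is 0.\<close>

lemma generic_iff_Generic:
 fixes r :: "'a => real ^ 'd"
 assumes "finite V"
 shows "generic V r <-> Generic \<rat> (V \<times> UNIV) (%(u, i). r u $ i)"
proof
 assume g: "generic V r"
 show "Generic \<rat> (V \<times> UNIV) (%(u, i). r u $ i)"
  unfolding Generic_def
 proof (intro ballI impI allI)
  fix P x assume "P : polyfun \<rat> (V \<times> (UNIV :: 'd set))" "P (%(u, i). r u $ i) = 0"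
  moreover from polyfun_mpoly[OF this(1)] obtain p where "mpoly_vars p <= V \<times> UNIV" "ALL a. mpoly_eval a p = P a" by blast
  ultimately show "P x = 0" using g unfolding generic_def by (metis mpoly_eval_0)
 qed
next
 assume g: "Generic \<rat> (V \<times> UNIV) (%(u, i). r u $ i)"
 show "generic V r"
  unfolding generic_def
 proof (intro allI impI)
  fix p :: "('a * 'd) rat_mpoly"
  assume p: "mpoly_vars p <= V \<times> UNIV & mpoly_eval (%(u, i). r u $ i) p = 0"
  hence "mpoly_eval a p = 0" for a
   using bspec[OF g[unfolded Generic_def] mpoly_polyfun[of p "V \<times> UNIV"]] by simp
  thus "p = 0" using mpoly_eval_eq_0[of "V \<times> UNIV" p] assms p by auto
 qed
qed

section \<open>Linear algebra over finite index sets\<close>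

text \<open>A vector over a finite index set \<open>J\<close> is a function of which only the values on \<open>J\<close> matter.\<close>

definition indep :: "'i set => 'j set => ('i => 'j => real) => bool" where
 "indep I J a <-> (ALL m. (ALL j:J. (SUM i:I. m i * a i j) = 0) --> (ALL i:I. m i = 0))"

lemma indepD: "indep I J a ==> (!!j. j : J ==> (SUM i:I. m i * a i j) = 0) ==> i : I ==> m i = 0"
 unfolding indep_def by blast

text \<open>Gaussian elimination: a nonzero entry of row \<open>i\<close> eliminates its column from
  the other rows, leaving one row and one unknown fewer.\<close>

lemma underdetermined:
 fixes a :: "'i => 'j => real"
 assumes "finite I" "finite J" "card I < card J"
 shows "EX x. (EX j:J. x j ~= 0) & (ALL i:I. (SUM j:J. x j * a i j) = 0)"
 using assms
proof (induction I arbitrary: J a rule: finite_induct)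
 case empty
 hence "J ~= {}" by auto
 thus ?case by (intro exI[of _ "%_. 1"]) auto
next
 case (insert i I)
 show ?case
 proof (cases "ALL j:J. a i j = 0")
  case True
  have "card I < card J" using insert by simp
  from insert.IH[OF insert.prems(1) this, of a] obtain x where
   "EX j:J. x j ~= 0" "ALL i:I. (SUM j:J. x j * a i j) = 0" by blast
  thus ?thesis using True by (intro exI[of _ x]) auto
 next
  case False
  then obtain j0 where j0: "j0 : J" "a i j0 ~= 0" by blast
  let ?J = "J - {j0}"
  have fJ: "finite ?J" and cJ: "card I < card ?J" using insert j0 by auto
  from insert.IH[OF this, of "%i' j. a i' j - a i' j0 * a i j / a i j0"] obtain x where
   x: "EX j:?J. x j ~= 0" "!!i'. i' : I ==> (SUM j:?J. x j * (a i' j - a i' j0 * a i j / a i j0)) = 0" by blast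
  define s where "s = (SUM j:?J. x j * a i j) / a i j0"
  define y where "y = x(j0 := - s)"
  have yJ: "(SUM j:J. y j * a i' j) = (SUM j:?J. x j * a i' j) - s * a i' j0" for i'
  proof -
   have "(SUM j:J. y j * a i' j) = y j0 * a i' j0 + (SUM j:?J. y j * a i' j)"
    using insert.prems(1) j0(1) by (rule sum.remove)
   also have "(SUM j:?J. y j * a i' j) = (SUM j:?J. x j * a i' j)" by (intro sum.cong) (auto simp: y_def)
   finally show ?thesis by (simp add: y_def)
  qed
  show ?thesis
  proof (intro exI[of _ y] conjI ballI)
   show "EX j:J. y j ~= 0" using x(1) by (auto simp: y_def)
  next
   fix i' assume "i' : insert i I"
   moreover have "(SUM j:J. y j * a i j) = 0" unfolding yJ s_def using j0(2) by simp
   moreover have "(SUM j:J. y j * a i' j) = 0" if "i' : I"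
   proof -
    have "(SUM j:?J. x j * (a i' j - a i' j0 * a i j / a i j0)) =
      (SUM j:?J. x j * a i' j - x j * a i j * (a i' j0 / a i j0))"
     by (intro sum.cong) (auto simp: algebra_simps)
    also have "... = (SUM j:?J. x j * a i' j) - s * a i' j0"
     by (simp add: sum_subtractf s_def sum_right sum_divide_distrib)
    finally show ?thesis unfolding yJ using x(2)[OF that] by simp
   qed
   ultimately show "(SUM j:J. y j * a i' j) = 0" by auto
  qed
 qed
qed

lemma indep_card:
 assumes "indep I J a" "finite I" "finite J"
 shows "card I <= card J"
proof (rule ccontr)
 assume "~ ?thesis"
 hence "card J < card I" by simp
 from underdetermined[OF assms(3,2) this, of "%j i. a i j"] show False
  using assms(1) unfolding indep_def by blast
qed

text \<open>Appending a unit vector as an additional column makes the system underdetermined, and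
  injectivity keeps the new unknown from vanishing; this gives a right inverse. It is also a left
  inverse, since the deviation from the identity lies in the kernel.\<close>

lemma square_inverse:
 fixes a :: "'i => 'j => real"
 assumes inj: "indep J I (%j i. a i j)" and "finite I" "finite J" "card I = card J"
 shows "EX b. (ALL i:I. ALL i':I. (SUM j:J. a i j * b j i') = (kr i i')) &
       (ALL j:J. ALL j':J. (SUM i:I. b j i * a i j') = (kr j j'))"
proof -
 have "EX x. ALL i:I. (SUM j:J. a i j * x j) = (kr i i')" for i'
 proof -
  define a' where "a' i j = (case j of None => if i = i' then 1 else 0 | Some j => a i j)" for i j
  let ?J = "insert None (Some ` J)"
  have fin: "finite ?J" and cd: "card I < card ?J" using assms by (auto simp: card_image)
  from underdetermined[OF assms(2) this, of a'] obtain x where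
   x: "EX j:?J. x j ~= 0" "!!i. i : I ==> (SUM j:?J. x j * a' i j) = 0" by blast
  have s: "(SUM j:?J. x j * a' i j) = x None * (kr i i') + (SUM j:J. x (Some j) * a i j)" for i
   using assms(3) by (simp add: sum.reindex a'_def image_iff)
  have n: "x None ~= 0"
  proof
   assume n: "x None = 0"
   hence "x (Some j) = 0" if "j : J" for j
    using indepD[OF inj, of "%j. x (Some j)" j] x(2) that unfolding s by simp
   thus False using n x(1) by auto
  qed
  have "(SUM j:J. a i j * (- x (Some j) / x None)) = (kr i i')" if "i : I" for i
  proof -
   have e: "(SUM j:J. a i j * (- x (Some j) / x None)) = - (SUM j:J. x (Some j) * a i j) / x None"
    by (simp add: sum_negf sum_divide_distrib mult.commute)
   have "(SUM j:J. x (Some j) * a i j) = - (x None * (kr i i'))"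
    using x(2)[OF that] unfolding s by linarith
   thus ?thesis unfolding e using n by simp
  qed
  thus ?thesis by (intro exI[of _ "%j. - x (Some j) / x None"]) blast
 qed
 hence "ALL i'. EX x. ALL i:I. (SUM j:J. a i j * x j) = (kr i i')" by blast
 then obtain c where c0: "ALL i'. ALL i:I. (SUM j:J. a i j * c i' j) = (kr i i')"
  by (rule choice[THEN exE])
 define b where "b j i' = c i' j" for j i'
 have b: "(SUM j:J. a i j * b j i') = (kr i i')" if "i : I" for i i'
  using c0 that by (simp add: b_def)
 have "(SUM i:I. b j i * a i j') = (kr j j')" if j: "j : J" "j' : J" for j j'
 proof -
  define y where "y j = (SUM i:I. b j i * a i j') - (kr j j')" for j
  have "y j = 0"
  proof (rule indepD[OF inj])
   fix i assume i: "i : I"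
   have "(SUM j:J. y j * a i j) = (SUM j:J. (SUM i':I. a i j * b j i' * a i' j') - (kr j j') * a i j)"
    unfolding y_def left_diff_distrib sum_right
    by (intro sum.cong arg_cong2[where f = "(-)"] refl) (simp add: mult_ac)
   also have "... = (SUM j:J. SUM i':I. a i j * b j i' * a i' j') - (SUM j:J. (kr j j') * a i j)"
    by (rule sum_subtractf)
   also have "(SUM j:J. SUM i':I. a i j * b j i' * a i' j') = (SUM i':I. (SUM j:J. a i j * b j i') * a i' j')"
    by (subst sum.swap) (simp add: sum_right)
   also have "... = a i j'" using b[OF i] i assms(2) by (simp add: if_mult cong: if_cong)
   also have "(SUM j:J. (kr j j') * a i j) = a i j'"
    using j assms(3) by (simp add: if_mult cong: if_cong)
   finally show "(SUM j:J. y j * a i j) = 0" by simp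
  qed (rule j)
  thus ?thesis by (simp add: y_def)
 qed
 thus ?thesis using b by blast
qed

lemma square_solve:
 fixes a :: "'i => 'j => real"
 assumes "indep J I (%j i. a i j)" and "finite I" "finite J" "card I = card J"
 shows "EX x. ALL i:I. (SUM j:J. a i j * x j) = y i"
proof -
 obtain b where b: "!!i i'. i : I ==> i' : I ==> (SUM j:J. a i j * b j i') = (kr i i')"
  using square_inverse[OF assms] by blast
 have "(SUM j:J. a i j * (SUM i':I. b j i' * y i')) = y i" if i: "i : I" for i
 proof -
  have "(SUM j:J. a i j * (SUM i':I. b j i' * y i')) = (SUM j:J. SUM i':I. a i j * b j i' * y i')"
   by (simp add: sum_left mult_ac)
  also have "... = (SUM i':I. (SUM j:J. a i j * b j i') * y i')"
   by (subst sum.swap) (simp add: sum_right)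
  also have "... = y i" using b[OF i] i assms(2) by (simp add: if_mult cong: if_cong)
  finally show ?thesis .
 qed
 thus ?thesis by (intro exI[of _ "%j. SUM i':I. b j i' * y i'"]) blast
qed

lemma indep_complete:
 fixes a :: "'i => 'j => real"
 assumes ind: "indep I J a" and "finite I" "finite J"
 shows "EX J0<=J. card I + card J0 = card J &
  (ALL x. (ALL i:I. (SUM j:J. a i j * x j) = 0) --> (ALL j:J0. x j = 0) --> (ALL j:J. x j = 0)) &
  (ALL y z. EX x. (ALL i:I. (SUM j:J. a i j * x j) = y i) & (ALL j:J0. x j = z j))"
proof -
 define det where "det J0 <-> J0 <= J &
  (ALL x. (ALL i:I. (SUM j:J. a i j * x j) = 0) --> (ALL j:J0. x j = 0) --> (ALL j:J. x j = 0))" for J0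
 have "det J" by (simp add: det_def)
 then obtain J0 where J0: "det J0" and min: "!!J1. det J1 ==> card J0 <= card J1"
  using exists_least_iff[of "%n. EX J0. det J0 & card J0 = n"] by (metis not_le)
 have sub: "J0 <= J" and fin0: "finite J0" using J0 assms(3) finite_subset unfolding det_def by auto
 define K where "K = I <+> J0"
 define s where "s k j = (case k of Inl i => a i j | Inr j' => if j = j' then 1 else 0)" for k j
 have finK: "finite K" unfolding K_def using assms(2) fin0 by simp
 have sumK: "(SUM k:K. m k * s k j) = (SUM i:I. m (Inl i) * a i j) + (if j : J0 then m (Inr j) else 0)" for m j
 proof -
  have "(SUM k:K. m k * s k j) = (SUM i:I. m (Inl i) * a i j) + (SUM j':J0. m (Inr j') * (kr j j'))"
   unfolding K_def using assms(2) fin0 by (subst sum.Plus) (auto simp: s_def)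
  also have "(SUM j':J0. m (Inr j') * (kr j j')) = (if j : J0 then m (Inr j) else 0)"
   using fin0 by (simp add: mult_if cong: if_cong)
  finally show ?thesis .
 qed
 have sumJ: "(SUM j:J. s k j * x j) = (case k of Inl i => (SUM j:J. a i j * x j) | Inr j' => x j')" if "k : K" for k x
  using that sub assms(3)
  by (auto simp: K_def s_def if_mult cong: if_cong)
 have rows: "indep K J s"
  unfolding indep_def
 proof (intro allI impI)
  fix m assume m: "ALL j:J. (SUM k:K. m k * s k j) = 0"
  have nu: "m (Inr j0) = 0" if j0: "j0 : J0" for j0
  proof (rule ccontr)
   assume nz: "m (Inr j0) ~= 0"
   have "det (J0 - {j0})"
    unfolding det_def
   proof (intro conjI allI impI)
    show "J0 - {j0} <= J" using sub by auto
   next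
    fix x assume x: "ALL i:I. (SUM j:J. a i j * x j) = 0" "ALL j:J0 - {j0}. x j = 0"
    have "0 = (SUM j:J. (SUM k:K. m k * s k j) * x j)" using m by simp
    also have "... = (SUM k:K. m k * (SUM j:J. s k j * x j))"
     by (rule sum_assoc(1))
    also have "... = (SUM k:K. m k * (case k of Inl i => 0 | Inr j' => x j'))"
    proof (rule sum.cong[OF refl])
     fix k assume k: "k : K"
     thus "m k * (SUM j:J. s k j * x j) = m k * (case k of Inl i => 0 | Inr j' => x j')"
      unfolding sumJ[OF k] using x(1) by (auto simp: K_def)
    qed
    also have "... = (SUM j:J0. m (Inr j) * x j)"
     unfolding K_def using assms(2) fin0 by (subst sum.Plus) auto
    also have "... = m (Inr j0) * x j0 + (SUM j:J0 - {j0}. m (Inr j) * x j)"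
     using fin0 j0 by (rule sum.remove)
    also have "... = m (Inr j0) * x j0" using x(2) by simp
    finally have "x j0 = 0" using nz by simp
    hence "ALL j:J0. x j = 0" using x(2) by auto
    thus "ALL j:J. x j = 0" using J0 x(1) unfolding det_def by blast
   qed
   thus False using min[of "J0 - {j0}"] fin0 j0 by (metis card_Diff1_less not_le)
  qed
  hence "(SUM i:I. m (Inl i) * a i j) = 0" if "j : J" for j
   using m that unfolding sumK by (auto split: if_splits)
  hence "m (Inl i) = 0" if "i : I" for i using indepD[OF ind, of "%i. m (Inl i)"] that by blast
  thus "ALL k:K. m k = 0" using nu by (auto simp: K_def)
 qed
 have cols: "indep J K (%j k. s k j)"
  unfolding indep_def
 proof (intro allI impI)
  fix x assume x0: "ALL k:K. (SUM j:J. x j * s k j) = 0"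
  hence x: "(SUM j:J. s k j * x j) = 0" if "k : K" for k using that by (simp add: mult.commute)
  have "ALL i:I. (SUM j:J. a i j * x j) = 0" using x[of "Inl _"] sumJ[of "Inl _"] by (auto simp: K_def)
  moreover have "ALL j:J0. x j = 0" using x[of "Inr _"] sumJ[of "Inr _"] by (auto simp: K_def)
  ultimately show "ALL j:J. x j = 0" using J0 unfolding det_def by blast
 qed
 have cK: "card K = card I + card J0" unfolding K_def using assms(2) fin0 by (rule card_Plus)
 have eq: "card K = card J"
  using indep_card[OF rows finK assms(3)] indep_card[OF cols assms(3) finK] by simp
 have "EX x. (ALL i:I. (SUM j:J. a i j * x j) = y i) & (ALL j:J0. x j = z j)" for y z
 proof -
  obtain x where x: "ALL k:K. (SUM j:J. s k j * x j) = (case k of Inl i => y i | Inr j => z j)"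
   using square_solve[OF cols finK assms(3) eq] by blast
  have "(SUM j:J. a i j * x j) = y i" if "i : I" for i
   using x[rule_format, of "Inl i"] sumJ[of "Inl i" x] that by (auto simp: K_def)
  moreover have "x j = z j" if "j : J0" for j
   using x[rule_format, of "Inr j"] sumJ[of "Inr j" x] that by (auto simp: K_def)
  ultimately show ?thesis by blast
 qed
 thus ?thesis using J0 cK eq unfolding det_def by (intro exI[of _ J0]) auto
qed

lemma indep_solve:
 fixes a :: "'i => 'j => real"
 assumes "indep I J a" "finite I" "finite J"
 shows "EX x. ALL i:I. (SUM j:J. a i j * x j) = y i"
 using indep_complete[OF assms] by blast

lemma max_indep:
 fixes a :: "'i => 'j => real"
 assumes "finite I"
 shows "EX I0<=I. indep I0 J a & (ALL i:I. EX m. ALL j:J. a i j = (SUM k:I0. m k * a k j))"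
proof -
 define Q where "Q n <-> (EX I0. I0 <= I & indep I0 J a & card I0 = n)" for n
 have "Q 0" unfolding Q_def by (intro exI[of _ "{}"]) (auto simp: indep_def)
 moreover have "ALL n. Q n --> n <= card I" unfolding Q_def using card_mono[OF assms] by auto
 ultimately have "Q (Greatest Q)" and mx: "!!n. Q n ==> n <= Greatest Q"
  using GreatestI_nat[of Q 0 "card I"] Greatest_le_nat[of Q _ "card I"] by auto
 then obtain I0 where I0: "I0 <= I" "indep I0 J a" "card I0 = Greatest Q" unfolding Q_def by blast
 have fin: "finite I0" using I0(1) assms finite_subset by blast
 have "EX m. ALL j:J. a i j = (SUM k:I0. m k * a k j)" if i: "i : I" for i
 proof (cases "i : I0")
  case True
  thus ?thesis using fin
   by (intro exI[of _ "%k. if k = i then 1 else 0"]) (simp add: if_mult cong: if_cong)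
 next
  case False
  have "~ indep (insert i I0) J a"
  using I0(1) i False fin mx I0(3) by (fastforce simp: Q_def)
  then obtain m where m: "!!j. j : J ==> (SUM k:insert i I0. m k * a k j) = 0" "EX k:insert i I0. m k ~= 0"
   unfolding indep_def by blast
  have s: "m i * a i j + (SUM k:I0. m k * a k j) = 0" if "j : J" for j
   using m(1)[OF that] False fin by simp
  have "m i ~= 0"
  proof
   assume z: "m i = 0"
   hence "m k = 0" if "k : I0" for k using indepD[OF I0(2), of m k] s that by simp
   thus False using z m(2) by auto
  qed
  hence "a i j = (SUM k:I0. (- m k / m i) * a k j)" if "j : J" for j
  proof -
   have e: "(SUM k:I0. (- m k / m i) * a k j) = - (SUM k:I0. m k * a k j) / m i"
    by (simp add: sum_negf sum_divide_distrib)
   have "(SUM k:I0. m k * a k j) = - (m i * a i j)" using s[OF that] by linarith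
   thus ?thesis unfolding e using \<open>m i ~= 0\<close> by simp
  qed
  thus ?thesis by (intro exI[of _ "%k. - m k / m i"]) simp
 qed
 thus ?thesis using I0 by blast
qed

text \<open>If \<open>f\<close> were independent of a maximal independent set of rows, there would
  be a vector on which all rows are 0 and \<open>f\<close> is 1.\<close>

lemma kernel_form:
 fixes a :: "'i => 'j => real"
 assumes "finite I" "finite J"
  and ker: "!!x. (!!i. i : I ==> (SUM j:J. a i j * x j) = 0) ==> (SUM j:J. f j * x j) = 0"
 shows "EX m. ALL j:J. f j = (SUM i:I. m i * a i j)"
proof -
 define b where "b k = (case k of None => f | Some i => a i)" for k
 obtain I0 where I0: "I0 <= I" "indep I0 J a" "!!i. i : I ==> EX m. ALL j:J. a i j = (SUM k:I0. m k * a k j)"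
  using max_indep[OF assms(1), of J a] by blast
 have fin: "finite I0" using I0(1) assms(1) finite_subset by blast
 have "~ indep (insert None (Some ` I0)) J b"
 proof
  assume ind: "indep (insert None (Some ` I0)) J b"
  obtain x where x: "ALL k:insert None (Some ` I0). (SUM j:J. b k j * x j) = (kr k None)"
   using indep_solve[OF ind _ assms(2), of "%k. if k = None then 1 else 0"] fin by blast
  have z: "(SUM j:J. a i j * x j) = 0" if i: "i : I" for i
  proof -
   obtain m where m: "!!j. j : J ==> a i j = (SUM k:I0. m k * a k j)" using I0(3)[OF i] by blast
   have "(SUM j:J. a i j * x j) = (SUM j:J. SUM k:I0. m k * (a k j * x j))"
    by (intro sum.cong refl) (simp add: m sum_right mult.assoc)
   also have "... = (SUM k:I0. m k * (SUM j:J. a k j * x j))"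
    by (subst sum.swap) (simp add: sum_left)
   also have "... = 0" using x by (intro sum.neutral) (auto simp: b_def)
   finally show ?thesis .
  qed
  hence "(SUM j:J. f j * x j) = 0" by (rule ker)
  thus False using x by (auto simp: b_def)
 qed
 then obtain m where m: "!!j. j : J ==> (SUM k:insert None (Some ` I0). m k * b k j) = 0"
   "EX k:insert None (Some ` I0). m k ~= 0"
  unfolding indep_def by blast
 have s: "m None * f j + (SUM k:I0. m (Some k) * a k j) = 0" if "j : J" for j
  using m(1)[OF that] fin by (simp add: sum.reindex b_def image_iff)
 have n: "m None ~= 0"
 proof
  assume z: "m None = 0"
  hence "m (Some k) = 0" if "k : I0" for k using indepD[OF I0(2), of "%k. m (Some k)" k] s that by simp
  thus False using z m(2) by auto
 qed
 have "f j = (SUM i:I. (if i : I0 then - m (Some i) / m None else 0) * a i j)" if "j : J" for j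
 proof -
  have "(SUM i:I. (if i : I0 then - m (Some i) / m None else 0) * a i j) = (SUM i:I0. - m (Some i) / m None * a i j)"
   using I0(1) assms(1) by (intro sum.mono_neutral_cong_right) auto
  also have "... = - (SUM k:I0. m (Some k) * a k j) / m None" by (simp add: sum_negf sum_divide_distrib)
  finally have e: "(SUM i:I. (if i : I0 then - m (Some i) / m None else 0) * a i j) = - (SUM k:I0. m (Some k) * a k j) / m None" .
  have "(SUM k:I0. m (Some k) * a k j) = - (m None * f j)" using s[OF that] by linarith
  thus ?thesis unfolding e using n by simp
 qed
 thus ?thesis by (intro exI[of _ "%i. if i : I0 then - m (Some i) / m None else 0"]) blast
qed

text \<open>\<open>U\<close> is a smallest set of positions that determines the vectors of the
  subspace, and minimality produces the dual basis \<open>k\<close>. Kernels of stresses and spaces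
  of stresses are coordinatized this way.\<close>

lemma subspace_coordinates:
 fixes Sub :: "('v => real) => bool"
 assumes "finite V" and S0: "Sub (%_. 0)"
  and lin: "!!x y a b. Sub x ==> Sub y ==> Sub (%v. a * x v + b * y v)"
 shows "EX U k. U <= V & (ALL u:U. Sub (k u) & (ALL u':U. k u u' = (kr u u'))) &
  (ALL x. Sub x --> (ALL w:V. x w = (SUM u:U. x u * k u w)))"
proof -
 define det where "det U <-> U <= V & (ALL x. Sub x --> (ALL u:U. x u = 0) --> (ALL w:V. x w = 0))" for U
 have "det V" by (simp add: det_def)
 then obtain U where U: "det U" and min: "!!U1. det U1 ==> card U <= card U1"
  using exists_least_iff[of "%n. EX U. det U & card U = n"] by (metis not_le)
 have sub: "U <= V" and fin: "finite U" using U assms(1) finite_subset unfolding det_def by auto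
 have "EX x. Sub x & (ALL u':U. x u' = (kr u u'))" if u: "u : U" for u
 proof -
  have "~ det (U - {u})" using min[of "U - {u}"] fin u by (metis card_Diff1_less not_le)
  then obtain x where x: "Sub x" "ALL u':U - {u}. x u' = 0" "~ (ALL w:V. x w = 0)"
   unfolding det_def using sub by blast
  have "x u ~= 0"
  using x(2) U x(1,3) by (auto simp: det_def)
  thus ?thesis using lin[OF x(1) x(1), of "1 / x u" 0] x(2) u
   by (intro exI[of _ "%v. 1 / x u * x v + 0 * x v"]) auto
 qed
 then obtain k where k: "!!u. u : U ==> Sub (k u)" "!!u u'. u : U ==> u' : U ==> k u u' = (kr u u')"
  by metis
 have comb: "Sub (%w. SUM u:T. c u * k u w)" if "T <= U" for c T
  using finite_subset[OF that fin] that
 proof (induction T rule: finite_induct)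
  case empty thus ?case using S0 by simp
 next
  case (insert u T)
  thus ?case using lin[OF k(1)[of u], of "%w. SUM u:T. c u * k u w" "c u" 1] by simp
 qed
 have "x w = (SUM u:U. x u * k u w)" if x: "Sub x" and w: "w : V" for x w
 proof -
  have "Sub (%w. 1 * x w + -1 * (SUM u:U. x u * k u w))" by (rule lin[OF x comb]) simp
  moreover have "x u' - (SUM u:U. x u * k u u') = 0" if "u' : U" for u'
   using that fin by (simp add: k(2) if_distrib[where f = "%a. _ * a"] cong: if_cong)
  ultimately show ?thesis using U w unfolding det_def by fastforce
 qed
 thus ?thesis using sub k by (intro exI[of _ U] exI[of _ k]) blast
qed

subsection \<open>Compactness and the spectral theorem\<close>

lemma bounded_convergent_subsequence:
 fixes x :: "nat => 'j => real"
 assumes "finite J" "!!n j. j : J ==> abs (x n j) <= B"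
 shows "EX r l. strict_mono (r :: nat => nat) & (ALL j:J. (%n. x (r n) j) ----> l j)"
 using assms
proof (induction J rule: finite_induct)
 case empty
 thus ?case by (intro exI[of _ id]) (auto simp: strict_mono_def)
next
 case (insert k J)
 then obtain r l where r: "strict_mono (r :: nat => nat)" "ALL j:J. (%n. x (r n) j) ----> l j" by auto
 have "ALL n. x (r n) k : {-B..B}" using insert.prems(1)[of k] by (auto simp: abs_le_iff minus_le_iff)
 then obtain m s where s: "strict_mono (s :: nat => nat)" "((%n. x (r n) k) \<circ> s) ----> m"
  using compact_imp_seq_compact[OF compact_Icc, of "-B" B] unfolding seq_compact_def by metis
 have "(%n. x (r (s n)) j) ----> l j" if "j : J" for j
  using LIMSEQ_subseq_LIMSEQ[OF r(2)[rule_format, OF that] s(1)] by (simp add: o_def)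
 thus ?case using s insert.hyps strict_mono_o[OF r(1) s(1)]
  by (intro exI[of _ "r \<circ> s"] exI[of _ "l(k := m)"]) (auto simp: o_def)
qed

text \<open>Only the coordinates in \<open>J\<close> matter, so closedness and continuity are
  demanded for sequences that converge on \<open>J\<close>.\<close>

lemma attains_max:
 fixes f :: "('j => real) => real"
 assumes "finite J" "C ~= {}" "!!v j. v : C ==> j : J ==> abs (v j) <= B"
  and closed: "!!x l. (!!n. x n : C) ==> (!!j. j : J ==> (%n. x n j) ----> l j) ==> l : C"
  and cont: "!!x l. (!!n. x n : C) ==> (!!j. j : J ==> (%n. x n j) ----> l j) ==> (%n. f (x n)) ----> f l"
 shows "EX l:C. ALL v:C. f v <= f l"
proof -
 have lim: "EX r l. strict_mono (r :: nat => nat) & l : C & (%n. f (x (r n))) ----> f l" if xC: "!!n. x n : C" for x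
 proof -
  obtain r l where r: "strict_mono (r :: nat => nat)" "ALL j:J. (%n. x (r n) j) ----> l j"
   using bounded_convergent_subsequence[OF assms(1), of x B] assms(3)[OF xC] by blast
  thus ?thesis using closed[of "%n. x (r n)" l] cont[of "%n. x (r n)" l] xC
   by (intro exI[of _ r] exI[of _ l]) simp
 qed
 have bdd: "bdd_above (f ` C)"
 proof (rule ccontr)
  assume "~ ?thesis"
  hence "ALL n. EX v:C. f v > real n" unfolding bdd_above_def by (metis imageE not_le)
  then obtain x where x: "!!n. x n : C" "!!n. f (x n) > real n" by metis
  obtain r l where r: "strict_mono (r :: nat => nat)" "(%n. f (x (r n))) ----> f l" using lim[of x, OF x(1)] by (elim exE conjE)
  have "real n <= f (x (r n))" for n using x(2)[of "r n"] seq_suble[OF r(1), of n] by linarith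
  hence "filterlim (%n. f (x (r n))) at_top sequentially"
   by (intro filterlim_at_top_mono[OF filterlim_real_sequentially]) auto
  thus False using r(2) not_tendsto_and_filterlim_at_infinity[OF sequentially_bot r(2)]
    filterlim_at_top_imp_at_infinity by blast
 qed
 define S where "S = Sup (f ` C)"
 have "EX v:C. f v > S - 1 / real (Suc n)" for n
 proof -
  have "S - 1 / real (Suc n) < Sup (f ` C)" by (simp add: S_def)
  thus ?thesis using less_cSup_iff[of "f ` C"] assms(2) bdd by auto
 qed
 then obtain x where x: "!!n. x n : C" "!!n. f (x n) > S - 1 / real (Suc n)" by metis
 obtain r l where r: "strict_mono (r :: nat => nat)" "l : C" "(%n. f (x (r n))) ----> f l" using lim[of x, OF x(1)] by (elim exE conjE)
 have "(%n. S - 1 / real (Suc n)) ----> S - 0"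
  by (intro tendsto_intros LIMSEQ_Suc[OF lim_1_over_n])
 from LIMSEQ_subseq_LIMSEQ[OF this r(1)] have "(%n. S - 1 / real (Suc (r n))) ----> S" by (simp add: o_def)
 hence "S <= f l" by (rule LIMSEQ_le[OF _ r(3)]) (use x(2) less_imp_le in blast)
 thus ?thesis using r(2) cSup_upper[OF _ bdd] unfolding S_def by (meson imageI order_trans)
qed

definition orthon :: "'p set => ('p => 'p => real) => bool" where
 "orthon P v <-> (ALL i:P. ALL j:P. (SUM p:P. v i p * v j p) = (kr i j))"

text \<open>For a square matrix the transpose, being inverse on one side, is inverse on the
  other.\<close>

lemma orthon_columns:
 assumes "orthon P v" "finite P" "p : P" "q : P"
 shows "(SUM i:P. v i p * v i q) = (kr p q)"
proof -
 have ind: "indep P P (%j i. v j i)"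
  unfolding indep_def
 proof (intro allI impI ballI)
  fix m k assume m: "ALL j:P. (SUM i:P. m i * v i j) = 0" and k: "k : P"
  have "0 = (SUM j:P. (SUM i:P. m i * v i j) * v k j)" using m by simp
  also have "... = (SUM i:P. m i * (SUM j:P. v i j * v k j))"
   by (rule sum_assoc(1))
  also have "... = m k" using assms(1) k assms(2) unfolding orthon_def by (simp add: mult_if cong: if_cong)
  finally show "m k = 0" by simp
 qed
 obtain b where b: "!!i j. i : P ==> j : P ==> (SUM k:P. v k i * b k j) = (kr i j)"
  using square_inverse[OF ind assms(2,2) refl] by blast
 have "b k q = v k q" if k: "k : P" for k
 proof -
  have "b k q = (SUM i:P. (kr k i) * b i q)" using k assms(2)
   by (simp add: if_mult cong: if_cong)
  also have "... = (SUM i:P. (SUM p:P. v k p * v i p) * b i q)"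
   using assms(1) k unfolding orthon_def by (intro sum.cong) auto
  also have "... = (SUM p:P. v k p * (SUM i:P. v i p * b i q))"
   by (rule sum_assoc(1))
  also have "... = v k q" using b assms(4) assms(2,4) by (simp add: mult_if cong: if_cong)
  finally show ?thesis .
 qed
 hence "(SUM i:P. v i p * v i q) = (SUM k:P. v k p * b k q)" by (intro sum.cong) auto
 thus ?thesis using b assms(3,4) by simp
qed

text \<open>Among orthonormal frames, the sum of the quadratic values of \<open>A\<close> weighted
  by distinct numbers has a maximum. There no rotation in the plane of two frame vectors helps,
  which forces the off-diagonal entries of \<open>A\<close> in this frame to vanish.\<close>

theorem spectral:
 fixes A :: "'p => 'p => real"
 assumes fin: "finite P" and sym: "!!p q. p : P ==> q : P ==> A p q = A q p"
 shows "EX v ev. orthon P v & (ALL i:P. ALL q:P. (SUM p:P. A q p * v i p) = ev i * v i q)"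
proof -
 obtain wt :: "'p => nat" where wt: "inj_on wt P" using finite_imp_inj_to_nat_seg[OF fin] by blast
 define bf where "bf x y = (SUM p:P. SUM q:P. x p * A p q * y q)" for x y
 define C where "C = {V :: 'p * 'p => real. orthon P (%i p. V (i, p))}"
 define f where "f V = (SUM i:P. real (wt i) * bf (%p. V (i, p)) (%p. V (i, p)))" for V :: "'p * 'p => real"
 have "EX l:C. ALL V:C. f V <= f l"
 proof (rule attains_max[of "P \<times> P" C 1 f])
  show "finite (P \<times> P)" using fin by simp
  have "(%(i, p). if i = p then 1 else 0) : C"
   unfolding C_def orthon_def using fin
   by (auto simp: if_mult mult_if cong: if_cong)
  thus "C ~= {}" by blast
  show "abs (V j) <= 1" if V: "V : C" and j: "j : P \<times> P" for V j
  proof -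
   obtain i p where ip: "j = (i, p)" "i : P" "p : P" using j by auto
   have "V (i, p) * V (i, p) <= (SUM p:P. V (i, p) * V (i, p))"
    using fin ip by (intro member_le_sum) auto
   also have "... = 1" using V ip unfolding C_def orthon_def by auto
   finally show ?thesis using ip abs_le_square_iff[of "V j" 1] by (simp add: power2_eq_square)
  qed
  show "l : C" if x: "!!n. x n : C" and l: "!!j. j : P \<times> P ==> (%n. x n j) ----> l j" for x l
   unfolding C_def orthon_def
  proof (intro CollectI ballI)
   fix i j assume ij: "i : P" "j : P"
   have "(%n. SUM p:P. x n (i, p) * x n (j, p)) ----> (SUM p:P. l (i, p) * l (j, p))"
    using ij by (intro tendsto_sum tendsto_mult l) auto
   moreover have "(SUM p:P. x n (i, p) * x n (j, p)) = (kr i j)" for n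
    using x[of n] ij unfolding C_def orthon_def by blast
   ultimately have "(%n. if i = j then 1 else 0 :: real) ----> (SUM p:P. l (i, p) * l (j, p))" by simp
   thus "(SUM p:P. l (i, p) * l (j, p)) = (kr i j)" by (simp only: LIMSEQ_const_iff)
  qed
  show "(%n. f (x n)) ----> f l" if "!!j. j : P \<times> P ==> (%n. x n j) ----> l j" for x l
   unfolding f_def bf_def by (intro tendsto_sum tendsto_mult tendsto_const that) auto
 qed
 then obtain V where V: "V : C" and mx: "!!W. W : C ==> f W <= f V" by blast
 define v where "v = (%i p. V (i, p))"
 have ov: "orthon P v" using V by (simp add: C_def v_def)
 have bsym: "bf x y = bf y x" for x y
 proof -
  have "bf x y = (SUM q:P. SUM p:P. x p * A p q * y q)" unfolding bf_def by (rule sum.swap)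
  also have "... = bf y x" unfolding bf_def using sym by (intro sum.cong) auto
  finally show ?thesis .
 qed
 have blin: "bf (%p. a * x p + b * y p) z = a * bf x z + b * bf y z" for a b x y z
  by (simp add: bf_def algebra_simps sum.distrib sum_left)
 have blin2: "bf z (%p. a * x p + b * y p) = a * bf z x + b * bf z y" for a b x y z
  using blin bsym by metis
 have off: "bf (v i) (v j) = 0" if ij: "i : P" "j : P" "i ~= j" for i j
 proof (rule ccontr)
  define b where "b = bf (v i) (v j)"
  define a where "a = bf (v i) (v i)"
  define d where "d = bf (v j) (v j)"
  assume "bf (v i) (v j) ~= 0"
  hence b0: "b ~= 0" by (simp add: b_def)
  define w where "w = real (wt i) - real (wt j)"
  have w0: "w ~= 0" using wt ij unfolding w_def inj_on_def by auto
  \<comment> \<open>The effect of rotating the vectors \<open>i\<close> and \<open>j\<close> by an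
    angle with cosine \<open>c\<close> and sine \<open>s\<close>; the factor \<open>w\<close> is
    nonzero because the weights are distinct.\<close>
  have rot: "w * (s^2 * (d - a) + 2 * c * s * b) <= 0" if cs: "c^2 + s^2 = 1" for c s
  proof -
   define s' where "s' = - s"
   define u where "u k = (if k = i then (%p. c * v i p + s * v j p)
    else if k = j then (%p. s' * v i p + c * v j p) else v k)" for k
   have o: "(SUM p:P. v k p * v l p) = (kr k l)" if "k : P" "l : P" for k l
    using ov that unfolding orthon_def by blast
   define ip where "ip x y = (SUM p:P. x p * y p)" for x y :: "'p => real"
   have il: "ip (%p. a * x p + b * y p) z = a * ip x z + b * ip y z"
    "ip z (%p. a * x p + b * y p) = a * ip z x + b * ip z y" for a b x y z
    by (simp_all add: ip_def algebra_simps sum.distrib sum_left)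
   have oi: "ip (v k) (v l) = (kr k l)" if "k : P" "l : P" for k l
    using o[OF that] by (simp add: ip_def)
   have cs': "c * c + s * s = 1" "s' * s' + c * c = 1" "c * s' + s * c = 0" "s' * c + c * s = 0"
    using cs by (simp_all add: power2_eq_square s'_def)
   have "ip (u k) (u l) = (kr k l)" if "k : P" "l : P" for k l
    unfolding u_def using that ij cs' by (auto simp: il oi)
   hence "(%(k, p). u k p) : C" by (simp add: C_def orthon_def ip_def)
   from mx[OF this] have "(SUM k:P. real (wt k) * bf (u k) (u k)) <= (SUM k:P. real (wt k) * bf (v k) (v k))"
    by (simp add: f_def v_def)
   moreover have "(SUM k:P. g k) = g i + g j + (SUM k:P - {i, j}. g k)" for g :: "'p => real"
   proof -
    have "(SUM k:P. g k) = g i + (SUM k:P - {i}. g k)" using fin ij by (intro sum.remove)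
    also have "(SUM k:P - {i}. g k) = g j + (SUM k:P - {i} - {j}. g k)" using fin ij by (intro sum.remove) auto
    also have "P - {i} - {j} = P - {i, j}" by auto
    finally show ?thesis by simp
   qed
   moreover have "(SUM k:P - {i, j}. real (wt k) * bf (u k) (u k)) = (SUM k:P - {i, j}. real (wt k) * bf (v k) (v k))"
    by (intro sum.cong) (auto simp: u_def)
   ultimately have "real (wt i) * bf (u i) (u i) + real (wt j) * bf (u j) (u j) <= real (wt i) * a + real (wt j) * d"
    by (simp add: a_def d_def)
   moreover have "bf (u i) (u i) = c^2 * a + 2 * c * s * b + s^2 * d"
    unfolding u_def using bsym[of "v j" "v i"]
    by (simp add: blin blin2 a_def b_def d_def power2_eq_square algebra_simps)
   moreover have "bf (u j) (u j) = s^2 * a - 2 * c * s * b + c^2 * d"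
    unfolding u_def using bsym[of "v j" "v i"] ij(3)
    by (simp add: blin blin2 a_def b_def d_def) (simp add: s'_def power2_eq_square algebra_simps)
   moreover have c2: "c^2 = 1 - s^2" using cs by simp
   ultimately show ?thesis unfolding w_def by (simp add: algebra_simps)
  qed
  define K where "K = abs (w * (d - a))"
  define e where "e = abs (w * b)"
  have e0: "e > 0" using w0 b0 by (simp add: e_def)
  \<comment> \<open>So small that the term linear in \<open>s\<close> outweighs the quadratic one;
    using \<open>s\<close> and \<open>- s\<close> bounds the absolute value of the linear
    term.\<close>
  define s where "s = min (1 / 2) (e / (2 * (K + 1)))"
  have K0: "K >= 0" by (simp add: K_def)
  have s0: "s > 0" "s <= 1 / 2" "s * K < e"
  proof -
   show "s > 0" using e0 K0 by (simp add: s_def)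
   show "s <= 1 / 2" unfolding s_def by (rule min.cobounded1)
   have "s * K <= e / (2 * (K + 1)) * K" using K0 by (intro mult_right_mono) (auto simp: s_def)
   also have "... < e" using e0 K0 by (simp add: field_simps) (smt (verit) mult_nonneg_nonneg)
   finally show "s * K < e" .
  qed
  define c where "c = sqrt (1 - s^2)"
  have s4: "s^2 <= 1 / 4" using s0 power_mono[of s "1/2" 2] by (simp add: power2_eq_square)
  have c: "c^2 = 1 - s^2" using s4 by (simp add: c_def)
  have c2: "c >= 1 / 2" unfolding c_def using s4 by (intro real_le_rsqrt) (simp add: power2_eq_square)
  have 1: "w * (s^2 * (d - a) + 2 * c * s * b) <= 0" using rot[of c s] c by simp
  have 2: "w * (s^2 * (d - a) - 2 * c * s * b) <= 0" using rot[of c "- s"] c by simp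
  have "2 * c * s * e <= s^2 * K"
  proof -
   have "2 * c * s * (w * b) <= - (s^2 * (w * (d - a)))" "- (2 * c * s * (w * b)) <= - (s^2 * (w * (d - a)))"
    using 1 2 by (simp_all add: algebra_simps)
   hence "abs (2 * c * s * (w * b)) <= - (s^2 * (w * (d - a)))" by linarith
   also have "... <= abs (s^2 * (w * (d - a)))" by linarith
   finally show ?thesis using c2 s0 by (simp add: e_def K_def abs_mult)
  qed
  hence "2 * c * e <= s * K" using s0(1) by (simp add: power2_eq_square)
  moreover have "e <= 2 * c * e" using c2 e0 by simp
  ultimately show False using s0(3) by linarith
 qed
 define ev where "ev i = bf (v i) (v i)" for i
 have "(SUM p:P. A q p * v i p) = ev i * v i q" if i: "i : P" and q: "q : P" for i q
 proof -
  define y where "y q = (SUM p:P. A q p * v i p)" for q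
  have yj: "(SUM r:P. v j r * y r) = bf (v j) (v i)" for j
   by (simp add: y_def bf_def sum_left mult_ac)
  have "y q = (SUM r:P. (kr q r) * y r)"
   using fin q by (simp add: if_mult cong: if_cong)
  also have "... = (SUM r:P. (SUM j:P. v j q * v j r) * y r)"
   using orthon_columns[OF ov fin q] by (intro sum.cong) auto
  also have "... = (SUM j:P. v j q * (SUM r:P. v j r * y r))"
   by (rule sum_assoc(1))
  also have "... = (SUM j:P. if j = i then v i q * ev i else 0)"
   unfolding yj ev_def using off i by (intro sum.cong) auto
  also have "... = ev i * v i q" using fin i by simp
  finally show ?thesis by (simp add: y_def)
 qed
 thus ?thesis using ov by blast
qed

subsection \<open>The Faddeev--LeVerrier recursion\<close>

text \<open>Scaled by factorials, so that no division occurs: \<open>flM A P k\<close> is \<open>k!\<close> times the matrix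
 \<open>A\<^sup>k - e\<^sub>1 A\<^sup>k\<^sup>-\<^sup>1 + ... \<plusminus> e\<^sub>k\<close>, where \<open>e\<^sub>j\<close> are the elementary symmetric functions of the eigenvalues.\<close>

primrec flM :: "('p => 'p => 'b::comm_ring_1) => 'p set => nat => 'p => 'p => 'b" where
 "flM A P 0 = (%i j. if i = j then 1 else 0)"
| "flM A P (Suc k) = (%i j. of_nat (Suc k) * (SUM l:P. A i l * flM A P k l j) -
   (SUM i:P. SUM l:P. A i l * flM A P k l i) * (kr i j))"

text \<open>The trace of \<open>A\<close> times \<open>flM A P k\<close>; up to sign it is
  \<open>(k + 1)!\<close> times the elementary symmetric function of degree \<open>k + 1\<close>,
  which explains the index shifts below.\<close>

definition flc :: "('p => 'p => 'b::comm_ring_1) => 'p set => nat => 'b" where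
 "flc A P k = (SUM i:P. SUM l:P. A i l * flM A P k l i)"

lemma flM_Suc:
 "flM A P (Suc k) i j = of_nat (Suc k) * (SUM l:P. A i l * flM A P k l j) - flc A P k * (kr i j)"
 by (simp add: flc_def)

definition esym :: "nat => ('p => real) => 'p set => real" where
 "esym k f S = (SUM U:{U. U <= S & card U = k}. prod f U)"

lemma esym_0 [simp]: "finite S ==> esym 0 f S = 1"
proof -
 assume "finite S"
 hence "{U. U <= S & card U = 0} = {{}}" by (auto dest: finite_subset)
 thus ?thesis by (simp add: esym_def)
qed

lemma esym_insert:
 assumes "finite S" "i ~: S"
 shows "esym (Suc k) f (insert i S) = esym (Suc k) f S + f i * esym k f S"
proof -
 let ?A = "{U. U <= S & card U = Suc k}" and ?B = "{U. U <= S & card U = k}"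
 have "{U. U <= insert i S & card U = Suc k} = ?A Un insert i ` ?B"
 proof (intro equalityI subsetI)
  fix U assume U: "U : {U. U <= insert i S & card U = Suc k}"
  hence finU: "finite U" using assms(1) by (auto dest: finite_subset)
  show "U : ?A Un insert i ` ?B"
  proof (cases "i : U")
   case True
   hence "U = insert i (U - {i})" "U - {i} : ?B" using U finU by auto
   thus ?thesis by blast
  qed (use U in auto)
 next
  fix U assume "U : ?A Un insert i ` ?B"
  thus "U : {U. U <= insert i S & card U = Suc k}"
  proof
   assume "U : insert i ` ?B"
   then obtain W where W: "U = insert i W" "W <= S" "card W = k" by blast
   hence "finite W" "i ~: W" using assms finite_subset by auto
   thus ?thesis using W by auto
  qed auto
 qed
 moreover have "?A \<inter> insert i ` ?B = {}" using assms(2) by auto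
 moreover have "finite ?A" "finite ?B" using assms(1) by auto
 moreover have "(SUM U:insert i ` ?B. prod f U) = f i * esym k f S"
 proof -
  have "inj_on (insert i) ?B" using assms(2) by (auto simp: inj_on_def)
  moreover have "prod f (insert i U) = f i * prod f U" if "U : ?B" for U
  proof -
   have "finite U" "i ~: U" using that assms finite_subset by auto
   thus ?thesis by simp
  qed
  ultimately show ?thesis by (simp add: sum.reindex esym_def sum_left)
 qed
 ultimately show ?thesis unfolding esym_def by (simp add: sum.union_disjoint)
qed

lemma esym_remove:
 assumes "finite S" "i : S"
 shows "esym (Suc k) f S = esym (Suc k) f (S - {i}) + f i * esym k f (S - {i})"
 using esym_insert[of "S - {i}" i k f] assms by (simp add: insert_absorb)

text \<open>Each product of \<open>Suc k\<close> factors is counted once for each of its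
  factors.\<close>

lemma esym_euler:
 assumes "finite S"
 shows "(SUM i:S. f i * esym k f (S - {i})) = real (Suc k) * esym (Suc k) f S"
 using assms
proof (induction S arbitrary: k rule: finite_induct)
 case empty
 have "{U :: 'a set. U = {} & card U = Suc k} = {}" by auto
 thus ?case by (simp add: esym_def)
next
 case (insert x S)
 have d: "insert x S - {i} = insert x (S - {i})" if "i : S" for i using that insert.hyps by auto
 have "(SUM i:insert x S. f i * esym k f (insert x S - {i})) =
   f x * esym k f S + (SUM i:S. f i * esym k f (insert x (S - {i})))"
  using insert.hyps d by simp
 also have "(SUM i:S. f i * esym k f (insert x (S - {i}))) = real (Suc k) * esym (Suc k) f S + real k * f x * esym k f S"
 proof (cases k)
  case 0
  thus ?thesis using insert.IH[of 0] insert.hyps by simp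
 next
  case (Suc k')
  have "(SUM i:S. f i * esym k f (insert x (S - {i}))) =
    (SUM i:S. f i * esym k f (S - {i}) + f x * (f i * esym k' f (S - {i})))"
   using insert.hyps Suc by (intro sum.cong) (auto simp: esym_insert algebra_simps)
  thus ?thesis using insert.IH[of k] insert.IH[of k'] Suc
   by (simp add: sum.distrib sum_left[symmetric])
 qed
 finally show ?case using insert.hyps by (simp add: esym_insert algebra_simps)
qed

lemma esym_nonzero_part:
 assumes "finite S"
 shows "esym k f S = esym k f {i:S. f i ~= 0}"
 unfolding esym_def
proof (rule sum.mono_neutral_right)
 show "finite {U. U <= S & card U = k}" using assms by auto
 show "ALL U:{U. U <= S & card U = k} - {U. U <= {i : S. f i ~= 0} & card U = k}. prod f U = 0"
 using assms finite_subset by (auto simp: prod_zero)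
qed auto

lemma esym_small: "finite S ==> card S < k ==> esym k f S = 0"
proof -
 assume "finite S" "card S < k"
 hence e: "{U. U <= S & card U = k} = {}" using card_mono by (auto simp: not_le[symmetric])
 show ?thesis unfolding esym_def e by simp
qed

lemma esym_card: "finite S ==> esym (card S) f S = prod f S"
proof -
 assume "finite S"
 hence e: "{U. U <= S & card U = card S} = {S}" using card_subset_eq by auto
 show ?thesis unfolding esym_def e by simp
qed

lemma orthon_expand:
 assumes "orthon P v" "finite P" "p : P"
 shows "x p = (SUM i:P. (SUM q:P. v i q * x q) * v i p)"
proof -
 have "(SUM i:P. (SUM q:P. v i q * x q) * v i p) = (SUM q:P. (SUM i:P. v i p * v i q) * x q)"
  by (subst sum_assoc) (simp add: mult_ac)
 also have "... = x p" using orthon_columns[OF assms] assms(2,3) by (simp add: if_mult cong: if_cong)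
 finally show ?thesis by simp
qed

lemma orthon_trace:
 assumes "orthon P v" "finite P"
 shows "(SUM p:P. X p p) = (SUM i:P. SUM p:P. v i p * (SUM q:P. X p q * v i q))"
proof -
 have "(SUM i:P. SUM p:P. v i p * (SUM q:P. X p q * v i q)) = (SUM p:P. SUM i:P. SUM q:P. X p q * (v i p * v i q))"
  by (subst sum.swap) (simp add: sum_left mult_ac)
 also have "... = (SUM p:P. SUM q:P. X p q * (SUM i:P. v i p * v i q))"
 proof (rule sum.cong[OF refl])
  fix p
  show "(SUM i:P. SUM q:P. X p q * (v i p * v i q)) = (SUM q:P. X p q * (SUM i:P. v i p * v i q))"
   by (subst sum.swap) (simp add: sum_left)
 qed
 also have "... = (SUM p:P. X p p)" using orthon_columns[OF assms] assms(2) by (simp add: mult_if cong: if_cong)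
 finally show ?thesis by simp
qed

lemma orthon_ext:
 assumes "orthon P v" "finite P" "p : P" "q : P"
  and "!!i. i : P ==> (SUM r:P. X p r * v i r) = (SUM r:P. Y p r * v i r)"
 shows "X p q = Y p q"
proof -
 have e: "Z p q = (SUM i:P. (SUM r:P. Z p r * v i r) * v i q)" for Z :: "'a => 'a => real"
  using orthon_expand[OF assms(1,2,4), of "Z p"] by (simp add: mult.commute)
 show ?thesis unfolding e[of X] e[of Y] using assms(5) by simp
qed

locale eigenbasis =
 fixes P :: "'p set" and A :: "'p => 'p => real" and v :: "'p => 'p => real" and ev :: "'p => real"
 assumes fin: "finite P" and ov: "orthon P v"
  and eig: "!!i q. i : P ==> q : P ==> (SUM p:P. A q p * v i p) = ev i * v i q"
begin

text \<open>The matrix \<open>flM A P k\<close> is a polynomial in \<open>A\<close>, so it acts on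
  eigenvectors by scalars. The recursion for these scalars is the deletion rule
  \<open>esym_remove\<close>, and the traces follow from \<open>esym_euler\<close>.\<close>

lemma flM_flc:
 "(ALL i:P. ALL q:P. (SUM p:P. flM A P k q p * v i p) = (-1) ^ k * fact k * esym k ev (P - {i}) * v i q) &
  flc A P k = (-1) ^ k * fact (Suc k) * esym (Suc k) ev P"
proof (induction k)
 have trc: "flc A P k = (SUM i:P. ev i * g i)"
  if g: "!!i q. i : P ==> q : P ==> (SUM p:P. flM A P k q p * v i p) = g i * v i q" for k g
 proof -
  have AM: "(SUM q:P. (SUM l:P. A p l * flM A P k l q) * v i q) = g i * ev i * v i p" if "i : P" "p : P" for i p
  proof -
   have "(SUM q:P. (SUM l:P. A p l * flM A P k l q) * v i q) = (SUM l:P. A p l * (SUM q:P. flM A P k l q * v i q))"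
    by (rule sum_assoc(1))
   also have "... = (SUM l:P. g i * (A p l * v i l))" using g that by (intro sum.cong) auto
   also have "... = g i * ev i * v i p" using eig that by (simp add: sum_left[symmetric])
   finally show ?thesis .
  qed
  have "flc A P k = (SUM i:P. SUM p:P. v i p * (SUM q:P. (SUM l:P. A p l * flM A P k l q) * v i q))"
   unfolding flc_def using orthon_trace[OF ov fin, of "%p q. SUM l:P. A p l * flM A P k l q"] .
  also have "... = (SUM i:P. ev i * g i * (SUM p:P. v i p * v i p))"
  using AM by (auto simp: sum_left mult_ac)
  also have "... = (SUM i:P. ev i * g i)" using ov unfolding orthon_def by simp
  finally show ?thesis .
 qed
 case 0
 have "(SUM p:P. flM A P 0 q p * v i p) = v i q" if "q : P" for i q
  using that fin by (simp add: if_mult cong: if_cong)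
 thus ?case using trc[of 0 "%_. 1"] esym_euler[OF fin, of ev 0] fin by simp
 case (Suc k)
 have st: "(SUM p:P. flM A P (Suc k) q p * v i p) = (-1) ^ Suc k * fact (Suc k) * esym (Suc k) ev (P - {i}) * v i q"
  if iq: "i : P" "q : P" for i q
 proof -
  let ?g = "(-1) ^ k * fact k * esym k ev (P - {i})"
  have "(SUM p:P. (SUM l:P. A q l * flM A P k l p) * v i p) = (SUM l:P. A q l * (SUM p:P. flM A P k l p * v i p))"
   by (rule sum_assoc(1))
  also have "... = (SUM l:P. ?g * (A q l * v i l))" using Suc iq by (intro sum.cong) auto
  also have "... = ?g * (ev i * v i q)" using eig[OF iq] by (simp add: sum_left[symmetric])
  finally have 1: "(SUM p:P. (SUM l:P. A q l * flM A P k l p) * v i p) = ?g * (ev i * v i q)" .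
  have "(SUM p:P. flM A P (Suc k) q p * v i p) =
    (SUM p:P. real (Suc k) * ((SUM l:P. A q l * flM A P k l p) * v i p) - flc A P k * ((kr q p) * v i p))"
   unfolding flM_Suc by (intro sum.cong refl) (simp only: left_diff_distrib mult.assoc of_nat_id)
  also have "... = real (Suc k) * (SUM p:P. (SUM l:P. A q l * flM A P k l p) * v i p) - flc A P k * (SUM p:P. (kr q p) * v i p)"
   by (simp only: sum_subtractf sum_left)
  also have "(SUM p:P. (kr q p) * v i p) = v i q"
   using fin iq by (simp add: if_mult cong: if_cong)
  also have "flc A P k = (-1) ^ k * fact (Suc k) * (esym (Suc k) ev (P - {i}) + ev i * esym k ev (P - {i}))"
   using Suc esym_remove[OF fin iq(1), of k ev] by simp
  finally show ?thesis unfolding 1 by (simp add: algebra_simps)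
 qed
 have "flc A P (Suc k) = (SUM i:P. ev i * ((-1) ^ Suc k * fact (Suc k) * esym (Suc k) ev (P - {i})))"
  by (rule trc) (use st in auto)
 also have "... = (-1) ^ Suc k * fact (Suc k) * (SUM i:P. ev i * esym (Suc k) ev (P - {i}))"
  by (simp only: sum_left mult_ac)
 also have "... = (-1) ^ Suc k * fact (Suc (Suc k)) * esym (Suc (Suc k)) ev P"
  unfolding esym_euler[OF fin] by simp
 finally show ?case using st by blast
qed

definition N where "N = {i:P. ev i ~= 0}"

lemma kernel_iff:
 "(ALL q:P. (SUM p:P. A q p * x p) = 0) <-> (ALL i:N. (SUM p:P. v i p * x p) = 0)"
proof -
 define c where "c i = (SUM p:P. v i p * x p)" for i
 have x: "x p = (SUM i:P. c i * v i p)" if "p : P" for p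
  using orthon_expand[OF ov fin that, of x] by (simp add: c_def)
 have Ax: "(SUM p:P. A q p * x p) = (SUM i:P. c i * ev i * v i q)" if "q : P" for q
 proof -
  have "(SUM p:P. A q p * x p) = (SUM p:P. SUM i:P. c i * (A q p * v i p))"
   by (intro sum.cong refl) (simp add: x sum_left mult_ac)
  also have "... = (SUM i:P. c i * (SUM p:P. A q p * v i p))"
   by (subst sum.swap) (simp add: sum_left)
  also have "... = (SUM i:P. c i * ev i * v i q)" using eig that by (intro sum.cong) auto
  finally show ?thesis .
 qed
 show ?thesis
 proof
  assume 0: "ALL q:P. (SUM p:P. A q p * x p) = 0"
  show "ALL i:N. (SUM p:P. v i p * x p) = 0"
  proof
   fix j assume j: "j : N"
   have "0 = (SUM q:P. (SUM i:P. c i * ev i * v i q) * v j q)" using 0 Ax by simp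
   also have "... = (SUM i:P. c i * ev i * (SUM q:P. v i q * v j q))"
    by (rule sum_assoc(1))
   also have "... = c j * ev j" using ov j fin unfolding orthon_def N_def by (simp add: N_def mult_if cong: if_cong)
   finally show "(SUM p:P. v j p * x p) = 0" using j by (simp add: N_def c_def)
  qed
 next
  assume "ALL i:N. (SUM p:P. v i p * x p) = 0"
  hence "c i * ev i = 0" if "i : P" for i using that by (auto simp: N_def c_def)
  hence "(SUM i:P. c i * ev i * v i q) = 0" for q by (intro sum.neutral) simp
  thus "ALL q:P. (SUM p:P. A q p * x p) = 0" using Ax by simp
 qed
qed

text \<open>With at most \<open>Suc k\<close> nonzero eigenvalues, the only product of
  \<open>Suc k\<close> eigenvalues that can be nonzero is that of all of them.\<close>

lemma flc_zero_iff:
 assumes "card N <= Suc k"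
 shows "flc A P k ~= 0 <-> card N = Suc k"
proof -
 have e: "esym (Suc k) ev P = esym (Suc k) ev N" unfolding N_def by (rule esym_nonzero_part[OF fin])
 have fN: "finite N" using fin by (simp add: N_def)
 have pN: "prod ev N ~= 0" using fN by (simp add: N_def)
 show ?thesis
 proof (cases "card N = Suc k")
  case True
  thus ?thesis using conjunct2[OF flM_flc[of k]] esym_card[OF fN, of ev] pN unfolding e by simp
 next
  case False
  thus ?thesis using conjunct2[OF flM_flc[of k]] esym_small[OF fN, of "Suc k" ev] assms unfolding e by simp
 qed
qed

text \<open>On the eigenvector of a nonzero eigenvalue, \<open>flM A P k\<close> acts by a symmetric
  function of degree \<open>k\<close> in the remaining eigenvalues, fewer than \<open>k\<close> of
  which are nonzero; the other eigenvectors are killed by \<open>A\<close>.\<close>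

lemma flM_kernel:
 assumes "card N = k" "p : P" "q : P"
 shows "(SUM l:P. A p l * flM A P k l q) = 0"
proof (rule orthon_ext[OF ov fin assms(2,3), where Y = "%_ _. 0" and X = "%p q. SUM l:P. A p l * flM A P k l q", simplified])
 fix i assume i: "i : P"
 have "(SUM r:P. (SUM l:P. A p l * flM A P k l r) * v i r) = (SUM l:P. A p l * (SUM r:P. flM A P k l r * v i r))"
  by (rule sum_assoc(1))
 also have "... = (SUM l:P. (-1) ^ k * fact k * esym k ev (P - {i}) * (A p l * v i l))"
  using conjunct1[OF flM_flc[of k]] i by (intro sum.cong) auto
 also have "... = (-1) ^ k * fact k * (esym k ev (P - {i}) * ev i) * v i p"
  using eig[OF i assms(2)] by (simp add: sum_left[symmetric])
 also have "esym k ev (P - {i}) * ev i = 0"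
 proof (cases "ev i = 0")
  case False
  have "{j:P - {i}. ev j ~= 0} = N - {i}" by (auto simp: N_def)
  moreover have "card (N - {i}) < k"
   unfolding assms(1)[symmetric] using False i fin by (intro card_Diff1_less) (auto simp: N_def)
  ultimately show ?thesis using esym_nonzero_part[of "P - {i}" k ev] esym_small[of "N - {i}" k ev] fin
   by (simp add: N_def)
 qed simp
 finally show "(SUM r:P. (SUM l:P. A p l * flM A P k l r) * v i r) = 0" by simp
qed

lemma flM_sym: "p : P ==> q : P ==> flM A P k p q = flM A P k q p"
proof -
 assume pq: "p : P" "q : P"
 define g where "g i = (-1) ^ k * fact k * esym k ev (P - {i})" for i
 have e: "flM A P k p q = (SUM i:P. g i * v i p * v i q)" if "p : P" "q : P" for p q
 proof -
  have "flM A P k p q = (SUM i:P. (SUM r:P. v i r * flM A P k p r) * v i q)"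
   by (rule orthon_expand[OF ov fin that(2)])
  also have "... = (SUM i:P. g i * v i p * v i q)"
   using conjunct1[OF flM_flc[of k]] that by (intro sum.cong) (auto simp: g_def mult.commute[of "v _ _" "flM _ _ _ _ _"])
  finally show ?thesis .
 qed
 show ?thesis unfolding e[OF pq] e[OF pq(2,1)] by (simp add: mult_ac)
qed

text \<open>Compares the known kernel vectors \<open>k s\<close> with the eigenvectors of eigenvalue
  0, which form a basis of the kernel.\<close>

lemma kernel_dim:
 fixes k :: "'s => 'p => real"
 assumes "finite S" and ker: "!!s q. s : S ==> q : P ==> (SUM p:P. A q p * k s p) = 0"
  and ind: "indep S P k"
 shows "card N + card S <= card P"
  and "card N + card S = card P <->
   (ALL x. (ALL q:P. (SUM p:P. A q p * x p) = 0) --> (EX c. ALL p:P. x p = (SUM s:S. c s * k s p)))"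
proof -
 let ?A = "ALL x. (ALL q:P. (SUM p:P. A q p * x p) = 0) --> (EX c. ALL p:P. x p = (SUM s:S. c s * k s p))"
 define Z where "Z = P - N"
 have fZ: "finite Z" "finite N" "N <= P" using fin by (auto simp: Z_def N_def)
 have cZ: "card N + card Z = card P" unfolding Z_def using fZ(2,3) fin
  by (metis card_Diff_subset card_mono le_add_diff_inverse)
 define a where "a s i = (SUM p:P. v i p * k s p)" for s i
 have exp0: "x p = (SUM i:Z. (SUM q:P. v i q * x q) * v i p)"
  if x: "ALL q:P. (SUM p:P. A q p * x p) = 0" and p: "p : P" for x p
 proof -
  have "x p = (SUM i:P. (SUM q:P. v i q * x q) * v i p)" by (rule orthon_expand[OF ov fin p])
  also have "... = (SUM i:Z. (SUM q:P. v i q * x q) * v i p)"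
   using x kernel_iff[of x] fin by (intro sum.mono_neutral_right) (auto simp: Z_def)
  finally show ?thesis .
 qed
 have kp: "k s p = (SUM i:Z. a s i * v i p)" if "s : S" "p : P" for s p
  unfolding a_def by (rule exp0) (use ker that in auto)
 have inda: "indep S Z a"
  unfolding indep_def
 proof (intro allI impI)
  fix m assume m: "ALL i:Z. (SUM s:S. m s * a s i) = 0"
  have "(SUM s:S. m s * k s p) = 0" if p: "p : P" for p
  proof -
   have "(SUM s:S. m s * k s p) = (SUM s:S. SUM i:Z. m s * a s i * v i p)"
    by (intro sum.cong refl) (simp add: kp p sum_left mult.assoc)
   also have "... = (SUM i:Z. (SUM s:S. m s * a s i) * v i p)"
    by (subst sum.swap) (simp add: sum_right)
   finally show ?thesis using m by simp
  qed
  thus "ALL s:S. m s = 0" using indepD[OF ind, of m] by blast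
 qed
 have le: "card S <= card Z" by (rule indep_card[OF inda assms(1) fZ(1)])
 thus "card N + card S <= card P" using cZ by linarith
 show "card N + card S = card P <->
   (?A)"
 proof
  assume "card N + card S = card P"
  hence eq: "card Z = card S" using cZ by linarith
  show "?A"
  proof (intro allI impI)
   fix x assume x: "ALL q:P. (SUM p:P. A q p * x p) = 0"
   obtain c where c: "ALL i:Z. (SUM s:S. a s i * c s) = (SUM q:P. v i q * x q)"
    using square_solve[of S Z "%i s. a s i" "%i. SUM q:P. v i q * x q"] inda fZ(1) assms(1) eq by blast
   have "x p = (SUM s:S. c s * k s p)" if p: "p : P" for p
   proof -
    have "(SUM s:S. c s * k s p) = (SUM s:S. SUM i:Z. a s i * c s * v i p)"
     by (intro sum.cong refl) (simp add: kp p sum_left mult_ac)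
    also have "... = (SUM i:Z. (SUM s:S. a s i * c s) * v i p)"
     by (subst sum.swap) (simp add: sum_right)
    also have "... = x p" using c exp0[OF x p] by simp
    finally show ?thesis by simp
   qed
   thus "EX c. ALL p:P. x p = (SUM s:S. c s * k s p)" by blast
  qed
 next
  assume sp: "?A"
  have "EX c. ALL p:P. v i p = (SUM s:S. c s * k s p)" if i: "i : Z" for i
  proof -
   have "(SUM p:P. A q p * v i p) = 0" if "q : P" for q using eig[of i q] i that by (auto simp: Z_def N_def)
   thus ?thesis using sp by blast
  qed
  hence "ALL i. EX c. i : Z --> (ALL p:P. v i p = (SUM s:S. c s * k s p))" by blast
  then obtain c where c: "!!i p. i : Z ==> p : P ==> v i p = (SUM s:S. c i s * k s p)"
   using choice[of "%i c. i : Z --> (ALL p:P. v i p = (SUM s:S. c s * k s p))"] by blast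
  have "indep Z S c"
   unfolding indep_def
  proof (intro allI impI ballI)
   fix m j assume m: "ALL s:S. (SUM i:Z. m i * c i s) = 0" and j: "j : Z"
   have z: "(SUM i:Z. m i * v i p) = 0" if p: "p : P" for p
   proof -
    have "(SUM i:Z. m i * v i p) = (SUM i:Z. SUM s:S. m i * c i s * k s p)"
     by (intro sum.cong refl) (simp add: c p sum_left mult.assoc)
    also have "... = (SUM s:S. (SUM i:Z. m i * c i s) * k s p)"
     by (subst sum.swap) (simp add: sum_right)
    finally show ?thesis using m by simp
   qed
   have "0 = (SUM p:P. (SUM i:Z. m i * v i p) * v j p)" using z by simp
   also have "... = (SUM i:Z. m i * (SUM p:P. v i p * v j p))"
    by (rule sum_assoc(1))
   also have "... = m j" using ov j fZ(1) unfolding orthon_def Z_def by (simp add: mult_if cong: if_cong)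
   finally show "m j = 0" by simp
  qed
  hence "card Z <= card S" using indep_card fZ(1) assms(1) by blast
  thus "card N + card S = card P" using le cZ by linarith
 qed
qed

end

text \<open>Packages the recursion for a matrix with a known part of the kernel:
  \<open>Suc k\<close> is the largest rank that this part allows, and the trace tests whether it is
  attained.\<close>

lemma fl_rank:
 fixes A :: "'p => 'p => real" and K :: "'s => 'p => real"
 assumes "finite P" and sym: "!!p q. p : P ==> q : P ==> A p q = A q p"
  and "finite S" and ker: "!!s q. s : S ==> q : P ==> (SUM p:P. A q p * K s p) = 0"
  and ind: "indep S P K" and m: "Suc k + card S = card P"
 shows "flc A P k ~= 0 <->
   (ALL x. (ALL q:P. (SUM p:P. A q p * x p) = 0) --> (EX c. ALL p:P. x p = (SUM s:S. c s * K s p)))"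
  and "flc A P k ~= 0 ==> p : P ==> q : P ==> (SUM l:P. A p l * flM A P (Suc k) l q) = 0"
  and "p : P ==> q : P ==> flM A P j p q = flM A P j q p"
proof -
 obtain v ev where v: "orthon P v" "ALL i:P. ALL q:P. (SUM p:P. A q p * v i p) = ev i * v i q"
  using spectral[OF assms(1), of A] sym by blast
 interpret eigenbasis P A v ev by standard (use v assms(1) in auto)
 have le: "card N <= Suc k" using kernel_dim(1)[OF assms(3) ker ind] m by linarith
 have e: "card N = Suc k <-> card N + card S = card P" using m by linarith
 show "flc A P k ~= 0 <->
   (ALL x. (ALL q:P. (SUM p:P. A q p * x p) = 0) --> (EX c. ALL p:P. x p = (SUM s:S. c s * K s p)))"
  unfolding flc_zero_iff[OF le] e by (rule kernel_dim(2)[OF assms(3) ker ind])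
 show "(SUM l:P. A p l * flM A P (Suc k) l q) = 0" if "flc A P k ~= 0" "p : P" "q : P"
  using flM_kernel[of "Suc k" p q] flc_zero_iff[OF le] that by blast
 show "flM A P j p q = flM A P j q p" if "p : P" "q : P" by (rule flM_sym[OF that])
qed

lemma flM_polyfun:
 assumes "\<rat> <= F" "!!p q. p : P ==> q : P ==> (%x. A x p q) : polyfun F J"
 shows "p : P ==> q : P ==> (%x. flM (A x) P k p q) : polyfun F J"
proof (induction k arbitrary: p q)
 case 0
 thus ?case using polyfun_rat[OF assms(1), of 1 J] polyfun_rat[OF assms(1), of 0 J] by simp
next
 case (Suc k)
 have r: "(%x. real (Suc k)) : polyfun F J" "(%x. if p = q then 1 else 0) : polyfun F J"
  using polyfun_rat[OF assms(1), of "real (Suc k)" J] polyfun_rat[OF assms(1), of 1 J]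
   polyfun_rat[OF assms(1), of 0 J] by auto
 show ?case
  unfolding flM.simps
  by (intro polyfun_diff polyfun_mult polyfun_sum assms r Suc)
qed

lemma flc_polyfun:
 assumes "\<rat> <= F" "!!p q. p : P ==> q : P ==> (%x. A x p q) : polyfun F J"
 shows "(%x. flc (A x) P k) : polyfun F J"
 unfolding flc_def by (intro polyfun_sum polyfun_mult assms flM_polyfun[OF assms(1)])

lemma sum_squares_zero:
 fixes f :: "'a => real"
 assumes "finite S" "(SUM s:S. f s * f s) = 0" "s : S"
 shows "f s = 0"
 using sum_nonneg_eq_0_iff[OF assms(1), of "%s. f s * f s"] assms(2,3) by simp

text \<open>The rows are independent iff their Gram matrix is injective, and the recursion tests
  this by a single polynomial.\<close>

lemma generic_rank:
 assumes "finite I" "finite J" "\<rat> <= F"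
  and "!!i j. i : I ==> j : J ==> (%x. a x i j) : polyfun F K"
 shows "EX Q:polyfun F K. ALL x. Q x ~= 0 <-> indep I J (a x)"
proof (cases "card I")
 case 0
 hence "I = {}" using assms(1) by simp
 thus ?thesis using polyfun_rat[OF assms(3), of 1 K]
  by (intro bexI[of _ "%_. 1"]) (auto simp: indep_def)
next
 case (Suc k)
 define A where "A x i i' = (SUM j:J. a x i j * a x i' j)" for x i i'
 show ?thesis
 proof (intro bexI[of _ "%x. flc (A x) I k"] allI)
  show "(%x. flc (A x) I k) : polyfun F K"
   unfolding A_def by (intro flc_polyfun polyfun_sum polyfun_mult assms)
  fix x
  have e: "(SUM i':I. A x i i' * m i') = (SUM j:J. a x i j * (SUM i':I. m i' * a x i' j))" for i m
   unfolding A_def by (subst sum_assoc) (simp add: mult_ac)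
  \<comment> \<open>No kernel vector is known in advance, hence the empty index set.\<close>
  have "flc (A x) I k ~= 0 <->
    (ALL m. (ALL i:I. (SUM i':I. A x i i' * m i') = 0) --> (EX c. ALL i:I. m i = (SUM s:({}::unit set). c s * (%_ _. 0) s i)))"
   by (rule fl_rank(1)) (use Suc assms(1) in "auto simp: A_def indep_def mult.commute")
  also have "... <-> indep I J (a x)"
  proof
   assume h: "ALL m. (ALL i:I. (SUM i':I. A x i i' * m i') = 0) --> (EX c. ALL i:I. m i = (SUM s:({}::unit set). c s * (%_ _. 0) s i))"
   show "indep I J (a x)"
    using h by (auto simp: indep_def e)
  next
   assume ind: "indep I J (a x)"
   have "m i = 0" if m: "ALL i:I. (SUM i':I. A x i i' * m i') = 0" and i: "i : I" for m i
   proof (rule indepD[OF ind _ i])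
    fix j assume j: "j : J"
    define y where "y j = (SUM i:I. m i * a x i j)" for j
    have "0 = (SUM i:I. m i * (SUM i':I. A x i i' * m i'))" using m by simp
    also have "... = (SUM i:I. SUM j:J. m i * a x i j * y j)"
     unfolding e y_def[symmetric] by (simp add: sum_left mult.assoc)
    also have "... = (SUM j:J. y j * y j)"
     by (subst sum.swap) (simp add: y_def sum_right)
    finally show "y j = 0" using sum_squares_zero[OF assms(2) _ j] by simp
   qed
   thus "ALL m. (ALL i:I. (SUM i':I. A x i i' * m i') = 0) --> (EX c. ALL i:I. m i = (SUM s:({}::unit set). c s * (%_ _. 0) s i))"
    by simp
  qed
  finally show "flc (A x) I k ~= 0 <-> indep I J (a x)" .
 qed
qed

text \<open>Independence at a single point \<open>x0\<close> suffices, because it is the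
  nonvanishing of one polynomial.\<close>

lemma Generic_indep:
 assumes "finite I" "finite J" "\<rat> <= F"
  and "!!i j. i : I ==> j : J ==> (%x. a x i j) : polyfun F K"
  and "Generic F K x" "indep I J (a x0)"
 shows "indep I J (a x)"
proof -
 obtain Q where Q: "Q : polyfun F K" "!!x. Q x ~= 0 <-> indep I J (a x)"
  using generic_rank[of I J F a K] assms(1-4) by blast
 hence "Q x0 ~= 0" using assms(6) by simp
 hence "Q x ~= 0" using bspec[OF assms(5)[unfolded Generic_def] Q(1)] by blast
 thus ?thesis using Q(2) by simp
qed

subsection \<open>Gram matrices\<close>

context
 fixes P :: "'p set" and S :: "'s set" and R :: "'p => 's => real" and B A
 assumes fin: "finite P" "finite S"
 defines "B == %p q. SUM s:S. R p s * R q s" and "A == %s t. SUM p:P. R p s * R p t"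
begin

text \<open>\<open>B\<close> is \<open>R\<close> times its transpose and \<open>A\<close> is the
  transpose times \<open>R\<close>. The transpose of \<open>R\<close> intertwines the two
  recursions, so they have the same traces.\<close>

lemma gram_transfer:
 "(ALL q:P. ALL s:S. (SUM p:P. R p s * flM B P k p q) = (SUM t:S. flM A S k s t * R q t)) & flc B P k = flc A S k"
proof (induction k)
 have BM: "(SUM l:P. B p l * X l q) = (SUM s:S. R p s * (SUM l:P. R l s * X l q))" for p q and X :: "'p => 'p => real"
  unfolding B_def by (rule sum_assoc(1))
 have tr: "flc B P k = flc A S k"
  if h: "!!q s. q : P ==> s : S ==> (SUM p:P. R p s * flM B P k p q) = (SUM t:S. flM A S k s t * R q t)" for k
 proof -
  have "flc B P k = (SUM i:P. SUM s:S. R i s * (SUM t:S. flM A S k s t * R i t))"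
   unfolding flc_def BM using h by (intro sum.cong) auto
  also have "... = (SUM i:P. SUM s:S. SUM t:S. R i t * R i s * flM A S k s t)"
   by (simp add: sum_left mult_ac)
  also have "... = (SUM s:S. SUM i:P. SUM t:S. R i t * R i s * flM A S k s t)" by (rule sum.swap)
  also have "... = (SUM s:S. SUM t:S. SUM i:P. R i t * R i s * flM A S k s t)"
   by (rule sum.cong[OF refl], rule sum.swap)
  also have "... = (SUM t:S. SUM s:S. SUM i:P. R i t * R i s * flM A S k s t)" by (rule sum.swap)
  also have "... = flc A S k" by (simp add: flc_def A_def sum_right)
  finally show ?thesis .
 qed
 case 0
 have "(SUM p:P. R p s * flM B P 0 p q) = (SUM t:S. flM A S 0 s t * R q t)" if "q : P" "s : S" for q s
  using that fin by (simp add: mult_if if_mult cong: if_cong)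
 thus ?case using tr[of 0] by blast
 case (Suc k)
 have "(SUM p:P. R p s * flM B P (Suc k) p q) = (SUM t:S. flM A S (Suc k) s t * R q t)" if qs: "q : P" "s : S" for q s
 proof -
  have "(SUM p:P. R p s * flM B P (Suc k) p q) =
   (SUM p:P. real (Suc k) * (R p s * (SUM l:P. B p l * flM B P k l q)) - flc B P k * (R p s * (kr p q)))"
   unfolding flM_Suc by (intro sum.cong refl) (simp only: right_diff_distrib mult_ac)
  also have "... = real (Suc k) * (SUM p:P. R p s * (SUM l:P. B p l * flM B P k l q)) - flc B P k * (SUM p:P. R p s * (kr p q))"
   by (simp only: sum_subtractf sum_left)
  also have "(SUM p:P. R p s * (kr p q)) = (SUM t:S. (kr s t) * R q t)"
   using qs fin by (simp add: mult_if if_mult cong: if_cong)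
  also have "(SUM p:P. R p s * (SUM l:P. B p l * flM B P k l q)) = (SUM p:P. R p s * (SUM s':S. R p s' * (SUM t:S. flM A S k s' t * R q t)))"
   unfolding BM using Suc qs by simp
  also have "... = (SUM p:P. SUM s':S. R p s * R p s' * (SUM t:S. flM A S k s' t * R q t))"
   by (simp add: sum_left mult.assoc)
  also have "... = (SUM s':S. A s s' * (SUM t:S. flM A S k s' t * R q t))"
   by (subst sum.swap) (simp add: A_def sum_right)
  also have "... = (SUM s':S. SUM t:S. A s s' * flM A S k s' t * R q t)"
   by (simp add: sum_left mult.assoc)
  also have "... = (SUM t:S. (SUM s':S. A s s' * flM A S k s' t) * R q t)"
   by (subst sum.swap) (simp add: sum_right)
  also have "real (Suc k) * ... - flc B P k * (SUM t:S. (kr s t) * R q t) =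
   (SUM t:S. real (Suc k) * ((SUM s':S. A s s' * flM A S k s' t) * R q t) - flc B P k * ((kr s t) * R q t))"
   by (simp only: sum_subtractf sum_left)
  also have "... = (SUM t:S. flM A S (Suc k) s t * R q t)"
   unfolding flM_Suc conjunct2[OF Suc] by (intro sum.cong refl) (simp only: left_diff_distrib mult.assoc)
  finally show ?thesis .
 qed
 thus ?case using tr[of "Suc k"] by blast
qed

text \<open>The kernel known in advance, in the application the trivial motions, belongs to
  \<open>A\<close>, whereas the matrix that produces stresses comes from \<open>B\<close>.
  \<open>A\<close> and \<open>R\<close> have the same kernel, and the traces agree, so the rank test
  for \<open>A\<close> can be run on \<open>B\<close>.\<close>

lemma gram_rank:
 fixes K :: "'t => 's => real"
 assumes "finite T" and ker: "!!t p. t : T ==> p : P ==> (SUM s:S. R p s * K t s) = 0"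
  and ind: "indep T S K" and m: "Suc k + card T = card S"
 shows "flc B P k ~= 0 <->
   (ALL y. (ALL p:P. (SUM s:S. R p s * y s) = 0) --> (EX c. ALL s:S. y s = (SUM t:T. c t * K t s)))"
  and "flc B P k ~= 0 ==> q : P ==> s : S ==> (SUM p:P. R p s * flM B P (Suc k) p q) = 0"
proof -
 let ?B = "(SUM t:S. R q t * flM A S (Suc k) t s)"
 let ?A = "(SUM p:P. R p s * flM B P (Suc k) p q)"
 have Ay: "(SUM t:S. A s t * y t) = (SUM p:P. R p s * (SUM t:S. R p t * y t))" for s y
  unfolding A_def by (rule sum_assoc(1))
 have Aker: "(ALL s:S. (SUM t:S. A s t * y t) = 0) <-> (ALL p:P. (SUM t:S. R p t * y t) = 0)" for y
 proof
  assume 0: "ALL s:S. (SUM t:S. A s t * y t) = 0"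
  define z where "z p = (SUM t:S. R p t * y t)" for p
  have "0 = (SUM s:S. (SUM p:P. R p s * z p) * y s)" using 0 unfolding Ay z_def by simp
  also have "... = (SUM p:P. SUM s:S. z p * (R p s * y s))"
   unfolding sum_right by (subst sum.swap) (simp add: mult_ac)
  also have "... = (SUM p:P. z p * z p)" by (simp add: z_def sum_left)
  finally have "(SUM p:P. z p * z p) = 0" by simp
  hence "z p = 0" if "p : P" for p by (rule sum_squares_zero[OF fin(1) _ that])
  thus "ALL p:P. (SUM t:S. R p t * y t) = 0" unfolding z_def by simp
 qed (simp add: Ay)
 have symA: "A s t = A t s" for s t by (simp add: A_def mult.commute)
 have kA: "(SUM u:S. A s u * K t u) = 0" if "t : T" "s : S" for t s using ker that by (simp add: Ay)
 note fl = fl_rank[where A = A and P = S and S = T and K = K and k = k, OF fin(2) symA assms(1) kA ind m]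
 have c: "flc B P k = flc A S k" using gram_transfer by blast
 show "flc B P k ~= 0 <->
   (ALL y. (ALL p:P. (SUM s:S. R p s * y s) = 0) --> (EX c. ALL s:S. y s = (SUM t:T. c t * K t s)))"
  unfolding c using fl(1) Aker by simp
 show "?A = 0" if nz: "flc B P k ~= 0" and qs: "q : P" "s : S"
 proof -
  have "ALL t:S. (SUM l:S. A t l * flM A S (Suc k) l s) = 0" using fl(2) nz c qs by simp
  hence z: "?B = 0"
   using iffD1[OF Aker[of "%l. flM A S (Suc k) l s"]] qs by simp
  have "?A = (SUM t:S. flM A S (Suc k) s t * R q t)"
   using gram_transfer[of "Suc k"] qs by blast
  also have "... = ?B"
   using fl(3) qs by (intro sum.cong refl) (simp only: mult.commute)
  finally show ?thesis using z by simp
 qed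
qed

text \<open>On the kernel of the transpose of \<open>R\<close> the product with \<open>B\<close>
  drops out of the recursion and minus the trace is left. Every stress is therefore reproduced up to
  this factor.\<close>

lemma gram_kernel:
 assumes w: "!!s. s : S ==> (SUM q:P. R q s * w q) = 0" and p: "p : P"
 shows "(SUM q:P. flM B P (Suc k) p q * w q) = - flc B P k * w p"
proof -
 have "(SUM q:P. (SUM l:P. B p l * flM B P k l q) * w q) = 0"
 proof -
  have "(SUM l:P. B p l * flM B P k l q) = (SUM s:S. R p s * (SUM t:S. flM A S k s t * R q t))" if "q : P" for q
  proof -
   have "(SUM l:P. B p l * flM B P k l q) = (SUM s:S. R p s * (SUM l:P. R l s * flM B P k l q))"
    unfolding B_def by (rule sum_assoc(1))
   thus ?thesis using gram_transfer[of k] that by simp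
  qed
  hence "(SUM q:P. (SUM l:P. B p l * flM B P k l q) * w q) =
    (SUM q:P. SUM s:S. SUM t:S. R p s * flM A S k s t * (R q t * w q))"
   by (intro sum.cong refl) (simp add: sum_left sum_right mult_ac)
  also have "... = (SUM s:S. SUM q:P. SUM t:S. R p s * flM A S k s t * (R q t * w q))" by (rule sum.swap)
  also have "... = (SUM s:S. SUM t:S. R p s * flM A S k s t * (SUM q:P. R q t * w q))"
  proof (rule sum.cong[OF refl])
   fix s
   show "(SUM q:P. SUM t:S. R p s * flM A S k s t * (R q t * w q)) = (SUM t:S. R p s * flM A S k s t * (SUM q:P. R q t * w q))"
    by (subst sum.swap) (simp add: sum_left)
  qed
  also have "... = 0" using w by simp
  finally show ?thesis .
 qed
 moreover have "(SUM q:P. (kr p q) * w q) = w p"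
  using fin p by (simp add: if_mult cong: if_cong)
 moreover have "(SUM q:P. flM B P (Suc k) p q * w q) =
   real (Suc k) * (SUM q:P. (SUM l:P. B p l * flM B P k l q) * w q) - flc B P k * (SUM q:P. (kr p q) * w q)"
 proof -
  have "(SUM q:P. flM B P (Suc k) p q * w q) = (SUM q:P. real (Suc k) * ((SUM l:P. B p l * flM B P k l q) * w q) - flc B P k * ((kr p q) * w q))"
   unfolding flM_Suc by (intro sum.cong refl) (simp only: left_diff_distrib mult.assoc)
  thus ?thesis by (simp only: sum_subtractf sum_left)
 qed
 ultimately show ?thesis by simp
qed

end

lemma flM_of_int:
 "flM (%i j. of_int (A i j)) P k i j = of_int (flM A P k i j)"
 by (induction k arbitrary: i j) (simp_all add: flc_def)

lemma flc_of_int: "flc (%i j. of_int (A i j)) P k = of_int (flc A P k)"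
 by (simp add: flc_def flM_of_int)

section \<open>Inverting quadratic maps locally\<close>

text \<open>Contraction principle for the simplified Newton iteration \<open>T\<close>, which uses
  the inverse \<open>b\<close> of the linear part at \<open>p\<close> throughout. The Lipschitz
  dependence of the solution on \<open>w\<close> is recorded because it later supplies
  continuity.\<close>

lemma quadratic_inverse:
 fixes I :: "'i set" and J :: "'j set" and F :: "('j => real) => 'i => real" and Q :: "('j => real) => 'i => real" and p :: "'j => real"
 defines "nm u == SUM j:J. abs (u j)"
 assumes fin: "finite I" "finite J" and card: "card I = card J" and inj: "indep J I (%j i. a i j)"
  and exp: "!!u i. i : I ==> F (%j. p j + u j) i = F p i + (SUM j:J. a i j * u j) + Q u i"
  and M0: "M >= 0" and Q0: "!!i. i : I ==> Q (%_. 0) i = 0"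
  and QM: "!!u u' i. i : I ==> abs (Q u i - Q u' i) <= M * (nm u + nm u') * nm (%j. u j - u' j)"
  and r: "r > 0"
 shows "EX h C sol. h > 0 &
  (ALL w. (ALL i:I. abs (w i - F p i) < h) --> (ALL i:I. F (sol w) i = w i) & (ALL j:J. abs (sol w j - p j) < r)) &
  (ALL w w'. (ALL i:I. abs (w i - F p i) < h) --> (ALL i:I. abs (w' i - F p i) < h) -->
    (ALL j:J. abs (sol w j - sol w' j) <= C * (SUM i:I. abs (w i - w' i)))) &
  (ALL w. (ALL i:I. w i = F p i) --> (ALL j:J. sol w j = p j))"
proof -
 obtain b where b: "!!i i'. i : I ==> i' : I ==> (SUM j:J. a i j * b j i') = (kr i i')"
  using square_inverse[OF inj fin card] by blast
 \<comment> \<open>A bound for the norm of \<open>b\<close>; the summand 1 keeps it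
   positive.\<close>
 define B where "B = (SUM j:J. SUM i:I. abs (b j i)) + 1"
 have B1: "B >= 1" unfolding B_def by (simp add: sum_nonneg)
 have nm0: "nm u >= 0" for u by (simp add: nm_def sum_nonneg)
 have nm_le: "abs (u j) <= nm u" if "j : J" for u j
  unfolding nm_def using that fin by (intro member_le_sum) auto
 have nm_tri: "nm (%j. u j - w j) <= nm (%j. u j - v j) + nm (%j. v j - w j)" for u v w
  unfolding nm_def sum.distrib[symmetric] by (rule sum_mono) linarith
 have nm_sub: "nm (%j. u j - v j) = nm (%j. v j - u j)" for u v
  unfolding nm_def by (intro sum.cong) auto
 have nmB: "nm (%j. SUM i:I. b j i * y i) <= B * e" if y: "!!i. i : I ==> abs (y i) <= e" and e: "e >= 0" for y e
 proof -
  have "nm (%j. SUM i:I. b j i * y i) <= (SUM j:J. SUM i:I. abs (b j i) * e)"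
   unfolding nm_def
  proof (rule sum_mono)
   fix j
   have "abs (SUM i:I. b j i * y i) <= (SUM i:I. abs (b j i * y i))" by (rule sum_abs)
   also have "... <= (SUM i:I. abs (b j i) * e)" by (rule sum_mono) (simp add: abs_mult mult_left_mono y)
   finally show "abs (SUM i:I. b j i * y i) <= (SUM i:I. abs (b j i) * e)" .
  qed
  also have "... = (B - 1) * e" by (simp add: B_def sum_right)
  also have "... <= B * e" using e by (simp add: left_diff_distrib)
  finally show ?thesis .
 qed
 \<comment> \<open>On the ball of this radius the iteration contracts by the factor 1/2.\<close>
 define R where "R = min (r / 2) (1 / (4 * B * M + 4))"
 have R0: "R > 0" "R < r" using r B1 M0 by (auto simp: R_def intro!: divide_pos_pos add_nonneg_pos)
 have RM: "B * M * (2 * R) <= 1 / 2"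
 proof -
  have "B * M * (2 * R) <= B * M * (2 * (1 / (4 * B * M + 4)))"
   using B1 M0 by (intro mult_left_mono) (auto simp: R_def)
  also have "... <= 1 / 2"
  proof -
   have "K * (2 * (1 / (4 * K + 4))) <= 1 / 2" if "K >= 0" for K :: real
    using that by (simp add: field_simps)
   from this[of "B * M"] show ?thesis using B1 M0 by (simp add: mult.assoc)
  qed
  finally show ?thesis .
 qed
 \<comment> \<open>Moving the target by less than \<open>h\<close> shifts the first iterate by at
   most \<open>R / 2\<close>, so the ball is mapped into itself.\<close>
 define h where "h = R / (2 * B)"
 have h0: "h > 0" using R0 B1 by (simp add: h_def)
 define near where "near w <-> (ALL i:I. abs (w i - F p i) < h)" for w
 define T where "T w u = (%j. SUM i:I. b j i * (w i - F p i - Q u i))" for w u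
 have contr: "nm (%j. T w u j - T w u' j) <= nm (%j. u j - u' j) / 2" if "nm u <= R" "nm u' <= R" for w u u'
 proof -
  have "T w u j - T w u' j = (SUM i:I. b j i * (Q u' i - Q u i))" for j
   unfolding T_def sum_subtractf[symmetric] by (intro sum.cong) (auto simp: algebra_simps)
  hence "nm (%j. T w u j - T w u' j) <= B * (M * (2 * R) * nm (%j. u j - u' j))"
  proof (simp, intro nmB)
   fix i assume i: "i : I"
   have "abs (Q u' i - Q u i) <= M * (nm u + nm u') * nm (%j. u j - u' j)" using QM[OF i, of u u'] by linarith
   also have "... <= M * (2 * R) * nm (%j. u j - u' j)"
    using that M0 nm0 by (intro mult_right_mono mult_left_mono) auto
   finally show "abs (Q u' i - Q u i) <= M * (2 * R) * nm (%j. u j - u' j)" .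
  qed (use M0 R0 nm0 in auto)
  also have "... = B * M * (2 * R) * nm (%j. u j - u' j)" by simp
  also have "... <= 1 / 2 * nm (%j. u j - u' j)" by (rule mult_right_mono[OF RM nm0])
  finally show ?thesis by simp
 qed
 have nm_zero: "nm (%_. 0) = 0" by (simp add: nm_def)
 have maps: "nm (T w u) <= R" if "near w" "nm u <= R" for w u
 proof -
  have "nm (T w (%_. 0)) <= B * h"
   unfolding T_def by (rule nmB) (use that(1) Q0 h0 in "auto simp: near_def less_imp_le")
  moreover have "nm (%j. T w u j - T w (%_. 0) j) <= nm u / 2"
   using contr[of u "%_. 0" w] that(2) nm_zero R0 by simp
  moreover have "nm (T w u) <= nm (%j. T w u j - T w (%_. 0) j) + nm (T w (%_. 0))"
   using nm_tri[of "T w u" "%_. 0" "T w (%_. 0)"] by simp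
  moreover have "B * h = R / 2" using B1 by (simp add: h_def)
  ultimately show ?thesis using that(2) by linarith
 qed
 have fp: "EX l. nm l <= R & (ALL j. T w l j = l j)" if w: "near w" for w
 proof -
  define u where "u n = ((T w) ^^ n) (%_. 0)" for n
  have uS: "u (Suc n) = T w (u n)" for n by (simp add: u_def)
  have un: "nm (u n) <= R" for n
   by (induction n) (use maps[OF w] R0 nm_zero uS in "auto simp: u_def")
  have d: "nm (%j. u (Suc n) j - u n j) <= R * (1 / 2) ^ n" for n
  proof (induction n)
   case 0
   thus ?case using un[of 1] by (simp add: u_def)
  next
   case (Suc n)
   thus ?case using contr[OF un[of "Suc n"] un[of n], of w] by (simp add: uS)
  qed
  have "EX l. (%n. u n j) ----> l" if j: "j : J" for j
  proof -
   have "summable (%n. u (Suc n) j - u n j)"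
   proof (rule summable_comparison_test)
    have "norm (u (Suc n) j - u n j) <= R * (1 / 2) ^ n" for n
     using d[of n] nm_le[OF j, of "%j. u (Suc n) j - u n j"] by simp
    thus "EX N. ALL n>=N. norm (u (Suc n) j - u n j) <= R * (1 / 2) ^ n" by blast
    show "summable (%n. R * (1 / 2) ^ n)" by (intro summable_mult summable_geometric) simp
   qed
   hence "convergent (%n. SUM i<n. u (Suc i) j - u i j)" by (simp add: summable_iff_convergent)
   moreover have "(SUM i<n. u (Suc i) j - u i j) = u n j - u 0 j" for n
    using sum_lessThan_telescope[of "%n. u n j" n] by simp
   ultimately have "convergent (%n. u n j - u 0 j)" by simp
   then obtain c where "(%n. u n j - u 0 j) ----> c" by (auto simp: convergent_def)
   from tendsto_add[OF this tendsto_const[of "u 0 j"]] show ?thesis by auto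
  qed
  then obtain l0 where l0: "!!j. j : J ==> (%n. u n j) ----> l0 j" by metis
  have ul: "(%n. nm (%j. u n j - l0 j)) ----> 0"
  proof -
   have "(%n. nm (%j. u n j - l0 j)) ----> (SUM j:J. abs (l0 j - l0 j))"
    unfolding nm_def by (intro tendsto_sum tendsto_rabs tendsto_diff l0 tendsto_const)
   thus ?thesis by simp
  qed
  have "(%n. nm (u n)) ----> nm l0" unfolding nm_def by (intro tendsto_sum tendsto_rabs l0)
  hence nl0: "nm l0 <= R" by (rule LIMSEQ_le_const2) (use un in auto)
  have z: "nm (%j. l0 j - T w l0 j) = 0"
  proof -
   have "nm (%j. l0 j - T w l0 j) <= nm (%j. u (Suc n) j - l0 j) + nm (%j. u n j - l0 j)" for n
   proof -
    have "nm (%j. l0 j - T w l0 j) <= nm (%j. l0 j - u (Suc n) j) + nm (%j. u (Suc n) j - T w l0 j)"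
     by (rule nm_tri)
    also have "nm (%j. u (Suc n) j - T w l0 j) <= nm (%j. u n j - l0 j) / 2"
     unfolding uS by (rule contr[OF un nl0])
    finally show ?thesis using nm_sub[of l0 "u (Suc n)"] nm0[of "%j. u n j - l0 j"] by linarith
   qed
   moreover have "(%n. nm (%j. u (Suc n) j - l0 j) + nm (%j. u n j - l0 j)) ----> 0 + 0"
    by (intro tendsto_add ul LIMSEQ_Suc[OF ul])
   ultimately have "nm (%j. l0 j - T w l0 j) <= 0 + 0"
    by (intro LIMSEQ_le_const) auto
   thus ?thesis using nm0[of "%j. l0 j - T w l0 j"] by linarith
  qed
  \<comment> \<open>The limit \<open>l0\<close> is determined on \<open>J\<close> only; one more
    application of \<open>T\<close> gives a fixed point as a function.\<close>
  define l where "l = T w l0"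
  have ll0: "l0 j = l j" if "j : J" for j
   using nm_le[OF that, of "%j. l0 j - T w l0 j"] z by (simp add: l_def)
  have nml: "nm l <= R" unfolding l_def by (rule maps[OF w nl0])
  have dz: "nm (%j. l j - l0 j) = 0" unfolding nm_def using ll0 by simp
  have "Q l i = Q l0 i" if "i : I" for i using QM[OF that, of l l0] unfolding dz by simp
  hence "T w l = T w l0" unfolding T_def by (intro ext sum.cong) auto
  thus ?thesis using nml by (intro exI[of _ l]) (simp add: l_def)
 qed
 hence "ALL w. EX l. near w --> nm l <= R & (ALL j. T w l j = l j)" by blast
 then obtain l where l0: "ALL w. near w --> nm (l w) <= R & (ALL j. T w (l w) j = l w j)"
  by (rule choice[THEN exE])
 hence l: "nm (l w) <= R" "T w (l w) = l w" if "near w" for w using that by auto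
 define sol where "sol w = (%j. p j + l w j)" for w
 have lip: "nm (%j. l w j - l w' j) <= 2 * B * (SUM i:I. abs (w i - w' i))" if "near w" "near w'" for w w'
 proof -
  have "nm (%j. T w (l w) j - T w' (l w') j) <= nm (%j. T w (l w) j - T w (l w') j) + nm (%j. T w (l w') j - T w' (l w') j)"
   by (rule nm_tri)
  also have "nm (%j. T w (l w) j - T w (l w') j) <= nm (%j. l w j - l w' j) / 2"
   by (rule contr[OF l(1)[OF that(1)] l(1)[OF that(2)]])
  also have "nm (%j. T w (l w') j - T w' (l w') j) <= B * (SUM i:I. abs (w i - w' i))"
  using nmB[of "%i. w i - w' i" "SUM i:I. abs (w i - w' i)"] member_le_sum[of _ I "%i. abs (w i - w' i)"] fin by (auto simp: algebra_simps sum_nonneg T_def sum_subtractf[symmetric])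
  finally show ?thesis using l(2) that by simp
 qed
 have sol1: "F (sol w) i = w i" if w: "near w" and i: "i : I" for w i
 proof -
  have "(SUM j:J. a i j * l w j) = (SUM j:J. a i j * T w (l w) j)" using l(2)[OF w] by simp
  also have "... = (SUM i':I. (SUM j:J. a i j * b j i') * (w i' - F p i' - Q (l w) i'))"
   unfolding T_def by (rule sum_assoc(1)[symmetric])
  also have "... = w i - F p i - Q (l w) i" using b i fin by (simp add: if_mult cong: if_cong)
  finally show ?thesis using exp[OF i, of "l w"] by (simp add: sol_def)
 qed
 have sol2: "abs (sol w j - p j) < r" if w: "near w" and j: "j : J" for w j
  using nm_le[OF j, of "l w"] l(1)[OF w] R0 by (simp add: sol_def)
 have sol3: "abs (sol w j - sol w' j) <= 2 * B * (SUM i:I. abs (w i - w' i))" if "near w" "near w'" "j : J" for w w' j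
  using nm_le[OF that(3), of "%j. l w j - l w' j"] lip[OF that(1,2)] by (simp add: sol_def)
 have sol4: "sol w j = p j" if w: "ALL i:I. w i = F p i" and j: "j : J" for w j
 proof -
  have nw: "near w" unfolding near_def using w h0 by simp
  have "T w (%_. 0) = (%_. 0)" unfolding T_def using w Q0 by (intro ext sum.neutral) auto
  hence "nm (%j. l w j - 0) <= nm (%j. l w j - 0) / 2"
   using contr[OF l(1)[OF nw], of "%_. 0" w] l(2)[OF nw] nm_zero R0 by simp
  hence "nm (l w) = 0" using nm0[of "l w"] by simp
  thus ?thesis using nm_le[OF j, of "l w"] by (simp add: sol_def)
 qed
 show ?thesis
  using h0 sol1 sol2 sol3 sol4 unfolding near_def
  by (intro exI[of _ h] exI[of _ "2 * B"] exI[of _ sol] conjI allI impI ballI) simp_all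
qed

text \<open>The form in which the inversion is applied: an equation is a linear form plus a sum of
  squares of linear forms, which covers squared lengths and coordinates alike.\<close>

lemma quadratic_inverse_forms:
 fixes I :: "'i set" and J :: "'j set" and F :: "('j => real) => 'i => real" and p :: "'j => real"
  and l :: "'i => 'j => real" and K :: "'i => 'a::finite => 'j => real"
 assumes fin: "finite I" "finite J" and card: "card I = card J"
  and F: "!!u i. i : I ==> F u i = (SUM j:J. l i j * u j) + (SU a. (SUM j:J. K i a j * u j)^2)"
  and inj: "indep J I (%j i. l i j + 2 * (SU a. (SUM k:J. K i a k * p k) * K i a j))"
  and r: "r > 0"
 shows "EX h C sol. h > 0 &
  (ALL w. (ALL i:I. abs (w i - F p i) < h) --> (ALL i:I. F (sol w) i = w i) & (ALL j:J. abs (sol w j - p j) < r)) &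
  (ALL w w'. (ALL i:I. abs (w i - F p i) < h) --> (ALL i:I. abs (w' i - F p i) < h) -->
    (ALL j:J. abs (sol w j - sol w' j) <= C * (SUM i:I. abs (w i - w' i)))) &
  (ALL w. (ALL i:I. w i = F p i) --> (ALL j:J. sol w j = p j))"
proof -
 define Q where "Q u i = (SU a. (SUM j:J. K i a j * u j)^2)" for u i
 define C where "C = (SUM i:I. SU a. SUM j:J. abs (K i a j))"
 have C0: "C >= 0" unfolding C_def by (intro sum_nonneg) auto
 have KC: "abs (K i a j) <= C" if "i : I" "j : J" for i a j
 proof -
  have "abs (K i a j) <= (SUM j:J. abs (K i a j))" using that fin by (intro member_le_sum) auto
  also have "... <= (SU a. SUM j:J. abs (K i a j))"
   by (rule member_le_sum[of a UNIV "%a. SUM j:J. abs (K i a j)"]) (auto intro: sum_nonneg)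
  also have "... <= C" unfolding C_def using that fin
   by (intro member_le_sum[of i I "%i. SU a. SUM j:J. abs (K i a j)"]) (auto intro!: sum_nonneg)
  finally show ?thesis .
 qed
 have lin: "abs (SUM j:J. K i a j * u j) <= C * (SUM j:J. abs (u j))" if "i : I" for i a u
 proof -
  have "abs (SUM j:J. K i a j * u j) <= (SUM j:J. abs (K i a j * u j))" by (rule sum_abs)
  also have "... <= (SUM j:J. C * abs (u j))"
   by (rule sum_mono) (auto simp: abs_mult intro!: mult_right_mono KC that)
  finally show ?thesis by (simp add: sum_left)
 qed
 show ?thesis
 proof (rule quadratic_inverse[where Q = Q and M = "real CARD('a) * (C * C)", OF fin card inj _ _ _ _ r])
  fix u i assume i: "i : I"
  define A where "A a = (SUM j:J. K i a j * p j)" for a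
  define U where "U a = (SUM j:J. K i a j * u j)" for a
  define B where "B j = (SU a. A a * K i a j)" for j
  have e: "(SUM j:J. K i a j * (p j + u j)) = A a + U a" for a
   by (simp add: A_def U_def distrib_left sum.distrib)
  have s: "(SU a. (A a + U a)^2) = (SU a. (A a)^2) + 2 * (SU a. A a * U a) + Q u i"
   by (simp add: power2_sum sum.distrib Q_def U_def[symmetric] sum_left mult.assoc)
  have t: "(SU a. A a * U a) = (SUM j:J. B j * u j)"
   unfolding B_def U_def by (rule sum_assoc(1)[symmetric])
  have r: "(SUM j:J. (l i j + 2 * B j) * u j) = (SUM j:J. l i j * u j) + 2 * (SUM j:J. B j * u j)"
   by (simp add: distrib_right sum.distrib sum_left mult.assoc)
  show "F (%j. p j + u j) i = F p i +
    (SUM j:J. (l i j + 2 * (SU a. (SUM k:J. K i a k * p k) * K i a j)) * u j) + Q u i"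
   unfolding F[OF i] e s t A_def[symmetric] B_def[symmetric] r by (simp add: distrib_left sum.distrib)
 next
  show "0 <= real CARD('a) * (C * C)" by simp
  show "Q (%_. 0) i = 0" for i by (simp add: Q_def)
  fix u u' i assume i: "i : I"
  define N where "N u = (SUM j:J. abs (u j))" for u :: "'j => real"
  have "abs (Q u i - Q u' i) <= (SU a. abs ((SUM j:J. K i a j * u j)^2 - (SUM j:J. K i a j * u' j)^2))"
   unfolding Q_def sum_subtractf[symmetric] by (rule sum_abs)
  also have "... <= (SUM a:(UNIV :: 'a set). (C * C) * ((N u + N u') * N (%j. u j - u' j)))"
  proof (rule sum_mono)
   fix a :: 'a
   define A where "A u = (SUM j:J. K i a j * u j)" for u
   have "abs ((A u)^2 - (A u')^2) = abs (A u + A u') * abs (A (%j. u j - u' j))"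
   proof -
    have "(A u)^2 - (A u')^2 = (A u + A u') * A (%j. u j - u' j)"
     by (simp add: A_def right_diff_distrib sum_subtractf power2_eq_square algebra_simps)
    thus ?thesis by (simp add: abs_mult)
   qed
   also have "... <= (C * (N u + N u')) * (C * N (%j. u j - u' j))"
   proof (rule mult_mono)
    show "abs (A u + A u') <= C * (N u + N u')"
     using lin[OF i, of a u] lin[OF i, of a u'] unfolding A_def N_def distrib_left by linarith
    show "abs (A (%j. u j - u' j)) <= C * N (%j. u j - u' j)"
     unfolding A_def N_def by (rule lin[OF i])
    show "0 <= C * (N u + N u')" using C0 by (simp add: N_def sum_nonneg)
   qed simp
   finally show "abs ((SUM j:J. K i a j * u j)^2 - (SUM j:J. K i a j * u' j)^2) <= (C * C) * ((N u + N u') * N (%j. u j - u' j))"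
    by (simp add: A_def mult_ac)
  qed
  finally show "abs (Q u i - Q u' i) <= real CARD('a) * (C * C) * ((SUM j:J. abs (u j)) + (SUM j:J. abs (u' j))) * (SUM j:J. abs (u j - u' j))"
   by (simp add: N_def mult_ac)
 qed
qed

lemma quadratic_inverse_formsE:
 fixes I :: "'i set" and J :: "'j set" and F :: "('j => real) => 'i => real" and p :: "'j => real"
  and l :: "'i => 'j => real" and K :: "'i => 'a::finite => 'j => real"
 assumes "finite I" "finite J" and "card I = card J"
  and "!!u i. i : I ==> F u i = (SUM j:J. l i j * u j) + (SU a. (SUM j:J. K i a j * u j)^2)"
  and "indep J I (%j i. l i j + 2 * (SU a. (SUM k:J. K i a k * p k) * K i a j))"
  and "r > 0"
 obtains e C sol where "e > 0"
  "!!w i. ALL i:I. abs (w i - F p i) < e ==> i : I ==> F (sol w) i = w i"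
  "!!w j. ALL i:I. abs (w i - F p i) < e ==> j : J ==> abs (sol w j - p j) < r"
  "!!w w' j. ALL i:I. abs (w i - F p i) < e ==> ALL i:I. abs (w' i - F p i) < e ==> j : J ==>
    abs (sol w j - sol w' j) <= C * (SUM i:I. abs (w i - w' i))"
  "!!w j. ALL i:I. w i = F p i ==> j : J ==> sol w j = p j"
proof -
 have "EX e C sol. e > 0 &
  (ALL w. (ALL i:I. abs (w i - F p i) < e) --> (ALL i:I. F (sol w) i = w i) & (ALL j:J. abs (sol w j - p j) < r)) &
  (ALL w w'. (ALL i:I. abs (w i - F p i) < e) --> (ALL i:I. abs (w' i - F p i) < e) -->
    (ALL j:J. abs (sol w j - sol w' j) <= C * (SUM i:I. abs (w i - w' i)))) &
  (ALL w. (ALL i:I. w i = F p i) --> (ALL j:J. sol w j = p j))"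
  by (rule quadratic_inverse_forms[where l = l and K = K, OF assms(1-3) _ assms(5,6)]) (rule assms(4))
 then obtain e C sol where h: "e > 0 &
  (ALL w. (ALL i:I. abs (w i - F p i) < e) --> (ALL i:I. F (sol w) i = w i) & (ALL j:J. abs (sol w j - p j) < r)) &
  (ALL w w'. (ALL i:I. abs (w i - F p i) < e) --> (ALL i:I. abs (w' i - F p i) < e) -->
    (ALL j:J. abs (sol w j - sol w' j) <= C * (SUM i:I. abs (w i - w' i)))) &
  (ALL w. (ALL i:I. w i = F p i) --> (ALL j:J. sol w j = p j))"
  by (elim exE)
 show thesis by (rule that[of e sol C]) (use h in blast)+
qed

section \<open>Frameworks in coordinates\<close>

text \<open>A framework is a point \<open>x\<close> with coordinates indexed by \<open>V \<times> UNIV\<close>; edges occur as ordered pairs.\<close>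

definition dd :: "('a * 'd::finite => real) => 'a * 'a => real" where
 "dd x e = (SU a. (x (fst e, a) - x (snd e, a))^2)"

text \<open>Polarization of \<open>dd\<close>: \<open>2 * bb x y e\<close> is the derivative of
  \<open>dd\<close> at \<open>x\<close> in the direction \<open>y\<close>, so \<open>bb x\<close> is
  the rigidity matrix.\<close>

definition bb :: "('a * 'd::finite => real) => ('a * 'd => real) => 'a * 'a => real" where
 "bb x y e = (SU a. (x (fst e, a) - x (snd e, a)) * (y (fst e, a) - y (snd e, a)))"

text \<open>The bilinear form of the stress matrix of \<open>w\<close>; the two orders of an edge
  add their weights.\<close>

definition sf :: "('a * 'a) set => ('a * 'a => real) => ('a => real) => ('a => real) => real" where
 "sf D w y z = (SUM e:D. w e * ((y (fst e) - y (snd e)) * (z (fst e) - z (snd e))))"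

text \<open>Infinitesimal rigidity without naming the trivial motions; on a spanning framework they
  are the motions that preserve all distances to first order, by
  \<open>trivial_motion\<close>.\<close>

definition inf_rigid :: "'a set => ('a * 'a) set => ('a * 'd::finite => real) => bool" where
 "inf_rigid V D x <-> (ALL y. (ALL e:D. bb x y e = 0) --> (ALL e:V \<times> V. bb x y e = 0))"

definition stress :: "('a * 'a) set => ('a * 'a => real) => ('a * 'd::finite => real) => bool" where
 "stress D w x <-> (ALL a z. sf D w (%u. x (u, a)) z = 0)"

definition affine_kernel :: "'a set => ('a * 'a) set => ('a * 'a => real) => ('a * 'd::finite => real) => bool" where
 "affine_kernel V D w x <->
   (ALL y. (ALL z. sf D w y z = 0) --> (EX A b. ALL u:V. y u = b + (SU a. A a * x (u, a))))"

text \<open>Affine spanning, tested by linear forms that are constant on the points.\<close>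

definition spanning :: "'a set => ('a * 'd::finite => real) => bool" where
 "spanning V x <-> (ALL c. (ALL u:V. ALL w:V. (SU a. c a * (x (u, a) - x (w, a))) = 0) --> (ALL a. c a = 0))"

lemma sf_sym: "sf D w y z = sf D w z y"
 by (simp add: sf_def mult_ac)

lemma sf_lin: "sf D w (%u. a * y u + b * y' u) z = a * sf D w y z + b * sf D w y' z"
 unfolding sf_def sum_left sum.distrib[symmetric] by (intro sum.cong) (auto simp: algebra_simps)

lemma sf_const [simp]: "sf D w (%_. c) z = 0"
 by (simp add: sf_def)

lemma sf_sum: "sf D w (%u. SUM s:S. c s * y s u) z = (SUM s:S. c s * sf D w (y s) z)"
proof (induction S rule: infinite_finite_induct)
 case (insert s S)
 thus ?case using sf_lin[of D w "c s" "y s" 1 "%u. SUM s:S. c s * y s u" z] by simp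
qed auto

lemma sum_bb: "(SUM e:D. w e * bb x y e) = (SU a. sf D w (%u. x (u, a)) (%u. y (u, a)))"
 unfolding bb_def sf_def sum_left by (rule sum.swap)

lemma dd_deriv:
 fixes y v :: "'a * 'd::finite => real"
 shows "((%t. dd (%j. y j + t * v j) e) has_real_derivative 2 * bb y v e) (at 0)"
proof -
 have "((%t. SU a. ((y (fst e, a) + t * v (fst e, a)) - (y (snd e, a) + t * v (snd e, a)))^2)
   has_real_derivative (SUM a:(UNIV::'d set). 2 * ((y (fst e, a) - y (snd e, a)) * (v (fst e, a) - v (snd e, a))))) (at 0)"
  by (rule DERIV_sum) (auto intro!: derivative_eq_intros simp: algebra_simps)
 thus ?thesis by (simp add: dd_def bb_def sum_left)
qed

lemma dd_polyfun:
 assumes "\<rat> <= F" "fst e : V" "snd e : V"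
 shows "(%x. dd x e) : polyfun F (V \<times> UNIV)"
 unfolding dd_def
 by (intro polyfun_sum polyfun_power polyfun_diff polyfun_coord assms) (use assms in auto)

lemma derivation_square: "derivation d ==> d (x^2) = 2 * (x * d x)"
 by (simp add: power2_eq_square derivation_mult)

lemma derivation_dd: "derivation d ==> d (dd x e) = 2 * bb x (%j. d (x j)) e"
 unfolding dd_def bb_def by (simp add: derivation_sum derivation_square derivation_diff sum_left)

lemma Generic_spanning:
 fixes x :: "'a * 'd::finite => real"
 assumes "finite V" "card V >= Suc CARD('d)" "Generic \<rat> (V \<times> UNIV) x"
 shows "spanning V x"
proof -
 obtain u0 where u0: "u0 : V" using assms(2) by fastforce
 have "CARD('d) <= card (V - {u0})" using assms(1,2) u0 by simp
 then obtain k :: "'d => 'a" where k: "inj k" "range k <= V - {u0}"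
  using card_le_inj[of "UNIV :: 'd set" "V - {u0}"] assms(1) by auto
 define m where "m x a u = x (u, a) - x (u0, a)" for x :: "'a * 'd => real" and a u
 have poly: "(%x. m x a u) : polyfun \<rat> (V \<times> UNIV)" if "u : V - {u0}" for a u
  unfolding m_def using that u0 by (intro polyfun_diff polyfun_coord) auto
 \<comment> \<open>Specialization: \<open>d\<close> vertices at the unit vectors, all others, among
   them \<open>u0\<close>, at the origin.\<close>
 have "indep UNIV (V - {u0}) (m (%(u, a). if u = k a then 1 else 0))"
  unfolding indep_def
 proof (intro allI impI ballI)
   fix d :: "'d => real" and b
   assume h: "ALL j:V - {u0}. (SU i. d i * m (%(u, a). if u = k a then 1 else 0) i j) = 0"
   have "k b : V - {u0}" "u0 ~: range k" using k by auto
   hence "0 = (SU i. d i * m (%(u, a). if u = k a then 1 else 0) i (k b))" using h by simp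
   also have "... = (SU i. if i = b then d b else 0)"
    using \<open>u0 ~: range k\<close> k(1) by (intro sum.cong) (auto simp: m_def inj_eq)
   finally show "d b = 0" by simp
 qed
 with poly have ind: "indep UNIV (V - {u0}) (m x)"
  using Generic_indep[of UNIV "V - {u0}" \<rat> m "V \<times> UNIV" x "%(u, a). if u = k a then 1 else 0"] assms by auto
 show ?thesis
  unfolding spanning_def
 proof (intro allI impI)
  fix c :: "'d => real" and a
  assume c: "ALL u:V. ALL w:V. (SU a. c a * (x (u, a) - x (w, a))) = 0"
  show "c a = 0" by (rule indepD[OF ind]) (use c u0 in "auto simp: m_def")
 qed
qed

subsection \<open>Stresses of equivalent frameworks\<close>

text \<open>Genericity of \<open>x\<close> makes every polynomial relation among its edge lengths an
  identity, so the relation persists along curves through \<open>y\<close>. Hence a velocity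
  \<open>v\<close> at \<open>y\<close> defines a derivation on the ring of these lengths; its
  extension moves \<open>x\<close> with the same first-order changes of length, and those are
  annihilated by the stress.\<close>

lemma stress_transfer:
 fixes x y :: "'a * 'd::finite => real"
 assumes "finite V" "D <= V \<times> V" and gen: "Generic \<rat> (V \<times> UNIV) x"
  and eq: "!!e. e : D ==> dd y e = dd x e" and st: "stress D w x"
 shows "stress D w y"
proof -
 have finD: "finite D" using assms(1,2) finite_subset by blast
 have "(SUM e:D. w e * bb y v e) = 0" for v :: "'a * 'd => real"
 proof -
  define dz where "dz P a <-> ((%t. P (dd (%j. y j + t * v j))) has_real_derivative a) (at 0)" for P a
  define G where "G = (UN P:polyfun \<rat> D. {(P (dd x), a) | a. dz P a})"
  have GI: "(P (dd x), a) : G" if "P : polyfun \<rat> D" "dz P a" for P a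
   unfolding G_def using that by (intro UN_I[of P]) auto
  have GE: thesis if "(x', a) : G" "!!P. P : polyfun \<rat> D ==> x' = P (dd x) ==> dz P a ==> thesis" for x' a thesis
   using that unfolding G_def by auto
  have yx: "P (dd y) = P (dd x)" if "P : polyfun \<rat> D" for P
   by (rule polyfun_cong[OF that]) (rule eq)
  have "der_graph G"
   unfolding der_graph_def
  proof (intro conjI allI impI)
   show "(1, 0) : G"
    using GI[OF polyfun_rat[of \<rat> 1 D], of 0] by (simp add: dz_def)
  next
   fix x' a y' b assume xa: "(x', a) : G" and yb: "(y', b) : G"
   obtain P where P: "P : polyfun \<rat> D" "x' = P (dd x)" "dz P a" using xa by (rule GE)
   obtain Q where Q: "Q : polyfun \<rat> D" "y' = Q (dd x)" "dz Q b" using yb by (rule GE)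
   have "dz (%x. P x + Q x) (a + b)"
    unfolding dz_def by (rule DERIV_add[OF P(3)[unfolded dz_def] Q(3)[unfolded dz_def]])
   from GI[OF polyfun_add[OF P(1) Q(1)] this] show "(x' + y', a + b) : G" using P(2) Q(2) by simp
   have "dz (%x. P x * Q x) (x' * b + a * y')"
    using DERIV_mult[OF P(3)[unfolded dz_def] Q(3)[unfolded dz_def]] P(2) Q(2) yx[OF P(1)] yx[OF Q(1)]
    unfolding dz_def by (simp add: algebra_simps)
   from GI[OF polyfun_mult[OF P(1) Q(1)] this] show "(x' * y', x' * b + a * y') : G" using P(2) Q(2) by simp
  next
   fix x' a assume "(x', a) : G"
   then obtain P where P: "P : polyfun \<rat> D" "x' = P (dd x)" "dz P a" by (rule GE)
   have "dz (%x. - P x) (- a)"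
    unfolding dz_def by (rule DERIV_minus[OF P(3)[unfolded dz_def]])
   from GI[OF polyfun_minus[OF _ P(1)] this] show "(- x', - a) : G" using P(2) by simp
  next
   fix a assume "(0, a) : G"
   then obtain P where P: "P : polyfun \<rat> D" "0 = P (dd x)" "dz P a" by (rule GE)
   have "(%x. P (%e. dd x e)) : polyfun \<rat> (V \<times> UNIV)"
    by (rule polyfun_comp[OF P(1)]) (use assms(2) in "auto intro!: dd_polyfun")
   hence "P (dd z) = 0" for z :: "'a * 'd => real"
    using gen P(2) unfolding Generic_def by fastforce
   hence "((%_. 0) has_real_derivative a) (at 0)" using P(3) unfolding dz_def by simp
   thus "a = 0" using DERIV_unique[OF _ DERIV_const] by blast
  qed
  then obtain d where d: "derivation d" "!!x a. (x, a) : G ==> d x = a"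
   using der_graph_extend by blast
  have "bb x (%j. d (x j)) e = bb y v e" if e: "e : D" for e
  using GI[OF polyfun_coord[OF e, of \<rat>], of "2 * bb y v e"] dd_deriv[of y v e] d derivation_dd[OF d(1), of x e] by (auto simp: dz_def)
  hence "(SUM e:D. w e * bb y v e) = (SUM e:D. w e * bb x (%j. d (x j)) e)" by simp
  also have "... = 0" unfolding sum_bb using st unfolding stress_def by simp
  finally show ?thesis .
 qed
 note all = this
 show ?thesis
  unfolding stress_def
 proof (intro allI)
  fix a z
  have "0 = (SU b. sf D w (%u. y (u, b)) (%u. if b = a then z u else 0))"
   using all[of "%(u, b). if b = a then z u else 0"] unfolding sum_bb by simp
  also have "... = (SU b. if b = a then sf D w (%u. y (u, a)) z else 0)"
   by (intro sum.cong refl) (simp add: sf_def)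
  finally show "sf D w (%u. y (u, a)) z = 0" by simp
 qed
qed

section \<open>Congruence, and the sufficiency of a stress with affine kernel\<close>

text \<open>The reflection in the hyperplane orthogonal to \<open>n\<close>; for
  \<open>n = 0\<close> it is the identity.\<close>

definition rf :: "'v::real_inner => 'v => 'v" where "rf n x = x - (2 * (x \<bullet> n) / (n \<bullet> n)) *\<^sub>R n"

lemma rf_linear: "linear (rf n)"
 by (rule linearI) (simp_all add: rf_def inner_add_left algebra_simps add_divide_distrib)

lemma rf_orthogonal: "orthogonal_transformation (rf n)"
using rf_linear[of n] by (auto simp: rf_def inner_diff_left inner_diff_right inner_commute field_simps orthogonal_transformation_def)

text \<open>If the motion found for \<open>V\<close> sends \<open>w\<close> to \<open>p\<close>
  instead of \<open>s w\<close>, it is followed by the reflection that exchanges these two points.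
  Every other \<open>s u\<close> is equidistant from both and stays fixed.\<close>

lemma congruent_all_pairs:
 fixes r s :: "'a => real ^ 'd"
 assumes "finite V" "!!u w. u : V ==> w : V ==> norm (s u - s w) = norm (r u - r w)"
 shows "congruent_frameworks V r s"
 using assms
proof (induction V)
 case empty
 have "rigid_motion (%x :: real ^ 'd. x + 0)" unfolding rigid_motion_def using orthogonal_transformation_id[unfolded id_def] by blast
 thus ?case unfolding congruent_frameworks_def by blast
next
 case (insert w V)
 then obtain f b where f: "orthogonal_transformation f" and s: "!!u. u : V ==> s u = f (r u) + b"
  unfolding congruent_frameworks_def rigid_motion_def by auto
 define p where "p = f (r w) + b"
 define n where "n = p - s w"
 have eq: "norm (s u - p) = norm (s u - s w)" if u: "u : V" for u
 proof -
  have "s u - p = f (r u - r w)" using f by (simp add: s[OF u] p_def orthogonal_transformation_def linear_diff)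
  thus ?thesis using orthogonal_transformation_norm[OF f] insert.prems[of u w] u by simp
 qed
 define h where "h = (1/2) *\<^sub>R (p + s w)"
 have fx: "rf n (s u - h) + h = s u" if u: "u : V" for u
 proof -
  have "(s u - p) \<bullet> (s u - p) = (s u - s w) \<bullet> (s u - s w)" using eq[OF u] by (simp add: dot_square_norm)
  hence "(s u - h) \<bullet> n = 0"
   by (simp add: n_def h_def inner_diff_left inner_diff_right inner_add_left inner_add_right inner_commute)
  thus ?thesis by (simp add: rf_def)
 qed
 have pw: "rf n (p - h) + h = s w"
 proof -
  have "p - h = (1/2) *\<^sub>R n" by (simp add: n_def h_def vec_eq_iff field_simps)
  hence "rf n (p - h) = (1/2) *\<^sub>R n - n" by (cases "n = 0") (simp_all add: rf_def)
  moreover have "(1/2) *\<^sub>R n - n + h = s w" by (simp add: n_def h_def vec_eq_iff field_simps)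
  ultimately show ?thesis by simp
 qed
 have "orthogonal_transformation (%x. rf n (f x))"
  using orthogonal_transformation_compose[OF rf_orthogonal f] by (simp add: o_def)
 hence "rigid_motion (%x. rf n (f x) + (rf n (b - h) + h))" unfolding rigid_motion_def by blast
 moreover have T: "rf n (f x) + (rf n (b - h) + h) = rf n (f x + b - h) + h" for x
  unfolding add_diff_eq[symmetric] linear_add[OF rf_linear] by (simp add: add.assoc)
 moreover have "s u = rf n (f (r u)) + (rf n (b - h) + h)" if "u : insert w V" for u
  unfolding T using that fx[of u] pw s[of u] by (auto simp: p_def)
 ultimately show ?case unfolding congruent_frameworks_def by blast
qed

definition coords :: "('a => real ^ 'd) => 'a * 'd => real" where
 "coords r = (%(u, i). r u $ i)"

lemma dd_coords: "dd (coords r) (u, w) = (norm (r u - r w))^2"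
 by (simp add: dd_def coords_def norm_vec_def L2_set_def sum_nonneg)

lemma dd_coords_eq_iff: "dd (coords s) (u, w) = dd (coords r) (u, w) <-> norm (s u - s w) = norm (r u - r w)"
 by (simp add: dd_coords)

text \<open>By \<open>stress_transfer\<close> an equivalent framework is \<open>M x + B\<close>. Up
  to a translation, \<open>z\<close> is \<open>M^T M - I\<close> applied to \<open>x\<close>, and it
  preserves the edge lengths to first order. Infinitesimal rigidity then makes \<open>M\<close>
  preserve all distances, which spares a discussion of edge directions on a conic at
  infinity.\<close>

lemma affine_kernel_globally_rigid:
 fixes r :: "'a => real ^ 'd::finite"
 assumes "graph V E" and card: "card V >= Suc CARD('d)" and gen: "generic V r"
  and rig: "inf_rigid V {(u, w). {u, w} : E} (coords r)"
  and st: "stress {(u, w). {u, w} : E} W (coords r)"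
  and ak: "affine_kernel V {(u, w). {u, w} : E} W (coords r)"
 shows "globally_rigid V E r"
 unfolding globally_rigid_def
proof (intro ballI impI)
 fix s :: "'a => real ^ 'd"
 assume eq: "ALL u w. {u, w} : E --> norm (s u - s w) = norm (r u - r w)"
 let ?D = "{(u, w). {u, w} : E}" and ?x = "coords r" and ?y = "coords s"
 have finV: "finite V" and DV: "?D <= V \<times> V" using assms(1) unfolding graph_def by auto
 have gx: "Generic \<rat> (V \<times> UNIV) ?x" using gen generic_iff_Generic[OF finV] unfolding coords_def by blast
 have sp: "spanning V ?x" by (rule Generic_spanning[OF finV card gx])
 have dyx: "dd ?y e = dd ?x e" if "e : ?D" for e
  using that eq dd_coords_eq_iff[of s "fst e" "snd e" r] by (cases e) simp
 have "stress ?D W ?y" by (rule stress_transfer[OF finV DV gx dyx st])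
 hence "ALL i. EX d B. ALL u:V. ?y (u, i) = B + (SU a. d a * ?x (u, a))"
  using ak unfolding stress_def affine_kernel_def by blast
 then obtain M B where y: "!!u i. u : V ==> ?y (u, i) = B i + (SU a. M i a * ?x (u, a))"
  by metis
 define z where "z = (%(u, b). (SU i. M i b * ?y (u, i)) - ?x (u, b))"
 \<comment> \<open>For the difference vector \<open>p\<close> of the pair, both sides are
   \<open>p^T (M^T M - I) p\<close>.\<close>
 have dz: "bb ?x z e = dd ?y e - dd ?x e" if e: "e : V \<times> V" for e
 proof -
  let ?p = "%b. ?x (fst e, b) - ?x (snd e, b)" and ?q = "%i. ?y (fst e, i) - ?y (snd e, i)"
  have q: "?q i = (SU b. M i b * ?p b)" for i using e by (auto simp: y right_diff_distrib sum_subtractf)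
  have "(SU b. ?p b * (SU i. M i b * ?q i)) = (SU i. (SU b. M i b * ?p b) * ?q i)"
   unfolding sum_left sum_right by (subst sum.swap) (simp add: mult_ac)
  moreover have "bb ?x z e = (SU b. ?p b * (SU i. M i b * ?q i)) - (SU b. ?p b * ?p b)"
   unfolding bb_def sum_subtractf[symmetric] by (intro sum.cong refl) (simp add: z_def sum_subtractf algebra_simps)
  ultimately show ?thesis unfolding q[symmetric] by (simp add: dd_def power2_eq_square)
 qed
 have "bb ?x z e = 0" if "e : ?D" for e using dz[OF subsetD[OF DV that]] dyx[OF that] by simp
 hence "dd ?y e = dd ?x e" if "e : V \<times> V" for e using rig[unfolded inf_rigid_def, rule_format, of z e] that dz[OF that] by simp
 thus "congruent_frameworks V r s" by (intro congruent_all_pairs[OF finV]) (simp add: dd_coords_eq_iff[symmetric])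
qed

lemma not_globally_rigidI:
 fixes r :: "'a => real ^ 'd::finite" and y :: "'a * 'd => real"
 assumes "graph V E" and eq: "!!e. e : {(u, w). {u, w} : E} ==> dd y e = dd (coords r) e"
  and e0: "e0 : V \<times> V" "dd y e0 ~= dd (coords r) e0"
 shows "~ globally_rigid V E r"
proof
 assume gr: "globally_rigid V E r"
 define s where "s u = (if u : V then (\<chi> i. y (u, i)) else undefined)" for u
 have dy: "dd (coords s) e = dd y e" if "e : V \<times> V" for e
  using that by (auto simp: dd_def coords_def s_def)
 have "s : frameworks V" by (auto simp: frameworks_def s_def PiE_def extensional_def)
 moreover have "norm (s u - s w) = norm (r u - r w)" if e: "{u, w} : E" for u w
 using assms(1) e eq[of "(u, w)"] dy[of "(u, w)"] dd_coords_eq_iff[of s u w r] by (auto simp: graph_def)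
 ultimately have "congruent_frameworks V r s" using gr unfolding globally_rigid_def by blast
 then obtain f b where fb: "orthogonal_transformation f" "ALL u:V. s u = f (r u) + b"
  unfolding congruent_frameworks_def rigid_motion_def by blast
 obtain u w where uw: "e0 = (u, w)" "u : V" "w : V" using e0(1) by auto
 have "s u - s w = f (r u - r w)"
  using fb uw orthogonal_transformation_linear[OF fb(1)] by (simp add: linear_diff)
 hence "norm (s u - s w) = norm (r u - r w)" using fb(1) by (simp add: orthogonal_transformation_norm)
 thus False using e0 uw dy[of e0] dd_coords_eq_iff[of s u w r] by simp
qed

subsection \<open>Flexible frameworks\<close>

text \<open>Coefficients of the linear form that takes the difference of coordinate \<open>a\<close>
  along \<open>e\<close>.\<close>

definition kap :: "'a * 'a => 'd => 'a * 'd => real" where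
 "kap e a j = (if snd j = a then (kr (fst j) (fst e)) - (kr (fst j) (snd e)) else 0)"

definition rrow :: "('a * 'd::finite => real) => 'a * 'a => 'a * 'd => real" where
 "rrow x e j = (SU a. (x (fst e, a) - x (snd e, a)) * kap e a j)"

lemma kap_sum:
 fixes u :: "'a * 'd::finite => real"
 assumes "finite V" "e : V \<times> V"
 shows "(SUM j:V \<times> UNIV. kap e a j * u j) = u (fst e, a) - u (snd e, a)"
proof -
 have "(SUM j:V \<times> UNIV. kap e a j * u j) = (SUM s:V. SU c. kap e a (s, c) * u (s, c))"
  by (simp add: sum.cartesian_product)
 also have "... = (SUM s:V. ((kr s (fst e)) - (kr s (snd e))) * u (s, a))"
 proof (rule sum.cong[OF refl])
  fix s
  have "(SU c. kap e a (s, c) * u (s, c)) =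
    (SU c. if c = a then ((kr s (fst e)) - (kr s (snd e))) * u (s, a) else 0)"
   by (intro sum.cong) (auto simp: kap_def)
  thus "(SU c. kap e a (s, c) * u (s, c)) = ((kr s (fst e)) - (kr s (snd e))) * u (s, a)"
   by simp
 qed
 also have "... = u (fst e, a) - u (snd e, a)"
  using assms by (auto simp: left_diff_distrib sum_subtractf if_mult cong: if_cong)
 finally show ?thesis .
qed

lemma rrow_sum:
 assumes "finite V" "e : V \<times> V"
 shows "(SUM j:V \<times> UNIV. rrow x e j * y j) = bb x y e"
proof -
 have "(SUM j:V \<times> UNIV. rrow x e j * y j) = (SU a. (x (fst e, a) - x (snd e, a)) * (SUM j:V \<times> UNIV. kap e a j * y j))"
  unfolding rrow_def by (rule sum_assoc(1))
 thus ?thesis using kap_sum[OF assms, of _ y] by (simp add: bb_def)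
qed

text \<open>A coefficient \<open>Q f\<close> is replaced by the polynomial \<open>Q\<close> in the
  variables \<open>Some i\<close>, and the variable of \<open>P\<close> becomes
  \<open>None\<close>.\<close>

lemma polyfun_lift:
 assumes "P : polyfun {Q f | Q. Q : polyfun \<rat> I} (UNIV :: unit set)"
 shows "EX H:polyfun \<rat> (insert None (Some ` I)). ALL s. P (%_. s) = H (case_option s f)"
 using assms
proof induction
 case (polyfun_const c)
 then obtain Q where Q: "Q : polyfun \<rat> I" "c = Q f" by blast
 have "(%y. Q (%i. y (Some i))) : polyfun \<rat> (insert None (Some ` I))"
  by (rule polyfun_comp[OF Q(1)]) (auto intro: polyfun_coord)
 thus ?case using Q(2) by (intro bexI[of _ "%y. Q (%i. y (Some i))"]) auto
next
 case (polyfun_coord i)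
 have "(%y. y None) : polyfun \<rat> (insert None (Some ` I))" by (rule polyfun.polyfun_coord) simp
 thus ?case by (intro bexI[of _ "%y. y None"]) auto
next
 case (polyfun_add P Q)
 then obtain H K where HK: "H : polyfun \<rat> (insert None (Some ` I))" "ALL s. P (%_. s) = H (case_option s f)"
  "K : polyfun \<rat> (insert None (Some ` I))" "ALL s. Q (%_. s) = K (case_option s f)" by (elim bexE)
 thus ?case using polyfun.polyfun_add[OF HK(1,3)] by (intro bexI[of _ "%x. H x + K x"]) simp_all
next
 case (polyfun_mult P Q)
 then obtain H K where HK: "H : polyfun \<rat> (insert None (Some ` I))" "ALL s. P (%_. s) = H (case_option s f)"
  "K : polyfun \<rat> (insert None (Some ` I))" "ALL s. Q (%_. s) = K (case_option s f)" by (elim bexE)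
 thus ?case using polyfun.polyfun_mult[OF HK(1,3)] by (intro bexI[of _ "%x. H x * K x"]) simp_all
qed

text \<open>If this length were transcendental over the lengths in \<open>I\<close>, a derivation
  would kill the latter but not the former, contrary to the dependency of the rows. The resulting
  algebraic relation holds for all frameworks by genericity, so fixing the lengths in
  \<open>I\<close> leaves finitely many values.\<close>

lemma length_algebraic:
 fixes x :: "'a * 'd::finite => real"
 assumes "finite V" "I <= V \<times> V" "e : V \<times> V" and gen: "Generic \<rat> (V \<times> UNIV) x"
  and dep: "!!j. j : V \<times> UNIV ==> rrow x e j = (SUM i:I. m i * rrow x i j)"
 shows "EX B. finite B & (ALL y. (ALL i:I. dd y i = dd x i) --> dd (y :: 'a * 'd => real) e : B)"
proof -
 have finI: "finite I" using assms(1,2) finite_subset by blast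
 define F where "F = {Q (dd x) | Q. Q : polyfun \<rat> I}"
 have QF: "\<rat> <= F"
 proof
  fix c :: real assume "c : \<rat>"
  hence "(%_. c) : polyfun \<rat> I" by (rule polyfun_const)
  thus "c : F" unfolding F_def by (intro CollectI exI[of _ "%_. c"]) simp
 qed
 have "~ Generic F (UNIV :: unit set) (%_. dd x e)"
 proof
  assume "Generic F (UNIV :: unit set) (%_. dd x e)"
  from Generic_derivation[OF this QF, of "%_. 1"] obtain d where
   d: "derivation d" "!!c. c : F ==> d c = 0" "d (dd x e) = 1" by auto
  have "bb x (%j. d (x j)) i = 0" if i: "i : I" for i
  using polyfun_coord[OF i, of \<rat>] d(2) derivation_dd[OF d(1), of x i] by (fastforce simp: F_def)
  hence "(SUM j:V \<times> UNIV. rrow x i j * d (x j)) = 0" if "i : I" for i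
   using rrow_sum[OF assms(1) subsetD[OF assms(2) that], of x "%j. d (x j)"] that by simp
  hence "(SUM i:I. m i * (SUM j:V \<times> UNIV. rrow x i j * d (x j))) = 0"
   by (intro sum.neutral) simp
  also have "(SUM i:I. m i * (SUM j:V \<times> UNIV. rrow x i j * d (x j))) = (SUM j:V \<times> UNIV. rrow x e j * d (x j))"
   by (simp add: sum_assoc dep)
  finally have "bb x (%j. d (x j)) e = 0" using rrow_sum[OF assms(1,3)] by metis
  thus False using d(3) derivation_dd[OF d(1), of x e] by simp
 qed
 then obtain P z where P: "P : polyfun F (UNIV :: unit set)" "P (%_. dd x e) = 0" "P z ~= 0"
  unfolding Generic_def by blast
 obtain H where H: "H : polyfun \<rat> (insert None (Some ` I))" "!!s. P (%_. s) = H (case_option s (dd x))"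
  using polyfun_lift P(1) unfolding F_def by blast
 define h where "h i y = (case i of None => dd y e | Some i => dd y i)" for i and y :: "'a * 'd => real"
 have hp: "(%y. H (%i. h i y)) : polyfun \<rat> (V \<times> UNIV)"
 using assms(3) subsetD[OF assms(2)] by (auto simp: dd_polyfun h_def intro: polyfun_comp[OF H(1)])
 have hc: "(%i. h i y) = case_option (dd y e) (dd y)" for y by (auto simp: h_def fun_eq_iff split: option.split)
 have "H (%i. h i x) = 0" using P(2) H(2) unfolding hc by simp
 hence H0: "H (case_option (dd y e) (dd y)) = 0" for y :: "'a * 'd => real"
  using bspec[OF gen[unfolded Generic_def] hp] by (simp add: hc)
 have "finite {s. P (%_. s) = 0}"
  using finite_zeros_line[OF P(1), of "%_. 0" "z ()" "%_. 1"] P(3) by simp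
 moreover have "dd y e : {s. P (%_. s) = 0}" if "ALL i:I. dd y i = dd x i" for y :: "'a * 'd => real"
 proof -
  have "H (case_option (dd y e) (dd x)) = H (case_option (dd y e) (dd y))"
   by (rule polyfun_cong[OF H(1)]) (use that in auto)
  thus ?thesis using H0[of y] H(2) by simp
 qed
 ultimately show ?thesis by blast
qed

text \<open>The lengths of a maximal independent set \<open>I\<close> of edges, the length of a
  further pair \<open>e0\<close> and some coordinates form a local chart. When only the length of
  \<open>e0\<close> is changed, the other edge lengths vary continuously among finitely many values
  and are therefore constant.\<close>

lemma flexible_deformation:
 fixes x :: "'a * 'd::finite => real"
 assumes finV: "finite V" and DV: "D <= V \<times> V" and gen: "Generic \<rat> (V \<times> UNIV) x"
  and flex: "~ inf_rigid V D x"
 shows "EX (y :: 'a * 'd => real) e0. (ALL e:D. dd y e = dd x e) & e0 : V \<times> V & dd y e0 ~= dd x e0"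
proof -
 define J where "J = V \<times> (UNIV :: 'd set)"
 have finJ: "finite J" using finV by (simp add: J_def)
 have rs: "(SUM j:J. rrow x e j * u j) = bb x u e" if "e : V \<times> V" for e u
  unfolding J_def by (rule rrow_sum[OF finV that])
 have ks: "(SUM j:J. kap e a j * u j) = u (fst e, a) - u (snd e, a)" if "e : V \<times> V" for e a u
  unfolding J_def by (rule kap_sum[OF finV that])
 have finD: "finite D" using finV DV finite_subset by blast
 obtain y0 e0 where y0: "!!e. e : D ==> bb x y0 e = 0" and e0: "e0 : V \<times> V" "bb x y0 e0 ~= 0"
  using flex unfolding inf_rigid_def by blast
 obtain I where I: "I <= D" "indep I J (rrow x)" "!!e. e : D ==> EX m. ALL j:J. rrow x e j = (SUM i:I. m i * rrow x i j)"
  using max_indep[OF finD, of J "rrow x"] by blast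
 have finI: "finite I" using I(1) finD finite_subset by blast
 have IV: "I <= V \<times> V" using I(1) DV by blast
 let ?I = "insert e0 I"
 have e0I: "e0 ~: I" using y0 e0(2) I(1) by blast
 have ind: "indep ?I J (rrow x)"
  unfolding indep_def
 proof (intro allI impI)
  fix m assume m: "ALL j:J. (SUM i:?I. m i * rrow x i j) = 0"
  have "0 = (SUM j:J. (SUM i:?I. m i * rrow x i j) * y0 j)"
   by (rule sum.neutral[symmetric]) (simp add: m)
  also have "... = (SUM i:?I. m i * (SUM j:J. rrow x i j * y0 j))"
   by (rule sum_assoc(1))
  also have "... = (SUM i:?I. m i * bb x y0 i)"
   using rs IV e0(1) by (intro sum.cong) auto
  also have "... = m e0 * bb x y0 e0 + (SUM i:I. m i * bb x y0 i)" using e0I finI by simp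
  also have "(SUM i:I. m i * bb x y0 i) = 0" using y0 subsetD[OF I(1)] by (intro sum.neutral) simp
  also have "m e0 * bb x y0 e0 + 0 = m e0 * bb x y0 e0" by simp
  finally have z: "m e0 = 0" using e0(2) by simp
  hence "ALL j:J. (SUM i:I. m i * rrow x i j) = 0" using m e0I finI by simp
  hence "ALL i:I. m i = 0" using I(2) unfolding indep_def by blast
  thus "ALL i:?I. m i = 0" using z by simp
 qed
 have finI': "finite ?I" using finI by simp
 obtain J0 where J0: "J0 <= J" "card ?I + card J0 = card J"
  "!!x'. (ALL i:?I. (SUM j:J. rrow x i j * x' j) = 0) ==> (ALL j:J0. x' j = 0) ==> (ALL j:J. x' j = 0)"
  using indep_complete[OF ind finI' finJ] by blast
 have finJ0: "finite J0" using J0(1) finJ finite_subset by blast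
 define K where "K = ?I <+> J0"
 have InlK: "Inl e : K <-> e : ?I" and InrK: "Inr j : K <-> j : J0" for e j
  by (auto simp: K_def)
 define F where "F u k = (case k of Inl e => dd u e | Inr j => u j)" for u :: "'a * 'd => real" and k
 define l where "l k j = (case k of Inl e => (0 :: real) | Inr j' => (kr j j'))" for k :: "'a * 'a + 'a * 'd" and j
 define h where "h k a j = (case k of Inl e => kap e a j | Inr j' => 0)" for k :: "'a * 'a + 'a * 'd" and a :: 'd and j :: "'a * 'd"
 have finK: "finite K" using finI' finJ0 by (simp add: K_def)
 have cardK: "card K = card J" using J0(2) finI' finJ0 by (simp add: K_def card_Plus)
 have lJ: "(SUM j:J. l (Inr j') j * u j) = u j'" if "j' : J0" for j' u
  using that J0(1) finJ by (auto simp: l_def if_mult cong: if_cong)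
 have Fk: "F u k = (SUM j:J. l k j * u j) + (SU a. (SUM j:J. h k a j * u j)^2)" if k: "k : K" for u k
 proof (cases k)
  case (Inl e)
  hence "e : V \<times> V" using k IV e0(1) by (auto simp: InlK)
  thus ?thesis using ks[of e _ u] Inl by (simp add: F_def l_def h_def dd_def)
 next
  case (Inr j')
  thus ?thesis using lJ[of j' u] k by (simp add: InrK F_def h_def)
 qed
 have inj: "indep J K (%j k. l k j + 2 * (SU a. (SUM k':J. h k a k' * x k') * h k a j))"
  unfolding indep_def
 proof (intro allI impI)
  fix u assume u: "ALL k:K. (SUM j:J. u j * (l k j + 2 * (SU a. (SUM k':J. h k a k' * x k') * h k a j))) = 0"
  have "(SUM j:J. rrow x e j * u j) = 0" if e: "e : ?I" for e
  proof -
   have eV: "e : V \<times> V" using e IV e0(1) by auto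
   have "(SU a. (SUM k':J. h (Inl e) a k' * x k') * h (Inl e) a j) = rrow x e j" for j
    using ks[OF eV, of _ x] by (simp add: h_def rrow_def)
   hence "(SUM j:J. u j * (2 * rrow x e j)) = 0" using u[rule_format, of "Inl e"] e unfolding InlK by (simp add: l_def)
   hence "2 * (SUM j:J. rrow x e j * u j) = 0" by (simp add: sum_left mult_ac)
   thus ?thesis by simp
  qed
  moreover have "u j = 0" if j: "j : J0" for j
  using u[rule_format, of "Inr j"] j lJ[OF j, of u] by (auto simp: h_def mult.commute InrK)
  ultimately show "ALL j:J. u j = 0" using J0(3) by blast
 qed
 obtain b C sol where sol: "b > 0"
  "!!w i. ALL i:K. abs (w i - F x i) < b ==> i : K ==> F (sol w) i = w i"
  "!!w w' j. ALL i:K. abs (w i - F x i) < b ==> ALL i:K. abs (w' i - F x i) < b ==> j : J ==>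
    abs (sol w j - sol w' j) <= C * (SUM i:K. abs (w i - w' i))"
  "!!w j. ALL i:K. w i = F x i ==> j : J ==> sol w j = x j"
  by (rule quadratic_inverse_formsE[where F = F and l = l and K = h and p = x, OF finK finJ cardK _ inj zero_less_one])
   (erule Fk, (rule that; assumption))
 define w where "w s k = F x k + (if k = Inl e0 then s else 0)" for s k
 define s1 where "s1 = b / 2"
 have s1: "0 < s1" "s1 < b" using sol(1) by (auto simp: s1_def)
 have wn: "ALL i:K. abs (w s i - F x i) < b" if "s : {0..s1}" for s using that s1 by (auto simp: w_def)
 define y where "y s = sol (w s)" for s
 have yI: "dd (y s) i = dd x i" if "s : {0..s1}" "i : I" for s i
 using sol(2)[OF wn[OF that(1)]] that(2) InlK e0I by (fastforce simp: F_def w_def y_def)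
 have ye: "dd (y s) e0 = dd x e0 + s" if "s : {0..s1}" for s

 using sol(2)[OF wn[OF that]] InlK by (fastforce simp: F_def w_def y_def)
 have y0x: "y 0 j = x j" if "j : J" for j
  unfolding y_def using sol(4)[of "w 0"] that by (simp add: w_def)
 have cont: "continuous_on {0..s1} (%s. y s j)" if j: "j : J" for j
 proof (rule continuous_onI)
  fix s r assume s: "s : {0..s1}" and r: "(r :: real) > 0"
  have lip: "abs (y t j - y s j) <= abs C * abs (t - s)" if t: "t : {0..s1}" for t
  proof -
   have "abs (y t j - y s j) <= C * (SUM i:K. abs (w t i - w s i))"
    unfolding y_def using sol(3)[OF wn[OF t] wn[OF s]] j by blast
   also have "(SUM i:K. abs (w t i - w s i)) = (SUM i:K. if i = Inl e0 then abs (t - s) else 0)"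
    by (intro sum.cong) (auto simp: w_def)
   also have "... = abs (t - s)" using finK InlK[of e0] by simp
   also have "C * abs (t - s) <= abs C * abs (t - s)" by (intro mult_right_mono) auto
   finally show ?thesis .
  qed
  show "EX d>0. ALL t:{0..s1}. dist t s < d --> dist (y t j) (y s j) <= r"
  proof (intro exI[of _ "r / (abs C + 1)"] conjI ballI impI)
   show "r / (abs C + 1) > 0" using r by simp
   fix t assume t: "t : {0..s1}" "dist t s < r / (abs C + 1)"
   have "abs (y t j - y s j) <= abs C * abs (t - s)" by (rule lip[OF t(1)])
   also have "... <= r" using t(2) by (simp add: dist_real_def field_simps)
   finally show "dist (y t j) (y s j) <= r" by (simp add: dist_real_def)
  qed
 qed
 have yD: "dd (y s) e = dd x e" if e: "e : D" and s: "s : {0..s1}" for e s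
 proof -
  have eV: "e : V \<times> V" using e DV by blast
  obtain m where m: "!!j. j : J ==> rrow x e j = (SUM i:I. m i * rrow x i j)" using I(3)[OF e] by blast
  obtain B where B: "finite B" "!!y :: 'a * 'd => real. ALL i:I. dd y i = dd x i ==> dd y e : B"
   using length_algebraic[OF finV IV eV gen, of m] m unfolding J_def by blast
  have c: "continuous_on {0..s1} (%s. dd (y s) e)"
   unfolding dd_def using eV by (intro continuous_intros cont) (auto simp: J_def)
  have f: "finite ((%s. dd (y s) e) ` {0..s1})"
   by (rule finite_subset[OF image_subsetI B(1)], rule B(2)) (use yI in blast)
  have "(%s. dd (y s) e) constant_on {0..s1}"
   by (rule continuous_finite_range_constant[OF _ c f]) simp
  hence "dd (y s) e = dd (y 0) e" using s s1 unfolding constant_on_def by fastforce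
  also have "... = dd x e" unfolding dd_def using eV y0x by (intro sum.cong) (auto simp: J_def)
  finally show ?thesis .
 qed
 show ?thesis
 proof (rule exI[of _ "y s1"], rule exI[of _ e0], intro conjI ballI)
  show "dd (y s1) e0 ~= dd x e0" using ye[of s1] s1 by simp
  show "dd (y s1) e = dd x e" if "e : D" for e using yD[OF that, of s1] s1 by simp
 qed (rule e0(1))
qed

theorem flexible_not_globally_rigid:
 fixes r :: "'a => real ^ 'd::finite"
 assumes g: "graph V E" and gen: "generic V r" and flex: "~ inf_rigid V {(u, w). {u, w} : E} (coords r)"
 shows "~ globally_rigid V E r"
proof -
 have finV: "finite V" and DV: "{(u, w). {u, w} : E} <= V \<times> V" using g unfolding graph_def by auto
 have gx: "Generic \<rat> (V \<times> UNIV) (coords r)" using gen generic_iff_Generic[OF finV] unfolding coords_def by blast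
 obtain y :: "'a * 'd => real" and e0 where "ALL e:{(u, w). {u, w} : E}. dd y e = dd (coords r) e" "e0 : V \<times> V" "dd y e0 ~= dd (coords r) e0"
  using flexible_deformation[OF finV DV gx flex] by blast
 thus ?thesis by (intro not_globally_rigidI[OF g, of y r e0]) blast+
qed

text \<open>With at most \<open>d\<close> other vertices, the vectors from a generic
  \<open>p\<close> to them are independent, so \<open>p\<close> has a velocity orthogonal to all of
  them except the one to \<open>q\<close>.\<close>

lemma small_missing_edge_flexible:
 fixes x :: "'a * 'd::finite => real"
 assumes finV: "finite V" and card: "card V <= Suc CARD('d)" and gen: "Generic \<rat> (V \<times> UNIV) x"
  and p: "p : V" "q : V" "p ~= q" and D: "(p, q) ~: D" "(q, p) ~: D" "D <= V \<times> V"
 shows "~ inf_rigid V D x"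
proof -
 have "card (V - {p}) <= CARD('d)" using card finV p(1) by simp
 then obtain k :: "'a => 'd" where k: "inj_on k (V - {p})"
  using card_le_inj[of "V - {p}" "UNIV :: 'd set"] finV by auto
 define m where "m x t a = x (t, a) - x (p, a)" for x :: "'a * 'd => real" and t a
 have poly: "(%x. m x t a) : polyfun \<rat> (V \<times> UNIV)" if "t : V - {p}" for t a
  unfolding m_def using that p by (intro polyfun_diff polyfun_coord) auto
 have "indep (V - {p}) UNIV (m (%(t, a). if t ~= p & a = k t then 1 else 0))"
  unfolding indep_def
 proof (intro allI impI ballI)
  fix w :: "'a => real" and s
  assume h: "ALL j:UNIV. (SUM i:V - {p}. w i * m (%(t, a). if t ~= p & a = k t then 1 else 0) i j) = 0" and s: "s : V - {p}"
  have "0 = (SUM i:V - {p}. w i * m (%(t, a). if t ~= p & a = k t then 1 else 0) i (k s))" using h by simp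
  also have "... = (SUM i:V - {p}. if i = s then w s else 0)"
   using k s by (intro sum.cong) (auto simp: m_def inj_on_def)
  finally show "w s = 0" using s finV by simp
 qed
 with poly have ind: "indep (V - {p}) UNIV (m x)"
  using Generic_indep[of "V - {p}" "UNIV :: 'd set" \<rat> m "V \<times> UNIV" x "%(t, a). if t ~= p & a = k t then 1 else 0"] finV gen by auto
 obtain c where c: "ALL t:V - {p}. (SU a. m x t a * c a) = (kr t q)"
  using indep_solve[OF ind, of "%t. if t = q then 1 else 0"] finV by auto
 define y where "y = (%(t, a). if t = p then c a else 0)"
 have b: "bb x y (s, t) = (if s = t then 0 else if s = p then - (SU a. m x t a * c a) else
   if t = p then - (SU a. m x s a * c a) else 0)" for s t
  by (auto simp: bb_def y_def m_def sum_negf[symmetric] algebra_simps intro!: sum.cong)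
 have "bb x y e = 0" if "e : D" for e
 using that D c by (auto simp: b)
 moreover have "bb x y (p, q) ~= 0" using c p unfolding b by auto
 ultimately show ?thesis using p unfolding inf_rigid_def by blast
qed

subsection \<open>Gram coordinates on the kernel of a stress\<close>

lemma sum_mult_delta:
 fixes f :: "'a => real"
 assumes "finite S"
 shows "(SUM a:S. f a * (kr a c)) = (if c : S then f c else 0)"
  and "(SUM a:S. (kr a c) * f a) = (if c : S then f c else 0)"
  and "(SUM a:S. f a * (kr c a)) = (if c : S then f c else 0)"
  and "(SUM a:S. (kr c a) * f a) = (if c : S then f c else 0)"
 using assms by (auto simp: if_mult mult_if sum.remove[of S c] intro!: sum.neutral split: if_splits)

section \<open>Triangular normal form of configurations under rotations\<close>

text \<open>An arbitrary numbering of the coordinate directions, which serves as the order for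
  triangular matrices.\<close>

definition tau :: "'d::finite => nat" where
 "tau = (SOME f. inj f)"

lemma inj_tau: "inj (tau :: 'd::finite => nat)"
using finite_imp_inj_to_nat_seg[of "UNIV :: 'd set"] by (auto simp: tau_def intro: someI[of inj])

text \<open>Skew matrices are parametrized by their entries below the diagonal.\<close>

definition Sk :: "('d::finite * 'd) set" where
 "Sk = {(a, b). tau b < tau a}"

definition sk :: "('d::finite * 'd => real) => 'd => 'd => real" where
 "sk A a b = (if tau b < tau a then A (a, b) else if tau a < tau b then - A (b, a) else 0)"

lemma finite_Sk [simp]: "finite Sk"
 by (rule finite_subset[OF subset_UNIV]) simp

lemma sk_skew: "sk A a b = - sk A b a"
 by (auto simp: sk_def)

lemma sk_diag [simp]: "sk A a a = 0"
 by (simp add: sk_def)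

lemma sk_zero: "(!!a b. sk A a b = 0) ==> s : Sk ==> A s = 0"
 by (cases s) (metis (mono_tags, lifting) Sk_def case_prodD mem_Collect_eq sk_def)

lemma sk_of_skew:
 assumes "!!a b. S a b = - S b a"
 shows "S = sk (%(a, b). S a b)"
proof (intro ext)
 fix a b
 show "S a b = sk (%(a, b). S a b) a b"
  using assms[of a b] assms[of a a] injD[OF inj_tau, of a b] unfolding sk_def
  by (cases "tau a" "tau b" rule: linorder_cases) auto
qed

lemma sk_lin: "sk (%s. SUM t:T. c t * A t s) a b = (SUM t:T. c t * sk (A t) a b)"
 by (auto simp: sk_def sum_negf[symmetric] intro!: sum.cong)

definition rmul :: "('a * 'd::finite => real) => ('d => 'd => real) => 'a * 'd => real" where
 "rmul t B = (%(u, a). SU b. t (u, b) * B b a)"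

text \<open>With the unknowns in the set \<open>J0\<close> from \<open>indep_complete\<close> put to
  0, the system is still solvable for every right-hand side; so the remaining \<open>d\<close>
  vertices form a nonsingular block.\<close>

lemma indep_block:
 fixes t :: "'a * 'd::finite => real"
 assumes finU: "finite U" and ind: "indep UNIV U (%a u. t (u, a))"
 shows "EX h :: 'd => 'a. inj h & range h <= U & indep UNIV UNIV (%a b. t (h b, a))"
proof -
 obtain J0 where J0: "J0 <= U" "CARD('d) + card J0 = card U"
  "ALL y z. EX x. (ALL a:UNIV. (SUM u:U. t (u, a) * x u) = y a) & (ALL u:J0. x u = z u)"
  using indep_complete[OF ind finite finU] by blast
 have "card (U - J0) = CARD('d)" using J0(1,2) finU card_Diff_subset[of J0 U] finite_subset[of J0 U] by auto
 then obtain h :: "'d => 'a" where h: "bij_betw h UNIV (U - J0)"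
  using finU finite_same_card_bij[of "UNIV :: 'd set" "U - J0"] by auto
 have "indep UNIV UNIV (%a b. t (h b, a))"
  unfolding indep_def
 proof (intro allI impI ballI)
  fix m :: "'d => real" and c
  assume m: "ALL b:UNIV. (SU a. m a * t (h b, a)) = 0"
  obtain x where x: "!!a. (SUM u:U. t (u, a) * x u) = (kr a c)" "!!u. u : J0 ==> x u = 0"
   using J0(3)[rule_format, of "%a. if a = c then 1 else 0" "%_. 0"] by auto
  have "m c = (SU a. m a * (SUM u:U. t (u, a) * x u))" unfolding x sum_mult_delta(1)[OF finite] by simp
  also have "... = (SUM u:U. (SU a. m a * t (u, a)) * x u)"
   by (rule sum_assoc(1)[symmetric])
  also have "... = 0"
  proof (rule sum.neutral, rule ballI)
   fix u assume u: "u : U"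
   show "(SU a. m a * t (u, a)) * x u = 0"
   proof (cases "u : J0")
    case False
    then obtain b where "u = h b" using h u unfolding bij_betw_def by (metis Diff_iff imageE)
    thus ?thesis using m by simp
   qed (simp add: x)
  qed
  finally show "m c = 0" .
 qed
 thus ?thesis using h by (intro exI[of _ h]) (auto simp: bij_betw_def)
qed

lemma indep_rotate:
 fixes f :: "'j => 'd::finite => real"
 assumes "indep UNIV T (%a u. f u a)" "orthon UNIV W"
 shows "indep UNIV T (%a u. SU b. f u b * W b a)"
 unfolding indep_def
proof (intro allI impI ballI)
 fix m c assume m: "ALL u:T. (SU a. m a * (SU b. f u b * W b a)) = 0"
 define y where "y b = (SU a. m a * W b a)" for b
 have "y b = 0" for b
 proof (rule indepD[OF assms(1)])
  fix u assume "u : T"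
  have "(SU b. y b * f u b) = (SU a. m a * (SU b. f u b * W b a))"
   unfolding y_def by (subst sum_assoc) (simp add: mult_ac)
  thus "(SU b. y b * f u b) = 0" using m \<open>u : T\<close> by simp
 qed simp
 hence "0 = (SU b. y b * W b c)" by simp
 also have "... = (SU a. m a * (SU b. W b a * W b c))"
  unfolding y_def by (rule sum_assoc(1))
 also have "... = (SU a. m a * (kr a c))" using orthon_columns[OF assms(2)] by simp
 also have "... = m c" unfolding sum_mult_delta(1)[OF finite] by simp
 finally show "m c = 0" by simp
qed

text \<open>Gram--Schmidt, with the last basis vector prescribed.\<close>

lemma orthonormal_flag:
 fixes r :: "'d::finite => 'd => real"
 assumes a0: "!!b :: 'd. tau b <= tau a0" and w0: "(SU p. w0 p * w0 p) = 1"
  and r0: "!!c :: 'd. tau c < tau a0 ==> (SU p. r c p * w0 p) = 0"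
 shows "EX w. orthon UNIV w & w a0 = w0 & (ALL c b. tau c < tau b --> (SU p. r c p * w b p) = 0)"
proof -
 define P where "P S w <-> w a0 = w0 &
  (ALL i:insert a0 S. ALL j:insert a0 S. (SU p. w i p * w j p) = (kr i j)) &
  (ALL b:insert a0 S. ALL c. tau c < tau b --> (SU p. r c p * w b p) = 0)" for S and w :: "'d => 'd => real"
 have "EX w. P S w" if "finite S" for S :: "'d set"
  using that
 proof (induction S rule: finite_ranking_induct[where f = "%x. - int (tau x)"])
  case empty
  show ?case by (rule exI[of _ "%_. w0"]) (simp add: P_def w0 r0)
 next
  case (insert x S)
  then obtain w where w: "P S w" by blast
  show ?case
  proof (cases "x : insert a0 S")
   case True
   hence "insert a0 (insert x S) = insert a0 S" by auto
   thus ?thesis using w unfolding P_def by auto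
  next
   case False
   \<comment> \<open>Directions are inserted by decreasing \<open>tau\<close>. The vector of
     \<open>x\<close> must be orthogonal to those already built and to the rows before it; neither
     index set contains \<open>x\<close>, so there are fewer than \<open>d\<close>
     conditions.\<close>
   let ?B = "insert a0 S" and ?C = "{c :: 'd. tau c < tau x}"
   have d: "?B \<inter> ?C = {}" using insert(2) a0[of x] by force
   have "card ?B + card ?C = card (?B Un ?C)" by (rule card_Un_disjoint[symmetric]) (use insert(1) d in auto)
   also have "... < card (UNIV :: 'd set)" by (rule psubset_card_mono) (use False in auto)
   finally have "card (?B <+> ?C) < card (UNIV :: 'd set)" by (simp add: card_Plus)
   then obtain y where y: "EX p. y p ~= 0" "!!b. b : ?B ==> (SU p. y p * w b p) = 0"
    "!!c. tau c < tau x ==> (SU p. y p * r c p) = 0"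
   proof -
    assume *: "!!y. EX p. y p ~= 0 ==> (!!b. b : ?B ==> (SU p. y p * w b p) = 0) ==>
     (!!c. tau c < tau x ==> (SU p. y p * r c p) = 0) ==> thesis"
    obtain y where y: "EX p:UNIV. y p ~= 0"
     "ALL k:?B <+> ?C. (SU p. y p * (case k of Inl b => w b | Inr c => r c) p) = 0"
     using underdetermined[of "?B <+> ?C" "UNIV :: 'd set" "%k. case k of Inl b => w b | Inr c => r c"]
      \<open>card (?B <+> ?C) < _\<close> insert(1) by auto
    show thesis
     by (rule *[of y]) (use y(1) y(2)[rule_format, of "Inl _"] y(2)[rule_format, of "Inr _"] in auto)
   qed
   define n where "n = (SU p. y p * y p)"
   have n: "n > 0"
   proof -
    obtain p where "y p ~= 0" using y(1) by blast
    hence "n ~= 0" using sum_squares_zero[of UNIV y p] unfolding n_def by auto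
    moreover have "n >= 0" unfolding n_def by (simp add: sum_nonneg)
    ultimately show ?thesis by simp
   qed
   define w' where "w' = w(x := %p. y p / sqrt n)"
   have yy: "(SU p. (y p / sqrt n) * (y p / sqrt n)) = 1"
    using n by (simp add: sum_divide_distrib[symmetric] n_def[symmetric])
   have yo: "(SU p. (y p / sqrt n) * w b p) = 0" "(SU p. w b p * (y p / sqrt n)) = 0" if "b : ?B" for b
    using y(2)[OF that] by (simp_all add: sum_divide_distrib[symmetric] mult.commute[of "w b _"])
   have yr: "(SU p. r c p * (y p / sqrt n)) = 0" if "tau c < tau x" for c
    using y(3)[OF that] by (simp add: sum_divide_distrib[symmetric] mult.commute[of "r c _"])
   have xa: "x ~= a0" "!!b. b : ?B ==> b ~= x" using False by auto
   have ins: "insert a0 (insert x S) = insert x ?B" by auto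
   have "P (insert x S) w'"
    using w xa yy yo yr by (auto simp: w'_def P_def ins)
   thus ?thesis by blast
  qed
 qed
 from this[of UNIV] obtain w where "P UNIV w" by auto
 thus ?thesis unfolding P_def orthon_def by (intro exI[of _ w]) auto
qed

text \<open>The second claim spends the prescribed last vector on a common annihilator
  \<open>c\<close> of the points in \<open>U\<close>, so that a whole coordinate vanishes after the
  rotation.\<close>

lemma triangular_rotation:
 fixes t :: "'a * 'd::finite => real" and h :: "'d => 'a"
 shows "EX W. orthon UNIV W & (ALL c b. tau c < tau b --> rmul t W (h c, b) = 0)"
  and "EX c. (EX a. c a ~= 0) & (ALL u:U. (SU a. t (u, a) * c a) = 0) ==> range h <= U ==>
   EX W a0. orthon UNIV W & (ALL c b. tau c < tau b --> rmul t W (h c, b) = 0) & (ALL u:U. rmul t W (u, a0) = 0)"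
proof -
 let ?A = "Max (range (tau :: 'd => nat))"
 obtain a0 :: 'd where a0: "tau b <= tau a0" for b :: 'd
 proof -
  have "?A : range (tau :: 'd => nat)" by (rule Max_in) auto
  then obtain a0 :: 'd where "tau a0 = ?A" by (metis imageE)
  moreover have "tau b <= ?A" for b :: 'd by (rule Max_ge) auto
  ultimately show ?thesis using that by metis
 qed
 have unit: "EX w0 k. (SU p. w0 p * w0 p) = 1 & (ALL p. w0 p = k * c p)" if c: "EX a. c a ~= 0" for c :: "'d => real"
 proof -
  define n where "n = (SU p. c p * c p)"
  obtain p where "c p ~= 0" using c by blast
  hence "n ~= 0" using sum_squares_zero[of UNIV c p] unfolding n_def by auto
  moreover have "n >= 0" unfolding n_def by (simp add: sum_nonneg)
  ultimately have n: "n > 0" by simp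
  have "(SU p. (1 / sqrt n * c p) * (1 / sqrt n * c p)) = 1"
   using n by (simp add: sum_divide_distrib[symmetric] n_def[symmetric])
  thus ?thesis by (intro exI[of _ "%p. 1 / sqrt n * c p"] exI[of _ "1 / sqrt n"]) simp
 qed
 have main: "EX W. orthon UNIV W & (ALL c b. tau c < tau b --> rmul t W (h c, b) = 0) & (ALL p. W p a0 = w0 p)"
  if w0: "(SU p. w0 p * w0 p) = 1" and r0: "!!c :: 'd. tau c < tau a0 ==> (SU p. t (h c, p) * w0 p) = 0" for w0
 proof -
  obtain w where w: "orthon UNIV w" "w a0 = w0" "!!c b. tau c < tau b ==> (SU p. t (h c, p) * w b p) = 0"
   using orthonormal_flag[where r = "%c p. t (h c, p)", OF a0 w0] r0 by auto
  have "orthon UNIV (%b a. w a b)"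
   unfolding orthon_def by (intro ballI orthon_columns[OF w(1)]) auto
  thus ?thesis using w by (intro exI[of _ "%b a. w a b"]) (simp add: rmul_def)
 qed
 have "card {c :: 'd. tau c < tau a0} < card (UNIV :: 'd set)" by (rule psubset_card_mono) auto
 then obtain y :: "'d => real" where y: "EX p. y p ~= 0" "!!c. tau c < tau a0 ==> (SU p. y p * t (h c, p)) = 0"
  using underdetermined[of "{c :: 'd. tau c < tau a0}" "UNIV :: 'd set" "%c p. t (h c, p)"] by auto
 obtain w0 k where w0: "(SU p. w0 p * w0 p) = 1" "!!p. w0 p = k * y p" using unit[OF y(1)] by blast
 have "(SU p. t (h c, p) * w0 p) = 0" if "tau c < tau a0" for c
 proof -
  have "(SU p. t (h c, p) * w0 p) = k * (SU p. y p * t (h c, p))"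
   by (simp add: w0(2) sum_left mult_ac)
  thus ?thesis using y(2)[OF that] by simp
 qed
 from main[OF w0(1) this]
 show "EX W. orthon UNIV W & (ALL c b. tau c < tau b --> rmul t W (h c, b) = 0)" by blast
 assume "EX c. (EX a. c a ~= 0) & (ALL u:U. (SU a. t (u, a) * c a) = 0)" and h: "range h <= U"
 then obtain c where c: "EX a. c a ~= 0" "!!u. u : U ==> (SU a. t (u, a) * c a) = 0" by blast
 obtain w1 k1 where w1: "(SU p. w1 p * w1 p) = 1" "!!p. w1 p = k1 * c p" using unit[OF c(1)] by blast
 have z: "(SU p. t (u, p) * w1 p) = 0" if "u : U" for u
 proof -
  have "(SU p. t (u, p) * w1 p) = k1 * (SU a. t (u, a) * c a)"
   by (simp add: w1(2) sum_left mult_ac)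
  thus ?thesis using c(2)[OF that] by simp
 qed
 have "EX W. orthon UNIV W & (ALL c b. tau c < tau b --> rmul t W (h c, b) = 0) & (ALL p. W p a0 = w1 p)"
  by (rule main[OF w1(1)]) (use z h in blast)
 then obtain W where "orthon UNIV W" "ALL c b. tau c < tau b --> rmul t W (h c, b) = 0" "ALL p. W p a0 = w1 p" by blast
 thus "EX W a0. orthon UNIV W & (ALL c b. tau c < tau b --> rmul t W (h c, b) = 0) & (ALL u:U. rmul t W (u, a0) = 0)"
  using z by (intro exI[of _ W] exI[of _ a0]) (simp add: rmul_def)
qed

definition tri :: "('d::finite => 'a) => ('a * 'd => real) => bool" where
 "tri h t <-> (ALL c b. tau c < tau b --> t (h c, b) = 0)"

text \<open>The entries that the triangular form leaves free. Restricting to them removes exactly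
  the infinitesimal rotations, as \<open>tri_flex\<close> and \<open>tri_rows\<close> show.\<close>

definition JT :: "'a set => ('d::finite => 'a) => ('a * 'd) set" where
 "JT U h = {j : U \<times> UNIV. ALL c. fst j = h c --> tau (snd j) <= tau c}"

lemma tri_outside: "tri h t ==> j : U \<times> UNIV ==> j ~: JT U h ==> t j = 0"
 unfolding tri_def JT_def by (cases j) force

text \<open>A zero on the diagonal would confine the rows up to \<open>a\<close> to the columns
  before \<open>a\<close>, which are too few for independent rows.\<close>

lemma tri_diag:
 fixes t :: "'a * 'd::finite => real"
 assumes tr: "tri h t" and ind: "indep UNIV UNIV (%a b. t (h b, a))"
 shows "t (h a, a) ~= 0"
proof
 assume z: "t (h a, a) = 0"
 let ?C = "{c :: 'd. tau c <= tau a}" and ?B = "{b :: 'd. tau b < tau a}"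
 have "?B \<subset> ?C" by auto
 hence "card ?B < card ?C" by (intro psubset_card_mono) auto
 then obtain x where x: "EX c:?C. x c ~= 0" "!!b. b : ?B ==> (SUM c:?C. x c * t (h c, b)) = 0"
  using underdetermined[of ?B ?C "%b c. t (h c, b)"] by auto
 define y where "y c = (if tau c <= tau a then x c else 0)" for c
 have y: "(SU c. t (h c, b) * y c) = 0" for b
 proof -
  have "(SU c. t (h c, b) * y c) = (SUM c:?C. x c * t (h c, b))"
   by (rule sum.mono_neutral_cong_right) (auto simp: y_def)
  also have "... = 0"
  proof (cases "tau b < tau a")
   case False
   have "t (h c, b) = 0" if "tau c <= tau a" for c
   using tr that False injD[OF inj_tau, of b a] injD[OF inj_tau, of c a] z by (fastforce simp: tri_def)
   thus ?thesis by simp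
  qed (use x(2) in simp)
  finally show ?thesis .
 qed
 obtain W where W: "!!b b'. (SU j. t (h b, j) * W j b') = (kr b b')"
  using square_inverse[of UNIV UNIV "%b a. t (h b, a)"] ind by auto
 have "y b = 0" for b
 proof -
  have "y b = (SU c. (SU j. t (h c, j) * W j b) * y c)"
   by (simp add: W if_mult cong: if_cong)
  also have "... = (SU j. W j b * (SU c. t (h c, j) * y c))"
   by (rule sum_assoc(3))
  finally show ?thesis using y by simp
 qed
 thus False using x(1) unfolding y_def by (metis mem_Collect_eq)
qed

text \<open>Forward substitution along \<open>tau\<close>: in row \<open>h a\<close> only the
  diagonal term with \<open>sk A a b\<close> is left.\<close>

lemma tri_skew_zero:
 fixes t :: "'a * 'd::finite => real"
 assumes tr: "tri h t" and diag: "!!a. t (h a, a) ~= 0"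
  and z: "!!c b. tau c < tau b ==> (SU a. t (h c, a) * sk A a b) = 0"
 shows "sk A a b = 0"
proof -
 have up: "sk A a b = 0" if "tau a < tau b" for a b
  using that
 proof (induction "tau a" arbitrary: a rule: less_induct)
  case less
  have "(SU a'. t (h a, a') * sk A a' b) = (SU a'. if a' = a then t (h a, a) * sk A a b else 0)"
  proof (rule sum.cong[OF refl])
   fix a'
   show "t (h a, a') * sk A a' b = (if a' = a then t (h a, a) * sk A a b else 0)"
   using less.hyps[of a'] less.prems injD[OF inj_tau, of a' a] tr by (fastforce simp: tri_def)
  qed
  thus ?case using z[OF less.prems] diag[of a] by simp
 qed
 show ?thesis
 proof (cases "tau a" "tau b" rule: linorder_cases)
  case greater
  thus ?thesis using up[of b a] sk_skew[of A a b] by simp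
 qed (use up in "auto simp: sk_def")
qed

text \<open>Skew matrices have as many parameters as there are entries above the diagonal, so the
  uniqueness in \<open>tri_skew_zero\<close> gives solvability.\<close>

lemma tri_solve:
 fixes t :: "'a * 'd::finite => real"
 assumes tr: "tri h t" and diag: "!!a. t (h a, a) ~= 0"
 shows "EX A. ALL c b. tau c < tau b --> (SU a. t (h c, a) * sk A a b) = s c b"
proof -
 let ?I = "{(c :: 'd, b :: 'd). tau c < tau b}"
 define e where "e S = (%S'. if S' = S then 1 else 0 :: real)" for S :: "'d * 'd"
 define m where "m i S = (SU a. t (h (fst i), a) * sk (e S) a (snd i))" for i S
 have sk_e: "sk (%S'. SUM S:Sk. x S * e S S') a b = (SUM S:Sk. x S * sk (e S) a b)" for x a b
  by (rule sk_lin)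
 have m: "(SUM S:Sk. m i S * x S) = (SU a. t (h (fst i), a) * sk (%S'. SUM S:Sk. x S * e S S') a (snd i))" for i x
  unfolding sk_e m_def by (subst sum_assoc) (simp add: mult_ac)
 have "?I = prod.swap ` Sk" by (auto simp: Sk_def image_iff)
 hence c: "card ?I = card (Sk :: ('d * 'd) set)" using card_image[OF inj_swap[of Sk]] by simp
 have "indep Sk ?I (%S i. m i S)"
  unfolding indep_def
 proof (intro allI impI ballI)
  fix x and S :: "'d * 'd" assume x: "ALL i:?I. (SUM S:Sk. x S * m i S) = 0" and S: "S : Sk"
  let ?A = "%S'. SUM S:Sk. x S * e S S'"
  have "(SU a. t (h c, a) * sk ?A a b) = 0" if "tau c < tau b" for c b
   using x[rule_format, of "(c, b)"] m[of "(c, b)" x] that by (simp add: mult.commute)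
  from tri_skew_zero[OF tr diag this] have "sk ?A a b = 0" for a b .
  from sk_zero[OF this S] have "?A S = 0" .
  thus "x S = 0" using S by (simp add: e_def sum_mult_delta)
 qed
 from square_solve[OF this _ _ c, of "%(c, b). s c b"]
 obtain x where x: "ALL i:?I. (SUM S:Sk. m i S * x S) = (case i of (c, b) => s c b)"
  using finite_subset[OF subset_UNIV, of ?I] by auto
 show ?thesis
  by (rule exI[of _ "%S'. SUM S:Sk. x S * e S S'"]) (use x m in auto)
qed

section \<open>Squared lengths as quadratic forms on a kernel\<close>

text \<open>Coordinates on a space of functions on \<open>V\<close> that vanish at
  \<open>u0\<close>: the values on \<open>U\<close> are free, and \<open>\<kappa> u\<close> is the
  dual basis. Keeping \<open>u0\<close> at the origin removes translations.\<close>

locale quadrics =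
 fixes V U :: "'a set" and \<kappa> :: "'a => 'a => real" and u0 :: 'a and dim :: "'d::finite itself"
 assumes finV: "finite V" and UV: "U <= V" and u0: "u0 : V"
  and \<kappa>U: "!!u w. u : U ==> w : U ==> \<kappa> u w = (kr u w)"
  and \<kappa>0: "!!u. u : U ==> \<kappa> u u0 = 0"
begin

definition kd :: "'a * 'a => 'a => real" where "kd e u = \<kappa> u (fst e) - \<kappa> u (snd e)"

definition lf :: "'a * 'a => ('a * 'd => real) => 'd => real" where
 "lf e t a = (SUM u:U. kd e u * t (u, a))"

definition ext :: "('a * 'd => real) => 'a * 'd => real" where
 "ext t = (%(w, a). SUM u:U. t (u, a) * \<kappa> u w)"

definition g :: "('a * 'd => real) => 'a * 'a => real" where "g t e = (SU a. (lf e t a)^2)"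

definition gb :: "('a * 'd => real) => ('a * 'd => real) => 'a * 'a => real" where
 "gb t s e = (SU a. lf e t a * lf e s a)"

lemma finU: "finite U" using UV finV finite_subset by blast

lemma ext_U: "u : U ==> ext t (u, a) = t (u, a)"
 unfolding ext_def using finU by (simp add: \<kappa>U mult_if cong: if_cong)

lemma ext_u0: "ext t (u0, a) = 0"
 unfolding ext_def by (simp add: \<kappa>0)

lemma ext_diff: "ext t (fst e, a) - ext t (snd e, a) = lf e t a"
 by (simp add: ext_def lf_def kd_def sum_subtractf[symmetric] algebra_simps)

lemma dd_ext: "dd (ext t) e = g t e" by (simp add: dd_def g_def ext_diff)

lemma bb_ext: "bb (ext t) (ext s) e = gb t s e" by (simp add: bb_def gb_def ext_diff)

lemma g_nonneg: "g t e >= 0" by (simp add: g_def sum_nonneg)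

lemma gb_self: "gb t t e = g t e" by (simp add: gb_def g_def power2_eq_square)

lemma gb_sym: "gb t s e = gb s t e" by (simp add: gb_def mult.commute)

lemma lf_add: "lf e (%j. c * t j + c' * s j) a = c * lf e t a + c' * lf e s a"
 by (simp add: lf_def sum.distrib sum_left algebra_simps)

lemma lf_sum: "lf e (%j. SUM k:T. c k * t k j) a = (SUM k:T. c k * lf e (t k) a)"
 unfolding lf_def by (rule sum_assoc(2))

lemma gb_add: "gb t (%j. c * s j + c' * s' j) e = c * gb t s e + c' * gb t s' e"
 by (simp add: gb_def lf_add sum.distrib sum_left algebra_simps)

lemma gb_sum: "gb t (%j. SUM k:T. c k * s k j) e = (SUM k:T. c k * gb t (s k) e)"
 unfolding gb_def lf_sum by (rule sum_assoc(2))

lemma gb_cong: "(!!u a. u : U ==> s (u, a) = s' (u, a)) ==> gb t s e = gb t s' e"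
 unfolding gb_def lf_def by simp

lemma g_cong: "(!!u a. u : U ==> s (u, a) = s' (u, a)) ==> g s e = g s' e"
 unfolding g_def lf_def by simp

lemma lf_rmul: "lf e (rmul t B) a = (SU b. lf e t b * B b a)"
 unfolding lf_def rmul_def case_prod_conv by (rule sum_assoc(1)[symmetric])

lemma gb_rmul_orth:
 assumes "orthon UNIV W"
 shows "gb (rmul t W) (rmul s W) e = gb t s e"
proof -
 have "gb (rmul t W) (rmul s W) e = (SU a. SU b. SU c. lf e t b * lf e s c * (W b a * W c a))"
  unfolding gb_def lf_rmul sum_product by (intro sum.cong refl) (simp add: mult_ac)
 also have "... = (SU b. SU a. SU c. lf e t b * lf e s c * (W b a * W c a))" by (rule sum.swap)
 also have "... = (SU b. SU c. lf e t b * lf e s c * (SU a. W b a * W c a))"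
 proof (rule sum.cong[OF refl])
  fix b
  show "(SU a. SU c. lf e t b * lf e s c * (W b a * W c a)) =
    (SU c. lf e t b * lf e s c * (SU a. W b a * W c a))"
   by (subst sum.swap) (simp add: sum_left)
 qed
 also have "... = gb t s e"
  using assms unfolding orthon_def gb_def by (simp add: mult_if cong: if_cong)
 finally show ?thesis .
qed

lemma g_rmul_orth: "orthon UNIV W ==> g (rmul t W) e = g t e"
 using gb_rmul_orth[of W t t e] by (simp add: gb_self)

lemma gb_skew:
 assumes "!!a b. B a b = - B b a"
 shows "gb t (rmul t B) e = 0"
proof -
 define q where "q = (SU a. SU b. lf e t a * (lf e t b * B b a))"
 have "q = (SU b. SU a. lf e t a * (lf e t b * B b a))" unfolding q_def by (rule sum.swap)
 also have "... = - q"
  unfolding q_def sum_negf[symmetric] by (intro sum.cong refl, subst assms) (simp add: mult_ac)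
 finally show ?thesis unfolding gb_def lf_rmul sum_left by (simp add: q_def)
qed

text \<open>The pairs with \<open>u0\<close> and then all other pairs show that the matrix of
  products \<open>ip u w\<close> is antisymmetric. Inverting a nonsingular block of \<open>t\<close>
  turns this into a skew matrix \<open>S\<close> with \<open>s = t S\<close>.\<close>

lemma trivial_flex:
 fixes t s :: "'a * 'd => real"
 assumes ind: "indep UNIV U (%a u. t (u, a))" and flex: "!!e. e : V \<times> V ==> gb t s e = 0"
 shows "EX A. ALL u:U. ALL a. s (u, a) = rmul t (sk A) (u, a)"
proof -
 obtain h :: "'d => 'a" where h: "inj h" "range h <= U" "indep UNIV UNIV (%a b. t (h b, a))"
  using indep_block[OF finU ind] by blast
 have hU: "h b : U" for b using h(2) by blast
 obtain W where W: "!!b b'. (SU a. t (h b, a) * W a b') = (kr b b')"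
  "!!a a'. (SU b. W a b * t (h b, a')) = (kr a a')"
  using square_inverse[of UNIV UNIV "%b a. t (h b, a)"] h(3) by auto
 define ip where "ip u w = (SU b. t (u, b) * s (w, b))" for u w
 have d0: "ip u u = 0" if "u : U" for u
 using ext_U[OF that] ext_u0 flex[of "(u, u0)"] that UV u0 by (auto simp: bb_ext[symmetric] bb_def ip_def)
 have anti: "ip u w = - ip w u" if "u : U" "w : U" for u w
 using ext_U that flex[of "(u, w)"] UV d0 by (fastforce simp: algebra_simps sum.distrib sum_subtractf bb_ext[symmetric] bb_def ip_def)
 define S where "S a b = (SU c. W a c * s (h c, b))" for a b
 have S1: "s (h c, b) = (SU a. t (h c, a) * S a b)" for c b
 proof -
  have "(SU a. t (h c, a) * S a b) = (SU c'. (SU a. t (h c, a) * W a c') * s (h c', b))"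
   unfolding S_def by (rule sum_assoc(1)[symmetric])
  thus ?thesis by (simp add: W if_mult cong: if_cong)
 qed
 have uniq: "y a = 0" if y: "!!c. (SU a. t (h c, a) * y a) = 0" for y a
 proof -
  have "0 = (SU c. W a c * (SU a. t (h c, a) * y a))" using y by simp
  also have "... = (SU a'. (SU c. W a c * t (h c, a')) * y a')"
   by (rule sum_assoc(1)[symmetric])
  also have "... = y a" by (simp add: W if_mult cong: if_cong)
  finally show ?thesis by simp
 qed
 have skew: "S a b = - S b a" for a b
 proof -
  have e: "(SU a. t (h c, a) * (SU b. t (h c', b) * S a b)) = ip (h c') (h c)" for c c'
  proof -
   have "(SU a. t (h c, a) * (SU b. t (h c', b) * S a b)) = (SU b. t (h c', b) * (SU a. t (h c, a) * S a b))"
    by (rule sum_assoc(2))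
   thus ?thesis by (simp add: S1[symmetric] ip_def)
  qed
  have e': "(SU a. t (h c, a) * (SU b. t (h c', b) * S b a)) = ip (h c) (h c')" for c c'
   by (simp add: S1[symmetric] ip_def)
  have "(SU b. t (h c', b) * (S a b + S b a)) = 0" for c' a
  proof (rule uniq)
   fix c
   have "(SU a. t (h c, a) * (SU b. t (h c', b) * (S a b + S b a))) =
     (SU a. t (h c, a) * (SU b. t (h c', b) * S a b)) + (SU a. t (h c, a) * (SU b. t (h c', b) * S b a))"
    by (simp add: distrib_left sum.distrib)
   thus "(SU a. t (h c, a) * (SU b. t (h c', b) * (S a b + S b a))) = 0"
    unfolding e e' using anti[OF hU hU, of c c'] by simp
  qed
  hence "S a b + S b a = 0" by (rule uniq)
  thus ?thesis by simp
 qed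
 have all: "s (u, b) = (SU a. t (u, a) * S a b)" if u: "u : U" for u b
 proof -
  have "s (u, b) - (SU a. t (u, a) * S a b) = 0"
  proof (rule uniq)
   fix c
   have "(SU b. t (h c, b) * (SU a. t (u, a) * S a b)) = (SU a. t (u, a) * (SU b. t (h c, b) * S a b))"
    by (rule sum_assoc(2))
   also have "(%a. SU b. t (h c, b) * S a b) = (%a. - s (h c, a))"
    unfolding S1 sum_negf[symmetric] by (intro ext sum.cong refl) (use skew in "metis mult_minus_right")
   finally have "(SU b. t (h c, b) * (SU a. t (u, a) * S a b)) = - ip u (h c)"
    by (simp add: ip_def sum_negf)
   moreover have "(SU b. t (h c, b) * s (u, b)) = ip (h c) u" by (simp add: ip_def)
   ultimately show "(SU b. t (h c, b) * (s (u, b) - (SU a. t (u, a) * S a b))) = 0"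
    using anti[OF hU u, of c] by (simp add: right_diff_distrib sum_subtractf)
  qed
  thus ?thesis by simp
 qed
 have "S = sk (%(a, b). S a b)" by (rule sk_of_skew[of S, OF skew])
 hence sS: "sk (%(a, b). S a b) a b = S a b" for a b by metis
 show ?thesis
  by (rule exI[of _ "%(a, b). S a b"]) (simp add: all rmul_def sS)
qed

text \<open>The motion is an infinitesimal rotation by \<open>trivial_flex\<close>, and one that
  respects the triangular form is 0.\<close>

lemma tri_flex:
 assumes tr: "tri h t" and h: "range h <= U" and ind: "indep UNIV UNIV (%a b. t (h b, a))"
  and v: "!!j. j : U \<times> UNIV ==> j ~: JT U h ==> v j = 0" and inj: "inj h"
  and flex: "!!e. e : V \<times> V ==> gb t v e = 0" and j: "j : U \<times> UNIV"
 shows "v j = 0"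
proof -
 have indU: "indep UNIV U (%a u. t (u, a))"
  using ind h unfolding indep_def by (metis UNIV_I image_subset_iff)
 obtain A where A: "!!u a. u : U ==> v (u, a) = rmul t (sk A) (u, a)"
  using trivial_flex[OF indU flex] by blast
 have "(SU a. t (h c, a) * sk A a b) = 0" if "tau c < tau b" for c b
 proof -
  have "(h c, b) ~: JT U h" using that unfolding JT_def by auto
  hence "v (h c, b) = 0" using v h by blast
  thus ?thesis using A[of "h c" b] h by (auto simp: rmul_def)
 qed
 from tri_skew_zero[OF tr tri_diag[OF tr ind] this]
 have "sk A a b = 0" for a b by blast
 thus ?thesis using A j by (cases j) (simp add: rmul_def)
qed

text \<open>Subtracting an infinitesimal rotation, which changes no length to first order, brings
  any direction \<open>s\<close> into the triangular form; so relations need to be checked only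
  there.\<close>

lemma tri_rows:
 assumes tr: "tri h t" and h: "range h <= U" "inj h" and ind: "indep UNIV UNIV (%a b. t (h b, a))"
  and v: "!!v. (!!j. j : U \<times> UNIV ==> j ~: JT U h ==> v j = 0) ==> (SUM i:I. m i * gb t v i) = 0"
 shows "(SUM i:I. m i * gb t s i) = 0"
proof -
 obtain A where A: "!!c b. tau c < tau b ==> (SU a. t (h c, a) * sk A a b) = s (h c, b)"
  using tri_solve[OF tr tri_diag[OF tr ind], of "%c b. s (h c, b)"] by blast
 define v where "v = (%j. 1 * s j + (-1) * rmul t (sk A) j)"
 have "v j = 0" if j: "j : U \<times> UNIV" "j ~: JT U h" for j
 using j A by (auto simp: not_le v_def rmul_def JT_def)
 from v[of v, OF this] have "(SUM i:I. m i * gb t v i) = 0" by blast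
 moreover have "gb t v i = gb t s i" for i
 proof -
  have "gb t (rmul t (sk A)) i = 0" by (rule gb_skew) (rule sk_skew)
  thus ?thesis unfolding v_def gb_add by simp
 qed
 ultimately show ?thesis by simp
qed

end

lemma derivation_lin:
 assumes "!!k. k : K ==> derivation (D k)"
 shows "derivation (%x. SUM k:K. c k * D k x)"
 using assms
 by (induction K rule: infinite_finite_induct)
  (auto simp: derivation_def distrib_left sum.distrib sum_left sum_right algebra_simps)

lemma indep_of_solvable:
 assumes "finite I" and s: "!!w. EX x. ALL i:I. (SUM j:J. a i j * x j) = (w i :: real)"
 shows "indep I J a"
 unfolding indep_def
proof (intro allI impI)
 fix m assume m: "ALL j:J. (SUM i:I. m i * a i j) = 0"
 obtain x where x: "!!i. i : I ==> (SUM j:J. a i j * x j) = m i" using s[of m] by blast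
 have "(SUM i:I. m i * m i) = (SUM i:I. m i * (SUM j:J. a i j * x j))" by (rule sum.cong) (auto simp: x)
 also have "... = (SUM j:J. (SUM i:I. m i * a i j) * x j)"
  by (rule sum_assoc(1)[symmetric])
 also have "... = 0" using m by simp
 finally show "ALL i:I. m i = 0" using sum_squares_zero[OF assms(1), of m] by blast
qed

lemma kernel_line:
 fixes a :: "'i => 'j => real"
 assumes "indep I J a" "finite I" "finite J" and card: "card J = Suc (card I)"
  and x: "!!i. i : I ==> (SUM j:J. a i j * x j) = 0" "EX j:J. x j ~= 0"
  and y: "!!i. i : I ==> (SUM j:J. a i j * y j) = 0"
 shows "EX c. ALL j:J. y j = c * x j"
proof -
 obtain J0 where J0: "J0 <= J" "card I + card J0 = card J"
  "!!x. ALL i:I. (SUM j:J. a i j * x j) = 0 ==> ALL j:J0. x j = 0 ==> ALL j:J. x j = 0"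
  using indep_complete[OF assms(1-3)] by blast
 hence "card J0 = 1" using card by simp
 then obtain j0 where j0: "J0 = {j0}" by (auto simp: card_1_singleton_iff)
 have x0: "x j0 ~= 0" using J0(3)[of x] x j0 by auto
 define c where "c = y j0 / x j0"
 have "(SUM j:J. a i j * (y j - c * x j)) = (SUM j:J. a i j * y j) - c * (SUM j:J. a i j * x j)" for i
  by (simp add: right_diff_distrib sum_subtractf sum_left mult_ac)
 hence "ALL j:J. y j - c * x j = 0"
  using x0 by (intro J0(3)) (auto simp: x(1) y j0 c_def)
 thus ?thesis by (intro exI[of _ c]) simp
qed

definition un :: "'j => 'j => real" where "un j k = (kr k j)"

context quadrics
begin

definition supp :: "('a * 'd) set => ('a * 'd => real) => bool" where
 "supp Z v <-> (ALL j:U \<times> UNIV. j ~: Z --> v j = 0)"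

lemma gb_cong2: "(!!j. j : U \<times> UNIV ==> s j = s' j) ==> gb t s e = gb t s' e"
 by (rule gb_cong) simp

lemma gb_unit:
 assumes "Z <= U \<times> UNIV" "supp Z v"
 shows "gb t v e = (SUM j:Z. v j * gb t (un j) e)"
proof -
 have fin: "finite Z" using assms(1) finU by (meson finite_SigmaI finite finite_subset)
 have "gb t v e = gb t (%k. SUM j:Z. v j * un j k) e"
 proof (rule gb_cong2)
  fix k assume "k : U \<times> (UNIV :: 'd set)"
  thus "v k = (SUM j:Z. v j * un j k)"
   unfolding un_def sum_mult_delta(3)[OF fin] using assms(2) unfolding supp_def by auto
 qed
 thus ?thesis unfolding gb_sum .
qed

lemma gb_scale: "gb t (%j. c * s j) e = c * gb t s e"
 using gb_add[of t c s 0 s e] by simp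

lemma g_scale: "g (%j. c * t j) e = c^2 * g t e"
proof -
 have "lf e (%j. c * t j) a = c * lf e t a" for a using lf_add[of e c t 0 t a] by simp
 thus ?thesis by (simp add: g_def power_mult_distrib sum_left)
qed

lemma g_tendsto:
 assumes "!!j. j : U \<times> UNIV ==> ((%n. t n j) \<longlongrightarrow> l j) F"
 shows "((%n. g (t n) e) \<longlongrightarrow> g l e) F"
 unfolding g_def lf_def by (intro tendsto_intros assms) auto

lemma lf_polyfun:
 assumes "\<rat> <= F" "!!u. u : U ==> kd e u : F" "!!u. u : U ==> (%x. t x (u, a)) : polyfun F K"
 shows "(%x. lf e (t x) a) : polyfun F K"
 unfolding lf_def by (intro polyfun_sum polyfun_mult polyfun_const assms)

lemma derivation_gb:
 assumes d: "derivation d" and k: "!!u. u : U ==> d (kd e u) = 0"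
 shows "d (g t e) = 2 * gb t (%j. d (t j)) e"
using k by (auto simp: lf_def derivation_sum[OF d] derivation_mult[OF d] g_def gb_def derivation_square[OF d] sum_left)

end

section \<open>The fold of the length map\<close>

text \<open>In the application \<open>x1\<close> is the generic framework with \<open>u0\<close>
  moved to the origin. \<open>K1\<close> and \<open>R1\<close> are independence and infinitesimal
  rigidity of the pairs in \<open>I\<close> within the kernel; \<open>cardU\<close> says that the
  kernel exceeds the affine functions.\<close>

locale folding = quadrics V U \<kappa> u0 dim
 for V U :: "'a set" and \<kappa> u0 and dim :: "'d::finite itself" +
 fixes I :: "('a * 'a) set" and x1 :: "'a * 'd => real"
 assumes IV: "I <= V \<times> V"
  and K1: "!!\<mu> i. (!!s. (SUM i:I. \<mu> i * gb x1 s i) = 0) ==> i : I ==> \<mu> i = 0"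
  and R1: "!!v e. (!!i. i : I ==> gb x1 v i = 0) ==> e : V \<times> V ==> gb x1 v e = 0"
  and B1: "!!\<iota> :: 'd => 'a. inj \<iota> ==> range \<iota> <= U ==> indep UNIV UNIV (%a b. x1 (\<iota> b, a))"
  and cardU: "card U >= Suc CARD('d)"
  and N1: "!!u. u : U ==> EX b. x1 (u, b) ~= 0"
begin

lemma finI: "finite I" using IV finV by (meson finite_SigmaI finite_subset)

abbreviation T where "T h == JT U (h :: 'd => 'a)"

lemma T_sub: "T h <= U \<times> UNIV" by (auto simp: JT_def)

lemma finT: "finite (T h)" using T_sub finU by (meson finite_SigmaI finite finite_subset)

text \<open>In the triangular form for \<open>h\<close> the differential of the lengths becomes
  square and invertible: \<open>R1\<close> with \<open>tri_flex\<close> makes it injective,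
  \<open>K1\<close> with \<open>tri_rows\<close> makes its rows independent. In particular all
  \<open>T h\<close> have the size of \<open>I\<close>.\<close>

lemma rotated:
 assumes h: "inj h" "range h <= U"
 shows "EX x. supp (T h) x & (ALL e. g x e = g x1 e) & card I = card (T h) &
  indep (T h) I (%j i. gb x (un j) i) & indep I (T h) (%i j. gb x (un j) i)"
proof -
 obtain W where W: "orthon UNIV W" "tri h (rmul x1 W)"
  using triangular_rotation(1)[of x1 h] unfolding tri_def by blast
 define x where "x = rmul x1 W"
 have ind: "indep UNIV UNIV (%a b. x (h b, a))"
  using indep_rotate[OF B1[OF h] W(1)] by (simp add: x_def rmul_def)
 have tr: "tri h x" using W(2) unfolding x_def .
 have inv: "EX s'. ALL i. gb x1 s' i = gb x s i" for s
 proof -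
  have "rmul (rmul s (%b a. W a b)) W j = s j" for j
  proof (cases j)
   case (Pair u a)
   have "rmul (rmul s (%b a. W a b)) W (u, a) = (SU c. s (u, c) * (SU b. W b c * W b a))"
    unfolding rmul_def case_prod_conv by (rule sum_assoc(1))
   also have "... = (SU c. s (u, c) * (kr c a))"
    using orthon_columns[OF W(1)] by simp
   also have "... = s (u, a)" unfolding sum_mult_delta(1)[OF finite] by simp
   finally show ?thesis using Pair by simp
  qed
  hence "rmul (rmul s (%b a. W a b)) W = s" by blast
  thus ?thesis using gb_rmul_orth[OF W(1), of x1 "rmul s (%b a. W a b)"] by (metis x_def)
 qed
 have inv': "gb x (rmul s W) i = gb x1 s i" for s i unfolding x_def by (rule gb_rmul_orth[OF W(1)])
 have c: "indep (T h) I (%j i. gb x (un j) i)"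
  unfolding indep_def
 proof (intro allI impI)
  fix v assume v: "ALL i:I. (SUM j:T h. v j * gb x (un j) i) = 0"
  define v' where "v' j = (if j : T h then v j else 0)" for j
  have z: "gb x v' i = 0" if "i : I" for i
   using gb_unit[OF T_sub, of h v' x i] v that by (simp add: supp_def v'_def)
  obtain s' where s': "!!i. gb x1 s' i = gb x v' i" using inv by blast
  have "gb x v' e = 0" if "e : V \<times> V" for e
   using R1[of s' e] z that by (simp add: s')
  hence "v' j = 0" if "j : U \<times> UNIV" for j
   using tri_flex[OF tr h(2) ind _ h(1) _ that, of v'] by (simp add: v'_def)
  thus "ALL j:T h. v j = 0" using T_sub unfolding v'_def by (metis subsetD)
 qed
 have r: "indep I (T h) (%i j. gb x (un j) i)"
  unfolding indep_def
 proof (intro allI impI ballI)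
  fix m i assume m: "ALL j:T h. (SUM i:I. m i * gb x (un j) i) = 0" and i: "i : I"
  have sv: "(SUM i:I. m i * gb x v i) = 0" if "supp (T h) v" for v
  proof -
   have "(SUM i:I. m i * gb x v i) = (SUM j:T h. v j * (SUM i:I. m i * gb x (un j) i))"
    unfolding gb_unit[OF T_sub that] by (rule sum_assoc(2))
   thus ?thesis using m by simp
  qed
  have "(SUM i:I. m i * gb x s i) = 0" for s
   by (rule tri_rows[OF tr h(2,1) ind]) (rule sv, simp add: supp_def)
  from this[of "rmul _ W"] have "(SUM i:I. m i * gb x1 s i) = 0" for s unfolding inv' .
  thus "m i = 0" by (rule K1) (rule i)
 qed
 have "card I = card (T h)"
  using indep_card[OF c finT finI] indep_card[OF r finI finT] by simp
 thus ?thesis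
  using c r tri_outside[OF tr] g_rmul_orth[OF W(1)] unfolding supp_def x_def by (intro exI[of _ "rmul x1 W"]) simp
qed

text \<open>If all forms in \<open>I\<close> vanish at \<open>t\<close>, every coordinate function
  of \<open>t\<close> is constant along \<open>I\<close>. Combined with a coordinate of
  \<open>x1\<close> it gives a motion that \<open>R1\<close> extends to all pairs, and the pairs
  with \<open>u0\<close> show \<open>t = 0\<close> on \<open>U\<close>. Compactness of the unit
  sphere yields the constant.\<close>

lemma proper: "EX c>0. ALL t. c * (SUM j:U \<times> UNIV. (t j)^2) <= (SUM i:I. g t i)"
proof -
 define J where "J = U \<times> (UNIV :: 'd set)"
 have finJ: "finite J" using finU by (simp add: J_def)
 have pos: "EX i:I. g t i ~= 0" if "EX j:J. t j ~= 0" for t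
 proof (rule ccontr)
  assume "~ ?thesis"
  hence g0: "g t i = 0" if "i : I" for i using that by blast
  have lf0: "lf i t a = 0" if "i : I" for i a
  using g0[OF that] by (auto simp: g_def power2_eq_square intro: sum_squares_zero[OF finite _ UNIV_I])
  have "t (u, a) = 0" if u: "u : U" for u a
  proof -
   obtain b where b: "x1 (u, b) ~= 0" using N1[OF u] by blast
   \<comment> \<open>Coordinate \<open>a\<close> of \<open>t\<close> is placed in direction
     \<open>b\<close>, so that \<open>gb x1 s e\<close> becomes the product of the two differences
     along \<open>e\<close>.\<close>
   define s where "s = (%(w, c). if c = b then t (w, a) else 0 :: real)"
   have lfs: "lf e s c = (if c = b then lf e t a else 0)" for e c by (simp add: s_def lf_def)
   have gbs: "gb x1 s e = lf e x1 b * lf e t a" for e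
    unfolding gb_def lfs by (simp add: mult_if cong: if_cong)
   have "gb x1 s (u, u0) = 0" by (rule R1) (use gbs lf0 u UV u0 in auto)
   moreover have "lf (u, u0) t' a' = t' (u, a')" for t' a'
    using ext_diff[of t' "(u, u0)" a'] by (simp add: ext_U[OF u] ext_u0)
   ultimately show ?thesis using b gbs by simp
  qed
  thus False using that unfolding J_def by auto
 qed
 obtain u where u: "u : U" using cardU by fastforce
 define C where "C = {t :: 'a * 'd => real. (SUM j:J. (t j)^2) = 1}"
 have bound: "abs (v j) <= 1" if "v : C" "j : J" for v j
 proof -
  have "(v j)^2 <= (SUM j:J. (v j)^2)" by (rule member_le_sum) (use that finJ in auto)
  thus ?thesis using that by (simp add: C_def abs_square_le_1)
 qed
 have ne: "C ~= {}"
 proof -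
  define j0 :: "'a * 'd" where "j0 = (u, undefined)"
  have j0: "j0 : J" by (simp add: j0_def J_def u)
  have "(SUM j:J. (un j0 j)^2) = (SUM j:J. un j0 j * un j0 j)" by (simp add: power2_eq_square)
  also have "... = 1" unfolding un_def[of j0] using sum_mult_delta(1)[OF finJ, of "%j. if j = j0 then 1 else 0" j0] j0 by simp
  finally have "un j0 : C" by (simp add: C_def)
  thus ?thesis by blast
 qed
 have "EX l:C. ALL v:C. - (SUM i:I. g v i) <= - (SUM i:I. g l i)"
 proof (rule attains_max[where f = "%v. - (SUM i:I. g v i)" and B = 1, OF finJ ne])
  show "!!v j. v : C ==> j : J ==> abs (v j) <= 1" by (rule bound)
 next
  fix x l assume "!!n. x n : C" and lim: "!!j. j : J ==> (%n. x n j) ----> l j"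
  hence "(%n. SUM j:J. (x n j)^2) = (%_. 1)" by (auto simp: C_def)
  moreover have "(%n. SUM j:J. (x n j)^2) ----> (SUM j:J. (l j)^2)" by (intro tendsto_intros lim)
  ultimately show "l : C" unfolding C_def by (simp add: LIMSEQ_const_iff)
 next
  fix x :: "nat => 'a * 'd => real" and l assume "!!j. j : J ==> (%n. x n j) ----> l j"
  thus "(%n. - (SUM i:I. g (x n) i)) ----> - (SUM i:I. g l i)"
   by (intro tendsto_intros g_tendsto) (simp add: J_def)
 qed
 then obtain l where l: "l : C" "!!v. v : C ==> (SUM i:I. g l i) <= (SUM i:I. g v i)" by auto
 have "EX j:J. l j ~= 0"
 proof (rule ccontr)
  assume "~ ?thesis"
  hence "(SUM j:J. (l j)^2) = 0" by simp
  thus False using l(1) unfolding C_def by simp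
 qed
 then obtain i where i: "i : I" "g l i ~= 0" using pos by blast
 hence "0 < g l i" using g_nonneg[of l i] by simp
 also have "... <= (SUM i:I. g l i)" by (rule member_le_sum) (use finI i g_nonneg in auto)
 finally have c: "0 < (SUM i:I. g l i)" .
 have "(SUM i:I. g l i) * (SUM j:J. (t j)^2) <= (SUM i:I. g t i)" for t
 proof (cases "(SUM j:J. (t j)^2) = 0")
  case True
  thus ?thesis by (simp add: sum_nonneg g_nonneg)
 next
  case False
  define n where "n = (SUM j:J. (t j)^2)"
  have n: "n > 0" using False sum_nonneg[of J "%j. (t j)^2"] unfolding n_def by simp
  have "(%j. 1 / sqrt n * t j) : C"
   using n by (simp add: C_def power_divide sum_divide_distrib[symmetric] n_def[symmetric])
  from l(2)[OF this] have "(SUM i:I. g l i) <= (SUM i:I. g t i) / n"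
   using n unfolding g_scale by (simp add: power_divide sum_divide_distrib)
  thus ?thesis using n by (simp add: n_def[symmetric] field_simps)
 qed
 thus ?thesis using c unfolding J_def by blast
qed

text \<open>Everything that is fixed before the generic direction \<open>z\<close> of the ray is
  chosen.\<close>

definition F2 where
 "F2 = \<rat> Un (%(e, u). kd e u) ` ((V \<times> V) \<times> U) Un g x1 ` I"

lemma F2: "\<rat> <= F2" "countable F2" "!!e u. e : V \<times> V ==> u : U ==> kd e u : F2" "!!i. i : I ==> g x1 i : F2"
using finV finU countable_rat finI by (auto simp: countable_finite F2_def)

text \<open>In place of Sard's theorem: a derivation may prescribe arbitrary values at the generic
  \<open>z\<close>. Differentiating the equation of the ray shows that \<open>z\<close> and the
  image of the differential of the lengths at \<open>t\<close> span everything.\<close>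

lemma sard:
 assumes z: "Generic F2 I z" and t: "!!i. i : I ==> g t i = g x1 i + l * z i" and l: "l ~= 0"
 shows "EX d. derivation d & (ALL c:F2. d c = 0) &
  (ALL i:I. 2 * gb t (%j. d (t j)) i - d l * z i = l * w i)"
proof -
 obtain d where d: "derivation d" "ALL c:F2. d c = 0" "ALL i:I. d (z i) = w i"
  using Generic_derivation[OF z F2(1) finI] by blast
 have "2 * gb t (%j. d (t j)) i - d l * z i = l * w i" if i: "i : I" for i
 proof -
  have "d (kd i u) = 0" if "u : U" for u using F2(3)[of i u] d(2) that i IV by blast
  hence "2 * gb t (%j. d (t j)) i = d (g x1 i + l * z i)"
   using derivation_gb[OF d(1), of i t] t[OF i] by simp
  thus ?thesis
   using d(2,3) F2(4) i by (simp add: derivation_add[OF d(1)] derivation_mult[OF d(1)])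
 qed
 thus ?thesis using d by blast
qed

text \<open>The differential of the map from \<open>(l, t)\<close> to \<open>g t - l z\<close>, with
  the unknown \<open>l\<close> at position \<open>None\<close>.\<close>

definition row :: "('a * 'd => real) => ('a * 'a => real) => 'a * 'a => ('a * 'd) option => real" where
 "row t z i k = (case k of None => - z i | Some j => 2 * gb t (un j) i)"

lemma sum_option:
 fixes f :: "'c option => real"
 shows "finite Z ==> (SUM k:insert None (Some ` Z). f k) = f None + (SUM j:Z. f (Some j))"
 by (subst sum.insert) (auto simp: sum.reindex)

lemma card_option: "finite Z ==> card (insert None (Some ` Z)) = Suc (card Z)"
 by (subst card_insert_disjoint) (auto simp: card_image)

lemma row_sum:
 assumes "Z <= U \<times> UNIV" "supp Z v"
 shows "(SUM k:insert None (Some ` Z). row t z i k * (case k of None => l | Some j => v j)) = 2 * gb t v i - l * z i"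
proof -
 have "finite Z" using assms(1) finU by (meson finite_SigmaI finite finite_subset)
 thus ?thesis
  unfolding gb_unit[OF assms] sum_option[OF \<open>finite Z\<close>] by (simp add: row_def sum_left mult_ac)
qed

lemma rows_indep:
 assumes z: "Generic F2 I z" and t: "!!i. i : I ==> g t i = g x1 i + l * z i" and l: "l ~= 0"
  and Z: "Z <= U \<times> UNIV" "supp Z t"
 shows "indep I (insert None (Some ` Z)) (row t z)"
proof (rule indep_of_solvable[OF finI])
 fix w
 obtain d where d: "derivation d" "ALL i:I. 2 * gb t (%j. d (t j)) i - d l * z i = l * (w i / l)"
  using sard[OF z t l, where w = "%i. w i / l"] by blast
 have "supp Z (%j. d (t j))" using Z(2) d(1) unfolding supp_def by simp
 from row_sum[OF Z(1) this, of t z _ "d l"] d(2) l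
 show "EX x. ALL i:I. (SUM k:insert None (Some ` Z). row t z i k * x k) = w i"
  by (intro exI[of _ "%k. case k of None => d l | Some j => d (t j)"]) simp
qed

text \<open>For \<open>t\<close> of smaller rank a rotation makes a whole coordinate zero. At least
  two free entries are lost, one in the block and one outside of it since \<open>U\<close> has more
  than \<open>d\<close> elements; then the independent rows of \<open>rows_indep\<close> would
  outnumber their columns.\<close>

lemma full_rank:
 assumes z: "Generic F2 I z" and t: "!!i. i : I ==> g t i = g x1 i + l * z i" and l: "l ~= 0"
 shows "indep UNIV U (%a u. t (u, a))"
proof (rule ccontr)
 assume "~ ?thesis"
 hence c: "EX c. (EX a. c a ~= 0) & (ALL u:U. (SU a. t (u, a) * c a) = 0)"
  unfolding indep_def by (auto simp: mult.commute)
 obtain h :: "'d => 'a" where h: "inj h" "range h <= U"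
  using card_le_inj[of "UNIV :: 'd set" U] finU cardU by auto
 obtain W a0 where W: "orthon UNIV W" "tri h (rmul t W)" "!!u. u : U ==> rmul t W (u, a0) = 0"
  using triangular_rotation(2)[OF c h(2)] unfolding tri_def by blast
 let ?Z = "T h - U \<times> {a0}"
 have "supp ?Z (rmul t W)" using tri_outside[OF W(2)] W(3) unfolding supp_def by auto
 moreover have "?Z <= U \<times> UNIV" using T_sub by blast
 ultimately have "indep I (insert None (Some ` ?Z)) (row (rmul t W) z)"
  using t g_rmul_orth[OF W(1)] by (intro rows_indep[OF z _ l]) auto
 hence "card I <= card (insert None (Some ` ?Z))" by (rule indep_card[OF _ finI]) (simp add: finT)
 hence le: "card I <= Suc (card ?Z)" using card_option[of ?Z] finT[of h] by simp
 have "card (range h) = CARD('d)" using h(1) by (simp add: card_image)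
 hence "range h ~= U" using cardU by auto
 then obtain u where u: "u : U" "u ~: range h" using h(2) by blast
 have "{(u, a0), (h a0, a0)} <= T h" using u h unfolding JT_def by (auto dest: injD)
 moreover have "u ~= h a0" using u(2) by blast
 hence "card {(u, a0), (h a0, a0)} = 2" by simp
 ultimately have "card (T h - {(u, a0), (h a0, a0)}) = card (T h) - 2" "2 <= card (T h)"
  using finT[of h] card_mono[OF finT, of "{(u, a0), (h a0, a0)}" h] card_Diff_subset[of "{(u, a0), (h a0, a0)}" "T h"] by auto
 moreover have "?Z <= T h - {(u, a0), (h a0, a0)}" using u h by auto
 moreover from this have "card ?Z <= card (T h - {(u, a0), (h a0, a0)})" by (rule card_mono[rotated]) (simp add: finT)
 moreover have "card I = card (T h)" using rotated[OF h] by blast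
 ultimately show False using le by linarith
qed

text \<open>The ray equations together with one more equation that chooses the local parameter
  \<open>s\<close>. With \<open>m = 1\<close> and \<open>h = 0\<close> it is the ray parameter, with
  \<open>m = 0\<close> and \<open>h = 1\<close> the squared length of \<open>e0\<close>. The factor
  of the latter is a square because lengths enter as sums of squares of linear forms.\<close>

lemma local_solutions:
 assumes card: "card I = card (T f)" and t: "supp (T f) t" and e0: "e0 : V \<times> V" and r: "r > 0"
  and inj: "ALL v x. supp (T f) v --> (ALL i:I. 2 * gb t v i = x * z i) -->
   m * x + h^2 * (2 * gb t v e0) = 0 --> x = 0 & (ALL j:T f. v j = 0)"
 obtains c C S L where "c > 0"
  "!!w s. ALL i:I. abs (w i - (g t i - l * z i)) < c ==> abs (s - (m * l + h^2 * g t e0)) < c ==>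
   (ALL i:I. g (S w s) i = w i + L w s * z i) & m * L w s + h^2 * g (S w s) e0 = s & abs (L w s - l) < r &
   supp (T f) (S w s)"
  "!!w s w' s'. ALL i:I. abs (w i - (g t i - l * z i)) < c ==> abs (s - (m * l + h^2 * g t e0)) < c ==>
   ALL i:I. abs (w' i - (g t i - l * z i)) < c ==> abs (s' - (m * l + h^2 * g t e0)) < c ==>
   abs (L w s - L w' s') <= C * (abs (s - s') + (SUM i:I. abs (w i - w' i)))"
  "!!w. ALL i:I. w i = g t i - l * z i ==> L w (m * l + h^2 * g t e0) = l"
proof -
 let ?A = "m * l + h^2 * g t e0"
 define II where "II = insert None (Some ` I)"
 define JJ where "JJ = insert None (Some ` T f)"
 define th where "th u j = (if j : T f then u (Some j) else 0)" for u :: "('a * 'd) option => real" and j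
 define ce where "ce k = (case k of None => h | Some i => 1)" for k :: "('a * 'a) option"
 define ee where "ee k = (case k of None => e0 | Some i => i)" for k :: "('a * 'a) option"
 define kp where "kp k a q = (case q of None => 0 | Some j => ce k * (if snd j = a then kd (ee k) (fst j) else 0))"
  for k :: "('a * 'a) option" and a :: 'd and q
 define cl where "cl k = (case k of None => m | Some i => - z i)" for k :: "('a * 'a) option"
 define ll where "ll k q = (case q of None => cl k | Some j => 0)" for k and q :: "('a * 'd) option"
 define F where "F u k = cl k * u None + (ce k)^2 * g (th u) (ee k)" for u k
 define p where "p k = (case k of None => l | Some j => t j)" for k
 have fin: "finite II" "finite JJ" using finI finT by (auto simp: II_def JJ_def)
 have sth: "supp (T f) (th u)" for u by (simp add: supp_def th_def)
 have cII: "card II = card JJ" unfolding II_def JJ_def card_option[OF finI] card_option[OF finT] card ..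
 have thp: "g (th p) e = g t e" for e
  by (rule g_cong) (use t in "auto simp: th_def p_def supp_def")
 have gbth: "gb (th p) v e = gb t v e" for v e
  unfolding gb_sym[of _ v] by (rule gb_cong) (use t in "auto simp: th_def p_def supp_def")
 have lsum: "(SUM q:JJ. ll k q * u q) = cl k * u None" for k u
  unfolding JJ_def sum_option[OF finT] by (simp add: ll_def)
 have ksum: "(SUM q:JJ. kp k a q * u q) = ce k * lf (ee k) (th u) a" for k a u
 proof -
  have "lf (ee k) (th u) a = (SUM w:U. SU b. (kr b a) * (kd (ee k) w * th u (w, b)))"
   unfolding lf_def sum_mult_delta(2)[OF finite] by simp
  also have "... = (SUM j:U \<times> UNIV. (kr (snd j) a) * (kd (ee k) (fst j) * th u j))"
   by (simp add: sum.cartesian_product case_prod_beta)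
  also have "... = (SUM j:T f. (kr (snd j) a) * (kd (ee k) (fst j) * th u j))"
   by (rule sum.mono_neutral_right) (use T_sub finU in "auto simp: th_def")
  finally show ?thesis
   unfolding JJ_def sum_option[OF finT]
   by (simp add: kp_def sum_left) (intro sum.cong refl, simp add: th_def)
 qed
 have gsum: "(SU a. (ce k * lf (ee k) s a) * (ce k * lf (ee k) v a)) = (ce k)^2 * gb s v (ee k)" for k s v
  by (simp add: gb_def sum_left power2_eq_square mult_ac)
 have FF: "F u k = (SUM q:JJ. ll k q * u q) + (SU a. (SUM q:JJ. kp k a q * u q)^2)" for u k
  unfolding lsum ksum using gsum[of k "th u" "th u"] by (simp add: F_def gb_self power2_eq_square)
 have ind: "indep JJ II (%q k. ll k q + 2 * (SU a. (SUM q:JJ. kp k a q * p q) * kp k a q))"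
  unfolding indep_def
 proof (intro allI impI)
  fix d assume d: "ALL k:II. (SUM q:JJ. d q * (ll k q + 2 * (SU a. (SUM q:JJ. kp k a q * p q) * kp k a q))) = 0"
  have e: "cl k * d None + (ce k)^2 * (2 * gb t (th d) (ee k)) = 0" if "k : II" for k
  proof -
   have "(SUM q:JJ. d q * (ll k q + 2 * (SU a. (SUM q:JJ. kp k a q * p q) * kp k a q))) =
     (SUM q:JJ. ll k q * d q) + 2 * (SU a. (SUM q:JJ. kp k a q * p q) * (SUM q:JJ. kp k a q * d q))"
    unfolding distrib_left sum.distrib sum_left
    by (subst (2) sum.swap) (simp add: mult_ac)
   thus ?thesis
    using d that unfolding lsum ksum gsum gbth by simp
  qed
  have e1: "m * d None + h^2 * (2 * gb t (th d) e0) = 0"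
   using e[of None] by (simp add: II_def cl_def ce_def ee_def)
  have e2: "2 * gb t (th d) i = d None * z i" if "i : I" for i
   using e[of "Some i"] that by (simp add: II_def cl_def ce_def ee_def)
  from inj[rule_format, OF sth e2 e1] show "ALL q:JJ. d q = 0" by (auto simp: JJ_def th_def)
 qed
 obtain c C sol where c: "c > 0"
  and s1: "!!w i. ALL i:II. abs (w i - F p i) < c ==> i : II ==> F (sol w) i = w i"
  and s2: "!!w j. ALL i:II. abs (w i - F p i) < c ==> j : JJ ==> abs (sol w j - p j) < r"
  and s3: "!!w w' j. ALL i:II. abs (w i - F p i) < c ==> ALL i:II. abs (w' i - F p i) < c ==> j : JJ ==>
    abs (sol w j - sol w' j) <= C * (SUM i:II. abs (w i - w' i))"
  and s4: "!!w j. ALL i:II. w i = F p i ==> j : JJ ==> sol w j = p j"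
  by (rule quadratic_inverse_formsE[where F = F and p = p, OF fin cII _ ind r]) (rule FF, (rule that; assumption))
 define ws where "ws w s k = (case k of None => s | Some i => w i)" for w and s :: real and k :: "('a * 'a) option"
 have wsS: "ws w s None = s" "ws w s (Some i) = w i" for w s i by (simp_all add: ws_def)
 have nN: "None : JJ" by (simp add: JJ_def)
 have Fp: "F p None = ?A" "F p (Some i) = g t i - l * z i" for i
  by (simp_all add: F_def cl_def ce_def ee_def thp p_def)
 have near: "ALL k:II. abs (ws w s k - F p k) < c"
  if "ALL i:I. abs (w i - (g t i - l * z i)) < c" "abs (s - (?A)) < c" for w s
  using that by (auto simp: II_def Fp ws_def)
 have sumw: "(SUM k:II. abs (ws w s k - ws w' s' k)) = abs (s - s') + (SUM i:I. abs (w i - w' i))" for w s w' s'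
  unfolding II_def sum_option[OF finI] by (simp add: ws_def)
 show ?thesis
 proof (rule that[of c "%w s. th (sol (ws w s))" "%w s. sol (ws w s) None" C], rule c, intro conjI ballI)
  fix w s i assume a: "ALL i:I. abs (w i - (g t i - l * z i)) < c" "abs (s - (?A)) < c"
  note n = near[OF a]
  show "m * sol (ws w s) None + h^2 * g (th (sol (ws w s))) e0 = s"
   using s1[OF n, of None] by (simp add: II_def F_def cl_def ce_def ee_def wsS)
  show "abs (sol (ws w s) None - l) < r" using s2[OF n nN] by (simp add: p_def)
  show "supp (T f) (th (sol (ws w s)))" by (rule sth)
  assume "i : I"
  thus "g (th (sol (ws w s))) i = w i + sol (ws w s) None * z i"
   using s1[OF n, of "Some i"] by (simp add: II_def F_def cl_def ce_def ee_def wsS algebra_simps)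
 next
  fix w s w' s' assume a: "ALL i:I. abs (w i - (g t i - l * z i)) < c" "abs (s - (?A)) < c"
   "ALL i:I. abs (w' i - (g t i - l * z i)) < c" "abs (s' - (?A)) < c"
  show "abs (sol (ws w s) None - sol (ws w' s') None) <= C * (abs (s - s') + (SUM i:I. abs (w i - w' i)))"
   using s3[OF near[OF a(1,2)] near[OF a(3,4)] nN] unfolding sumw .
 next
  fix w assume "ALL i:I. w i = g t i - l * z i"
  hence "ALL k:II. ws w (?A) k = F p k" by (auto simp: II_def Fp ws_def)
  from s4[OF this nN] show "sol (ws w (?A)) None = l" by (simp add: p_def)
 qed
qed

text \<open>If the length were transcendental, a derivation could move it alone, and together with
  those of \<open>sard\<close> reach arbitrary values on \<open>T h\<close>; so \<open>t\<close>
  would be generic over \<open>F2\<close>. At a generic point the differential is as injective as at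
  the rotated \<open>x1\<close>, but the derivation that moves only this length gives a kernel
  direction.\<close>

lemma transversal:
 assumes h: "inj h" "range h <= U" and z: "Generic F2 I z" and l: "l ~= 0" and e0: "e0 : V \<times> V"
  and t: "!!i. i : I ==> g t i = g x1 i + l * z i" "supp (T h) t"
 shows "~ Generic (F2 Un z ` I Un {l}) (UNIV :: unit set) (%_. g t e0)"
proof
 assume s: "Generic (F2 Un z ` I Un {l}) (UNIV :: unit set) (%_. g t e0)"
 obtain x where x: "supp (T h) x" and card: "card I = card (T h)"
  and xc: "indep (T h) I (%j i. gb x (un j) i)" and xr: "indep I (T h) (%i j. gb x (un j) i)"
  using rotated[OF h] by blast
 obtain d0 where d0: "derivation d0" "ALL c:F2 Un z ` I Un {l}. d0 c = 0" "d0 (g t e0) = 1"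
  using Generic_derivation[OF s, of "%_. 1"] F2(1) by auto
 have kd0: "d0 (kd e u) = 0" if "e : V \<times> V" "u : U" for e u
  using F2(3)[OF that] d0(2) by blast
 define v where "v = (%j. d0 (t j))"
 have sv: "supp (T h) v" using t(2) d0(1) by (simp add: supp_def v_def)
 have v0: "gb t v i = 0" if i: "i : I" for i
 proof -
  have "2 * gb t v i = d0 (g t i)"
   unfolding v_def by (rule derivation_gb[symmetric, OF d0(1)]) (use kd0 i IV in blast)
  also have "... = 0"
   unfolding t(1)[OF i] using d0(2) F2(4)[OF i] i
   by (simp add: derivation_add[OF d0(1)] derivation_mult[OF d0(1)])
  finally show ?thesis by simp
 qed
 have v1: "2 * gb t v e0 = 1"
  using derivation_gb[OF d0(1), of e0 t] kd0[OF e0] d0(3) by (simp add: v_def)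
 have "ALL k. EX d. derivation d & (ALL c:F2. d c = 0) &
   (ALL i:I. 2 * gb t (%j. d (t j)) i - d l * z i = l * (kr i k))"
  using sard[OF z t(1) l, where w = "%i. if i = _ then 1 else 0"] by blast
 then obtain dk where dk: "!!k. derivation (dk k)" "!!k c. c : F2 ==> dk k c = 0"
  "!!k i. i : I ==> 2 * gb t (%j. dk k (t j)) i - dk k l * z i = l * (kr i k)"
  by metis
 define D where "D q = (case q of None => d0 | Some k => dk k)" for q
 have D: "derivation (D q)" "c : F2 ==> D q c = 0" for q c
  using d0 dk by (auto simp: D_def split: option.split)
 define cc where "cc q k = (case k of None => D q l | Some j => D q (t j))" for q and k :: "('a * 'd) option"
 let ?I = "insert None (Some ` I)" and ?J = "insert None (Some ` T h)"
 \<comment> \<open>A square matrix: \<open>d0\<close> and one derivation for each pair in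
   \<open>I\<close>, evaluated at \<open>l\<close> and at the free entries of
   \<open>t\<close>.\<close>
 have "indep ?I ?J cc"
  unfolding indep_def
 proof (intro allI impI)
  fix m assume m: "ALL k:?J. (SUM q:?I. m q * cc q k) = 0"
  define E where "E x = (SUM q:?I. m q * D q x)" for x
  have E0: "E l = 0" "j : T h ==> E (t j) = 0" for j
   using m[rule_format, of None] m[rule_format, of "Some j"] by (auto simp: E_def cc_def)
  have "m (Some i) * l = 0" if i: "i : I" for i
  proof -
   have "E 0 = 0" unfolding E_def using derivation_0[OF D(1)] by simp
   hence "supp (T h) (%j. E (t j))" using t(2) by (simp add: supp_def)
   hence "0 = 2 * gb t (%j. E (t j)) i - E l * z i"
    using gb_unit[OF T_sub, of h "%j. E (t j)" t i] E0 by simp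
   also have "... = (SUM q:?I. m q * (2 * gb t (%j. D q (t j)) i - D q l * z i))"
    unfolding E_def gb_sum by (simp add: sum_left sum_right sum_subtractf right_diff_distrib mult_ac)
   also have "... = m (Some i) * l" using dk(3)[OF i] v0[OF i] d0(2) sum_mult_delta(3)[OF finI, of "%k. m (Some k) * l" i] i unfolding sum_option[OF finI] v_def by (auto simp: D_def mult.assoc)
   finally show ?thesis by simp
  qed
  hence mS: "m (Some i) = 0" if "i : I" for i using that l by auto
  have "E x = m None * d0 x" for x
   unfolding E_def sum_option[OF finI] using mS by (simp add: D_def)
  hence "m None * v j = 0" if "j : T h" for j using E0(2)[OF that] by (simp add: v_def)
  moreover have "EX j:T h. v j ~= 0"
   using gb_unit[OF T_sub sv, of t e0] v1 by (metis (no_types, lifting) mult_zero_left mult_zero_right sum.neutral zero_neq_one)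
  ultimately have "m None = 0" by auto
  thus "ALL q:?I. m q = 0" using mS by auto
 qed
 hence solv: "EX c. ALL k:?J. (SUM q:?I. cc q k * c q) = w k" for w
  using finI finT card card_option[OF finI] card_option[OF finT]
  by (intro square_solve) auto
 have gen: "Generic F2 (T h) t"
 proof (rule derivation_Generic[OF _ F2(1) finT])
  fix w
  obtain c where c: "!!k. k : ?J ==> (SUM q:?I. cc q k * c q) = (case k of None => 0 | Some j => w j)"
   using solv[of "%k. case k of None => 0 | Some j => w j"] by blast
  have "(SUM q:?I. c q * D q (t j)) = w j" if "j : T h" for j
   using c[of "Some j"] that by (simp add: cc_def mult.commute)
  thus "EX d. derivation d & (ALL c:F2. d c = 0) & (ALL i:T h. d (t i) = w i)"
   using derivation_lin[of ?I D c] D by (intro exI[of _ "%x. SUM q:?I. c q * D q x"]) simp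
 qed
 define th where "th u j = (if j : T h then u j else 0)" for u :: "'a * 'd => real" and j
 have gbth: "gb (th u) s e = gb u s e" if "supp (T h) u" for u s e
  unfolding gb_sym[of _ s] by (rule gb_cong) (use that in "auto simp: th_def supp_def")
 have "indep (T h) I (%j i. gb (th t) (un j) i)"
 proof (rule Generic_indep[OF finT finI F2(1) _ gen])
  show "indep (T h) I (%j i. gb (th x) (un j) i)" unfolding gbth[OF x] by (rule xc)
  fix j i assume j: "j : T h" and i: "i : I"
  have "(%u. th u (w, a)) : polyfun F2 (T h)" for w a
   by (cases "(w, a) : T h") (auto simp: th_def intro: polyfun_coord polyfun_const polyfun_rat[OF F2(1)])
  moreover have "(%u. un j (w, a)) : polyfun F2 (T h)" for w a
   by (rule polyfun_rat[OF F2(1)]) (simp add: un_def)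
  ultimately show "(%u. gb (th u) (un j) i) : polyfun F2 (T h)"
   unfolding gb_def using F2(3)[of i] i IV
   by (intro polyfun_sum polyfun_mult lf_polyfun F2(1)) auto
 qed
 hence c: "indep (T h) I (%j i. gb t (un j) i)" unfolding gbth[OF t(2)] .
 have "v j = 0" if "j : T h" for j
  by (rule indepD[OF c _ that]) (use gb_unit[OF T_sub sv] v0 in simp)
 thus False using gb_unit[OF T_sub sv, of t e0] v1 by simp
qed

text \<open>Where the differential of the lengths is injective, the ray parameter is a local
  coordinate and can be increased.\<close>

lemma push:
 assumes card: "card I = card (T h)" and t: "supp (T h) t" "!!i. i : I ==> g t i = g x1 i + l * z i" and l: "l < 1"
  and inj: "!!v j. supp (T h) v ==> (!!i. i : I ==> gb t v i = 0) ==> j : T h ==> v j = 0"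
 shows "EX s>l. s <= 1 & (EX t'. ALL i:I. g t' i = g x1 i + s * z i)"
proof -
 have u: "(u0, u0) : V \<times> V" using u0 by simp
 have i: "ALL v x. supp (T h) v --> (ALL i:I. 2 * gb t v i = x * z i) -->
   1 * x + 0^2 * (2 * gb t v (u0, u0)) = 0 --> x = 0 & (ALL j:T h. v j = 0)"
  using inj by simp
 obtain c S L where c: "c > 0" and sol: "!!w s. ALL i:I. abs (w i - (g t i - l * z i)) < c ==> abs (s - (1 * l + 0^2 * g t (u0, u0))) < c ==>
   (ALL i:I. g (S w s) i = w i + L w s * z i) & 1 * L w s + 0^2 * g (S w s) (u0, u0) = s & abs (L w s - l) < 1 & supp (T h) (S w s)"
  by (rule local_solutions[OF card t(1) u zero_less_one i]) (rule that; assumption)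
 define s where "s = l + min (c / 2) (1 - l)"
 have s: "l < s" "s <= 1" "abs (s - l) < c" using c l by (auto simp: s_def)
 hence "ALL i:I. g (S (g x1) s) i = g x1 i + s * z i" using sol[of "g x1" s] t(2) c by simp
 thus ?thesis using s by blast
qed

text \<open>At the last realizable parameter \<open>l\<close> the differential has a kernel
  direction, along which the length of some pair \<open>e0\<close> changes. As a function of this
  length the ray parameter \<open>L\<close> has a maximum; it drops on both sides, so every slightly
  smaller level is attained twice, also on neighbouring parallel rays.\<close>

theorem fold:
 "EX t0 e0 d. e0 : V \<times> V & d > 0 &
  (ALL t'. (ALL i:I. abs (g t' i - g t0 i) < d) --> (EX t''. (ALL i:I. g t'' i = g t' i) & g t'' e0 ~= g t' e0))"
proof -
 obtain c0 where c0: "c0 > 0" "!!t. c0 * (SUM j:U \<times> UNIV. (t j)^2) <= (SUM i:I. g t i)"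
  using proper by blast
 have coord: "(t j)^2 <= (SUM i:I. g t i) / c0" if "j : U \<times> UNIV" for t j
 proof -
  have "(t j)^2 <= (SUM j:U \<times> UNIV. (t j)^2)" by (rule member_le_sum) (use that finU in auto)
  also have "... <= (SUM i:I. g t i) / c0" using c0(2)[of t] c0(1) by (simp add: field_simps)
  finally show ?thesis .
 qed
 obtain i0 where i0: "i0 : I" "g x1 i0 > 0"
 proof -
  obtain u where u: "u : U" using cardU by fastforce
  then obtain b where "x1 (u, b) ~= 0" using N1 by blast
  hence "0 < (x1 (u, b))^2" by simp
  also have "... <= (SUM i:I. g x1 i) / c0" by (rule coord) (simp add: u)
  finally have "(SUM i:I. g x1 i) > 0" using c0(1) by (simp add: zero_less_divide_iff)
  then obtain i where "i : I" "g x1 i ~= 0" by (metis less_irrefl sum.neutral)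
  thus thesis using that g_nonneg[of x1 i] by (metis less_eq_real_def)
 qed
 \<comment> \<open>Close to \<open>- 2 * g x1\<close> the squared length of \<open>i0\<close> would
   be negative at parameter 1, so the ray leaves the realizable lengths.\<close>
 obtain z where z: "Generic F2 I z" and "ALL i:I. abs (z i - (- 2 * g x1 i)) < g x1 i0"
  using Generic_dense[OF F2(2) finI i0(2), of "%i. - 2 * g x1 i"] by blast
 hence z0: "g x1 i0 + z i0 < 0" using i0(1) by fastforce
 have finJ: "finite (insert None (Some ` (U \<times> (UNIV :: 'd set))))" using finU by simp
 define S where "S = {v :: ('a * 'd) option => real. 0 <= v None & v None <= 1 &
  (ALL i:I. g (%j. v (Some j)) i = g x1 i + v None * z i)}"
 have "EX v:S. ALL v':S. v' None <= v None"
 proof (rule attains_max[where f = "%v. v None" and B = "1 + (SUM i:I. g x1 i + abs (z i)) / c0", OF finJ])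
  show "S ~= {}"
  proof -
   have "(%k. case k of None => 0 | Some j => x1 j) : S" by (simp add: S_def)
   thus ?thesis by blast
  qed
 next
  fix v k assume v: "v : S" and k: "k : insert None (Some ` (U \<times> (UNIV :: 'd set)))"
  have "(SUM i:I. g x1 i + abs (z i)) / c0 >= 0" using c0(1) g_nonneg by (simp add: sum_nonneg)
  moreover have "abs (v (Some j)) <= 1 + (SUM i:I. g x1 i + abs (z i)) / c0" if j: "j : U \<times> UNIV" for j
  proof -
   have "abs (v (Some j)) <= 1 + (v (Some j))^2"
    using zero_le_power2[of "abs (v (Some j)) - 1"] by (simp add: power2_diff)
   also have "(v (Some j))^2 <= (SUM i:I. g (%j. v (Some j)) i) / c0" using coord[OF j, of "%j. v (Some j)"] by simp
   also have "(SUM i:I. g (%j. v (Some j)) i) <= (SUM i:I. g x1 i + abs (z i))"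
   proof (rule sum_mono)
    fix i assume "i : I"
    have "v None * z i <= 1 * abs (z i)"
     using v mult_right_mono[of "v None" 1 "abs (z i)"] mult_left_mono[OF abs_ge_self, of "v None" "z i"] by (simp add: S_def)
    thus "g (%j. v (Some j)) i <= g x1 i + abs (z i)" using v \<open>i : I\<close> by (simp add: S_def)
   qed
   finally show ?thesis using c0(1) by (simp add: divide_right_mono)
  qed
  ultimately show "abs (v k) <= 1 + (SUM i:I. g x1 i + abs (z i)) / c0" using k v by (auto simp: S_def)
 next
  fix x :: "nat => ('a * 'd) option => real" and l
  assume xS: "!!n. x n : S" and lim: "!!j. j : insert None (Some ` (U \<times> UNIV)) ==> (%n. x n j) ----> l j"
  have limN: "(%n. x n None) ----> l None" by (rule lim) simp
  have "g (%j. l (Some j)) i = g x1 i + l None * z i" if "i : I" for i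
  proof (rule LIMSEQ_unique)
   show "(%n. g (%j. x n (Some j)) i) ----> g (%j. l (Some j)) i" by (rule g_tendsto) (use lim in auto)
   have "(%n. g (%j. x n (Some j)) i) = (%n. g x1 i + x n None * z i)" using xS that by (simp add: S_def)
   thus "(%n. g (%j. x n (Some j)) i) ----> g x1 i + l None * z i"
    by (simp only:) (intro tendsto_intros limN)
  qed
  moreover have "0 <= l None" by (rule LIMSEQ_le_const[OF limN]) (use xS in "auto simp: S_def")
  moreover have "l None <= 1" by (rule LIMSEQ_le_const2[OF limN]) (use xS in "auto simp: S_def")
  ultimately show "l : S" by (simp add: S_def)
 qed simp
 then obtain v where v: "v : S" "!!v'. v' : S ==> v' None <= v None" by blast
 define l where "l = v None"
 define q where "q = (%j. v (Some j))"
 have q: "g q i = g x1 i + l * z i" if "i : I" for i using v(1) that by (simp add: S_def q_def l_def)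
 have lmax: "l' <= l" if "0 <= l'" "l' <= 1" "!!i. i : I ==> g t i = g x1 i + l' * z i" for l' t
  using v(2)[of "%k. case k of None => l' | Some j => t j"] that by (simp add: S_def l_def)
 have "l ~= 1" using q[OF i0(1)] z0 g_nonneg[of q i0] by auto
 hence l1: "l < 1" using v(1) by (simp add: S_def l_def)
 have cardI: "card I = card (T y)" if "inj y" "range y <= U" for y using rotated[OF that] by blast
 have l0: "l > 0"
 proof -
  obtain y :: "'d => 'a" where y: "inj y" "range y <= U"
   using card_le_inj[of "UNIV :: 'd set" U] finU cardU by auto
  obtain x where x: "supp (T y) x" "!!e. g x e = g x1 e" and xc: "indep (T y) I (%j i. gb x (un j) i)"
   using rotated[OF y] by blast
  have "EX s>0. s <= 1 & (EX t'. ALL i:I. g t' i = g x1 i + s * z i)"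
  proof (rule push[OF cardI[OF y] x(1)])
   show "v j = 0" if "supp (T y) v" "!!i. i : I ==> gb x v i = 0" "j : T y" for v j
    by (rule indepD[OF xc _ that(3)]) (use that(2) gb_unit[OF T_sub that(1), of x] in simp)
  qed (simp_all add: x(2))
  then obtain s t' where "s > 0" "s <= 1" "ALL i:I. g t' i = g x1 i + s * z i" by blast
  thus ?thesis using lmax[of s t'] by auto
 qed
 obtain y :: "'d => 'a" where y: "inj y" "range y <= U" and blk: "indep UNIV UNIV (%a b. q (y b, a))"
  using indep_block[OF finU full_rank[OF z q]] l0 by auto
 obtain W where W: "orthon UNIV W" "tri y (rmul q W)"
  using triangular_rotation(1)[of q y] unfolding tri_def by blast
 define p where "p = rmul q W"
 have p: "g p i = g x1 i + l * z i" if "i : I" for i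
  using q[OF that] g_rmul_orth[OF W(1), of q i] by (simp add: p_def)
 have tr: "tri y p" and pblk: "indep UNIV UNIV (%a b. p (y b, a))"
  using W(2) indep_rotate[OF blk W(1)] by (simp_all add: p_def rmul_def)
 have sp: "supp (T y) p" using tri_outside[OF tr] by (simp add: supp_def)
 have rows: "indep I (insert None (Some ` T y)) (row p z)"
  using l0 by (intro rows_indep[OF z p _ T_sub sp]) auto
 have cI: "card I = card (T y)" by (rule cardI[OF y])
 obtain x where x: "EX k:insert None (Some ` T y). x k ~= 0"
  "!!i. i : I ==> (SUM k:insert None (Some ` T y). x k * row p z i k) = 0"
 proof -
  have "card I < card (insert None (Some ` T y))" unfolding card_option[OF finT] cI by simp
  from underdetermined[OF finI _ this, of "row p z"] show thesis using that finT by blast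
 qed
 have KL: "EX c. A = c * x None & (ALL j:T y. v j = c * x (Some j))"
  if sv: "supp (T y) v" and e: "!!i. i : I ==> 2 * gb p v i = A * z i" for v A
 proof -
  have "EX c. ALL k:insert None (Some ` T y). (case k of None => A | Some j => v j) = c * x k"
  proof (rule kernel_line[OF rows finI])
   show "finite (insert None (Some ` T y))" by (simp add: finT)
   show "card (insert None (Some ` T y)) = Suc (card I)" unfolding card_option[OF finT] cI ..
   show "EX k:insert None (Some ` T y). x k ~= 0" by (rule x(1))
   fix i assume i: "i : I"
   show "(SUM k:insert None (Some ` T y). row p z i k * x k) = 0" using x(2)[OF i] by (simp only: mult.commute)
   show "(SUM k:insert None (Some ` T y). row p z i k * (case k of None => A | Some j => v j)) = 0"
    unfolding row_sum[OF T_sub sv] using e[OF i] by simp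
  qed
  thus ?thesis by auto
 qed
 \<comment> \<open>Otherwise the differential in \<open>t\<close> alone would be injective, and
   \<open>push\<close> would pass the maximum.\<close>
 have x0: "x None = 0"
 proof (rule ccontr)
  assume xN: "x None ~= 0"
  have "EX s>l. s <= 1 & (EX t'. ALL i:I. g t' i = g x1 i + s * z i)"
  proof (rule push[OF cI sp p l1])
   fix v j assume v: "supp (T y) v" "!!i. i : I ==> gb p v i = 0" and j: "j : T y"
   obtain c where "0 = c * x None" "ALL j:T y. v j = c * x (Some j)" using KL[OF v(1), of 0] v(2) by auto
   thus "v j = 0" using xN j by simp
  qed
  then obtain s t' where "s > l" "s <= 1" "ALL i:I. g t' i = g x1 i + s * z i" by blast
  thus False using lmax[of s t'] l0 by auto
 qed
 define v0 where "v0 j = (if j : T y then x (Some j) else 0)" for j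
 have sv0: "supp (T y) v0" by (simp add: supp_def v0_def)
 have "~ (ALL e:V \<times> V. gb p v0 e = 0)"
 proof
  assume *: "ALL e:V \<times> V. gb p v0 e = 0"
  have "v0 j = 0" if "j : U \<times> UNIV" for j
   by (rule tri_flex[OF tr y(2) pblk _ y(1) _ that]) (simp add: v0_def, rule *[rule_format])
  hence "x (Some j) = 0" if "j : T y" for j using that T_sub[of y] unfolding v0_def by (metis subsetD)
  thus False using x(1) x0 by auto
 qed
 then obtain e0 where e0: "e0 : V \<times> V" "gb p v0 e0 ~= 0" by blast
 have inj: "ALL v A. supp (T y) v --> (ALL i:I. 2 * gb p v i = A * z i) -->
  0 * A + 1^2 * (2 * gb p v e0) = 0 --> A = 0 & (ALL j:T y. v j = 0)"
 proof (intro allI impI)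
  fix v A assume sv: "supp (T y) v" and e: "ALL i:I. 2 * gb p v i = A * z i" and e': "0 * A + 1^2 * (2 * gb p v e0) = 0"
  then obtain c where c: "A = c * x None" "ALL j:T y. v j = c * x (Some j)" using KL[of v A] by blast
  have "gb p v e0 = gb p (%j. c * v0 j) e0"
   by (rule gb_cong2) (use c(2) sv in "auto simp: v0_def supp_def")
  hence "c = 0" using e' e0(2) by (simp add: gb_scale)
  thus "A = 0 & (ALL j:T y. v j = 0)" using c by simp
 qed
 have r: "min l (1 - l) > 0" using l0 l1 by simp
 obtain d C St L where d: "d > 0"
  and s1': "!!w s. ALL i:I. abs (w i - (g p i - l * z i)) < d ==> abs (s - (0 * l + 1^2 * g p e0)) < d ==>
   (ALL i:I. g (St w s) i = w i + L w s * z i) & 0 * L w s + 1^2 * g (St w s) e0 = s & abs (L w s - l) < min l (1 - l) &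
   supp (T y) (St w s)"
  and s2': "!!w s w' s'. ALL i:I. abs (w i - (g p i - l * z i)) < d ==> abs (s - (0 * l + 1^2 * g p e0)) < d ==>
   ALL i:I. abs (w' i - (g p i - l * z i)) < d ==> abs (s' - (0 * l + 1^2 * g p e0)) < d ==>
   abs (L w s - L w' s') <= C * (abs (s - s') + (SUM i:I. abs (w i - w' i)))"
  and s3': "!!w. ALL i:I. w i = g p i - l * z i ==> L w (0 * l + 1^2 * g p e0) = l"
  by (rule local_solutions[where m = 0 and h = 1 and z = z and l = l, OF cI sp e0(1) r inj]) (rule that; assumption)
 have s1: "(ALL i:I. g (St w s) i = w i + L w s * z i) & g (St w s) e0 = s & abs (L w s - l) < min l (1 - l) & supp (T y) (St w s)"
  if "ALL i:I. abs (w i - g x1 i) < d" "abs (s - g p e0) < d" for w s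
  using s1'[of w s] that p by simp
 have s2: "abs (L w s - L w' s') <= C * (abs (s - s') + (SUM i:I. abs (w i - w' i)))"
  if "ALL i:I. abs (w i - g x1 i) < d" "abs (s - g p e0) < d" "ALL i:I. abs (w' i - g x1 i) < d" "abs (s' - g p e0) < d" for w s w' s'
  using s2'[of w s w' s'] that p by simp
 have s3: "L w (g p e0) = l" if "ALL i:I. w i = g x1 i" for w using s3'[of w] that p by simp
 define y1 where "y1 = g x1"
 have y1: "ALL i:I. abs (y1 i - g x1 i) < d" using d by (simp add: y1_def)
 \<comment> \<open>\<open>L\<close> cannot exceed the maximum \<open>l\<close>, and by
   \<open>transversal\<close> it differs from \<open>l\<close> at lengths that are generic over the
   data; such lengths are dense.\<close>
 have side: "EX s. abs (s - a) < d / 2 & L y1 s < l" if a: "abs (a - g p e0) <= d / 2" for a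
 proof -
  have "countable (F2 Un z ` I Un {l})" using F2(2) finI by (simp add: countable_finite)
  from Generic_dense[OF this finite, of "d / 2" UNIV "%_::unit. a"] obtain s' where
   s': "Generic (F2 Un z ` I Un {l}) (UNIV :: unit set) s'" "abs (s' () - a) < d / 2" using d by auto
  define s where "s = s' ()"
  have sa: "abs (s - a) < d / 2" using s'(2) by (simp add: s_def)
  hence sn: "abs (s - g p e0) < d" using a by linarith
  note t = s1[OF y1 sn]
  have "L y1 s <= l" by (rule lmax[of _ "St y1 s"]) (use t in "auto simp: y1_def")
  moreover have "L y1 s ~= l"
  proof
   assume e: "L y1 s = l"
   have "~ Generic (F2 Un z ` I Un {l}) (UNIV :: unit set) (%_. g (St y1 s) e0)"
    by (rule transversal[OF y z _ e0(1)]) (use t e l0 in "auto simp: y1_def")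
   moreover have "(%_. g (St y1 s) e0) = s'" using t by (auto simp: s_def)
   ultimately show False using s'(1) by simp
  qed
  ultimately show ?thesis using sa by (intro exI[of _ s]) simp
 qed
 obtain sp where sp': "abs (sp - (g p e0 + d / 2)) < d / 2" "L y1 sp < l" using side[of "g p e0 + d / 2"] d by auto
 obtain sm where sm': "abs (sm - (g p e0 - d / 2)) < d / 2" "L y1 sm < l" using side[of "g p e0 - d / 2"] d by auto
 have ord: "sm < g p e0" "g p e0 < sp" "abs (sp - g p e0) < d" "abs (sm - g p e0) < d" using sp'(1) sm'(1) by linarith+
 \<comment> \<open>Half of the smaller drop: the level \<open>c\<close> keeps distance
   \<open>E\<close> from the maximum and at least \<open>E\<close> from both end values.\<close>
 define E where "E = (l - max (L y1 sp) (L y1 sm)) / 2"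
 define c where "c = l - E"
 have E: "E > 0" "L y1 sp <= c - E" "L y1 sm <= c - E" using sp'(2) sm'(2) by (auto simp: E_def c_def max_def field_simps)
 \<comment> \<open>By the Lipschitz bound, shifting the lengths by less than \<open>d'\<close>
   changes \<open>L\<close> by less than \<open>E\<close>.\<close>
 define d' where "d' = min d (E / ((abs C + 1) * (real (card I) + 1)))"
 have d': "d' > 0" using d E(1) by (simp add: d'_def)
 have two: "EX s s'. s ~= s' & abs (s - g p e0) < d & abs (s' - g p e0) < d & L w s = c & L w s' = c"
  if w: "ALL i:I. abs (w i - y1 i) < d'" for w
 proof -
  have wn: "ALL i:I. abs (w i - g x1 i) < d" using w by (auto simp: d'_def y1_def)
  have "(SUM i:I. abs (w i - y1 i)) <= (SUM i:I. d')" by (rule sum_mono) (use w less_imp_le in blast)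
  also have "... < (real (card I) + 1) * d'" using d' by (simp add: distrib_right)
  also have "... <= (real (card I) + 1) * (E / ((abs C + 1) * (real (card I) + 1)))"
   by (rule mult_left_mono) (auto simp: d'_def)
  also have "... = E / (abs C + 1)"
   using nonzero_mult_divide_mult_cancel_left[of "real (card I) + 1" E "abs C + 1"] by (simp add: mult.commute[of "abs C + 1"])
  finally have small: "(SUM i:I. abs (w i - y1 i)) < E / (abs C + 1)" .
  have close: "abs (L w s - L y1 s) < E" if s: "abs (s - g p e0) < d" for s
  proof -
   have "abs (L w s - L y1 s) <= C * (SUM i:I. abs (w i - y1 i))" using s2[OF wn s y1 s] by simp
   also have "... <= (abs C + 1) * (SUM i:I. abs (w i - y1 i))" by (rule mult_right_mono) (auto simp: sum_nonneg)
   also have "... < E" using small by (simp add: field_simps)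
   finally show ?thesis .
  qed
  have "L y1 (g p e0) = l" by (rule s3) (simp add: y1_def)
  hence mid: "L w (g p e0) > c" using close[of "g p e0"] d by (simp add: c_def)
  have ends: "L w sp < c" "L w sm < c" using close[OF ord(3)] close[OF ord(4)] E by linarith+
  have cont: "continuous_on {a..b} (L w)" if "!!s. s : {a..b} ==> abs (s - g p e0) < d" for a b
  proof (rule lipschitz_on_continuous_on)
   show "\<bar>C\<bar>-lipschitz_on {a..b} (L w)"
   proof (rule lipschitz_onI)
    fix s s' assume "s : {a..b}" "s' : {a..b}"
    hence "abs (L w s - L w s') <= C * abs (s - s')" using s2[OF wn that wn that] by simp
    also have "... <= abs C * abs (s - s')" by (rule mult_right_mono) auto
    finally show "dist (L w s) (L w s') <= abs C * dist s s'" by (simp add: dist_real_def)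
   qed simp
  qed
  have "EX s>=g p e0. s <= sp & L w s = c"
   by (rule IVT2') (use mid ends ord cont in auto)
  moreover have "EX s>=sm. s <= g p e0 & L w s = c"
   by (rule IVT') (use mid ends ord cont in auto)
  ultimately obtain s s' where s: "g p e0 <= s" "s <= sp" "L w s = c" "sm <= s'" "s' <= g p e0" "L w s' = c" by blast
  hence "s ~= g p e0" using mid by auto
  thus ?thesis using s ord by (intro exI[of _ s] exI[of _ s']) auto
 qed
 obtain s where s: "abs (s - g p e0) < d" "L y1 s = c" using two[of y1] d' by auto
 have t0: "g (St y1 s) i = y1 i + c * z i" if "i : I" for i using s1[OF y1 s(1)] s(2) that by simp
 have "EX t''. (ALL i:I. g t'' i = g t' i) & g t'' e0 ~= g t' e0"
  if t': "ALL i:I. abs (g t' i - g (St y1 s) i) < d'" for t'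
 proof -
  \<comment> \<open>The parallel ray that passes through the lengths of \<open>t'\<close> at level
    \<open>c\<close>; of its two realizations there, at least one has a length of \<open>e0\<close>
    different from that of \<open>t'\<close>.\<close>
  define w where "w i = g t' i - c * z i" for i
  have w: "ALL i:I. abs (w i - y1 i) < d'" using t' t0 by (simp add: w_def algebra_simps)
  hence wn: "ALL i:I. abs (w i - g x1 i) < d" by (auto simp: d'_def y1_def)
  obtain a b where ab: "a ~= b" "abs (a - g p e0) < d" "abs (b - g p e0) < d" "L w a = c" "L w b = c" using two[OF w] by blast
  have "g (St w a) i = w i + c * z i" "g (St w b) i = w i + c * z i" if "i : I" for i
   using s1[OF wn ab(2)] s1[OF wn ab(3)] ab(4,5) that by simp_all
  hence "ALL i:I. g (St w a) i = g t' i" "ALL i:I. g (St w b) i = g t' i" by (simp_all add: w_def)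
  moreover have "g (St w a) e0 = a" "g (St w b) e0 = b" using s1[OF wn ab(2)] s1[OF wn ab(3)] by simp_all
  ultimately show ?thesis using ab(1) by metis
 qed
 thus ?thesis using e0(1) d' by blast
qed

end

subsection \<open>Stresses with large kernel\<close>

lemma sf_cong:
 assumes "D <= V \<times> V" "!!e. e : D ==> w e = w' e" "!!u. u : V ==> y u = y' u" "!!u. u : V ==> z u = z' u"
 shows "sf D w y z = sf D w' y' z'"
 unfolding sf_def by (rule sum.cong) (use assms in auto)

lemma sf_unit:
 assumes "finite V" "D <= V \<times> V"
 shows "sf D W y z = (SUM w:V. z w * sf D W y (un w))"
proof -
 have "sf D W y z = sf D W y (%v. SUM w:V. z w * un w v)"
  by (rule sf_cong[OF assms(2)]) (simp_all add: un_def sum_mult_delta(3)[OF assms(1)])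
 thus ?thesis unfolding sf_sym[of D W y] sf_sum .
qed

lemma derivation_sf:
 assumes d: "derivation d"
 shows "d (sf D W y (un w)) = sf D (%e. d (W e)) y (un w) + sf D W (%u. d (y u)) (un w)"
proof -
 have u: "d (un w u - un w v) = 0" for u v by (rule derivation_Rats[OF d]) (auto simp: un_def)
 have "d (c * ((a - b) * u)) = d c * ((a - b) * u) + c * ((d a - d b) * u)" if "d u = 0" for a b c u
  by (simp add: derivation_mult[OF d] derivation_diff[OF d] that)
 from this[OF u] show ?thesis
  unfolding sf_def derivation_sum[OF d] sum.distrib[symmetric] by (intro sum.cong refl)
qed

text \<open>\<open>W\<close> is generic among the stresses of \<open>x\<close>, so \<open>x\<close>
  and \<open>W\<close> can be varied to first order independently. The hypothesis on
  \<open>W'\<close> makes it the derivative of \<open>W\<close> along a variation that keeps the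
  stress equations; differentiating \<open>W y = 0\<close> for a kernel vector then shows that
  \<open>W'\<close> vanishes on the kernel. Thus a relation of length forms seen at \<open>x\<close>
  holds on the whole kernel.\<close>

theorem flat_stress:
 fixes x :: "'a * 'd::finite => real"
 assumes finV: "finite V" and DV: "D <= V \<times> V" and gen: "Generic \<rat> (V \<times> UNIV) x"
 shows "EX W. stress D W x & (ALL W'. (ALL a z. (ALL z'. sf D W z z' = 0) --> sf D W' (%u. x (u, a)) z = 0) -->
  (ALL y z. (ALL z'. sf D W y z' = 0) --> (ALL z'. sf D W z z' = 0) --> sf D W' y z = 0))"
proof -
 have finD: "finite D" using finV DV finite_subset by blast
 have lin: "sf D (%e. a * W e + b * W' e) y z = a * sf D W y z + b * sf D W' y z" for a b W W' y z
  unfolding sf_def sum_left sum.distrib[symmetric] by (intro sum.cong refl) (simp add: algebra_simps)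
 have lin0: "sf D (%_. 0) y z = 0" for y z by (simp add: sf_def)
 have linS: "sf D (%e. SUM u:S. c u * W u e) y z = (SUM u:S. c u * sf D (W u) y z)" for S c W y z
  unfolding sf_def by (rule sum_assoc(1))
 have S0: "stress D (%_. 0) x" by (simp add: stress_def lin0)
 have SL: "stress D (%e. a * W e + b * W' e) x" if "stress D W x" "stress D W' x" for a b W W'
  using that unfolding stress_def lin by simp
 obtain S k where S: "S <= D" "ALL u:S. stress D (k u) x & (ALL u':S. k u u' = (kr u u'))"
  "ALL W. stress D W x --> (ALL w:D. W w = (SUM u:S. W u * k u w))"
  using subspace_coordinates[of D "%W. stress D W x", OF finD S0 SL] by blast
 have finS: "finite S" using S(1) finD finite_subset by blast
 define F where "F = \<rat> Un x ` (V \<times> UNIV)"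
 have "countable F" using finV by (simp add: F_def countable_rat countable_finite)
 from Generic_dense[OF this finS zero_less_one, of "%_. 0"] obtain z where z: "Generic F S z" by blast
 define W where "W e = (SUM u:S. z u * k u e)" for e
 have st: "sf D W (%u. x (u, a)) y = 0" for a y
  using S(2) unfolding W_def linS stress_def by simp
 have WS: "W u = z u" if "u : S" for u
 proof -
  have "W u = (SUM u':S. z u' * (kr u' u))" unfolding W_def by (rule sum.cong) (use S(2) that in auto)
  thus ?thesis unfolding sum_mult_delta(1)[OF finS] using that by simp
 qed
 have flat: "sf D W' y0 z0 = 0"
  if W': "!!a z. (!!z'. sf D W z z' = 0) ==> sf D W' (%u. x (u, a)) z = 0"
   and y0: "!!z'. sf D W y0 z' = 0" and z0: "!!z'. sf D W z0 z' = 0" for W' y0 z0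
 proof -
  \<comment> \<open>\<open>W'\<close> applied to \<open>x\<close> annihilates the kernel of the
    symmetric form \<open>W\<close>, hence lies in its image; \<open>- m\<close> will be the
    velocity of \<open>x\<close>.\<close>
  have "EX m. ALL w:V. sf D W' (%u. x (u, a)) (un w) = (SUM v:V. m v * sf D W (un v) (un w))" for a
  proof (rule kernel_form[OF finV finV])
   fix y assume "!!v. v : V ==> (SUM w:V. sf D W (un v) (un w) * y w) = 0"
   hence "sf D W (un v) y = 0" if "v : V" for v
    using that sf_unit[OF finV DV, of W "un v" y] by (simp add: mult.commute)
   hence "sf D W y z' = 0" for z' using sf_unit[OF finV DV, of W y z'] by (simp add: sf_sym[of D W y])
   from W'[OF this, of a] show "(SUM w:V. sf D W' (%u. x (u, a)) (un w) * y w) = 0"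
    unfolding sf_unit[OF finV DV, of W' _ y] by (simp add: mult.commute)
  qed
  then obtain m where m: "!!a w. w : V ==> sf D W' (%u. x (u, a)) (un w) = (SUM v:V. m a v * sf D W (un v) (un w))"
   by metis
  have m': "sf D W' (%u. x (u, a)) y = sf D W (m a) y" for a y
  proof -
   have "sf D W' (%u. x (u, a)) (un w) = sf D W (m a) (un w)" if "w : V" for w
    using m[OF that, of a] sf_unit[OF finV DV, of W "un w" "m a"] by (simp add: sf_sym[of D W "un w"])
   thus ?thesis unfolding sf_unit[OF finV DV, of _ _ y] by simp
  qed
  \<comment> \<open>\<open>d1\<close> moves \<open>x\<close> by \<open>- m\<close>;
    \<open>d2\<close> fixes \<open>x\<close> and corrects the motion of the free coordinates of
    \<open>W\<close> to that of \<open>W'\<close>.\<close>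
  obtain d1 where d1: "derivation d1" "ALL j:V \<times> UNIV. d1 (x j) = - m (snd j) (fst j)"
   using Generic_derivation[OF gen order_refl, of "%j. - m (snd j) (fst j)"] finV by auto
  obtain d2 where d2: "derivation d2" "ALL c:F. d2 c = 0" "ALL i:S. d2 (z i) = W' i - d1 (z i)"
   using Generic_derivation[OF z _ finS, of "%i. W' i - d1 (z i)"] by (auto simp: F_def)
  define d where "d c = d1 c + d2 c" for c
  have d: "derivation d" using derivation_comb[OF d1(1) d2(1), of 1 1] by (simp add: d_def[abs_def])
  have dx: "d (x (u, a)) = - m a u" if "u : V" for u a
   using d1(2) d2(2) that by (simp add: d_def F_def)
  have dz: "d (W u) = W' u" if "u : S" for u using d2(3) that by (simp add: d_def WS)
  have "sf D (%e. d (W e)) (%u. x (u, a)) (un w) = sf D W' (%u. x (u, a)) (un w)" for a w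
  proof -
   have "0 = d (sf D W (%u. x (u, a)) (un w))" using d st by simp
   also have "... = sf D (%e. d (W e)) (%u. x (u, a)) (un w) + sf D W (%u. d (x (u, a))) (un w)"
    by (rule derivation_sf[OF d])
   also have "sf D W (%u. d (x (u, a))) (un w) = sf D W (%u. (-1) * m a u + 0 * m a u) (un w)"
    by (rule sf_cong[OF DV]) (simp_all add: dx)
   finally show ?thesis unfolding sf_lin m' by simp
  qed
  hence "sf D (%e. d (W e)) (%u. x (u, a)) y = sf D W' (%u. x (u, a)) y" for a y
   unfolding sf_unit[OF finV DV, of _ _ y] by simp
  hence "stress D (%e. 1 * d (W e) + (-1) * W' e) x" unfolding stress_def lin by simp
  from S(3)[rule_format, OF this] have "d (W e) = W' e" if "e : D" for e using that dz by simp
  hence "sf D W' y0 z0 = sf D (%e. d (W e)) y0 z0" by (intro sf_cong[OF DV]) auto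
  also have "... = - sf D W (%u. d (y0 u)) z0"
  proof -
   have "sf D (%e. d (W e)) y0 (un w) = - sf D W (%u. d (y0 u)) (un w)" for w
    using derivation_sf[OF d, of D W y0 w] y0 d by simp
   thus ?thesis unfolding sf_unit[OF finV DV, of _ _ z0] by (simp add: sum_negf)
  qed
  also have "... = 0" using z0 by (simp add: sf_sym[of D W _ z0])
  finally show ?thesis .
 qed
 show ?thesis
  by (rule exI[of _ W]) (use st flat in "auto simp: stress_def")
qed

text \<open>\<open>folding\<close> is applied on the kernel of the stress from
  \<open>flat_stress\<close>, whose flatness gives \<open>K1\<close>. The fold provides second
  realizations for all lengths near those of \<open>t0\<close>; so \<open>t0\<close> may be moved
  slightly towards \<open>x\<close>, which stays in the kernel and reaches a generic point.\<close>

theorem large_kernels_flip: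
 fixes x :: "'a * 'd::finite => real"
 assumes finV: "finite V" and DV: "D <= V \<times> V" and gen: "Generic \<rat> (V \<times> UNIV) x"
  and card: "card V >= Suc CARD('d)" and rig: "inf_rigid V D x"
  and no: "!!W. stress D W x ==> ~ affine_kernel V D W x"
 shows "EX (x' :: 'a * 'd => real) y e0. Generic \<rat> (V \<times> UNIV) x' & (ALL e:D. dd y e = dd x' e) &
  e0 : V \<times> V & dd (y :: 'a * 'd => real) e0 ~= dd x' e0"
proof -
 have finD: "finite D" using finV DV finite_subset by blast
 obtain W where st: "stress D W x"
  and flat: "!!W' y z. (!!a z. (!!z'. sf D W z z' = 0) ==> sf D W' (%u. x (u, a)) z = 0) ==>
   (!!z'. sf D W y z' = 0) ==> (!!z'. sf D W z z' = 0) ==> sf D W' y z = 0"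
  using flat_stress[OF finV DV gen] by metis
 define Ker where "Ker y <-> (ALL z. sf D W y z = 0)" for y
 have KerL: "Ker (%v. a * y v + b * z v)" if "Ker y" "Ker z" for a b y z using that unfolding Ker_def sf_lin by simp
 have Ker1: "Ker (%_. c)" for c by (simp add: Ker_def)
 have Kerx: "Ker (%u. x (u, a))" for a using st by (simp add: Ker_def stress_def)
 obtain u0 where u0: "u0 : V" using card by fastforce
 have "EX U h. U <= V & (ALL u:U. (Ker (h u) & h u u0 = 0) & (ALL u':U. h u u' = (kr u u'))) &
  (ALL y. Ker y & y u0 = 0 --> (ALL w:V. y w = (SUM u:U. y u * h u w)))"
  by (rule subspace_coordinates[OF finV]) (auto simp: Ker1 intro: KerL)
 then obtain U h where UV: "U <= V" and hK: "!!u. u : U ==> Ker (h u)" and h0: "!!u. u : U ==> h u u0 = 0"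
  and hU: "!!u w. u : U ==> w : U ==> h u w = (kr u w)"
  and co: "!!y w. Ker y ==> y u0 = 0 ==> w : V ==> y w = (SUM u:U. y u * h u w)"
  by blast
 interpret Q: quadrics V U h u0 "TYPE('d)"
  by unfold_locales (fact finV UV u0 hU h0)+
 have finU: "finite U" by (rule Q.finU)
 have u0U: "u0 ~: U" using h0 hU by force
 define x1 where "x1 = (%(w, a). x (w, a) - x (u0, a))"
 have x1K: "Ker (%w. x1 (w, a))" for a
  using KerL[OF Kerx[of a] Ker1[of "x (u0, a)"], of 1 "-1"] by (simp add: x1_def)
 have sp: "spanning V x" by (rule Generic_spanning[OF finV card gen])
 have extx: "Q.ext x1 (w, a) = x1 (w, a)" if "w : V" for w a
  using co[OF x1K[of a] _ that] by (simp add: Q.ext_def x1_def)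
 have lfx: "Q.lf e x1 a = x (fst e, a) - x (snd e, a)" if "e : V \<times> V" for e a
  using Q.ext_diff[of x1 e a] extx that by (auto simp: x1_def)
 have lfz: "Q.lf e (%(u, b). if b = a then z u - z u0 else 0) b = (if b = a then z (fst e) - z (snd e) else 0)"
  if e: "e : V \<times> V" and z: "Ker z" for e a b z
 proof -
  have K: "Ker (%w. z w - z u0)" using KerL[OF z Ker1[of "z u0"], of 1 "-1"] by simp
  have "(SUM u:U. Q.kd e u * (z u - z u0)) = (SUM u:U. (z u - z u0) * h u (fst e)) - (SUM u:U. (z u - z u0) * h u (snd e))"
   by (simp add: Q.kd_def algebra_simps sum_subtractf sum.distrib)
  also have "... = z (fst e) - z (snd e)"
   using co[OF K, of "fst e"] co[OF K, of "snd e"] e by auto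
  finally show ?thesis by (simp add: Q.lf_def)
 qed
 have indU: "indep UNIV U (%a u. x1 (u, a))"
  unfolding indep_def
 proof (intro allI impI)
  fix c assume c: "ALL u:U. (SU a. c a * x1 (u, a)) = 0"
  have 0: "(SU a. c a * x1 (w, a)) = 0" if "w : V" for w
  proof -
   have "(SU a. c a * x1 (w, a)) = (SUM u:U. (SU a. c a * x1 (u, a)) * h u w)"
    unfolding extx[OF that, symmetric] Q.ext_def case_prod_conv by (rule sum_assoc(1)[symmetric])
   thus ?thesis using c by simp
  qed
  have "(SU a. c a * (x (u, a) - x (w, a))) = (SU a. c a * x1 (u, a)) - (SU a. c a * x1 (w, a))" for u w
   by (simp add: x1_def sum_subtractf[symmetric] algebra_simps)
  thus "ALL a:UNIV. c a = 0" using sp 0 unfolding spanning_def by simp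
 qed
 have cardU: "card U >= Suc CARD('d)"
 proof (rule ccontr)
  assume "~ ?thesis"
  hence cU: "card U = CARD('d)" using indep_card[OF indU finite finU] by simp
  have "affine_kernel V D W x"
   unfolding affine_kernel_def
  proof (intro allI impI)
   fix y assume "ALL z. sf D W y z = 0"
   hence "Ker y" by (simp add: Ker_def)
   hence K: "Ker (%w. y w - y u0)" using KerL[OF _ Ker1[of "y u0"], of y 1 "-1"] by simp
   obtain A where A: "!!u. u : U ==> (SU a. x1 (u, a) * A a) = y u - y u0"
    using square_solve[of UNIV U "%u a. x1 (u, a)" "%u. y u - y u0", OF indU finU finite cU] by blast
   have "y w = (y u0 - (SU a. A a * x (u0, a))) + (SU a. A a * x (w, a))" if w: "w : V" for w
   proof -
    have "y w - y u0 = (SUM u:U. (y u - y u0) * h u w)" using co[OF K _ w] by simp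
    also have "... = (SUM u:U. (SU a. x1 (u, a) * A a) * h u w)" by (simp add: A)
    also have "... = (SU a. A a * x1 (w, a))"
     unfolding extx[OF w, symmetric] Q.ext_def case_prod_conv by (rule sum_assoc(3))
    finally show ?thesis by (simp add: x1_def right_diff_distrib sum_subtractf)
   qed
   thus "EX A B. ALL u:V. y u = B + (SU a. A a * x (u, a))" by blast
  qed
  thus False using no st by blast
 qed
 \<comment> \<open>The length form of \<open>e\<close> as a matrix on the kernel; \<open>I\<close>
   keeps a maximal independent set of forms, from which the others follow.\<close>
 define qd where "qd e = (%(u, w). Q.kd e u * Q.kd e w)" for e
 obtain I where ID: "I <= D" and Iind: "indep I (U \<times> U) qd"
  and Isp: "!!e. e : D ==> EX m. ALL j:U \<times> U. qd e j = (SUM k:I. m k * qd k j)"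
  using max_indep[OF finD, of "U \<times> U" qd] by blast
 have gbq: "Q.gb t s e = (SUM j:U \<times> U. qd e j * (SU a. t (fst j, a) * s (snd j, a)))" for t s e
 proof -
  have "Q.gb t s e = (SU a. SUM j:U \<times> U. qd e j * (t (fst j, a) * s (snd j, a)))"
   unfolding Q.gb_def Q.lf_def sum_product sum.cartesian_product
   by (intro sum.cong refl) (auto simp: qd_def mult_ac)
  thus ?thesis unfolding sum_left by (subst sum.swap) simp
 qed
 have span: "EX m. ALL t s. Q.gb t s e = (SUM k:I. m k * Q.gb t s k)" if e: "e : D" for e
 proof -
  obtain m where m: "ALL j:U \<times> U. qd e j = (SUM k:I. m k * qd k j)" using Isp[OF e] by blast
  have "Q.gb t s e = (SUM k:I. m k * Q.gb t s k)" for t s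
  proof -
   have "Q.gb t s e = (SUM j:U \<times> U. (SUM k:I. m k * qd k j) * (SU a. t (fst j, a) * s (snd j, a)))"
    unfolding gbq[of t s e] by (rule sum.cong) (use m in auto)
   also have "... = (SUM j:U \<times> U. SUM k:I. m k * (qd k j * (SU a. t (fst j, a) * s (snd j, a))))"
    by (simp only: sum_right mult.assoc)
   also have "... = (SUM k:I. SUM j:U \<times> U. m k * (qd k j * (SU a. t (fst j, a) * s (snd j, a))))" by (rule sum.swap)
   finally show ?thesis unfolding gbq sum_left .
  qed
  thus ?thesis by blast
 qed
 have spg: "Q.g t e = Q.g s e" if "e : D" "!!i. i : I ==> Q.g t i = Q.g s i" for t s e
  using span[OF that(1)] that(2) unfolding Q.gb_self[symmetric] by (metis (no_types, lifting) sum.cong)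
 interpret Q: folding V U h u0 "TYPE('d)" I x1
 proof unfold_locales
  show "I <= V \<times> V" using ID DV by blast
 next
  fix m i assume m: "!!s. (SUM i:I. m i * Q.gb x1 s i) = 0" and i: "i : I"
  \<comment> \<open>The coefficients of the relation are read as edge weights, to which flatness
    applies.\<close>
  define W' where "W' e = (if e : I then m e else 0)" for e
  have sI: "sf D W' y z = (SUM i:I. m i * ((y (fst i) - y (snd i)) * (z (fst i) - z (snd i))))" for y z
   unfolding sf_def by (rule sum.mono_neutral_cong_right) (use finD ID in "auto simp: W'_def")
  have "sf D W' (%u. x (u, a)) z = 0" if z: "!!z'. sf D W z z' = 0" for a z
  proof -
   let ?s = "%(u, b). if b = a then z u - z u0 else 0"
   have "Ker z" using z by (simp add: Ker_def)
   have "Q.gb x1 ?s i = (x (fst i, a) - x (snd i, a)) * (z (fst i) - z (snd i))" if "i : I" for i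
   proof -
    have iV: "i : V \<times> V" using that ID DV by blast
    have "Q.gb x1 ?s i = (SU b. (x (fst i, b) - x (snd i, b)) * (z (fst i) - z (snd i)) * (kr b a))"
     unfolding Q.gb_def lfx[OF iV] lfz[OF iV \<open>Ker z\<close>] by (intro sum.cong) auto
    thus ?thesis unfolding sum_mult_delta(1)[OF finite] by simp
   qed
   thus ?thesis using m[of ?s] unfolding sI by simp
  qed
  from flat[of W', OF this] have 0: "sf D W' (h u) (h w) = 0" if "u : U" "w : U" for u w
   using hK that unfolding Ker_def by blast
  show "m i = 0"
  proof (rule indepD[OF Iind _ i])
   fix j assume "j : U \<times> U"
   then obtain u w where "j = (u, w)" "u : U" "w : U" by blast
   thus "(SUM i:I. m i * qd i j) = 0" using 0[of u w] unfolding sI by (simp add: qd_def Q.kd_def)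
  qed
 next
  fix v e assume v: "!!i. i : I ==> Q.gb x1 v i = 0" and e: "e : V \<times> V"
  have b: "bb x (Q.ext v) e = Q.gb x1 v e" if "e : V \<times> V" for e
   using that unfolding bb_def Q.gb_def by (intro sum.cong refl) (simp add: lfx Q.ext_diff)
  have "bb x (Q.ext v) e = 0" if eD: "e : D" for e
  proof -
   have "e : V \<times> V" using eD DV by blast
   moreover obtain m where "ALL t s. Q.gb t s e = (SUM k:I. m k * Q.gb t s k)" using span[OF eD] by (elim exE)
   ultimately show ?thesis using v b by simp
  qed
  thus "Q.gb x1 v e = 0" using rig b e unfolding inf_rigid_def by metis
 next
  fix f :: "'d => 'a" assume f: "inj f" "range f <= U"
  have V': "insert u0 (range f) <= V" using f(2) UV u0 by blast
  have "u0 ~: range f" using f(2) u0U by blast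
  hence "card (insert u0 (range f)) = Suc CARD('d)" using f(1) by (simp add: card_image)
  moreover have "Generic \<rat> (insert u0 (range f) \<times> UNIV) x" by (rule Generic_subset[OF gen]) (use V' in auto)
  ultimately have sp': "spanning (insert u0 (range f)) x" by (intro Generic_spanning) auto
  show "indep UNIV UNIV (%a b. x1 (f b, a))"
   unfolding indep_def
  proof (intro allI impI)
   fix c assume c: "ALL b:UNIV. (SU a. c a * x1 (f b, a)) = 0"
   have 0: "(SU a. c a * x1 (w, a)) = 0" if "w : insert u0 (range f)" for w
    using that c by (auto simp: x1_def)
   have "(SU a. c a * (x (u, a) - x (w, a))) = (SU a. c a * x1 (u, a)) - (SU a. c a * x1 (w, a))" for u w
    by (simp add: x1_def sum_subtractf[symmetric] algebra_simps)
   thus "ALL a:UNIV. c a = 0" using sp' 0 unfolding spanning_def by simp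
  qed
 next
  show "Suc CARD('d) <= card U" by (rule cardU)
 next
  fix u assume u: "u : U"
  let ?P = "%x. x (u, undefined) - x (u0, undefined) :: real"
  have "?P : polyfun \<rat> (V \<times> UNIV)"
   using u UV u0 by (intro polyfun_diff polyfun_coord) auto
  moreover have "?P (un (u, undefined)) ~= 0" using u u0U by (auto simp: un_def)
  ultimately have "?P x ~= 0" using gen[unfolded Generic_def, rule_format, of ?P "un (u, undefined)"] by blast
  thus "EX b. x1 (u, b) ~= 0" by (intro exI[of _ undefined]) (simp add: x1_def)
 qed
 obtain t0 e0 r where e0: "e0 : V \<times> V" and r: "r > 0"
  and two: "!!t'. ALL i:I. abs (Q.g t' i - Q.g t0 i) < r ==> EX t''. (ALL i:I. Q.g t'' i = Q.g t' i) & Q.g t'' e0 ~= Q.g t' e0"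
  using Q.fold by blast
 define t where "t l = (%j. (1 - l) * t0 j + l * x1 j)" for l :: real
 have "eventually (%l. ALL i:I. abs (Q.g (t l) i - Q.g t0 i) < r) (nhds 0)"
 proof (rule eventually_ball_finite[OF Q.finI], rule ballI)
  fix i
  have "((%l. (1 - l) * t0 j + l * x1 j) \<longlongrightarrow> (1 - 0) * t0 j + 0 * x1 j) (nhds 0)" for j
   by (intro tendsto_intros filterlim_ident)
  hence "((%l. Q.g (t l) i) \<longlongrightarrow> Q.g t0 i) (nhds 0)" unfolding t_def by (intro Q.g_tendsto) simp
  thus "eventually (%l. abs (Q.g (t l) i - Q.g t0 i) < r) (nhds 0)"
   unfolding dist_real_def[symmetric] by (rule tendstoD[OF _ r])
 qed
 then obtain n where n: "n > 0" "!!l. abs l < n ==> ALL i:I. abs (Q.g (t l) i - Q.g t0 i) < r"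
  unfolding eventually_nhds_metric by (auto simp: dist_real_def)
 \<comment> \<open>The realization \<open>t0\<close> with \<open>u0\<close> placed where it is in
   \<open>x\<close>, so that differences along the line to \<open>x\<close> are given by
   \<open>t l\<close>.\<close>
 define y0 where "y0 = (%(w, a). Q.ext t0 (w, a) + x (u0, a))"
 have cV: "countable (V \<times> (UNIV :: 'd set))" using finV by (simp add: countable_finite)
 obtain l where l: "abs (l - 0) < n" "Generic \<rat> (V \<times> UNIV) (%i. y0 i + l * (x i - y0 i))"
  using Generic_line[OF gen countable_rat cV n(1), of 0 y0] by blast
 define x' where "x' = (%i. y0 i + l * (x i - y0 i))"
 have x': "dd x' e = Q.g (t l) e" if e: "e : V \<times> V" for e
 proof -
  have "x' (fst e, a) - x' (snd e, a) = Q.lf e (t l) a" for a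
  proof -
   have "Q.lf e (t l) a = (1 - l) * Q.lf e t0 a + l * Q.lf e x1 a" unfolding t_def by (rule Q.lf_add)
   thus ?thesis using lfx[OF e, of a] Q.ext_diff[of t0 e a] by (simp add: x'_def y0_def algebra_simps)
  qed
  thus ?thesis by (simp add: dd_def Q.g_def)
 qed
 obtain t'' where t'': "ALL i:I. Q.g t'' i = Q.g (t l) i" "Q.g t'' e0 ~= Q.g (t l) e0"
  using two[OF n(2)] l(1) by auto
 have "ALL e:D. dd (Q.ext t'') e = dd x' e"
 proof
  fix e assume e: "e : D"
  hence "Q.g t'' e = Q.g (t l) e" by (rule spg) (use t''(1) in blast)
  thus "dd (Q.ext t'') e = dd x' e" using x' e DV by (auto simp: Q.dd_ext)
 qed
 moreover have "dd (Q.ext t'') e0 ~= dd x' e0" using t''(2) x'[OF e0] by (simp add: Q.dd_ext)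
 moreover have "Generic \<rat> (V \<times> UNIV) x'" using l(2) by (simp add: x'_def)
 ultimately show ?thesis using e0 by blast
qed

section \<open>Programs\<close>

text \<open>\<open>ew\<close>, \<open>cw\<close> and \<open>pw\<close> bound the size of a value, the cost of an evaluation and the cost of one pass
 through a program, in units of the maximal length of a number in memory.\<close>

fun ew :: "expr => nat" where
 "ew (Const n) = bits n" | "ew (Mem a) = 1" | "ew (Add a b) = ew a + ew b" | "ew (Sub a b) = ew a"
| "ew (Mul a b) = ew a + ew b" | "ew (Div a b) = ew a" | "ew (Mod a b) = ew a"

fun cw :: "expr => nat" where
 "cw (Const n) = bits n" | "cw (Mem a) = cw a + ew a + 1"
| "cw (Add a b) = cw a + cw b + ew a + ew b" | "cw (Sub a b) = cw a + cw b + ew a + ew b"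
| "cw (Mul a b) = cw a + cw b + ew a + ew b" | "cw (Div a b) = cw a + cw b + ew a + ew b"
| "cw (Mod a b) = cw a + cw b + ew a + ew b"

fun pw :: "prog => nat" where
 "pw Skip = 1" | "pw (Store a b) = 1 + cw a + cw b + ew a + ew b" | "pw (Toss a) = 1 + cw a + ew a"
| "pw (Seq c d) = pw c + pw d" | "pw (IfNZ a c d) = 1 + cw a + pw c + pw d" | "pw (WhileNZ a c) = 1 + cw a + pw c"

definition bd :: "nat => store => bool" where "bd W s <-> W >= 1 & (ALL a. s a < 2 ^ W)"

lemma bits_le: "n < 2 ^ k ==> bits n <= max 1 k"
 unfolding bits_def using floorlog_le_iff[of 2 n k] by simp

lemma less_bits: "n < 2 ^ bits n"
 unfolding bits_def using floorlog_leD[of 2 n "max 1 (floorlog 2 n)"] by simp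

lemma ew_pos: "ew e >= 1" by (induction e) (auto simp: bits_def)

lemma eval_less: "bd W s ==> eval_expr e s < 2 ^ (ew e * W)"
proof (induction e)
 case (Const n)
 have "n < 2 ^ bits n" by (rule less_bits)
 also have "(2::nat) ^ bits n <= 2 ^ (bits n * W)" using Const by (intro power_increasing) (auto simp: bd_def)
 finally show ?case by simp
next
 case (Add a b)
 have p: "1 <= ew a * W" "1 <= ew b * W" using ew_pos[of a] ew_pos[of b] Add.prems by (auto simp: bd_def)
 have "eval_expr (Add a b) s < 2 ^ (ew a * W) + 2 ^ (ew b * W)" using Add by simp
 also have "... <= 2 ^ (ew a * W) * 2 ^ (ew b * W)"
 proof -
  have "(2::nat) <= 2 ^ (ew a * W)" "(2::nat) <= 2 ^ (ew b * W)" using p power_increasing[of 1 _ "2::nat"] by auto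
  then obtain x y where "(2::nat) ^ (ew a * W) = 2 + x" "(2::nat) ^ (ew b * W) = 2 + y" by (metis le_Suc_ex)
  thus ?thesis by simp
 qed
 finally show ?case by (simp add: add_mult_distrib power_add)
next
 case (Mul a b)
 thus ?case by (simp add: add_mult_distrib power_add mult_strict_mono)
next
 case (Mod a b)
 thus ?case using le_less_trans[OF mod_less_eq_dividend] by simp
next
 case (Div a b)
 thus ?case using le_less_trans[OF div_le_dividend] by simp
qed (auto simp: bd_def)

lemma bits_eval: "bd W s ==> bits (eval_expr e s) <= ew e * W"
 using bits_le[OF eval_less, of W s e] ew_pos[of e] by (auto simp: bd_def split: if_splits)

lemma cost_le: "bd W s ==> cost_expr e s <= cw e * W"
proof (induction e)
 case (Const n)
 thus ?case by (simp add: bd_def)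
next
 case (Mem a)
 have "bits (s (eval_expr a s)) <= W" using Mem.prems bits_le[of _ W] by (auto simp: bd_def split: if_splits)
 thus ?case using Mem.IH[OF Mem.prems] bits_eval[OF Mem.prems, of a] by (simp add: add_mult_distrib)
next
 case (Add a b)
 thus ?case using bits_eval[OF Add.prems, of a] bits_eval[OF Add.prems, of b] by (simp add: add_mult_distrib)
next
 case (Sub a b)
 thus ?case using bits_eval[OF Sub.prems, of a] bits_eval[OF Sub.prems, of b] by (simp add: add_mult_distrib)
next
 case (Mul a b)
 thus ?case using bits_eval[OF Mul.prems, of a] bits_eval[OF Mul.prems, of b] by (simp add: add_mult_distrib)
next
 case (Div a b)
 thus ?case using bits_eval[OF Div.prems, of a] bits_eval[OF Div.prems, of b] by (simp add: add_mult_distrib)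
next
 case (Mod a b)
 thus ?case using bits_eval[OF Mod.prems, of a] bits_eval[OF Mod.prems, of b] by (simp add: add_mult_distrib)
qed

text \<open>Time is counted in passes of cost \<open>pw c * W\<close>; this separates the number of
  loop rounds from the size of the numbers.\<close>

definition run :: "nat => prog => store => bool list => nat => store => bool list => bool" where
 "run W c s r n s' r' <-> (EX t<=n * (pw c * W). exec c s r t s' r')"

lemma run_mono: "run W c s r n s' r' ==> n <= n' ==> run W c s r n' s' r'"
 unfolding run_def by (meson le_trans mult_le_mono1)

lemma run_Store: "bd W s ==> s' = s(eval_expr a s := eval_expr b s) ==> run W (Store a b) s r 1 s' r"
 unfolding run_def
 by (rule exI, rule conjI[rotated], simp, rule exec_Store)
  (use cost_le[of W s a] cost_le[of W s b] bits_eval[of W s a] bits_eval[of W s b] in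
   \<open>simp add: add_mult_distrib bd_def\<close>)

lemma run_Toss: "bd W s ==> s' = s(eval_expr a s := of_bool x) ==> run W (Toss a) s (x # r) 1 s' r"
 unfolding run_def
 by (rule exI, rule conjI[rotated], simp only:, rule exec_Toss)
  (use cost_le[of W s a] bits_eval[of W s a] in "simp add: add_mult_distrib bd_def")

lemma run_Seq:
 assumes "run W c s r n s1 r1" "run W d s1 r1 m s2 r2"
 shows "run W (Seq c d) s r (n + m) s2 r2"
proof -
 obtain t u where tu: "exec c s r t s1 r1" "t <= n * (pw c * W)" "exec d s1 r1 u s2 r2" "u <= m * (pw d * W)"
  using assms unfolding run_def by blast
 have "t + u <= (n + m) * (pw (Seq c d) * W)"
  using tu(2,4) by (simp add: algebra_simps)
 thus ?thesis using exec_Seq[OF tu(1,3)] unfolding run_def by blast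
qed

lemma run_If:
 assumes "bd W s" "if eval_expr a s ~= 0 then run W c s r n s' r' else run W d s r n s' r'" "n >= 1"
 shows "run W (IfNZ a c d) s r n s' r'"
proof -
 have c: "1 + cost_expr a s <= n * ((1 + cw a) * W)"
 proof -
  have "1 + cost_expr a s <= 1 * ((1 + cw a) * W)" using cost_le[OF assms(1), of a] assms(1) by (simp add: bd_def)
  also have "... <= n * ((1 + cw a) * W)" using assms(3) by (rule mult_le_mono1)
  finally show ?thesis .
 qed
 show ?thesis
 proof (cases "eval_expr a s = 0")
  case True
  then obtain t where "t <= n * (pw d * W)" "exec d s r t s' r'" using assms(2) unfolding run_def by auto
  thus ?thesis unfolding run_def
   by (intro exI[of _ "1 + cost_expr a s + t"] conjI exec_IfFalse True) (use c in "simp_all add: algebra_simps")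
 next
  case False
  then obtain t where "t <= n * (pw c * W)" "exec c s r t s' r'" using assms(2) unfolding run_def by auto
  thus ?thesis unfolding run_def
   by (intro exI[of _ "1 + cost_expr a s + t"] conjI exec_IfTrue False) (use c in "simp_all add: algebra_simps")
 qed
qed

text \<open>Each round needs \<open>n\<close> passes for the body and one for the guard, and the
  failing guard is counted as a further round.\<close>

lemma run_While:
 assumes "!!k. k <= L ==> bd W (S k)" "!!k. k < L ==> eval_expr a (S k) ~= 0" "eval_expr a (S L) = 0"
  and "!!k. k < L ==> run W c (S k) (R k) n (S (Suc k)) (R (Suc k))"
 shows "run W (WhileNZ a c) (S 0) (R 0) (Suc L * Suc n) (S L) (R L)"
proof -
 let ?A = "(pw (WhileNZ a c) * W)"
 have "run W (WhileNZ a c) (S (L - j)) (R (L - j)) (Suc j * Suc n) (S L) (R L)" if "j <= L" for j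
  using that
 proof (induction j)
  case 0
  have "1 + cost_expr a (S L) <= Suc n * ?A"
   using cost_le[OF assms(1)[OF order_refl], of a] assms(1)[of L] by (simp add: bd_def algebra_simps)
  thus ?case using exec_WhileFalse[OF assms(3)] unfolding run_def by auto
 next
  case (Suc j)
  define k where "k = L - Suc j"
  have k: "k < L" "Suc k = L - j" using Suc.prems by (auto simp: k_def)
  obtain t where t: "t <= Suc j * Suc n * ?A" "exec (WhileNZ a c) (S (Suc k)) (R (Suc k)) t (S L) (R L)"
   using Suc k(2) unfolding run_def by auto
  obtain u where u: "u <= n * (pw c * W)" "exec c (S k) (R k) u (S (Suc k)) (R (Suc k))"
   using assms(4)[OF k(1)] unfolding run_def by blast
  have "1 + cost_expr a (S k) <= (1 + cw a) * W"
   using cost_le[OF assms(1)[OF less_imp_le[OF k(1)]], of a] assms(1)[of k] k by (simp add: bd_def)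
  hence "1 + cost_expr a (S k) + u + t <= Suc (Suc j) * Suc n * ?A"
   using t(1) u(1) by (simp add: algebra_simps)
  thus ?case
   using exec_WhileTrue[OF assms(2)[OF k(1)] u(2) t(2)] unfolding run_def k_def by blast
 qed
 from this[of L] show ?thesis by simp
qed

text \<open>The working memory above the input is divided into sixteen interleaved arrays; array 0 holds the scalars.\<close>

definition mk :: "bool list => (nat => nat => nat) => store" where
 "mk x s i = (if i <= length x then input_store x i else s ((i - length x - 1) mod 16) ((i - length x - 1) div 16))"

text \<open>The offset is computed from cell 0, which holds the input length until the answer is
  written there.\<close>

definition adr :: "nat => expr => expr" where
 "adr t e = Add (Add (Mem (Const 0)) (Const (t + 1))) (Mul (Const 16) e)"

definition ar :: "nat => expr => expr" where "ar t e = Mem (adr t e)"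
definition St :: "nat => expr => expr => prog" where "St t e = Store (adr t e)"
definition inp :: "expr => expr" where "inp e = Mem (Add (Const 1) e)"
definition vr :: "nat => expr" where "vr i = ar 0 (Const i)"

lemma mk_0: "mk x s 0 = length x" by (simp add: mk_def input_store_def)

lemma eval_adr: "eval_expr (adr t e) (mk x s) = length x + 1 + t + 16 * eval_expr e (mk x s)"
 by (simp add: adr_def mk_0)

lemma mk_adr: "t < 16 ==> mk x s (length x + 1 + t + 16 * j) = s t j"
 by (simp add: mk_def)

lemma eval_ar [simp]: "t < 16 ==> eval_expr (ar t e) (mk x s) = s t (eval_expr e (mk x s))"
 unfolding ar_def eval_expr.simps eval_adr by (rule mk_adr)

lemma eval_vr [simp]: "eval_expr (vr i) (mk x s) = s 0 i" by (simp add: vr_def)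

lemma eval_inp: "eval_expr e (mk x s) < length x ==> eval_expr (inp e) (mk x s) = of_bool (x ! eval_expr e (mk x s))"
 by (simp add: inp_def mk_def input_store_def)

definition upd :: "(nat => nat => nat) => nat => nat => nat => nat => nat => nat" where
 "upd s t j y = s(t := (s t)(j := y))"

lemma mk_upd: "t < 16 ==> (mk x s)(length x + 1 + t + 16 * j := y) = mk x (upd s t j y)"
proof
 let ?A = "length x + 1 + t + 16 * j"
 fix i assume t: "t < 16"
 have *: "i = ?A" if "~ i <= length x" "(i - length x - 1) mod 16 = t" "(i - length x - 1) div 16 = j"
  using that(1) mult_div_mod_eq[of 16 "i - length x - 1"] unfolding that(2,3) by linarith
 show "((mk x s)(?A := y)) i = mk x (upd s t j y) i"
 proof (cases "i = ?A")
  case True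
  hence "mk x (upd s t j y) i = upd s t j y t j" using mk_adr[OF t] by simp
  thus ?thesis using True by (simp add: upd_def)
 next
  case False
  thus ?thesis unfolding mk_def upd_def by auto
 qed
qed

definition bds :: "nat => bool list => (nat => nat => nat) => bool" where
 "bds W x s <-> 1 <= W & length x < 2 ^ W & (ALL t j. s t j < 2 ^ W)"

lemma bds_bd: "bds W x s ==> bd W (mk x s)"
using one_less_power[of "2::nat" W] by (auto simp: bds_def mk_def input_store_def bd_def)

lemma bds_upd: "bds W x s ==> y < 2 ^ W ==> bds W x (upd s t j y)" by (auto simp: bds_def upd_def)

lemma run_St:
 "bds W x s ==> t < 16 ==> eval_expr e (mk x s) = j ==> eval_expr b (mk x s) = y ==>
  run W (St t e b) (mk x s) r 1 (mk x (upd s t j y)) r"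
 unfolding St_def by (rule run_Store[OF bds_bd]) (simp_all only: eval_adr mk_upd)

definition For :: "nat => expr => prog => prog" where
 "For i n c = Seq (St 0 (Const i) (Const 0)) (WhileNZ (Sub n (vr i)) (Seq c (St 0 (Const i) (Add (vr i) (Const 1)))))"

lemma run_For:
 assumes b: "!!k. k <= L ==> bds W x (S k)" "!!k. k < L ==> bds W x (S' k)" "bds W x s"
  and S0: "S 0 = upd s 0 i 0" and SS: "!!k. k < L ==> S (Suc k) = upd (S' k) 0 i (Suc k)"
  and S': "!!k. k < L ==> S' k 0 i = k"
  and n: "!!k. k <= L ==> eval_expr n (mk x (S k)) = L"
  and c: "!!k. k < L ==> run W c (mk x (S k)) (R k) m (mk x (S' k)) (R (Suc k))"
 shows "run W (For i n c) (mk x s) (R 0) (Suc L * (m + 2) + 1) (mk x (S L)) (R L)"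
proof -
 let ?A = "(Seq c (St 0 (Const i) (Add (vr i) (Const 1))))"
 have Si: "S k 0 i = k" if "k <= L" for k using S0 SS that by (cases k) (auto simp: upd_def)
 have "run W ?A (mk x (S k)) (R k) (m + 1) (mk x (S (Suc k))) (R (Suc k))" if "k < L" for k
  by (rule run_Seq[OF c[OF that]]) (use SS[OF that] S'[OF that] in \<open>simp only:\<close>, rule run_St[OF b(2)[OF that]], use S'[OF that] in simp_all)
 from run_While[where S = "%k. mk x (S k)" and R = R and a = "Sub n (vr i)", OF bds_bd[OF b(1)] _ _ this]
 have "run W (WhileNZ (Sub n (vr i)) ?A) (mk x (S 0)) (R 0) (Suc L * Suc (m + 1)) (mk x (S L)) (R L)"
  using n Si by simp
 from run_Seq[OF run_St[OF b(3), of 0 "Const i" i "Const 0" 0 "R 0"] this[unfolded S0]]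
 show ?thesis unfolding For_def by (simp add: add.commute)
qed

text \<open>For bodies whose effect is known only through an invariant: the successive states are
  chosen, which reduces the claim to \<open>run_For\<close>.\<close>

lemma run_For_inv:
 assumes inv: "!!k q. Inv k q ==> k <= L ==> bds W x q & q 0 i = k & eval_expr n (mk x q) = L"
  and init: "bds W x q" "Inv 0 (upd q 0 i 0)"
  and step: "!!k q. k < L ==> Inv k q ==> EX q'. run W c (mk x q) (R k) m (mk x q') (R (Suc k)) &
   bds W x q' & q' 0 i = k & Inv (Suc k) (upd q' 0 i (Suc k))"
 shows "EX q'. run W (For i n c) (mk x q) (R 0) (Suc L * (m + 2) + 1) (mk x q') (R L) & Inv L q'"
proof -
 define nx where "nx k q = (SOME q'. run W c (mk x q) (R k) m (mk x q') (R (Suc k)) &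
   bds W x q' & q' 0 i = k & Inv (Suc k) (upd q' 0 i (Suc k)))" for k q
 define S where "S = rec_nat (upd q 0 i 0) (%k s. upd (nx k s) 0 i (Suc k))"
 have nx: "run W c (mk x q) (R k) m (mk x (nx k q)) (R (Suc k)) &
   bds W x (nx k q) & nx k q 0 i = k & Inv (Suc k) (upd (nx k q) 0 i (Suc k))" if "k < L" "Inv k q" for k q
  using someI_ex[OF step[OF that]] unfolding nx_def .
 have S: "S 0 = upd q 0 i 0" "S (Suc k) = upd (nx k (S k)) 0 i (Suc k)" for k by (simp_all add: S_def)
 have I: "Inv k (S k)" if "k <= L" for k using that by (induction k) (use init(2) nx S in auto)
 have "run W (For i n c) (mk x q) (R 0) (Suc L * (m + 2) + 1) (mk x (S L)) (R L)"
  by (rule run_For[where S' = "%k. nx k (S k)"]) (use inv I nx S init(1) in auto)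
 thus ?thesis using I[OF order_refl] by blast
qed

subsection \<open>Array loops modulo N\<close>

definition rp :: "nat => int => nat" where "rp N z = nat (z mod int N)"

text \<open>The state inside a loop, which differs from the start only in array \<open>t\<close> and
  in the loop counter, scalar 0.\<close>

definition st :: "(nat => nat => nat) => nat => (nat => nat) => nat => nat => nat => nat" where
 "st s t f k = s(t := f, 0 := (s 0)(0 := k))"

lemma rp_less: "N > 0 ==> rp N z < N"
 by (simp add: rp_def nat_less_iff)

lemma rp_int: "N > 0 ==> int (rp N z) = z mod int N" by (simp add: rp_def)

lemma rp_zero: "N > 0 ==> rp N z = 0 <-> int N dvd z"
 by (simp add: rp_def dvd_eq_mod_eq_0 flip: of_nat_eq_iff[where 'a = int])

lemma rp_eqI: "N > 0 ==> int y mod int N = z mod int N ==> y mod N = rp N z"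
 by (metis nat_int rp_def zmod_int)

lemma bds_st: "bds W x s ==> (!!j. f j < 2 ^ W) ==> k < 2 ^ W ==> bds W x (st s t f k)"
 by (auto simp: bds_def st_def)

lemma st_simps [simp]:
 "t ~= 0 ==> st S t f k t = f" "s ~= 0 ==> s ~= t ==> st S t f k s = S s"
 "st S t f k 0 0 = k" "i ~= 0 ==> t ~= 0 ==> st S t f k 0 i = S 0 i"
 by (simp_all add: st_def)

text \<open>Nested loops are flattened into one loop, whose counter the expressions split by
  \<open>Div\<close> and \<open>Mod\<close>. Scalar 2 holds the modulus.\<close>

definition Acc :: "expr => nat => expr => expr => prog" where
 "Acc n t a b = For 0 n (St t a (Mod (Add (ar t a) b) (vr 2)))"

definition Asg :: "expr => nat => expr => prog" where
 "Asg n t b = For 0 n (St t (vr 0) (Mod b (vr 2)))"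

definition ready :: "nat => bool list => nat => (nat => nat => nat) => bool" where
 "ready W x N s <-> bds W x s & s 0 2 = N & 0 < N"

lemma ready_st: "ready W x N s ==> t ~= 0 ==> k < 2 ^ W ==> ready W x N (st s t (%j. rp N (z j)) k)"
proof -
 assume a: "ready W x N s" "t ~= 0" "k < 2 ^ W"
 hence "N < 2 ^ W" by (auto simp: ready_def bds_def)
 hence "rp N (z j) < 2 ^ W" for j using rp_less[of N "z j"] a(1) by (simp add: ready_def)
 thus ?thesis using a by (simp add: ready_def bds_st)
qed

lemma run_loop:
 assumes r: "ready W x N s" and t: "0 < t" "t < 16" and L: "L < 2 ^ W"
  and z0: "s t = (%j. rp N (zz 0 j))"
  and n: "!!f k. eval_expr n (mk x (st s t f k)) = L"
  and a: "!!f k. k < L ==> eval_expr a (mk x (st s t f k)) = A k"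
  and b: "!!k. k < L ==> int (eval_expr b (mk x (st s t (%j. rp N (zz k j)) k))) mod int N = B k mod int N"
  and zz: "!!k. k < L ==> zz (Suc k) = (zz k)(A k := B k)"
 shows "run W (For 0 n (St t a (Mod b (vr 2)))) (mk x s) r (3 * L + 4) (mk x (st s t (%j. rp N (zz L j)) L)) r"
proof -
 let ?S = "%k. st s t (%j. rp N (zz k j)) k" and ?S' = "%k. st s t (%j. rp N (zz (Suc k) j)) k"
 have N: "N > 0" and b2: "bds W x s" and N2: "s 0 2 = N" using r by (auto simp: ready_def)
 have bS: "bds W x (?S k)" "bds W x (?S' k)" if "k <= L" for k
  using ready_st[OF r, of t k] that L t by (auto simp: ready_def)
 have "run W (For 0 n (St t a (Mod b (vr 2)))) (mk x s) r (Suc L * (1 + 2) + 1) (mk x (?S L)) r"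
 proof (rule run_For[where S = ?S and S' = ?S' and R = "%_. r"])
  show "?S 0 = upd s 0 0 0" using z0 by (auto simp: st_def upd_def)
  fix k assume k: "k < L"
  show "?S (Suc k) = upd (?S' k) 0 0 (Suc k)" by (auto simp: st_def upd_def)
  show "?S' k 0 0 = k" by simp
  have e: "?S' k = upd (?S k) t (A k) (rp N (B k))" using t zz[OF k] by (auto simp: st_def upd_def fun_eq_iff)
  have v: "eval_expr (Mod b (vr 2)) (mk x (?S k)) = rp N (B k)"
   using rp_eqI[OF N b[OF k]] t N2 by simp
  show "run W (St t a (Mod b (vr 2))) (mk x (?S k)) r 1 (mk x (?S' k)) r"
   unfolding e by (rule run_St[OF bS(1)]) (use k t a v in simp_all)
 qed (use bS b2 n in auto)
 thus ?thesis by (rule run_mono) simp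
qed

lemma run_Acc:
 assumes r: "ready W x N s" and t: "0 < t" "t < 16" and L: "L < 2 ^ W"
  and z0: "s t = (%j. rp N (z j))"
  and n: "!!f k. eval_expr n (mk x (st s t f k)) = L"
  and a: "!!f k. k < L ==> eval_expr a (mk x (st s t f k)) = A k"
  and b: "!!f k. k < L ==> int (eval_expr b (mk x (st s t f k))) mod int N = B k mod int N"
 shows "run W (Acc n t a b) (mk x s) r (3 * L + 4)
  (mk x (st s t (%j. rp N (z j + (SUM k | k < L & A k = j. B k))) L)) r"
 unfolding Acc_def
proof (rule run_loop[where zz = "%K j. z j + (SUM k | k < K & A k = j. B k)" and A = A
   and B = "%K. z (A K) + (SUM k | k < Suc K & A k = A K. B k)", OF r t L _ n a])
 have e: "(SUM k | k < Suc K & A k = j. B k) = (SUM k | k < K & A k = j. B k) + (if A K = j then B K else 0)" for K j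
 proof -
  have "{k. k < Suc K & A k = j} = (if A K = j then insert K {k. k < K & A k = j} else {k. k < K & A k = j})"
   by (auto simp: less_Suc_eq)
  thus ?thesis by (cases "A K = j") (simp_all only: if_True if_False, simp)
 qed
 show "(%j. z j + (SUM k | k < Suc K & A k = j. B k)) =
   (%j. z j + (SUM k | k < K & A k = j. B k))(A K := z (A K) + (SUM k | k < Suc K & A k = A K. B k))" for K
  unfolding fun_upd_def e by (rule ext) simp
 fix K assume K: "K < L"
 let ?f = "%j. rp N (z j + (SUM k | k < K & A k = j. B k))"
 have "N > 0" using r by (simp add: ready_def)
 have "int (eval_expr (Add (ar t a) b) (mk x (st s t ?f K))) mod int N =
   ((z (A K) + (SUM k | k < K & A k = A K. B k)) mod int N + int (eval_expr b (mk x (st s t ?f K)))) mod int N"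
  using a[OF K] t \<open>N > 0\<close> by (simp add: rp_int)
 also have "... = (z (A K) + (SUM k | k < K & A k = A K. B k) + B K) mod int N"
  by (rule mod_add_cong[OF mod_mod_trivial b[OF K]])
 finally show "int (eval_expr (Add (ar t a) b) (mk x (st s t ?f K))) mod int N =
   (z (A K) + (SUM k | k < Suc K & A k = A K. B k)) mod int N"
  by (simp add: e add_ac)
qed (use z0 in simp_all)

lemma run_Asg:
 assumes r: "ready W x N s" and t: "0 < t" "t < 16" and L: "L < 2 ^ W"
  and z0: "s t = (%j. rp N (z j))"
  and n: "!!f k. eval_expr n (mk x (st s t f k)) = L"
  and b: "!!f k. k < L ==> int (eval_expr b (mk x (st s t f k))) mod int N = B k mod int N"
 shows "run W (Asg n t b) (mk x s) r (3 * L + 4) (mk x (st s t (%j. rp N (if j < L then B j else z j)) L)) r"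
 unfolding Asg_def
 by (rule run_loop[where zz = "%K j. if j < K then B j else z j" and A = "%k. k" and B = B, OF r t L _ n])
  (use z0 b in "auto simp: fun_eq_iff less_Suc_eq")

text \<open>Undoes the flattening: the rounds that hit cell \<open>a\<close> form an inner
  loop.\<close>

lemma sum_div:
 fixes f :: "nat => 'b::comm_monoid_add"
 assumes "a < m"
 shows "(SUM k | k < m * n & k div n = a. f k) = (SUM j<n. f (a * n + j))"
proof -
 let ?A = "(%j. a * n + j) ` {..<n}"
 have "{k. k < m * n & k div n = a} = ?A"
 proof (intro set_eqI iffI)
  fix k assume "k : {k. k < m * n & k div n = a}"
  hence k: "k < m * n" "k div n = a" by auto
  hence "n > 0" by (cases n) auto
  thus "k : ?A"
   using k div_mult_mod_eq[of k n] by (intro image_eqI[of _ _ "k mod n"]) auto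
 next
  fix k assume "k : ?A"
  then obtain j where j: "k = a * n + j" "j < n" by auto
  have "a * n + j < Suc a * n" using j by simp
  also have "... <= m * n" using assms by (intro mult_le_mono1) simp
  finally show "k : {k. k < m * n & k div n = a}" using j by simp
 qed
 thus ?thesis by (simp add: sum.reindex inj_on_def)
qed

subsection \<open>The Faddeev--LeVerrier iteration\<close>

definition eqx :: "expr => expr => expr" where "eqx a b = Sub (Const 1) (Add (Sub a b) (Sub b a))"

lemma eval_eqx [simp]: "eval_expr (eqx a b) s = (if eval_expr a s = eval_expr b s then 1 else 0)"
 by (simp add: eqx_def)

text \<open>Negation modulo the number in scalar 2 as multiplication by its predecessor, since
  \<open>Sub\<close> is truncated.\<close>

definition neg :: "expr => expr" where "neg a = Mul (Sub (vr 2) (Const 1)) a"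

lemma eval_neg: "s 0 2 = N ==> N > 0 ==> int (eval_expr (neg a) (mk x s)) mod int N = (- int (eval_expr a (mk x s))) mod int N"
proof -
 assume "s 0 2 = N" "N > 0"
 hence e: "int (eval_expr (neg a) (mk x s)) = - int (eval_expr a (mk x s)) + int N * int (eval_expr a (mk x s))"
  by (simp add: neg_def of_nat_diff left_diff_distrib)
 show ?thesis unfolding e by (rule mod_mult_self2)
qed

text \<open>Array 3 holds the matrix, array 4 the current \<open>flM\<close>, array 5 their product
  and array 6 its trace. Scalar 4 is the size of the matrix and scalar 1 the index of the
  step.\<close>

definition FLstep :: prog where
 "FLstep = Seq (Asg (Mul (vr 4) (vr 4)) 5 (Const 0))
  (Seq (Acc (Mul (Mul (vr 4) (vr 4)) (vr 4)) 5 (Div (vr 0) (vr 4))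
   (Mul (ar 3 (Add (Mul (Div (Div (vr 0) (vr 4)) (vr 4)) (vr 4)) (Mod (vr 0) (vr 4))))
      (ar 4 (Add (Mul (Mod (vr 0) (vr 4)) (vr 4)) (Mod (Div (vr 0) (vr 4)) (vr 4))))))
  (Seq (Asg (Const 1) 6 (Const 0))
  (Seq (Acc (vr 4) 6 (Const 0) (ar 5 (Add (Mul (vr 0) (vr 4)) (vr 0))))
    (Asg (Mul (vr 4) (vr 4)) 4 (Add (Mul (Add (vr 1) (Const 1)) (ar 5 (vr 0)))
     (neg (Mul (ar 6 (Const 0)) (eqx (Div (vr 0) (vr 4)) (Mod (vr 0) (vr 4))))))))))"

definition FL :: prog where
 "FL = Seq (Asg (Mul (vr 4) (vr 4)) 4 (eqx (Div (vr 0) (vr 4)) (Mod (vr 0) (vr 4)))) (For 1 (vr 5) FLstep)"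

text \<open>The whole array consists of residues, so that numbers stay bounded, but only the first
  \<open>L\<close> are specified. With \<open>L = 0\<close> just the former is said, which suffices
  for an array that is to be overwritten.\<close>

definition holds :: "nat => (nat => nat => nat) => nat => nat => (nat => int) => bool" where
 "holds N s t L f <-> (EX z. s t = (%j. rp N (z j)) & (ALL j<L. z j = f j))"

lemma holdsD: "holds N s t L f ==> j < L ==> s t j = rp N (f j)" by (auto simp: holds_def)

definition same :: "nat set => nat set => (nat => nat => nat) => (nat => nat => nat) => bool" where
 "same A J s s' <-> (ALL t. t ~= 0 --> t ~: A --> s' t = s t) & (ALL j. j ~: J --> s' 0 j = s 0 j)"

lemma Asg_step:
 assumes r: "ready W x N s" and t: "0 < t" "t < 16" and L: "L < 2 ^ W" and z: "holds N s t 0 f"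
  and n: "!!f k. eval_expr n (mk x (st s t f k)) = L"
  and b: "!!f k. k < L ==> int (eval_expr b (mk x (st s t f k))) mod int N = B k mod int N"
 shows "EX s'. run W (Asg n t b) (mk x s) r (3 * L + 4) (mk x s') r & ready W x N s' & same {t} {0} s s' & holds N s' t L B"
proof -
 obtain z where z: "s t = (%j. rp N (z j))" using assms(5) unfolding holds_def by blast
 show ?thesis
  by (intro exI conjI, rule run_Asg[OF r t L z n b])
   (use ready_st[OF r] t L in "auto simp: same_def holds_def")
qed

lemma Acc_step:
 assumes r: "ready W x N s" and t: "0 < t" "t < 16" and L: "L < 2 ^ W" and z: "holds N s t M f"
  and n: "!!f k. eval_expr n (mk x (st s t f k)) = L"
  and a: "!!f k. k < L ==> eval_expr a (mk x (st s t f k)) = A k"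
  and b: "!!f k. k < L ==> int (eval_expr b (mk x (st s t f k))) mod int N = B k mod int N"
 shows "EX s'. run W (Acc n t a b) (mk x s) r (3 * L + 4) (mk x s') r & ready W x N s' & same {t} {0} s s' &
  holds N s' t M (%j. f j + (SUM k | k < L & A k = j. B k))"
proof -
 obtain z where z: "s t = (%j. rp N (z j))" "ALL j<M. z j = f j" using assms(5) unfolding holds_def by blast
 show ?thesis
  by (intro exI conjI, rule run_Acc[OF r t L z(1) n a b])
   (use ready_st[OF r] t L z(2) in "auto simp: same_def holds_def")
qed

lemma holds_same: "holds N s t L f ==> same A J s s' ==> t ~= 0 ==> t ~: A ==> holds N s' t L f"
 unfolding holds_def same_def by simp

lemma holds_mono: "holds N s t L f ==> L' <= L ==> (!!j. j < L' ==> f j = f' j) ==> holds N s t L' f'"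
 unfolding holds_def by (elim exE conjE, rule exI, rule conjI, assumption) simp

lemma same_trans: "same A J s s' ==> same B K s' s'' ==> same (A Un B) (J Un K) s s''"
 unfolding same_def by simp

lemma same_var: "same A J s s' ==> i ~: J ==> s' 0 i = s 0 i"
 unfolding same_def by simp

lemma int_mult_mod:
 assumes "N > 0" "a = rp N x" "b = rp N y"
 shows "int (a * b) mod int N = (x * y) mod int N"
 unfolding assms(2,3) of_nat_mult rp_int[OF assms(1)] by (rule mod_mult_eq)

lemma ready_upd: "ready W x N s ==> k < 2 ^ W ==> i ~= 2 ==> ready W x N (upd s 0 i k)"
 using bds_upd[of W x s k 0 i] by (auto simp: ready_def upd_def)

lemma holds_upd: "t ~= 0 ==> holds N (upd s 0 i k) t l f = holds N s t l f"
 by (simp add: holds_def upd_def)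

lemma same_upd: "same A J s s' ==> i : J ==> same A J s (upd s' 0 i k)"
 by (auto simp: same_def upd_def)

lemma run_FLstep:
 fixes A :: "nat => nat => int"
 assumes r: "ready W x N S" and v: "S 0 4 = n" "S 0 1 = k" and W: "n * n * n < 2 ^ W" "n > 0"
  and A: "holds N S 3 (n * n) (%j. A (j div n) (j mod n))"
  and M: "holds N S 4 (n * n) (%j. flM A {..<n} k (j div n) (j mod n))"
  and h: "holds N S 5 0 (%_. 0)" "holds N S 6 0 (%_. 0)"
 shows "EX S'. run W FLstep (mk x S) r (15 * (n * n * n) + 20) (mk x S') r & ready W x N S' &
  same {4, 5, 6} {0} S S' & holds N S' 4 (n * n) (%j. flM A {..<n} (Suc k) (j div n) (j mod n)) &
  holds N S' 5 0 (%_. 0) & holds N S' 6 1 (%_. flc A {..<n} k)"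
proof -
 let ?E = "(ar 5 (Add (Mul (vr 0) (vr 4)) (vr 0)))"
 let ?D = "(%j. flM A {..<n} k (j div n) (j mod n))"
 let ?C = "(Mul (Add (vr 1) (Const 1)) (ar 5 (vr 0)))"
 let ?B = "(Mul (ar 3 (Add (Mul (Div (Div (vr 0) (vr 4)) (vr 4)) (vr 4)) (Mod (vr 0) (vr 4)))) (ar 4 (Add (Mul (Mod (vr 0) (vr 4)) (vr 4)) (Mod (Div (vr 0) (vr 4)) (vr 4)))))"
 let ?A = "(Mul (ar 6 (Const 0)) (eqx (Div (vr 0) (vr 4)) (Mod (vr 0) (vr 4))))"
 have N: "N > 0" using r by (simp add: ready_def)
 have n1: "1 <= n" "n <= n * n" "n * n <= n * n * n" using W(2) by simp_all
 have L: "n * n < 2 ^ W" "n < 2 ^ W" "1 < (2::nat) ^ W" "0 < (2::nat) ^ W"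
  using le_less_trans[OF n1(3) W(1)] le_less_trans[OF n1(2) le_less_trans[OF n1(3) W(1)]] one_less_power[of "2::nat" W] r
  by (simp_all add: ready_def bds_def)
 obtain s1 where s1: "run W (Asg (Mul (vr 4) (vr 4)) 5 (Const 0)) (mk x S) r (3 * (n * n) + 4) (mk x s1) r"
  "ready W x N s1" "same {5} {0} S s1" "holds N s1 5 (n * n) (%_. 0)"
  using Asg_step[OF r _ _ L(1) h(1), of "Mul (vr 4) (vr 4)" "Const 0" "%_. 0"] v(1) by auto
 have v1: "s1 0 4 = n" "s1 0 1 = k" using same_var[OF s1(3)] v by auto
 note A1 = holds_same[OF A s1(3)] and M1 = holds_same[OF M s1(3)]
 let ?T = "%i j. SUM l<n. A i l * flM A {..<n} k l j"
 obtain s2 where s2: "run W (Acc (Mul (Mul (vr 4) (vr 4)) (vr 4)) 5 (Div (vr 0) (vr 4))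
   ?B) (mk x s1) r (3 * (n * n * n) + 4) (mk x s2) r"
  "ready W x N s2" "same {5} {0} s1 s2" "holds N s2 5 (n * n) (%j. 0 + (SUM q | q < n * n * n & q div n = j.
    A (q div n div n) (q mod n) * flM A {..<n} k (q mod n) (q div n mod n)))"
 proof (atomize_elim, rule Acc_step[OF s1(2) _ _ W(1) s1(4)])
  fix f q assume q: "q < n * n * n"
  show "eval_expr (Div (vr 0) (vr 4)) (mk x (st s1 5 f q)) = q div n" using v1 by simp
  have q1: "q div n < n * n" "q mod n < n" "q div n mod n < n" "q div n div n < n"
   using q W(2) by (simp_all add: less_mult_imp_div_less)
  have q2: "i * n + j < n * n" "(i * n + j) div n = i" "(i * n + j) mod n = j" if "i < n" "j < n" for i j
  proof -
   have "i * n + j < Suc i * n" using that by simp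
   also have "... <= n * n" using that by (intro mult_le_mono1) simp
   finally show "i * n + j < n * n" .
  qed (use that in simp_all)
  have 1: "s1 3 (q div n div n * n + q mod n) = rp N (A (q div n div n) (q mod n))"
   using holdsD[OF A1 q2(1)[OF q1(4,2)]] q2[OF q1(4,2)] by simp
  have 2: "s1 4 (q mod n * n + q div n mod n) = rp N (flM A {..<n} k (q mod n) (q div n mod n))"
   using holdsD[OF M1 q2(1)[OF q1(2,3)]] q2[OF q1(2,3)] by simp
  show "int (eval_expr ?B (mk x (st s1 5 f q))) mod int N =
   (A (q div n div n) (q mod n) * flM A {..<n} k (q mod n) (q div n mod n)) mod int N"
   using v1 int_mult_mod[OF N 1 2] by simp
 qed (use v1 in simp_all)
 have T2: "holds N s2 5 (n * n) (%j. ?T (j div n) (j mod n))"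
 proof (rule holds_mono[OF s2(4) order_refl])
  fix j assume j: "j < n * n"
  show "0 + (SUM q | q < n * n * n & q div n = j. A (q div n div n) (q mod n) * flM A {..<n} k (q mod n) (q div n mod n)) = ?T (j div n) (j mod n)"
   unfolding sum_div[OF j] by simp
 qed
 obtain s3 where s3: "run W (Asg (Const 1) 6 (Const 0)) (mk x s2) r (3 * 1 + 4) (mk x s3) r"
  "ready W x N s3" "same {6} {0} s2 s3" "holds N s3 6 1 (%_. 0)"
  using Asg_step[OF s2(2) _ _ L(3), of 6 "%_. 0" "Const 1" "Const 0" "%_. 0"]
   holds_same[OF holds_same[OF h(2) s1(3)] s2(3)] by auto
 have v3: "s3 0 4 = n" "s3 0 1 = k" using same_var[OF s2(3)] same_var[OF s3(3)] v1 by auto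
 note T3 = holds_same[OF T2 s3(3)]
 obtain s4 where s4: "run W (Acc (vr 4) 6 (Const 0) ?E) (mk x s3) r (3 * n + 4) (mk x s4) r"
  "ready W x N s4" "same {6} {0} s3 s4" "holds N s4 6 1 (%j. 0 + (SUM q | q < n & 0 = j. ?T q q))"
 proof (atomize_elim, rule Acc_step[OF s3(2) _ _ L(2) s3(4)])
  fix f q assume q: "q < n"
  have "q * n + q < Suc q * n" using q by simp
  also have "... <= n * n" using q by (intro mult_le_mono1) simp
  finally have "s3 5 (q * n + q) = rp N (?T q q)" using holdsD[OF T3, of "q * n + q"] q by simp
  thus "int (eval_expr ?E (mk x (st s3 6 f q))) mod int N = ?T q q mod int N"
   using v3 rp_int[OF N] by simp
 qed (use v3 in simp_all)
 have c4: "holds N s4 6 1 (%_. flc A {..<n} k)"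
  by (rule holds_mono[OF s4(4)]) (simp_all add: flc_def lessThan_def)
 have v4: "s4 0 4 = n" "s4 0 1 = k" using same_var[OF s4(3)] v3 by auto
 note T4 = holds_same[OF T3 s4(3)]
 have N4: "s4 0 2 = N" using s4(2) by (simp add: ready_def)
 obtain s5 where s5: "run W (Asg (Mul (vr 4) (vr 4)) 4 (Add ?C
     (neg ?A))) (mk x s4) r (3 * (n * n) + 4) (mk x s5) r"
  "ready W x N s5" "same {4} {0} s4 s5" "holds N s5 4 (n * n) (%j. flM A {..<n} (Suc k) (j div n) (j mod n))"
 proof (atomize_elim, rule Asg_step[OF s4(2) _ _ L(1)])
  have "holds N s4 4 0 ?D"
   by (rule holds_mono[OF holds_same[OF holds_same[OF holds_same[OF M1 s2(3)] s3(3)] s4(3)]]) simp_all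
  thus "holds N s4 4 0 ?D" .
  fix f j assume j: "j < n * n"
  let ?s = "mk x (st s4 4 f j)" and ?d = "if j div n = j mod n then 1 else 0 :: int"
  have t: "s4 5 j = rp N (?T (j div n) (j mod n))" by (rule holdsD[OF T4 j]) simp_all
  have c: "s4 6 0 = rp N (flc A {..<n} k)" by (rule holdsD[OF c4]) simp
  have "int (eval_expr ?A ?s) mod int N = (flc A {..<n} k * ?d) mod int N"
   using v4 c by (simp add: rp_int[OF N])
  hence 1: "int (eval_expr (neg ?A) ?s) mod int N = (- (flc A {..<n} k * ?d)) mod int N"
   using N4 N by (subst eval_neg) (auto intro: mod_minus_cong)
  have 2: "int (eval_expr ?C ?s) mod int N = (of_nat (Suc k) * ?T (j div n) (j mod n)) mod int N"
  proof -
   have "eval_expr ?C ?s = Suc k * rp N (?T (j div n) (j mod n))"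
    using v4 t by simp
   thus ?thesis by (simp only: of_nat_mult rp_int[OF N] mod_mult_right_eq)
  qed
  show "int (eval_expr (Add ?C
     (neg ?A)) ?s) mod int N =
    flM A {..<n} (Suc k) (j div n) (j mod n) mod int N"
   using mod_add_cong[OF 2 1] unfolding flM_Suc eval_expr.simps(3) of_nat_add by simp
 qed (use v4 in simp_all)
 have "run W FLstep (mk x S) r (3 * (n * n) + 4 + (3 * (n * n * n) + 4 + (3 * 1 + 4 + (3 * n + 4 + (3 * (n * n) + 4))))) (mk x s5) r"
  unfolding FLstep_def by (intro run_Seq[OF s1(1)] run_Seq[OF s2(1)] run_Seq[OF s3(1)] run_Seq[OF s4(1)] s5(1))
 hence "run W FLstep (mk x S) r (15 * (n * n * n) + 20) (mk x s5) r" by (rule run_mono) (use n1 in linarith)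
 moreover have "same {4, 5, 6} {0} S s5"
  using same_trans[OF same_trans[OF same_trans[OF same_trans[OF s1(3) s2(3)] s3(3)] s4(3)] s5(3)] by (simp add: insert_commute)
 moreover have "holds N s5 5 0 (%_. 0)" by (rule holds_mono[OF holds_same[OF T4 s5(3)]]) simp_all
 ultimately show ?thesis using s5(2,4) holds_same[OF c4 s5(3)] by auto
qed

lemma run_FL:
 fixes A :: "nat => nat => int"
 assumes r: "ready W x N S" and v: "S 0 4 = n" "S 0 5 = K" and W: "n * n * n < 2 ^ W" "n > 0" "K < 2 ^ W" "K > 0"
  and A: "holds N S 3 (n * n) (%j. A (j div n) (j mod n))"
  and h: "holds N S 4 0 (%_. 0)" "holds N S 5 0 (%_. 0)" "holds N S 6 0 (%_. 0)"
 shows "EX S'. run W FL (mk x S) r (Suc K * (18 * (n * n * n) + 30)) (mk x S') r & ready W x N S' &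
  same {4, 5, 6} {0, 1} S S' & holds N S' 4 (n * n) (%j. flM A {..<n} K (j div n) (j mod n)) &
  holds N S' 5 0 (%_. 0) & holds N S' 6 1 (%_. flc A {..<n} (K - 1))"
proof -
 let ?A = "(Suc K * (15 * (n * n * n) + 20 + 2) + 1)"
 have N: "N > 0" using r by (simp add: ready_def)
 have n1: "n <= n * n" "n * n <= n * n * n" using W(2) by simp_all
 have L: "n * n < 2 ^ W" "0 < (2::nat) ^ W" using le_less_trans[OF n1(2) W(1)] by simp_all
 obtain s0 where s0: "run W (Asg (Mul (vr 4) (vr 4)) 4 (eqx (Div (vr 0) (vr 4)) (Mod (vr 0) (vr 4)))) (mk x S) r (3 * (n * n) + 4) (mk x s0) r"
  "ready W x N s0" "same {4} {0} S s0" "holds N s0 4 (n * n) (%j. flM A {..<n} 0 (j div n) (j mod n))"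
  by (atomize_elim, rule Asg_step[OF r _ _ L(1) h(1)]) (use v(1) in simp_all)
 define Inv where "Inv k s <-> ready W x N s & same {4, 5, 6} {0, 1} S s & s 0 1 = k &
  holds N s 4 (n * n) (%j. flM A {..<n} k (j div n) (j mod n)) & holds N s 5 0 (%_. 0) & holds N s 6 0 (%_. 0) &
  (k > 0 --> holds N s 6 1 (%_. flc A {..<n} (k - 1)))" for k s
 have "EX s'. run W (For 1 (vr 5) FLstep) (mk x s0) r ?A (mk x s') r & Inv K s'"
 proof (rule run_For_inv[where R = "%_. r" and Inv = Inv])
  fix k s assume "Inv k s" "k <= K"
  thus "bds W x s & s 0 1 = k & eval_expr (vr 5) (mk x s) = K"
   using v by (auto simp: Inv_def ready_def same_def)
 next
  show "bds W x s0" using s0(2) by (simp add: ready_def)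
  have "same {4, 5, 6} {0, 1} S s0" using s0(3) by (auto simp: same_def)
  moreover have "holds N s0 5 0 (%_. 0)" "holds N s0 6 0 (%_. 0)" using holds_same[OF h(2) s0(3)] holds_same[OF h(3) s0(3)] by auto
  ultimately show "Inv 0 (upd s0 0 1 0)"
   using s0(4) unfolding Inv_def
   by (intro conjI ready_upd[OF s0(2) L(2)] same_upd) (simp_all only: holds_upd, simp_all add: upd_def)
 next
  fix k s assume k: "k < K" and "Inv k s"
  hence s: "ready W x N s" "same {4, 5, 6} {0, 1} S s" "s 0 1 = k"
   "holds N s 4 (n * n) (%j. flM A {..<n} k (j div n) (j mod n))" "holds N s 5 0 (%_. 0)" "holds N s 6 0 (%_. 0)"
   by (auto simp: Inv_def)
  have "s 0 4 = n" using same_var[OF s(2)] v by simp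
  from run_FLstep[OF s(1) this s(3) W(1,2) holds_same[OF A s(2)] s(4-6)] obtain s' where
   s': "run W FLstep (mk x s) r (15 * (n * n * n) + 20) (mk x s') r" "ready W x N s'" "same {4, 5, 6} {0} s s'"
    "holds N s' 4 (n * n) (%j. flM A {..<n} (Suc k) (j div n) (j mod n))" "holds N s' 5 0 (%_. 0)"
    "holds N s' 6 1 (%_. flc A {..<n} k)" by auto
  have "Inv (Suc k) (upd s' 0 1 (Suc k))"
   unfolding Inv_def
  proof (intro conjI impI)
   show "ready W x N (upd s' 0 1 (Suc k))" by (rule ready_upd[OF s'(2)]) (use k W(3) in simp_all)
   show "same {4, 5, 6} {0, 1} S (upd s' 0 1 (Suc k))"
    using same_upd[OF same_trans[OF s(2) s'(3)], of 1 "Suc k"] by (simp add: insert_commute)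
   show "holds N (upd s' 0 1 (Suc k)) 6 0 (%_. 0)" by (rule holds_mono[of _ _ _ 1]) (use s'(6) in "simp_all add: holds_upd")
  qed (use s'(4-6) in \<open>simp_all only: holds_upd diff_Suc_1\<close>, simp_all add: upd_def)
  moreover have "s' 0 1 = k" using same_var[OF s'(3)] s(3) by simp
  ultimately show "EX s'. run W FLstep (mk x s) r (15 * (n * n * n) + 20) (mk x s') r & bds W x s' & s' 0 1 = k &
    Inv (Suc k) (upd s' 0 1 (Suc k))"
   using s'(1,2) by (auto simp: ready_def)
 qed
 then obtain s' where s': "run W (For 1 (vr 5) FLstep) (mk x s0) r ?A (mk x s') r" "Inv K s'" by blast
 have "run W FL (mk x S) r (3 * (n * n) + 4 + ?A) (mk x s') r"
  unfolding FL_def by (rule run_Seq[OF s0(1) s'(1)])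
 hence "run W FL (mk x S) r (Suc K * (18 * (n * n * n) + 30)) (mk x s') r"
 proof (rule run_mono)
  define P where "P = n * n * n"
  have "n * n <= P" using n1 by (simp add: P_def)
  thus "3 * (n * n) + 4 + ?A <= Suc K * (18 * (n * n * n) + 30)"
   unfolding P_def[symmetric] by (simp add: algebra_simps)
 qed
 thus ?thesis using s'(2) W(4) unfolding Inv_def by auto
qed

subsection \<open>The certificate\<close>

definition dl :: "nat => nat => 'b::comm_ring_1" where "dl a b = (kr a b)"

text \<open>The rigidity matrix with numbered rows and columns: row \<open>p\<close> is the ordered
  pair \<open>(p div v, p mod v)\<close>, masked by \<open>ad\<close> unless it is an edge, and
  column \<open>s\<close> is coordinate \<open>s mod d\<close> of vertex
  \<open>s div d\<close>.\<close>

definition rr :: "nat => nat => (nat => 'b::comm_ring_1) => (nat => 'b) => nat => nat => 'b" where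
 "rr d v ad X p s = ad p * ((X (p div v * d + s mod d) - X (p mod v * d + s mod d)) *
   (dl (s div d) (p div v) - dl (s div d) (p mod v)))"

definition BB :: "nat => nat => (nat => 'b::comm_ring_1) => (nat => 'b) => nat => nat => 'b" where
 "BB d v ad X p q = (SUM s<v * d. rr d v ad X p s * rr d v ad X q s)"

text \<open>The number of coordinates minus the dimension of the group of rigid motions.\<close>

definition rk :: "nat => nat => nat" where "rk d v = v * d - d * (d + 1) div 2"

text \<open>After the \<open>v * d\<close> coordinates, \<open>X\<close> contains arbitrary edge
  weights; if the rank is \<open>rk d v\<close>, the recursion matrix turns them into a
  stress.\<close>

definition om :: "nat => nat => (nat => 'b::comm_ring_1) => (nat => 'b) => nat => 'b" where
 "om d v ad X p = (SUM q<v * v. flM (BB d v ad X) {..<v * v} (rk d v) p q * (X (v * d + q) * ad p))"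

definition OM :: "nat => nat => (nat => 'b::comm_ring_1) => (nat => 'b) => nat => nat => 'b" where
 "OM d v ad X u w = (SUM p<v * v. om d v ad X p *
   ((dl u (p div v) - dl u (p mod v)) * (dl w (p div v) - dl w (p mod v))))"

definition c1 :: "nat => nat => (nat => 'b::comm_ring_1) => (nat => 'b) => 'b" where
 "c1 d v ad X = flc (BB d v ad X) {..<v * v} (rk d v - 1)"

text \<open>Index \<open>v - d - 2\<close> tests for rank \<open>v - d - 1\<close>, the largest
  possible one when the kernel contains the affine functions of a spanning framework.\<close>

definition c2 :: "nat => nat => (nat => 'b::comm_ring_1) => (nat => 'b) => 'b" where
 "c2 d v ad X = flc (OM d v ad X) {..<v} (v - d - 2)"

subsection \<open>The algorithm\<close>

definition cge :: "nat => store => expr => int => bool" where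
 "cge N s e z <-> int (eval_expr e s) mod int N = z mod int N"

lemma cge_add: "cge N s a y ==> cge N s b z ==> cge N s (Add a b) (y + z)"
 unfolding cge_def eval_expr.simps of_nat_add by (rule mod_add_cong)

lemma cge_mult: "cge N s a y ==> cge N s b z ==> cge N s (Mul a b) (y * z)"
 unfolding cge_def eval_expr.simps of_nat_mult by (rule mod_mult_cong)

lemma cge_dl: "eval_expr a s = y ==> eval_expr b s = z ==> cge N s (eqx a b) (dl y z)"
 by (simp add: cge_def dl_def)

lemma cge_ar: "holds N s t L f ==> 0 < N ==> t < 16 ==> eval_expr e (mk x s) = j ==> j < L ==> cge N (mk x s) (ar t e) (f j)"
 by (simp add: cge_def holdsD rp_int)

lemma cge_inp: "eval_expr e (mk x s) = j ==> j < length x ==> cge N (mk x s) (inp e) (of_bool (x ! j))"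
 by (simp add: cge_def eval_inp)

definition xv :: expr where "xv = vr 3"
definition xd :: "nat => expr" where "xd d = Mul xv (Const d)"
definition xx :: expr where "xx = Mul xv xv"
definition ed :: "expr => expr => expr" where
 "ed a p = Add (eqx a (Div p xv)) (neg (eqx a (Mod p xv)))"

definition rows_prog :: "nat => prog" where
 "rows_prog d = (let p = Div (vr 0) (xd d); s = Mod (vr 0) (xd d); c = (%u. ar 1 (Add (Mul u (Const d)) (Mod s (Const d)))) in
   Asg (Mul xx (xd d)) 2 (Mul (inp p) (Mul (Add (c (Div p xv)) (neg (c (Mod p xv)))) (ed (Div s (Const d)) p))))"

definition gram_prog :: "nat => prog" where
 "gram_prog d = (let p = Div (vr 0) (xd d); s = Mod (vr 0) (xd d) in
   Acc (Mul (Mul xx xx) (xd d)) 3 p (Mul (ar 2 (Add (Mul (Div p xx) (xd d)) s)) (ar 2 (Add (Mul (Mod p xx) (xd d)) s))))"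

definition stress_prog :: "nat => prog" where
 "stress_prog d = Acc (Mul xx xx) 7 (Div (vr 0) xx)
   (Mul (ar 4 (vr 0)) (Mul (ar 1 (Add (xd d) (Mod (vr 0) xx))) (inp (Div (vr 0) xx))))"

definition form_prog :: prog where
 "form_prog = (let q = Div (vr 0) xx; p = Mod (vr 0) xx in
   Acc (Mul xx xx) 3 q (Mul (ar 7 p) (Mul (ed (Div q xv) p) (ed (Mod q xv) p))))"

text \<open>Array 1 contains the random integers, 2 the rigidity matrix, 3 first its Gram matrix and
  later the stress matrix, 7 the stress. Array 8 saves \<open>c1\<close> from the second call of
  \<open>FL\<close>. The final product is not reduced, so it is nonzero iff both residues
  are.\<close>

definition rank_prog :: "nat => prog" where
 "rank_prog d = Seq (rows_prog d) (Seq (gram_prog d)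
   (Seq (St 0 (Const 4) xx) (Seq (St 0 (Const 5) (Sub (xd d) (Const (d * (d + 1) div 2)))) (Seq FL
   (Seq (Asg (Const 1) 8 (ar 6 (Const 0))) (Seq (stress_prog d)
   (Seq (Asg xx 3 (Const 0)) (Seq form_prog
   (Seq (St 0 (Const 4) xv) (Seq (St 0 (Const 5) (Sub xv (Const (d + 1)))) (Seq FL
    (Store (Const 0) (Mul (ar 8 (Const 0)) (ar 6 (Const 0)))))))))))))))"

text \<open>Array 10 counts the ordered pairs of distinct vertices that are not joined, and
  truncated subtraction turns the count into the answer.\<close>

definition complete_prog :: prog where
 "complete_prog = Seq (Acc xx 10 (Const 0)
   (Mul (Sub (Const 1) (inp (vr 0))) (Sub (Const 1) (eqx (Div (vr 0) xv) (Mod (vr 0) xv)))))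
   (Store (Const 0) (Sub (Const 1) (ar 10 (Const 0))))"

lemma step_index:
 fixes n :: nat
 assumes "i < m" "j < n"
 shows "i * n + j < m * n" "(i * n + j) div n = i" "(i * n + j) mod n = j"
proof -
 have "i * n + j < Suc i * n" using assms by simp
 also have "... <= m * n" using assms by (intro mult_le_mono1) simp
 finally show "i * n + j < m * n" .
qed (use assms in simp_all)

definition frame :: "nat => bool list => nat => nat => nat => (nat => int) => (nat => nat => nat) => bool" where
 "frame W x N d v X s <-> ready W x N s & s 0 3 = v & holds N s 1 (v * d + v * v) X"

lemma frame_step: "frame W x N d v X s ==> same A J s s' ==> ready W x N s' ==> 1 ~: A ==> 3 ~: J ==> frame W x N d v X s'"
 unfolding frame_def using holds_same[of N s 1 _ X A J s'] same_var[of A J s s' 3] by auto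

lemma frame_upd: "frame W x N d v X s ==> k < 2 ^ W ==> i ~= 2 ==> i ~= 3 ==> frame W x N d v X (upd s 0 i k)"
 unfolding frame_def using ready_upd[of W x N s k i] holds_upd[of 1 N s i k] by (auto simp: upd_def)

lemma ready_st2: "ready W x N S ==> 0 < t ==> holds N S s L g ==> 0 < s ==> s ~= t ==> holds N (st S t f k) s L g"
 by (simp add: holds_def)

lemma cge_diff': "s 0 2 = N ==> 0 < N ==> cge N (mk x s) a y ==> cge N (mk x s) b z ==> cge N (mk x s) (Add a (neg b)) (y - z)"
 using cge_add[of N "mk x s" a y "neg b" "- z"] mod_minus_cong[of "int (eval_expr b (mk x s))" "int N" z]
 by (simp add: cge_def eval_neg)

context
 fixes W N d v :: nat and x :: "bool list" and \<xi> :: "nat => int" and ad :: "nat => int"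
 assumes len: "length x = v * v" and d: "d > 0" and v: "v > 0" and W: "(v * v) * (v * v) * (v * v + v * d) < 2 ^ W"
  and N: "N > 0" and ad: "ad = (%p. of_bool (x ! p))"
begin

text \<open>Loop counters must fit into \<open>W\<close> bits; the longest loops compute the Gram
  matrix and the product in the recursion on \<open>v * v\<close> rows.\<close>

lemma lens: "v < 2 ^ W" "v * v < 2 ^ W" "v * v * (v * d) < 2 ^ W" "v * v * (v * v) < 2 ^ W" "v * v * (v * v) * (v * d) < 2 ^ W"
 "v * v * (v * v) * (v * v) < 2 ^ W" "v * v * v < 2 ^ W" "v * d < 2 ^ W" "1 < (2::nat) ^ W"
proof -
 let ?A = "(v * v) * (v * v) * (v * v + v * d)"
 have vv: "1 <= v * v" "v <= v * v" using v by simp_all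
 have A: "(v * v) * (v * v) * (v * v) <= ?A"
  "(v * v) * (v * v) * (v * d) <= ?A" by (intro mult_le_mono2; simp)+
 show a: "v * v * (v * v) * (v * v) < 2 ^ W" and b: "v * v * (v * v) * (v * d) < 2 ^ W"
  using A W by linarith+
 have "(v * v) * (v * v) <= (v * v) * (v * v) * (v * v)" "v * v <= (v * v) * (v * v)" "v * v * v <= (v * v) * (v * v)"
  "v * v * (v * d) <= v * v * (v * v) * (v * d)" "v * d <= v * v * (v * d)"
  using v d by (simp_all add: mult_le_mono)
 thus "v < 2 ^ W" "v * v < 2 ^ W" "v * v * (v * d) < 2 ^ W" "v * v * (v * v) < 2 ^ W" "v * v * v < 2 ^ W" "v * d < 2 ^ W"
  using a b vv by linarith+
 have "1 < v * v + v * d" using v d by (cases v; cases d) auto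
 also have "... <= ?A" using vv by simp
 finally show "1 < (2::nat) ^ W" using W by linarith
qed

lemma rows_step:
 assumes f: "frame W x N d v X S" and h: "holds N S 2 0 (%_. 0)"
 shows "EX S'. run W (rows_prog d) (mk x S) r (3 * (v * v * (v * d)) + 4) (mk x S') r & ready W x N S' & same {2} {0} S S' &
  holds N S' 2 (v * v * (v * d)) (%j. rr d v ad X (j div (v * d)) (j mod (v * d)))"
 unfolding rows_prog_def Let_def
proof (rule Asg_step[OF _ _ _ _ h])
 let ?A = "(Mod (Mod (vr 0) (xd d)) (Const d))"
 have r: "ready W x N S" "S 0 3 = v" "holds N S 1 (v * d + v * v) X" using f by (auto simp: frame_def)
 show "ready W x N S" by (rule r)
 fix f k assume k: "k < v * v * (v * d)"
 let ?p = "k div (v * d)" and ?s = "k mod (v * d)"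
 have p: "?p < v * v" "?p div v < v" "?p mod v < v" using k v by (simp_all add: less_mult_imp_div_less)
 have s: "?s mod d < d" using d by simp
 have c: "cge N (mk x (st S 2 f k)) (ar 1 (Add (Mul u (Const d)) ?A)) (X (y * d + ?s mod d))"
  if "eval_expr u (mk x (st S 2 f k)) = y" "y < v" for u y
  by (rule cge_ar[OF ready_st2[OF r(1) _ r(3)] N])
   (use that r(2) step_index(1)[OF that(2) s] in "simp_all add: xd_def xv_def")
 have "st S 2 f k 0 2 = N" using r(1) by (simp add: ready_def)
 thus "int (eval_expr (Mul (inp (Div (vr 0) (xd d))) (Mul (Add (ar 1 (Add (Mul (Div (Div (vr 0) (xd d)) xv) (Const d)) ?A))
   (neg (ar 1 (Add (Mul (Mod (Div (vr 0) (xd d)) xv) (Const d)) ?A))))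
   (ed (Div (Mod (vr 0) (xd d)) (Const d)) (Div (vr 0) (xd d))))) (mk x (st S 2 f k))) mod int N = rr d v ad X ?p ?s mod int N"
  unfolding cge_def[symmetric] rr_def ad ed_def
  by (intro cge_mult cge_inp cge_diff' cge_dl c N) (use r(2) p len in "simp_all add: xd_def xv_def")
qed (use f lens in "simp_all add: frame_def xd_def xv_def xx_def")

lemma gram_step:
 assumes f: "frame W x N d v X S" and h: "holds N S 3 (v * v * (v * v)) (%_. 0)"
  and R: "holds N S 2 (v * v * (v * d)) (%j. rr d v ad X (j div (v * d)) (j mod (v * d)))"
 shows "EX S'. run W (gram_prog d) (mk x S) r (3 * (v * v * (v * v) * (v * d)) + 4) (mk x S') r & ready W x N S' &
  same {3} {0} S S' & holds N S' 3 (v * v * (v * v)) (%j. BB d v ad X (j div (v * v)) (j mod (v * v)))"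
proof -
 let ?A = "v * v * (v * v) * (v * d)"
 have r: "ready W x N S" "S 0 3 = v" using f by (auto simp: frame_def)
 let ?b = "%k. rr d v ad X (k div (v * d) div (v * v)) (k mod (v * d)) * rr d v ad X (k div (v * d) mod (v * v)) (k mod (v * d))"
 have "EX S'. run W (gram_prog d) (mk x S) r (3 * (?A) + 4) (mk x S') r & ready W x N S' &
  same {3} {0} S S' & holds N S' 3 (v * v * (v * v)) (%j. 0 + (SUM k | k < ?A & k div (v * d) = j. ?b k))"
  unfolding gram_prog_def Let_def
 proof (rule Acc_step[OF r(1) _ _ _ h])
  fix f k assume k: "k < ?A"
  let ?p = "k div (v * d)" and ?s = "k mod (v * d)"
  have p: "?p div (v * v) < v * v" "?p mod (v * v) < v * v" "?s < v * d" using k v d by (simp_all add: less_mult_imp_div_less)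
  have c: "cge N (mk x (st S 3 f k)) (ar 2 (Add (Mul u (xd d)) (Mod (vr 0) (xd d)))) (rr d v ad X y ?s)"
   if "eval_expr u (mk x (st S 3 f k)) = y" "y < v * v" for u y
   using cge_ar[OF ready_st2[OF r(1) _ R] N, of 3 "Add (Mul u (xd d)) (Mod (vr 0) (xd d))" x f k "y * (v * d) + ?s"]
    that r(2) step_index[OF that(2) p(3)] by (simp add: xd_def xv_def)
  show "int (eval_expr (Mul (ar 2 (Add (Mul (Div (Div (vr 0) (xd d)) xx) (xd d)) (Mod (vr 0) (xd d))))
    (ar 2 (Add (Mul (Mod (Div (vr 0) (xd d)) xx) (xd d)) (Mod (vr 0) (xd d))))) (mk x (st S 3 f k))) mod int N = ?b k mod int N"
   unfolding cge_def[symmetric] by (intro cge_mult c) (use r(2) p in "simp_all add: xd_def xv_def xx_def")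
 qed (use r lens in "simp_all add: xd_def xv_def xx_def")
 note ex = this
 have e: "0 + (SUM k | k < ?A & k div (v * d) = j. ?b k) = BB d v ad X (j div (v * v)) (j mod (v * v))"
  if "j < v * v * (v * v)" for j
  unfolding sum_div[OF that] BB_def add_0 by (intro sum.cong refl) (simp add: step_index(2,3)[OF that])
 show ?thesis
  by (rule ex_forward[OF ex], elim conjE, intro conjI, assumption, assumption, assumption, rule holds_mono, assumption, rule order_refl, rule e)
qed

lemma stress_step:
 assumes f: "frame W x N d v X s" and h: "holds N s 7 (v * v) (%_. 0)"
  and M: "holds N s 4 (v * v * (v * v)) (%j. flM (BB d v ad X) {..<v * v} (rk d v) (j div (v * v)) (j mod (v * v)))"
 shows "EX s'. run W (stress_prog d) (mk x s) r (3 * (v * v * (v * v)) + 4) (mk x s') r & ready W x N s' &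
  same {7} {0} s s' & holds N s' 7 (v * v) (om d v ad X)"
proof -
 have r: "ready W x N s" "s 0 3 = v" "holds N s 1 (v * d + v * v) X" using f by (auto simp: frame_def)
 let ?b = "%k. flM (BB d v ad X) {..<v * v} (rk d v) (k div (v * v)) (k mod (v * v)) * (X (v * d + k mod (v * v)) * ad (k div (v * v)))"
 have "EX s'. run W (stress_prog d) (mk x s) r (3 * (v * v * (v * v)) + 4) (mk x s') r & ready W x N s' &
  same {7} {0} s s' & holds N s' 7 (v * v) (%j. 0 + (SUM k | k < v * v * (v * v) & k div (v * v) = j. ?b k))"
  unfolding stress_prog_def
 proof (rule Acc_step[OF r(1) _ _ _ h])
  fix f k assume k: "k < v * v * (v * v)"
  have p: "k div (v * v) < v * v" "k mod (v * v) < v * v" using k v by (simp_all add: less_mult_imp_div_less)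
  show "int (eval_expr (Mul (ar 4 (vr 0)) (Mul (ar 1 (Add (xd d) (Mod (vr 0) xx))) (inp (Div (vr 0) xx)))) (mk x (st s 7 f k))) mod int N = ?b k mod int N"
   unfolding cge_def[symmetric] ad
   by (intro cge_mult cge_inp cge_ar[OF ready_st2[OF r(1) _ M[unfolded ad]] N] cge_ar[OF ready_st2[OF r(1) _ r(3)] N])
    (use r(2) p k len in "simp_all add: xd_def xv_def xx_def")
 qed (use r lens in "simp_all add: xd_def xv_def xx_def")
 note ex = this
 have e: "0 + (SUM k | k < v * v * (v * v) & k div (v * v) = j. ?b k) = om d v ad X j" if "j < v * v" for j
  unfolding sum_div[OF that] om_def add_0 by (intro sum.cong refl) (simp add: step_index(2,3)[OF that])
 show ?thesis
  by (rule ex_forward[OF ex], elim conjE, intro conjI, assumption, assumption, assumption, rule holds_mono, assumption, rule order_refl, rule e)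
qed

lemma form_step:
 assumes f: "frame W x N d v X s" and h: "holds N s 3 (v * v) (%_. 0)" and M: "holds N s 7 (v * v) (om d v ad X)"
 shows "EX s'. run W form_prog (mk x s) r (3 * (v * v * (v * v)) + 4) (mk x s') r & ready W x N s' &
  same {3} {0} s s' & holds N s' 3 (v * v) (%j. OM d v ad X (j div v) (j mod v))"
proof -
 have r: "ready W x N s" "s 0 3 = v" using f by (auto simp: frame_def)
 let ?b = "%k. om d v ad X (k mod (v * v)) *
  ((dl (k div (v * v) div v) (k mod (v * v) div v) - dl (k div (v * v) div v) (k mod (v * v) mod v)) *
   (dl (k div (v * v) mod v) (k mod (v * v) div v) - dl (k div (v * v) mod v) (k mod (v * v) mod v)))"
 have "EX s'. run W form_prog (mk x s) r (3 * (v * v * (v * v)) + 4) (mk x s') r & ready W x N s' &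
  same {3} {0} s s' & holds N s' 3 (v * v) (%j. 0 + (SUM k | k < v * v * (v * v) & k div (v * v) = j. ?b k))"
  unfolding form_prog_def Let_def
 proof (rule Acc_step[OF r(1) _ _ _ h])
  fix f k assume k: "k < v * v * (v * v)"
  have "st s 3 f k 0 2 = N" using r(1) by (simp add: ready_def)
  thus "int (eval_expr (Mul (ar 7 (Mod (vr 0) xx)) (Mul (ed (Div (Div (vr 0) xx) xv) (Mod (vr 0) xx))
    (ed (Mod (Div (vr 0) xx) xv) (Mod (vr 0) xx)))) (mk x (st s 3 f k))) mod int N = ?b k mod int N"
   unfolding cge_def[symmetric] ed_def
   by (intro cge_mult cge_diff' cge_dl cge_ar[OF ready_st2[OF r(1) _ M] N] N) (use r(2) v in "simp_all add: xv_def xx_def")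
 qed (use r lens in "simp_all add: xv_def xx_def")
 note ex = this
 have e: "0 + (SUM k | k < v * v * (v * v) & k div (v * v) = j. ?b k) = OM d v ad X (j div v) (j mod v)" if "j < v * v" for j
  unfolding sum_div[OF that] OM_def add_0 by (intro sum.cong refl) (simp add: step_index(2,3)[OF that])
 show ?thesis
  by (rule ex_forward[OF ex], elim conjE, intro conjI, assumption, assumption, assumption, rule holds_mono, assumption, rule order_refl, rule e)
qed

lemma run_last:
 "ready W x N s ==> eval_expr e (mk x s) = y ==> run W (Store (Const 0) e) (mk x s) r 1 ((mk x s)(0 := y)) r"
 by (rule run_Store) (auto simp: ready_def bds_bd)

lemma run_rank_prog:
 assumes f: "frame W x N d v X S" and h: "!!t. 2 <= t ==> S t = (%_. 0)" and dv: "d + 2 <= v"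
 shows "EX s'. run W (rank_prog d) (mk x S) r (200 * ((v * v) * (v * v) * (v * v) * (v * d))) s' r &
  (s' 0 ~= 0 <-> ~ int N dvd c1 d v ad X & ~ int N dvd c2 d v ad X)"
proof -
 let ?E = "(%j. OM d v ad X (j div v) (j mod v))"
 let ?D = "v * v * (v * v) * (v * d)"
 let ?C = "%j. BB d v ad X (j div (v * v)) (j mod (v * v))"
 let ?B = "Suc (v - (d + 1)) * (18 * (v * v * v) + 30)"
 let ?A = "v * v * (v * v) * (v * v)"
 have h0: "holds N S t L (%_. 0)" if "2 <= t" for t L
  unfolding holds_def h[OF that] by (intro exI[of _ "%_. 0"]) (simp add: rp_def)
 have le: "d * (d + 1) div 2 < v * d"
 proof -
  have "d * (d + 1) div 2 <= d * (d + 1)" by (rule div_le_dividend)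
  also have "... < d * v" using dv d by (intro mult_strict_left_mono) simp_all
  finally show ?thesis by (simp only: mult.commute)
 qed
 have rk: "0 < rk d v" "rk d v <= v * d" unfolding rk_def using le by linarith+
 hence rk: "0 < rk d v" "rk d v <= v * d" "rk d v < 2 ^ W" using lens(8) by linarith+
 obtain a1 where a1: "run W (rows_prog d) (mk x S) r (3 * (v * v * (v * d)) + 4) (mk x a1) r" "ready W x N a1" "same {2} {0} S a1"
  "holds N a1 2 (v * v * (v * d)) (%j. rr d v ad X (j div (v * d)) (j mod (v * d)))"
  using rows_step[OF f h0] by auto
 note f1 = frame_step[OF f a1(3,2)]
 obtain a2 where a2: "run W (gram_prog d) (mk x a1) r (3 * (?D) + 4) (mk x a2) r" "ready W x N a2" "same {3} {0} a1 a2"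
  "holds N a2 3 (v * v * (v * v)) (?C)"
  using gram_step[OF f1 holds_same[OF h0 a1(3)] a1(4)] by auto
 note s2 = same_trans[OF a1(3) a2(3)]
 have f2: "frame W x N d v X a2" by (rule frame_step[OF f s2 a2(2)]) simp_all
 define b2 where "b2 = upd (upd a2 0 4 (v * v)) 0 5 (rk d v)"
 have f2': "frame W x N d v X (upd a2 0 4 (v * v))" "frame W x N d v X b2"
  unfolding b2_def using lens rk f2 by (simp_all add: frame_upd)
 have r4: "run W (St 0 (Const 4) xx) (mk x a2) r 1 (mk x (upd a2 0 4 (v * v))) r"
  by (rule run_St) (use f2 in "auto simp: frame_def ready_def xx_def xv_def")
 have r5: "run W (St 0 (Const 5) (Sub (xd d) (Const (d * (d + 1) div 2)))) (mk x (upd a2 0 4 (v * v))) r 1 (mk x b2) r"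
  unfolding b2_def by (rule run_St) (use f2'(1) in "auto simp: frame_def ready_def xd_def xv_def rk_def")
 have hb: "holds N b2 t L f = holds N a2 t L f" if "t ~= 0" for t L f unfolding b2_def using that by (simp add: holds_upd)
 have hb0: "holds N b2 t 0 (%_. 0)" if "4 <= t" for t
  using holds_same[OF h0 s2, of t 0] that by (simp add: hb)
 have sb: "same {2, 3} {0, 4, 5} S b2" using s2 unfolding b2_def by (auto simp: same_def upd_def)
 have p2: "ready W x N b2" "b2 0 4 = v * v" "b2 0 5 = rk d v" "0 < v * v"
  "holds N b2 3 (v * v * (v * v)) (?C)"
  using f2'(2) v a2(4) by (simp_all add: frame_def hb) (simp_all add: b2_def upd_def)
 obtain a3 where a3: "run W FL (mk x b2) r (Suc (rk d v) * (18 * (?A) + 30)) (mk x a3) r" "ready W x N a3"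
  "same {4, 5, 6} {0, 1} b2 a3" "holds N a3 4 (v * v * (v * v)) (%j. flM (BB d v ad X) {..<v * v} (rk d v) (j div (v * v)) (j mod (v * v)))"
  "holds N a3 5 0 (%_. 0)" "holds N a3 6 1 (%_. c1 d v ad X)"
  using run_FL[OF p2(1-3) lens(6) p2(4) rk(3,1) p2(5) hb0 hb0 hb0] unfolding c1_def by auto
 note s3 = same_trans[OF sb a3(3)]
 have f3: "frame W x N d v X a3" by (rule frame_step[OF f s3 a3(2)]) simp_all
 obtain a4 where a4: "run W (Asg (Const 1) 8 (ar 6 (Const 0))) (mk x a3) r (3 * 1 + 4) (mk x a4) r" "ready W x N a4"
  "same {8} {0} a3 a4" "holds N a4 8 1 (%_. c1 d v ad X)"
 proof (atomize_elim, rule Asg_step[OF a3(2) _ _ lens(9)])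
  show "holds N a3 8 0 (%_. 0)" using holds_same[OF h0 s3, of 8 0] by simp
  fix f k
  show "int (eval_expr (ar 6 (Const 0)) (mk x (st a3 8 f k))) mod int N = c1 d v ad X mod int N"
   unfolding cge_def[symmetric] by (rule cge_ar[OF ready_st2[OF a3(2) _ a3(6)] N]) simp_all
 qed simp_all
 note s4 = same_trans[OF s3 a4(3)]
 have f4: "frame W x N d v X a4" by (rule frame_step[OF f s4 a4(2)]) simp_all
 obtain a5 where a5: "run W (stress_prog d) (mk x a4) r (3 * (v * v * (v * v)) + 4) (mk x a5) r" "ready W x N a5"
  "same {7} {0} a4 a5" "holds N a5 7 (v * v) (om d v ad X)"
  using stress_step[OF f4 _ holds_same[OF a3(4) a4(3)]] holds_same[OF h0 s4, of 7] by auto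
 note s5 = same_trans[OF s4 a5(3)]
 have f5: "frame W x N d v X a5" by (rule frame_step[OF f s5 a5(2)]) simp_all
 have "holds N b2 3 0 (%_. 0)" by (rule holds_mono[of _ _ _ "v * v * (v * v)" "?C"]) (use a2(4) in "simp_all add: hb")
 note h5 = holds_same[OF holds_same[OF holds_same[OF this a3(3)] a4(3)] a5(3)]
 obtain a6 where a6: "run W (Asg xx 3 (Const 0)) (mk x a5) r (3 * (v * v) + 4) (mk x a6) r" "ready W x N a6"
  "same {3} {0} a5 a6" "holds N a6 3 (v * v) (%_. 0)"
  by (atomize_elim, rule Asg_step[OF a5(2) _ _ lens(2) h5]) (use f5 in "simp_all add: frame_def xx_def xv_def")
 note s6 = same_trans[OF s5 a6(3)]
 have f6: "frame W x N d v X a6" by (rule frame_step[OF f s6 a6(2)]) simp_all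
 obtain a7 where a7: "run W form_prog (mk x a6) r (3 * (v * v * (v * v)) + 4) (mk x a7) r" "ready W x N a7"
  "same {3} {0} a6 a7" "holds N a7 3 (v * v) ?E"
  using form_step[OF f6 a6(4) holds_same[OF a5(4) a6(3)]] by auto
 note s7 = same_trans[OF s6 a7(3)]
 have f7: "frame W x N d v X a7" by (rule frame_step[OF f s7 a7(2)]) simp_all
 define b7 where "b7 = upd (upd a7 0 4 v) 0 5 (v - (d + 1))"
 have f7': "frame W x N d v X (upd a7 0 4 v)" "frame W x N d v X b7"
  unfolding b7_def using lens(1) f7 by (simp_all add: frame_upd)
 have r74: "run W (St 0 (Const 4) xv) (mk x a7) r 1 (mk x (upd a7 0 4 v)) r"
  by (rule run_St) (use f7 in "auto simp: frame_def ready_def xv_def")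
 have r75: "run W (St 0 (Const 5) (Sub xv (Const (d + 1)))) (mk x (upd a7 0 4 v)) r 1 (mk x b7) r"
  unfolding b7_def by (rule run_St) (use f7'(1) in "auto simp: frame_def ready_def xv_def")
 have hb7: "holds N b7 t L f = holds N a7 t L f" if "t ~= 0" for t L f unfolding b7_def using that by (simp add: holds_upd)
 note keep = holds_same[OF holds_same[OF holds_same[OF holds_same[OF _ a4(3)] a5(3)] a6(3)] a7(3)]
 have k4: "holds N b7 4 0 (%_. 0)" and k5: "holds N b7 5 0 (%_. 0)" and k6: "holds N b7 6 0 (%_. 0)"
  using holds_mono[OF keep[OF a3(4)], of 0 "%_. 0"] keep[OF a3(5)] holds_mono[OF keep[OF a3(6)], of 0 "%_. 0"] by (simp_all add: hb7)
 have p7: "ready W x N b7" "b7 0 4 = v" "b7 0 5 = v - (d + 1)" "v - (d + 1) < 2 ^ W" "0 < v - (d + 1)"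
  "holds N b7 3 (v * v) ?E"
  using f7'(2) lens(1) dv a7(4) by (simp_all add: frame_def hb7) (simp_all add: b7_def upd_def)
 obtain a8 where a8: "run W FL (mk x b7) r (?B) (mk x a8) r" "ready W x N a8"
  "same {4, 5, 6} {0, 1} b7 a8" "holds N a8 6 1 (%_. c2 d v ad X)"
  using run_FL[OF p7(1-3) lens(7) v p7(4-6) k4 k5 k6] unfolding c2_def by (auto simp: diff_Suc numeral_2_eq_2)
 have "holds N a8 8 1 (%_. c1 d v ad X)"
  using holds_same[OF holds_same[OF holds_same[OF a4(4) a5(3)] a6(3)] a7(3)] holds_same[OF _ a8(3), of N 8 1] by (simp add: hb7)
 hence e: "a8 8 0 = rp N (c1 d v ad X)" "a8 6 0 = rp N (c2 d v ad X)" using holdsD[OF a8(4)] by (auto dest: holdsD)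
 note R = run_Seq[OF a1(1) run_Seq[OF a2(1) run_Seq[OF r4 run_Seq[OF r5 run_Seq[OF a3(1) run_Seq[OF a4(1) run_Seq[OF a5(1)
  run_Seq[OF a6(1) run_Seq[OF a7(1) run_Seq[OF r74 run_Seq[OF r75 run_Seq[OF a8(1) run_last[OF a8(2) refl]]]]]]]]]]]]]
 let ?s = "(mk x a8)(0 := eval_expr (Mul (ar 8 (Const 0)) (ar 6 (Const 0))) (mk x a8))"
 have "run W (rank_prog d) (mk x S) r (200 * ((v * v) * (v * v) * (v * v) * (v * d))) ?s r"
  unfolding rank_prog_def
 proof (rule run_mono[OF R])
  define p where "p = ?A"
  \<comment> \<open>\<open>Q\<close> dominates all summands; of the 200 units, 96 pay for the first
    call of \<open>FL\<close> and 48 for the second.\<close>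
  define Q where "Q = p * (v * d)"
  have vd: "1 <= v * d" "v <= v * d" "1 <= p" using v d by (simp_all add: p_def)
  have "1 * p <= v * d * p" using vd by (intro mult_le_mono1) simp
  hence pQ: "p <= Q" "1 <= Q" using vd by (simp_all add: Q_def mult.commute)
  have A: "v * v * (v * d) <= Q" "?D <= Q" using v d by (simp_all add: Q_def p_def mult_le_mono)
  have B: "v * v * (v * v) <= p" "v * v <= p" using v by (simp_all add: p_def mult_le_mono)
  have "Suc (rk d v) <= 2 * (v * d)" "18 * p + 30 <= 48 * p" using rk(2) vd by linarith+
  hence "Suc (rk d v) * (18 * p + 30) <= 2 * (v * d) * (48 * p)" by (rule mult_le_mono)
  hence C: "Suc (rk d v) * (18 * p + 30) <= 96 * Q" by (simp add: Q_def mult_ac)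
  have "18 * (v * v * v) + 30 <= 48 * (v * v * v)" using v by simp
  hence "?B <= v * (48 * (v * v * v))" using v by (intro mult_le_mono) auto
  moreover have "v * (v * v * v) <= p" using B(1) by (simp add: mult_ac)
  ultimately have E: "?B <= 48 * Q" using pQ by linarith
  show "3 * (v * v * (v * d)) + 4 + (3 * (?D) + 4 + (1 + (1 + (Suc (rk d v) * (18 * (?A) + 30) +
    (3 * 1 + 4 + (3 * (v * v * (v * v)) + 4 + (3 * (v * v) + 4 + (3 * (v * v * (v * v)) + 4 + (1 + (1 + (?B + 1)))))))))))
   <= 200 * (?A * (v * d))"
   unfolding p_def[symmetric] Q_def[symmetric] using A B C E pQ by linarith
 qed
 moreover have "?s 0 ~= 0 <-> ~ int N dvd c1 d v ad X & ~ int N dvd c2 d v ad X"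
  using rp_zero[OF N] by (simp add: e)
 ultimately show ?thesis by blast
qed

text \<open>The modulus must exceed \<open>v * v\<close>, lest the count of missing pairs be reduced
  to 0.\<close>

lemma run_complete_prog:
 assumes f: "frame W x N d v X q" and h: "!!t. 2 <= t ==> q t = (%_. 0)" and Nv: "v * v < N"
 shows "EX s'. run W complete_prog (mk x q) r (3 * (v * v) + 5) s' r &
  (s' 0 ~= 0 <-> (ALL p<v * v. p div v ~= p mod v --> x ! p))"
proof -
 let ?A = "(Acc xx 10 (Const 0) (Mul (Sub (Const 1) (inp (vr 0))) (Sub (Const 1) (eqx (Div (vr 0) xv) (Mod (vr 0) xv)))))"
 have r: "ready W x N q" "q 0 3 = v" using f by (auto simp: frame_def)
 have h0: "holds N q 10 1 (%_. 0)"
  unfolding holds_def h[of 10, simplified] by (intro exI[of _ "%_. 0"]) (simp add: rp_def)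
 let ?b = "%p. of_bool (~ x ! p & p div v ~= p mod v) :: int"
 obtain a where a: "run W ?A (mk x q) r (3 * (v * v) + 4) (mk x a) r"
  "ready W x N a" "holds N a 10 1 (%j. 0 + (SUM k | k < v * v & 0 = j. ?b k))"
 proof (atomize_elim, goal_cases)
  case 1
  have "EX q'. run W ?A (mk x q) r (3 * (v * v) + 4) (mk x q') r &
   ready W x N q' & same {10} {0} q q' & holds N q' 10 1 (%j. 0 + (SUM k | k < v * v & 0 = j. ?b k))"
   by (rule Acc_step[OF r(1) _ _ lens(2) h0]) (use r(2) len in "simp_all add: xx_def xv_def eval_inp")
  thus ?case by blast
 qed
 define n where "n = card {p. p < v * v & ~ x ! p & p div v ~= p mod v}"
 have S: "(SUM k | k < v * v & 0 = (0::nat). ?b k) = int n"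
  by (simp add: n_def of_bool_def sum.If_cases Int_def conj_ac)
 have "n <= card {..<v * v}" unfolding n_def by (rule card_mono) auto
 hence "n < N" using Nv by simp
 hence e: "a 10 0 = n" using holdsD[OF a(3), of 0] S by (simp add: rp_def)
 have "n = 0 <-> (ALL p<v * v. p div v ~= p mod v --> x ! p)" by (auto simp: n_def)
 thus ?thesis
  unfolding complete_prog_def
  using run_mono[OF run_Seq[OF a(1) run_last[OF a(2) refl, of "Sub (Const 1) (ar 10 (Const 0))" r]], of "3 * (v * v) + 5"] e
  by (intro exI conjI) (auto simp: e)
qed

end

section \<open>Random integers from coin tosses, and the whole program\<close>

text \<open>The integers are read in blocks of \<open>b\<close> coins, high bits first: coin
  \<open>k\<close> is appended to the integer with index \<open>k div b\<close>.\<close>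

primrec dec :: "nat => bool list => nat => nat => int" where
 "dec b r 0 = (%_. 0)"
| "dec b r (Suc k) = (dec b r k)(k div b := 2 * dec b r k (k div b) + of_bool (r ! k))"

text \<open>\<open>bt\<close> is the bit length of a random integer and \<open>nc\<close> the number
  of coins. \<open>e1\<close> and \<open>e2\<close> bound the bits that one step of the first and
  second recursion adds, by \<open>fl_bound\<close>. \<open>tt\<close> bounds the bits of both
  certificates; its summand \<open>2 * v + 1\<close> also makes the modulus exceed
  \<open>v * v\<close>.\<close>

definition bt :: "nat => nat => nat" where "bt K v = 2 * (v * v) + K"
definition e1 :: "nat => nat => nat => nat" where "e1 K d v = 5 * v + (d + 1) + 2 * bt K v"
definition e2 :: "nat => nat => nat => nat" where "e2 K d v = 6 * v + 1 + (v * d * e1 K d v + bt K v)"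
definition tt :: "nat => nat => nat => nat" where
 "tt K d v = v * d * e1 K d v + v * e2 K d v + (2 * v + 1)"
definition nc :: "nat => nat => nat => nat" where "nc K d v = (v * d + v * v) * bt K v"

definition bx :: "nat => expr" where "bx K = Add (Mul (Const 2) xx) (Const K)"
definition e1x :: "nat => nat => expr" where
 "e1x K d = Add (Add (Mul (Const 5) xv) (Const (d + 1))) (Mul (Const 2) (bx K))"
definition e2x :: "nat => nat => expr" where
 "e2x K d = Add (Add (Mul (Const 6) xv) (Const 1)) (Add (Mul (xd d) (e1x K d)) (bx K))"
definition tx :: "nat => nat => expr" where
 "tx K d = Add (Add (Mul (xd d) (e1x K d)) (Mul xv (e2x K d))) (Add (Mul (Const 2) xv) (Const 1))"

lemma eval_size [simp]:
 "s 0 3 = v ==> eval_expr (bx K) (mk x s) = bt K v" "s 0 3 = v ==> eval_expr (tx K d) (mk x s) = tt K d v"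
 by (auto simp: bx_def bt_def tx_def tt_def e1x_def e1_def e2x_def e2_def xx_def xv_def xd_def)

definition coins_prog :: "nat => nat => prog" where
 "coins_prog K d = For 0 (Mul (Add (xd d) xx) (bx K)) (Seq (Toss (adr 0 (Const 6)))
   (St 1 (Div (vr 0) (bx K)) (Mod (Add (Mul (Const 2) (ar 1 (Div (vr 0) (bx K)))) (vr 6)) (vr 2))))"

text \<open>The number of vertices is found as the square root of the input length, the modulus by
  repeated doubling. The empty graph is accepted at once.\<close>

definition main_prog :: "nat => nat => prog" where
 "main_prog K d = Seq (WhileNZ (Sub (Mem (Const 0)) xx) (St 0 (Const 3) (Add xv (Const 1))))
   (IfNZ xv (Seq (St 0 (Const 2) (Const 1)) (Seq (For 0 (tx K d) (St 0 (Const 2) (Mul (Const 2) (vr 2))))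
    (Seq (coins_prog K d) (IfNZ (Sub xv (Const (d + 1))) (rank_prog d) complete_prog))))
    (Store (Const 0) (Const 1)))"

text \<open>Enough bits for every number in memory: the input length, the modulus and all loop
  counters.\<close>

definition ww :: "nat => nat => nat => nat" where
 "ww K d v = tt K d v + nc K d v + (v * v) * (v * v) * (v * v + v * d) + v * v + 2"

definition tm :: "nat => nat => nat => nat" where
 "tm K d v = 2 * Suc v + (3 * tt K d v + 4 * nc K d v + 20 + 200 * ((v * v) * (v * v) * (v * v) * (v * d)) + 3 * (v * v))"

lemma run_coins:
 assumes r: "ready W x N S" "S 0 3 = v" "!!t. 1 <= t ==> S t = (%_. 0)" and L: "nc K d v < 2 ^ W" "nc K d v <= length rs"
 shows "EX S'. run W (coins_prog K d) (mk x S) rs (4 * nc K d v + 5) (mk x S') (drop (nc K d v) rs) &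
  frame W x N d v (dec (bt K v) rs (nc K d v)) S' & (ALL t>=2. S' t = (%_. 0))"
proof -
 let ?B = "(Toss (adr 0 (Const 6)))"
 let ?A = "(St 1 (Div (vr 0) (bx K)) (Mod (Add (Mul (Const 2) (ar 1 (Div (vr 0) (bx K)))) (vr 6)) (vr 2)))"
 let ?b = "bt K v"
 define Inv where "Inv k s <-> ready W x N s & s 0 3 = v & s 0 0 = k & s 1 = (%j. rp N (dec ?b rs k j)) & (ALL t>=2. s t = (%_. 0))" for k s
 have N: "N > 0" "N < 2 ^ W" and "0 < (2::nat) ^ W" and W1: "1 < (2::nat) ^ W"
  using r(1) one_less_power[of "2::nat" W] by (auto simp: ready_def bds_def)
 have "EX S'. run W (coins_prog K d) (mk x S) (drop 0 rs) (Suc (nc K d v) * ((1 + 1) + 2) + 1) (mk x S') (drop (nc K d v) rs) & Inv (nc K d v) S'"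
  unfolding coins_prog_def
 proof (rule run_For_inv[where Inv = Inv and R = "%k. drop k rs"])
  fix k s assume "Inv k s" "k <= nc K d v"
  thus "bds W x s & s 0 0 = k & eval_expr (Mul (Add (xd d) xx) (bx K)) (mk x s) = nc K d v"
   by (auto simp: Inv_def ready_def nc_def xd_def xx_def xv_def)
 next
  show "bds W x S" using r(1) by (simp add: ready_def)
  show "Inv 0 (upd S 0 0 0)"
   unfolding Inv_def using ready_upd[OF r(1) \<open>0 < 2 ^ W\<close>, of 0] r(2,3) by (simp add: upd_def rp_def)
 next
  fix k s assume k: "k < nc K d v" and "Inv k s"
  hence s: "ready W x N s" "s 0 3 = v" "s 0 0 = k" "s 1 = (%j. rp N (dec ?b rs k j))" "!!t. t >= 2 ==> s t = (%_. 0)"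
   by (auto simp: Inv_def)
  define s1 where "s1 = upd s 0 6 (of_bool (rs ! k))"
  have "of_bool (rs ! k) < (2::nat) ^ W" using W1 by (cases "rs ! k") auto
  hence r1: "ready W x N s1" unfolding s1_def by (intro ready_upd[OF s(1)]) auto
  have "drop k rs = rs ! k # drop (Suc k) rs" using k L(2) by (simp add: Cons_nth_drop_Suc)
  moreover have "run W ?B (mk x s) (rs ! k # drop (Suc k) rs) 1 (mk x s1) (drop (Suc k) rs)"
   using s(1) mk_upd[of 0 x s 6 "of_bool (rs ! k)"] unfolding s1_def
   by (intro run_Toss bds_bd) (auto simp: ready_def eval_adr)
  ultimately have t: "run W ?B (mk x s) (drop k rs) 1 (mk x s1) (drop (Suc k) rs)" by simp
  let ?y = "rp N (2 * dec ?b rs k (k div ?b) + of_bool (rs ! k))"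
  define s2 where "s2 = upd s1 1 (k div ?b) ?y"
  have s1': "s1 0 3 = v" "s1 0 0 = k" "s1 1 = s 1" "s1 0 6 = of_bool (rs ! k)" "s1 0 2 = N"
   using s r1 by (simp_all add: s1_def upd_def ready_def)
  have y: "(2 * s 1 (k div ?b) + of_bool (rs ! k)) mod N = ?y"
  proof (rule rp_eqI[OF N(1)])
   have "int (2 * s 1 (k div ?b) + of_bool (rs ! k)) mod int N = (2 * (dec ?b rs k (k div ?b) mod int N) + of_bool (rs ! k)) mod int N"
    unfolding s(4) by (simp add: rp_int[OF N(1)])
   also have "... = (2 * dec ?b rs k (k div ?b) + of_bool (rs ! k)) mod int N"
    by (rule mod_add_cong) (simp_all add: mod_mult_right_eq)
   finally show "int (2 * s 1 (k div ?b) + of_bool (rs ! k)) mod int N = (2 * dec ?b rs k (k div ?b) + of_bool (rs ! k)) mod int N" .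
  qed
  have st: "run W ?A (mk x s1) (drop (Suc k) rs) 1 (mk x s2) (drop (Suc k) rs)"
   unfolding s2_def by (rule run_St) (use r1 s1' y in "simp_all add: ready_def")
  have yW: "?y < 2 ^ W" using rp_less[OF N(1)] N(2) by (rule less_trans)
  have r2: "ready W x N s2" using r1 bds_upd[OF _ yW] by (auto simp: ready_def s2_def upd_def)
  have "Inv (Suc k) (upd s2 0 0 (Suc k))"
   unfolding Inv_def using ready_upd[OF r2, of "Suc k" 0] k L(1) s1' s
   by (auto simp: s2_def s1_def upd_def fun_eq_iff)
  thus "EX s'. run W (Seq ?B ?A)
    (mk x s) (drop k rs) (1 + 1) (mk x s') (drop (Suc k) rs) & bds W x s' & s' 0 0 = k & Inv (Suc k) (upd s' 0 0 (Suc k))"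
   using run_Seq[OF t st] r2 s1' by (intro exI[of _ s2]) (simp add: ready_def s2_def upd_def)
 qed
 then obtain s where s: "run W (coins_prog K d) (mk x S) rs (Suc (nc K d v) * ((1 + 1) + 2) + 1) (mk x s) (drop (nc K d v) rs)" "Inv (nc K d v) s" by auto
 have "run W (coins_prog K d) (mk x S) rs (4 * nc K d v + 5) (mk x s) (drop (nc K d v) rs)"
  by (rule run_mono[OF s(1)]) simp
 thus ?thesis using s(2) by (auto simp: Inv_def frame_def holds_def)
qed

lemma run_main:
 assumes len: "length x = v * v" and d: "d > 0" and rs: "nc K d v <= length rs"
 defines "X == dec (bt K v) rs (nc K d v)" and "ad == %p. of_bool (x ! p) :: int" and "N == 2 ^ tt K d v"
 shows "EX s' rs'. run (ww K d v) (main_prog K d) (input_store x) rs (tm K d v) s' rs' &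
  (s' 0 ~= 0 <-> (if d + 2 <= v then ~ N dvd c1 d v ad X & ~ N dvd c2 d v ad X
   else ALL p<v * v. p div v ~= p mod v --> x ! p))"
proof -
 let ?H = "(Sub (Mem (Const 0)) xx)"
 let ?G = "((v * v) * (v * v) * (v * v) * (v * d))"
 let ?F = "(if d + 2 <= v then ~ N dvd c1 d v ad X & ~ N dvd c2 d v ad X else ALL p<v * v. p div v ~= p mod v --> x ! p)"
 let ?E = "?F"
 let ?D = "?F"
 let ?C = "(St 0 (Const 2) (Mul (Const 2) (vr 2)))"
 let ?B = "(IfNZ (Sub xv (Const (d + 1))) (rank_prog d) complete_prog)"  let ?A = "(3 * tt K d v + 4 * nc K d v + 20 + 200 * ?G + 3 * (v * v))"  let ?W = "ww K d v" and ?N = "2 ^ tt K d v :: nat"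
 have N': "N = int ?N" by (simp add: N_def)
 have big: "n < 2 ^ ?W" if "n <= ?W" for n using less_le_trans[OF less_exp power_increasing[OF that]] by simp
 have W: "length x < 2 ^ ?W" "tt K d v < 2 ^ ?W" "nc K d v < 2 ^ ?W" "v < 2 ^ ?W" "1 < (2::nat) ^ ?W"
  "(v * v) * (v * v) * (v * v + v * d) < 2 ^ ?W" "(2::nat) ^ tt K d v < 2 ^ ?W"
 proof -
  have v: "v <= v * v" by simp
  show "length x < 2 ^ ?W" "tt K d v < 2 ^ ?W" "nc K d v < 2 ^ ?W" "v < 2 ^ ?W" "1 < (2::nat) ^ ?W"
   "(v * v) * (v * v) * (v * v + v * d) < 2 ^ ?W"
   using v by (intro big; simp only: ww_def len; linarith)+
  show "(2::nat) ^ tt K d v < 2 ^ ?W" by (rule power_strict_increasing) (simp_all add: ww_def)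
 qed
 define s0 where "s0 k = upd (%_ _. 0) 0 3 k" for k :: nat
 have b0: "bds ?W x (s0 k)" if "k <= v" for k
  unfolding s0_def by (rule bds_upd) (use that W in "auto simp: bds_def ww_def")
 have i0: "input_store x = mk x (s0 0)"
  by (auto simp: mk_def s0_def upd_def input_store_def fun_eq_iff)
 have find: "run ?W (WhileNZ ?H (St 0 (Const 3) (Add xv (Const 1)))) (mk x (s0 0)) rs (Suc v * Suc 1) (mk x (s0 v)) rs"
 proof (rule run_While[where S = "%k. mk x (s0 k)" and R = "%_. rs"])
  show "bd ?W (mk x (s0 k))" if "k <= v" for k by (rule bds_bd[OF b0[OF that]])
  show "eval_expr ?H (mk x (s0 v)) = 0" by (simp add: mk_0 len xx_def xv_def s0_def upd_def)
  fix k assume k: "k < v"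
  hence "k * k < v * v" by (simp add: mult_strict_mono)
  thus "eval_expr ?H (mk x (s0 k)) ~= 0" by (simp add: mk_0 len xx_def xv_def s0_def upd_def)
  have "s0 (Suc k) = upd (s0 k) 0 3 (Suc k)" by (simp add: s0_def upd_def)
  thus "run ?W (St 0 (Const 3) (Add xv (Const 1))) (mk x (s0 k)) rs 1 (mk x (s0 (Suc k))) rs"
   using b0[of k] k by (simp only:) (rule run_St, simp_all add: xv_def s0_def upd_def)
 qed
 define rest where "rest = IfNZ xv (Seq (St 0 (Const 2) (Const 1)) (Seq (For 0 (tx K d) ?C)
    (Seq (coins_prog K d) ?B))) (Store (Const 0) (Const 1))"
 have xv0: "eval_expr xv (mk x (s0 v)) = v" by (simp add: xv_def s0_def upd_def)
 have "EX s' rs'. run ?W rest (mk x (s0 v)) rs ?A s' rs' &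
  (s' 0 ~= 0 <-> ?E)"
 proof (cases "v = 0")
  case True
  have "run ?W (Store (Const 0) (Const 1)) (mk x (s0 v)) rs 1 ((mk x (s0 v))(0 := 1)) rs"
   by (rule run_Store[OF bds_bd[OF b0]]) simp_all
  hence "run ?W rest (mk x (s0 v)) rs 1 ((mk x (s0 v))(0 := 1)) rs"
   unfolding rest_def using xv0 True by (intro run_If[OF bds_bd[OF b0]]) (simp_all only:, simp_all)
  thus ?thesis
   by (intro exI conjI, rule run_mono) (use True in simp_all)
 next
  case False
  define s1 where "s1 k = upd (upd (s0 v) 0 2 (2 ^ k)) 0 0 k" for k
  have pw2: "(2::nat) ^ k < 2 ^ ?W" if "k <= tt K d v" for k
   using le_less_trans[OF power_increasing[OF that, of "2::nat"] W(7)] by simp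
  have b1: "bds ?W x (s1 k)" if "k <= tt K d v" for k
   unfolding s1_def by (intro bds_upd b0 pw2 that le_less_trans[OF that W(2)] order_refl)
  have r1: "run ?W (St 0 (Const 2) (Const 1)) (mk x (s0 v)) rs 1 (mk x (upd (s0 v) 0 2 1)) rs"
   by (rule run_St[OF b0]) simp_all
  have "run ?W (For 0 (tx K d) ?C) (mk x (upd (s0 v) 0 2 1)) rs
    (Suc (tt K d v) * (1 + 2) + 1) (mk x (s1 (tt K d v))) rs"
  proof (rule run_For[where S = s1 and S' = "%k. upd (s1 k) 0 2 (2 ^ Suc k)" and R = "%_. rs"])
   show "bds ?W x (upd (s0 v) 0 2 1)" using bds_upd[OF b0 pw2[of 0], of v 0 2] by simp
   fix k assume k: "k < tt K d v"
   show "bds ?W x (upd (s1 k) 0 2 (2 ^ Suc k))" by (rule bds_upd[OF b1 pw2]) (use k in simp_all)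
   show "s1 (Suc k) = upd (upd (s1 k) 0 2 (2 ^ Suc k)) 0 0 (Suc k)" by (simp add: s1_def upd_def fun_eq_iff)
   show "upd (s1 k) 0 2 (2 ^ Suc k) 0 0 = k" by (simp add: s1_def upd_def)
   show "run ?W ?C (mk x (s1 k)) rs 1 (mk x (upd (s1 k) 0 2 (2 ^ Suc k))) rs"
    by (rule run_St[OF b1]) (use k in "simp_all add: s1_def upd_def")
  qed (use b1 in "simp_all add: s1_def s0_def upd_def")
  hence r2: "run ?W (For 0 (tx K d) ?C) (mk x (upd (s0 v) 0 2 1)) rs (3 * tt K d v + 4) (mk x (s1 (tt K d v))) rs"
   by (rule run_mono) simp
  have rd: "ready ?W x ?N (s1 (tt K d v))" using b1 by (simp add: ready_def s1_def upd_def)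
  obtain s2 where s2: "run ?W (coins_prog K d) (mk x (s1 (tt K d v))) rs (4 * nc K d v + 5) (mk x s2) (drop (nc K d v) rs)"
   "frame ?W x ?N d v X s2" "!!t. t >= 2 ==> s2 t = (%_. 0)"
   using run_coins[OF rd _ _ W(3) rs] unfolding X_def by (auto simp: s1_def s0_def upd_def)
  let ?r = "drop (nc K d v) rs" and ?t = "200 * ?G + 3 * (v * v) + 5"
  have sv: "eval_expr (Sub xv (Const (d + 1))) (mk x s2) ~= 0 <-> d + 2 <= v"
   using s2(2) by (auto simp: frame_def xv_def)
  have bs: "bd ?W (mk x s2)" using s2(2) by (auto simp: frame_def ready_def intro: bds_bd)
  have ad: "ad = (%p. of_bool (x ! p))" by (simp add: ad_def)
  have vp: "v > 0" and Np: "?N > 0" using False by simp_all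
  have "EX s'. run ?W ?B (mk x s2) ?r ?t s' ?r &
   (s' 0 ~= 0 <-> ?D)"
  proof (cases "d + 2 <= v")
   case True
   obtain s' where s': "run ?W (rank_prog d) (mk x s2) ?r (200 * ?G) s' ?r"
    "s' 0 ~= 0 <-> ~ N dvd c1 d v ad X & ~ N dvd c2 d v ad X"
    using run_rank_prog[OF len d vp W(6) Np ad s2(2,3) True] unfolding N' by blast
   have "run ?W (rank_prog d) (mk x s2) ?r ?t s' ?r" by (rule run_mono[OF s'(1)]) simp
   thus ?thesis using s'(2) sv True by (intro exI[of _ s'] conjI run_If[OF bs]) simp_all
  next
   case F: False
   have "v < 2 ^ v" by (rule less_exp)
   hence "v * v < 2 ^ v * 2 ^ v" by (rule mult_strict_mono) simp_all
   also have "... = 2 ^ (2 * v)" by (simp add: mult_2 power_add)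
   also have "... <= ?N" by (rule power_increasing) (simp_all add: tt_def)
   finally have "v * v < ?N" .
   from run_complete_prog[OF len d vp W(6) Np ad s2(2,3) this, of ?r] obtain s' where
    s': "run ?W complete_prog (mk x s2) ?r (3 * (v * v) + 5) s' ?r" "s' 0 ~= 0 <-> (ALL p<v * v. p div v ~= p mod v --> x ! p)" by blast
   have "run ?W complete_prog (mk x s2) ?r ?t s' ?r" by (rule run_mono[OF s'(1)]) simp
   thus ?thesis using s'(2) sv F by (intro exI[of _ s'] conjI run_If[OF bs]) simp_all
  qed
  then obtain s' where s': "run ?W ?B (mk x s2) ?r ?t s' ?r"
   "s' 0 ~= 0 <-> ?D" by blast
  have "run ?W rest (mk x (s0 v)) rs (1 + (3 * tt K d v + 4 + (4 * nc K d v + 5 + ?t))) s' ?r"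
   unfolding rest_def using run_Seq[OF r1 run_Seq[OF r2 run_Seq[OF s2(1) s'(1)]]] xv0 False
   by (intro run_If[OF bds_bd[OF b0]]) (simp_all only:, simp_all)
  hence "run ?W rest (mk x (s0 v)) rs ?A s' ?r"
   by (rule run_mono) simp
  thus ?thesis using s'(2) by blast
 qed
 then obtain s' rs' where s': "run ?W rest (mk x (s0 v)) rs ?A s' rs'"
  "s' 0 ~= 0 <-> ?E" by blast
 have "run ?W (main_prog K d) (input_store x) rs (tm K d v) s' rs'"
  unfolding main_prog_def rest_def[symmetric] i0 by (rule run_mono[OF run_Seq[OF find s'(1)]]) (simp add: tm_def)
 thus ?thesis using s'(2) by blast
qed

subsection \<open>Random integers rarely annihilate a polynomial\<close>

text \<open>The degree in each variable separately, stated for functions, so that it can be computed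
  along sums and products.\<close>

definition ldeg :: "nat => ((nat => real) => real) => bool" where
 "ldeg D G <-> (ALL x j. EX p. degree p <= D & (ALL t. poly p t = G (x(j := t))))"

lemma ldeg_const: "ldeg D (%_. c)"
 unfolding ldeg_def by (intro allI exI[of _ "[:c:]"]) simp

lemma ldeg_coord: "ldeg 1 (%x. x i)"
 unfolding ldeg_def
proof (intro allI)
 fix x :: "nat => real" and j
 show "EX p. degree p <= 1 & (ALL t. poly p t = (x(j := t)) i)"
  by (cases "i = j") (auto intro: exI[of _ "[:0, 1:]"] exI[of _ "[:x i:]"])
qed

lemma ldeg_add: "ldeg D G ==> ldeg D H ==> ldeg D (%x. G x + H x)"
 unfolding ldeg_def by (metis (no_types, lifting) degree_add_le poly_add)

lemma ldeg_mult: "ldeg D G ==> ldeg D' H ==> ldeg (D + D') (%x. G x * H x)"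
 unfolding ldeg_def by (metis (no_types, lifting) add_mono degree_mult_le le_trans poly_mult)

lemma ldeg_cmult: "ldeg D H ==> ldeg D (%x. c * H x)"
 using ldeg_mult[OF ldeg_const[of 0 c], of D H] by simp

lemma ldeg_diff: "ldeg D G ==> ldeg D H ==> ldeg D (%x. G x - H x)"
 using ldeg_add[of D G "%x. - 1 * H x"] ldeg_cmult[of D H "- 1"] by simp

lemma ldeg_sum: "(!!i. i : S ==> ldeg D (G i)) ==> ldeg D (%x. SUM i:S. G i x)"
 by (induction S rule: infinite_finite_induct) (auto intro: ldeg_add ldeg_const)

lemma ldeg_fl:
 assumes "!!p q. p : P ==> q : P ==> ldeg D (%x. A x p q)"
 shows "p : P ==> q : P ==> ldeg (k * D) (%x. flM (A x) P k p q)"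
  and "ldeg (Suc k * D) (%x. flc (A x) P k)"
proof -
 have c: "ldeg (Suc k * D) (%x. flc (A x) P k)" if "!!p q. p : P ==> q : P ==> ldeg (k * D) (%x. flM (A x) P k p q)" for k
  unfolding flc_def using assms that by (simp add: add_mult_distrib) (intro ldeg_sum ldeg_mult; simp)
 show M: "ldeg (k * D) (%x. flM (A x) P k p q)" if "p : P" "q : P" for k p q
  using that
 proof (induction k arbitrary: p q)
  case 0
  thus ?case by (simp add: ldeg_const)
 next
  case (Suc k)
  have "ldeg (Suc k * D) (%x. SUM l:P. A x p l * flM (A x) P k l q)"
   using assms Suc by (simp add: add_mult_distrib) (intro ldeg_sum ldeg_mult; simp)
  thus ?case
   unfolding flM_Suc using c[OF Suc.IH] ldeg_mult[OF c[OF Suc.IH] ldeg_const[of 0]] by (intro ldeg_diff ldeg_cmult) auto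
 qed
 show "ldeg (Suc k * D) (%x. flc (A x) P k)" by (rule c[OF M])
qed

definition num :: "bool list => int" where "num r = foldl (%a c. 2 * a + of_bool c) 0 r"

lemma num_snoc: "num (r @ [c]) = 2 * num r + of_bool c" by (simp add: num_def)

lemma num_bound: "0 <= num r & num r < 2 ^ length r"
 by (induction r rule: rev_induct) (auto simp: num_snoc num_def)

lemma num_inj: "length r = length r' ==> num r = num r' ==> r = r'"
proof (induction r arbitrary: r' rule: rev_induct)
 case (snoc c r)
 then obtain r'' c' where r': "r' = r'' @ [c']" by (metis length_append_singleton length_0_conv nat.distinct(1) rev_exhaust)
 have "2 * num r + of_bool c = 2 * num r'' + of_bool c'" using snoc.prems(2) by (simp add: r' num_snoc)
 hence "c = c' & num r = num r''" by (cases c; cases c'; simp; presburger)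
 thus ?case using snoc r' by auto
qed simp

lemma dec_prefix: "k <= length r ==> dec b (r @ r') k = dec b r k"
 by (induction k) (simp_all add: nth_append)

lemma dec_zero: "k <= n * b ==> n <= j ==> dec b r k j = 0"
proof (induction k)
 case (Suc k)
 hence "k div b < n" by (simp add: less_mult_imp_div_less)
 thus ?case using Suc by auto
qed simp

lemma dec_append:
 assumes "length r = n * b" "length r' = b"
 shows "dec b (r @ r') (Suc n * b) = (dec b r (n * b))(n := num r')"
proof -
 have "dec b (r @ r') (n * b + k) = (dec b r (n * b))(n := num (take k r'))" if "k <= b" for k
  using that
 proof (induction k)
  case 0
  have "dec b r (n * b) n = 0" by (rule dec_zero[of _ n]) simp_all
  thus ?case using dec_prefix[of "n * b" r] assms(1) by (auto simp: num_def fun_eq_iff)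
 next
  case (Suc k)
  hence "(n * b + k) div b = n" by simp
  moreover have "take (Suc k) r' = take k r' @ [r' ! k]" using Suc assms(2) by (simp add: take_Suc_conv_app_nth)
  ultimately show ?case using Suc assms by (auto simp: num_snoc nth_append fun_eq_iff)
 qed
 from this[of b] show ?thesis using assms(2) by (simp add: add.commute)
qed

lemma dec_bound: "length r = n * b ==> 0 <= dec b r (n * b) j & dec b r (n * b) j < 2 ^ b"
proof (induction n arbitrary: r)
 case (Suc n)
 have "length (take (n * b) r) = n * b" "length (drop (n * b) r) = b" using Suc.prems by auto
 thus ?case
  using dec_append[of "take (n * b) r" n b "drop (n * b) r"] Suc.IH[of "take (n * b) r"] num_bound[of "drop (n * b) r"] by simp
qed simp

lemma finite_lists: "finite {r :: bool list. length r = n}" "card {r :: bool list. length r = n} = 2 ^ n"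
 using finite_lists_length_eq[of "UNIV :: bool set" n] card_lists_length_eq[of "UNIV :: bool set" n] by auto

text \<open>Either the earlier integers already annihilate \<open>H\<close>, which is
  \<open>G\<close> with the last variable set to the value of the witness \<open>x\<close>, or
  \<open>G\<close> is a nonzero polynomial of degree at most \<open>D\<close> in the last variable.
  In the latter case at most \<open>D\<close> coin blocks are bad, since distinct blocks give
  distinct integers.\<close>

lemma schwartz_zippel:
 assumes "ldeg D G" "ALL j>=n. x j = 0" "G x ~= 0"
 shows "card {r. length r = n * b & G (%j. of_int (dec b r (n * b) j)) = 0} * 2 ^ b <= n * D * 2 ^ (n * b)"
 using assms
proof (induction n arbitrary: G x)
 case 0
 hence "x = (%_. 0)" by auto
 thus ?case using 0 by simp
next
 case (Suc n)
 define H where "H y = G (y(n := x n))" for y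
 define e where "e b r n = (%j. real_of_int (dec b r (n * b) j))" for b r n
 have "ldeg D H"
  unfolding ldeg_def
 proof (intro allI)
  fix y j
  show "EX p. degree p <= D & (ALL t. poly p t = H (y(j := t)))"
  proof (cases "j = n")
   case True
   thus ?thesis by (intro exI[of _ "[:G (y(n := x n)):]"]) (simp add: H_def)
  next
   case False
   thus ?thesis
    using Suc.prems(1)[unfolded ldeg_def, rule_format, of "y(n := x n)" j] by (simp add: H_def fun_upd_twist)
  qed
 qed
 moreover have "H (x(n := 0)) ~= 0" using Suc.prems(3) by (simp add: H_def)
 moreover have "ALL j>=n. (x(n := 0)) j = 0" using Suc.prems(2) by auto
 ultimately have IH: "card {r. length r = n * b & H (e b r n) = 0} * 2 ^ b <= n * D * 2 ^ (n * b)"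
  unfolding e_def by (intro Suc.IH)
 define L where "L k = {r :: bool list. length r = k}" for k
 have fL: "finite (L k)" "card (L k) = 2 ^ k" for k unfolding L_def by (rule finite_lists)+
 define B where "B = {r : L (n * b). H (e b r n) = 0}"
 have ea: "e b (r1 @ r2) (Suc n) = (e b r1 n)(n := of_int (num r2))" if "r1 : L (n * b)" "r2 : L b" for r1 r2
  using that dec_append[of r1 n b r2] unfolding e_def L_def by auto
 have sub: "{r : L (Suc n * b). G (e b r (Suc n)) = 0} <= (%(r1, r2). r1 @ r2) ` (B \<times> L b) Un
   (UN r1:L (n * b) - B. (%r2. r1 @ r2) ` {r2 : L b. G (e b (r1 @ r2) (Suc n)) = 0})"
 proof
  fix r assume r: "r : {r : L (Suc n * b). G (e b r (Suc n)) = 0}"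
  hence t: "take (n * b) r : L (n * b)" "drop (n * b) r : L b" "r = take (n * b) r @ drop (n * b) r" by (auto simp: L_def)
  show "r : (%(r1, r2). r1 @ r2) ` (B \<times> L b) Un
   (UN r1:L (n * b) - B. (%r2. r1 @ r2) ` {r2 : L b. G (e b (r1 @ r2) (Suc n)) = 0})"
  proof (cases "take (n * b) r : B")
   case True
   hence "(take (n * b) r, drop (n * b) r) : B \<times> L b" using t by blast
   thus ?thesis using t(3) by (metis (mono_tags, lifting) UnI1 case_prod_conv image_eqI)
  next
   case False
   have "r : (%r2. take (n * b) r @ r2) ` {r2 : L b. G (e b (take (n * b) r @ r2) (Suc n)) = 0}"
    using t r by (intro image_eqI[of _ _ "drop (n * b) r"]) auto
   thus ?thesis using False t(1) by blast
  qed
 qed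
 have inner: "card {r2 : L b. G (e b (r1 @ r2) (Suc n)) = 0} <= D" if r1: "r1 : L (n * b) - B" for r1
 proof -
  obtain p where p: "degree p <= D" "!!t. poly p t = G ((e b r1 n)(n := t))"
   using Suc.prems(1) unfolding ldeg_def by blast
  have "p ~= 0" using p(2)[of "x n"] r1 by (auto simp: B_def H_def)
  have "card {r2 : L b. G (e b (r1 @ r2) (Suc n)) = 0} <= card {t. poly p t = 0}"
  proof (rule card_inj_on_le[where f = "%r2. real_of_int (num r2)"])
   show "inj_on (%r2. real_of_int (num r2)) {r2 : L b. G (e b (r1 @ r2) (Suc n)) = 0}"
    by (auto simp: inj_on_def L_def intro: num_inj)
   show "(%r2. real_of_int (num r2)) ` {r2 : L b. G (e b (r1 @ r2) (Suc n)) = 0} <= {t. poly p t = 0}"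
    using r1 by (auto simp: p(2) ea)
  qed (rule poly_roots_finite[OF \<open>p ~= 0\<close>])
  also have "... <= degree p" by (rule card_poly_roots_bound[OF \<open>p ~= 0\<close>])
  finally show ?thesis using p(1) by simp
 qed
 have "card (UN r1:L (n * b) - B. (%r2. r1 @ r2) ` {r2 : L b. G (e b (r1 @ r2) (Suc n)) = 0}) <=
   (SUM r1:L (n * b) - B. card ((%r2. r1 @ r2) ` {r2 : L b. G (e b (r1 @ r2) (Suc n)) = 0}))"
  by (rule card_UN_le) (simp add: fL)
 also have "... <= (SUM r1:L (n * b) - B. D)"
 proof (rule sum_mono)
  fix r1 assume r1: "r1 : L (n * b) - B"
  have "finite {r2 : L b. G (e b (r1 @ r2) (Suc n)) = 0}" by (simp add: fL)
  from le_trans[OF card_image_le[OF this] inner[OF r1]]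
  show "card ((%r2. r1 @ r2) ` {r2 : L b. G (e b (r1 @ r2) (Suc n)) = 0}) <= D" .
 qed
 also have "... <= card (L (n * b)) * D" using card_mono[OF fL(1), of "L (n * b) - B"] by simp
 finally have 2: "card (UN r1:L (n * b) - B. (%r2. r1 @ r2) ` {r2 : L b. G (e b (r1 @ r2) (Suc n)) = 0}) <= 2 ^ (n * b) * D"
  by (simp add: fL)
 have fB: "finite B" unfolding B_def by (simp add: fL)
 have 1: "card ((%(r1, r2). r1 @ r2) ` (B \<times> L b)) <= card B * 2 ^ b"
  using card_image_le[of "B \<times> L b" "%(r1, r2). r1 @ r2"] fB fL by (simp add: card_cartesian_product)
 have "card {r : L (Suc n * b). G (e b r (Suc n)) = 0} <= card B * 2 ^ b + 2 ^ (n * b) * D"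
  by (rule le_trans[OF card_mono[OF _ sub] le_trans[OF card_Un_le add_mono[OF 1 2]]]) (simp add: fB fL)
 hence "card {r : L (Suc n * b). G (e b r (Suc n)) = 0} * 2 ^ b <= card B * 2 ^ b * 2 ^ b + 2 ^ (n * b) * D * 2 ^ b"
  using mult_le_mono1[of _ "card B * 2 ^ b + 2 ^ (n * b) * D" "2 ^ b"] by (simp only: add_mult_distrib)
 also have "... <= n * D * 2 ^ (n * b) * 2 ^ b + 2 ^ (n * b) * D * 2 ^ b"
  using IH unfolding B_def L_def by (intro add_mono mult_le_mono1) simp_all
 also have "... = Suc n * D * 2 ^ (Suc n * b)" by (simp add: power_add algebra_simps)
 finally show ?case unfolding e_def L_def by simp
qed

text \<open>One step multiplies the bound by \<open>2 ^ a\<close> for the entry of \<open>A\<close>,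
  by \<open>2 ^ n\<close> twice for sums over \<open>P\<close> or the factor \<open>Suc k\<close>,
  and by 2 for the difference of two terms. The factor is why \<open>k\<close> must not exceed
  \<open>card P\<close>.\<close>

lemma fl_bound:
 fixes A :: "'p => 'p => int"
 assumes A: "!!p q. p : P ==> q : P ==> abs (A p q) <= 2 ^ a" and P: "card P <= 2 ^ n" "finite P"
 shows "k <= card P ==> p : P ==> q : P ==> abs (flM A P k p q) <= 2 ^ (k * (a + 2 * n + 1))"
  and "k < card P ==> abs (flc A P k) <= 2 ^ (Suc k * (a + 2 * n + 1))"
proof -
 let ?m = "%k. (2::int) ^ (k * (a + 2 * n + 1))"
 have P': "int (card P) <= 2 ^ n" using P(1) by (metis of_nat_le_iff of_nat_numeral of_nat_power)
 have s: "abs (SUM l:P. A p l * flM A P k l q) <= 2 ^ n * (2 ^ a * ?m k)"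
  if "p : P" "q : P" and M: "!!p q. p : P ==> q : P ==> abs (flM A P k p q) <= ?m k" for k p q
 proof -
  have "abs (SUM l:P. A p l * flM A P k l q) <= (SUM l:P. abs (A p l * flM A P k l q))" by (rule sum_abs)
  also have "... <= (SUM l:P. 2 ^ a * ?m k)"
   by (rule sum_mono) (use A M that in "simp add: abs_mult mult_mono")
  also have "... <= 2 ^ n * (2 ^ a * ?m k)" using P' by (simp add: mult_right_mono)
  finally show ?thesis .
 qed
 have c: "abs (flc A P k) <= 2 ^ n * (2 ^ n * (2 ^ a * ?m k))" if M: "!!p q. p : P ==> q : P ==> abs (flM A P k p q) <= ?m k" for k
 proof -
  have "abs (flc A P k) <= (SUM i:P. abs (SUM l:P. A i l * flM A P k l i))" unfolding flc_def by (rule sum_abs)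
  also have "... <= (SUM i:P. 2 ^ n * (2 ^ a * ?m k))" by (rule sum_mono) (rule s[OF _ _ M])
  also have "... <= 2 ^ n * (2 ^ n * (2 ^ a * ?m k))" using P' by (simp add: mult_right_mono)
  finally show ?thesis .
 qed
 have mS: "?m (Suc k) = 2 * (2 ^ n * (2 ^ n * (2 ^ a * ?m k)))" for k
  by (simp add: power_add[symmetric] algebra_simps)
 show M: "abs (flM A P k p q) <= ?m k" if "k <= card P" "p : P" "q : P" for k p q
  using that
 proof (induction k arbitrary: p q)
  case (Suc k)
  have IH: "abs (flM A P k p q) <= ?m k" if "p : P" "q : P" for p q using Suc that by simp
  have "abs (flM A P (Suc k) p q) <= int (Suc k) * abs (SUM l:P. A p l * flM A P k l q) + abs (flc A P k)"
   unfolding flM_Suc by (rule order_trans[OF abs_triangle_ineq4]) (auto simp: abs_mult)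
  also have "int (Suc k) * abs (SUM l:P. A p l * flM A P k l q) <= 2 ^ n * (2 ^ n * (2 ^ a * ?m k))"
  proof (rule mult_mono)
   show "int (Suc k) <= 2 ^ n" using P' Suc.prems(1) by linarith
  qed (use s[OF Suc.prems(2,3) IH] in simp_all)
  finally show ?case using c[OF IH] mS[of k] by linarith
 qed simp
 show "abs (flc A P k) <= ?m (Suc k)" if "k < card P"
  using c[OF M, of k] that mS[of k] zero_le_power[of "2::int" "n"] abs_ge_zero[of "flc A P k"] by simp
qed

subsection \<open>The certificate of a framework\<close>

lemma card_Sk: "2 * card (Sk :: ('d::finite * 'd) set) + CARD('d) = CARD('d) * CARD('d)"
proof -
 let ?S = "Sk :: ('d * 'd) set" and ?D = "range (%a :: 'd. (a, a))"
 have "j : (?S Un prod.swap ` ?S) Un ?D" for j :: "'d * 'd"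
  using injD[OF inj_tau, of "fst j" "snd j"] by (cases j; cases "tau (fst j)" "tau (snd j)" rule: linorder_cases) (auto simp: Sk_def)
 hence U: "(UNIV :: ('d * 'd) set) = (?S Un prod.swap ` ?S) Un ?D" by blast
 have d: "?S \<inter> prod.swap ` ?S = {}" "(?S Un prod.swap ` ?S) \<inter> ?D = {}" by (auto simp: Sk_def)
 have "card ((?S Un prod.swap ` ?S) Un ?D) = card ?S + card (prod.swap ` ?S) + card ?D"
  using d by (simp add: card_Un_disjoint)
 moreover have "card (prod.swap ` ?S) = card ?S" by (rule card_image[OF inj_swap])
 moreover have "card ?D = CARD('d)" by (rule card_image) (auto simp: inj_on_def)
 ultimately show ?thesis using arg_cong[OF U, of card] by simp
qed

lemma bb_skew:
 fixes x :: "'a * 'd::finite => real"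
 shows "bb x (%(u, a). (SU b. x (u, b) * sk A b a) + c a) e = 0"
proof -
 define y where "y a = x (fst e, a) - x (snd e, a)" for a
 have "bb x (%(u, a). (SU b. x (u, b) * sk A b a) + c a) e = (SU a. SU b. y a * (y b * sk A b a))"
  by (simp add: bb_def y_def sum_subtractf[symmetric] left_diff_distrib[symmetric] sum_left)
 moreover have "(SU a. SU b. y a * (y b * sk A b a)) = - (SU a. SU b. y a * (y b * sk A b a))" (is "?q = _")
 proof -
  have "?q = (SU b. SU a. y a * (y b * sk A b a))" by (rule sum.swap)
  also have "... = - ?q" unfolding sum_negf[symmetric] by (intro sum.cong refl, subst sk_skew) (simp add: mult_ac)
  finally show ?thesis .
 qed
 ultimately show ?thesis by simp
qed

text \<open>This is \<open>quadrics\<close> with all vertices but \<open>u0\<close> as coordinates.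
  Relative to \<open>u0\<close> the motion is a rotation by \<open>trivial_flex\<close>; what
  \<open>u0\<close> itself does accounts for the translation.\<close>

lemma trivial_motion:
 fixes x y :: "'a * 'd::finite => real"
 assumes finV: "finite V" and sp: "spanning V x" and flex: "!!e. e : V \<times> V ==> bb x y e = 0"
 shows "EX A c. ALL u:V. ALL a. y (u, a) = (SU b. x (u, b) * sk A b a) + c a"
proof -
 have "V ~= {}" using sp[unfolded spanning_def, rule_format, of "%_. 1"] by auto
 then obtain u0 where u0: "u0 : V" by blast
 interpret Q: quadrics V "V - {u0}" "%u w. if u = w then 1 else 0" u0 "TYPE('d)"
  by unfold_locales (use finV u0 in auto)
 define p where "p = (%(x :: 'a * 'd => real) (w, a). x (w, a) - x (u0, a))"
 have ext: "Q.ext (p t) (w, a) = t (w, a) - t (u0, a)" if "w : V" for t w and a :: 'd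
  using that Q.ext_U[of w "p t" a] Q.ext_u0[of "p t" a] by (cases "w = u0") (auto simp: p_def)
 have "indep UNIV (V - {u0}) (%a u. p x (u, a))"
  unfolding indep_def
 proof (intro allI impI)
  fix c assume c: "ALL u:V - {u0}. (SU a. c a * p x (u, a)) = 0"
  hence 0: "(SU a. c a * p x (w, a)) = 0" if "w : V" for w using that by (cases "w = u0") (auto simp: p_def)
  have "(SU a. c a * (x (u, a) - x (w, a))) = (SU a. c a * p x (u, a)) - (SU a. c a * p x (w, a))" for u w
   by (simp add: p_def sum_subtractf[symmetric] algebra_simps)
  thus "ALL a:UNIV. c a = 0" using sp 0 unfolding spanning_def by simp
 qed
 moreover have "Q.gb (p x) (p y) e = 0" if "e : V \<times> V" for e
  using flex[OF that] that unfolding Q.bb_ext[symmetric] bb_def by (auto simp: ext)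
 ultimately obtain A where A: "!!u a. u : V - {u0} ==> p y (u, a) = rmul (p x) (sk A) (u, a)"
  using Q.trivial_flex[of "p x" "p y"] by auto
 have "y (u, a) = (SU b. x (u, b) * sk A b a) + (y (u0, a) - (SU b. x (u0, b) * sk A b a))" if "u : V" for u a
  using A[of u a] that by (cases "u = u0") (auto simp: p_def rmul_def left_diff_distrib sum_subtractf)
 thus ?thesis by (intro exI[of _ A] exI[of _ "%a. y (u0, a) - (SU b. x (u0, b) * sk A b a)"]) blast
qed

lemma nth_adjacency:
 assumes "p < length vs * length vs"
 shows "adjacency_bits vs E ! p = ({vs ! (p div length vs), vs ! (p mod length vs)} : E)"
proof -
 have "concat (map (%u. map (g u) vs) us) ! p = g (us ! (p div length vs)) (vs ! (p mod length vs))"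
  if "p < length us * length vs" for us p and g :: "'a => 'a => bool"
  using that
 proof (induction us arbitrary: p)
  case (Cons u us)
  show ?case
  proof (cases "p < length vs")
   case False
   hence "p = (p - length vs) + length vs" "vs ~= []" using Cons.prems by auto
   hence "p div length vs = Suc ((p - length vs) div length vs)" "p mod length vs = (p - length vs) mod length vs"
    by (simp_all add: le_div_geq le_mod_geq)
   thus ?thesis using False Cons.IH[of "p - length vs"] Cons.prems by (simp add: nth_append)
  qed (simp add: nth_append)
 qed simp
 from this[OF assms, of "%u w. {u, w} : E"] show ?thesis unfolding adjacency_bits_def .
qed

lemma length_adjacency: "length (adjacency_bits vs E) = length vs * length vs"
 by (simp add: adjacency_bits_def length_concat o_def sum_list_triv)

lemma poly_certificate:
 assumes F: "\<rat> <= F" and ad: "!!p. ad p : \<rat>" and X: "!!j. (%x. X x j) : polyfun F K"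
 shows "(%x. c1 d v ad (X x)) : polyfun F K" "(%x. c2 d v ad (X x)) : polyfun F K"
proof -
 have dl: "(%_. dl a b) : polyfun F K" for a b by (rule polyfun_rat[OF F]) (simp add: dl_def)
 have B: "(%x. BB d v ad (X x) p q) : polyfun F K" for p q
  unfolding BB_def rr_def by (intro polyfun_sum polyfun_mult polyfun_diff X dl F polyfun_rat ad)
 thus "(%x. c1 d v ad (X x)) : polyfun F K" unfolding c1_def by (intro flc_polyfun F)
 have "(%x. OM d v ad (X x) p q) : polyfun F K" for p q
  unfolding OM_def om_def by (intro polyfun_sum polyfun_mult polyfun_diff flM_polyfun X dl F polyfun_rat ad B; simp)
 thus "(%x. c2 d v ad (X x)) : polyfun F K" unfolding c2_def by (intro flc_polyfun F)
qed

text \<open>Entries of the Gram matrix have degree 2 in each variable, a stress gains 1 from the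
  weights, and each step of a recursion adds the degree of the matrix.\<close>

lemma ldeg_certificate:
 assumes "0 < rk d v" "d + 2 <= v"
 shows "ldeg (2 * rk d v + (v - d - 1) * (2 * rk d v + 1)) (%X. c1 d v ad X * c2 d v ad X)"
proof -
 have B: "ldeg 2 (%X. BB d v ad X p q)" for p q
 proof -
  have "ldeg (1 + 0) (%X. (X i - X j) * c)" for i j c by (intro ldeg_mult ldeg_diff ldeg_coord ldeg_const)
  hence "ldeg 1 (%X. rr d v ad X p s)" for p s unfolding rr_def by (intro ldeg_cmult) simp
  hence "ldeg (1 + 1) (%X. BB d v ad X p q)" unfolding BB_def by (intro ldeg_sum ldeg_mult)
  thus ?thesis by (simp add: numeral_2_eq_2)
 qed
 have 1: "ldeg (rk d v * 2) (%X. c1 d v ad X)"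
  using ldeg_fl(2)[of "{..<v * v}" 2 "%X. BB d v ad X" "rk d v - 1"] B assms(1) unfolding c1_def by simp
 have "ldeg (rk d v * 2 + (1 + 0)) (%X. om d v ad X p)" if "p < v * v" for p
  unfolding om_def using that B by (intro ldeg_sum ldeg_mult ldeg_fl(1) ldeg_coord ldeg_const) auto
 hence "ldeg (rk d v * 2 + 1 + 0) (%X. OM d v ad X u w)" for u w
  unfolding OM_def by (intro ldeg_sum ldeg_mult ldeg_const) auto
 hence "ldeg (Suc (v - d - 2) * (rk d v * 2 + 1)) (%X. c2 d v ad X)"
  unfolding c2_def by (intro ldeg_fl(2)) simp
 moreover have "Suc (v - d - 2) = v - d - 1" using assms(2) by simp
 ultimately have "ldeg ((v - d - 1) * (rk d v * 2 + 1)) (%X. c2 d v ad X)" by metis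
 from ldeg_mult[OF 1 this] show ?thesis by (simp add: mult.commute)
qed

lemma of_int_certificate:
 "c1 d v (%p. of_int (ad p)) (%j. of_int (X j)) = (of_int (c1 d v ad X) :: real)"
 "c2 d v (%p. of_int (ad p)) (%j. of_int (X j)) = (of_int (c2 d v ad X) :: real)"
proof -
 have dl: "of_int (dl a b) = (dl a b :: real)" for a b by (simp add: dl_def)
 have "rr d v (%p. of_int (ad p)) (%j. of_int (X j)) p s = (of_int (rr d v ad X p s) :: real)" for p s
  by (simp add: rr_def dl)
 hence B: "BB d v (%p. of_int (ad p)) (%j. of_int (X j)) = (%p q. of_int (BB d v ad X p q) :: real)"
  by (simp add: BB_def fun_eq_iff)
 thus "c1 d v (%p. of_int (ad p)) (%j. of_int (X j)) = (of_int (c1 d v ad X) :: real)" by (simp add: c1_def flc_of_int)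
 have "om d v (%p. of_int (ad p)) (%j. of_int (X j)) p = (of_int (om d v ad X p) :: real)" for p
  by (simp add: om_def B flM_of_int)
 hence "OM d v (%p. of_int (ad p)) (%j. of_int (X j)) = (%p q. of_int (OM d v ad X p q) :: real)"
  by (simp add: OM_def dl fun_eq_iff)
 thus "c2 d v (%p. of_int (ad p)) (%j. of_int (X j)) = (of_int (c2 d v ad X) :: real)" by (simp add: c2_def flc_of_int)
qed

text \<open>The reason for the choice of \<open>tt\<close>: a nonzero integer below the modulus does
  not vanish modulo it.\<close>

lemma certificate_bound:
 assumes X: "!!j. 0 <= X j & X j < 2 ^ bt K v" and ad: "!!p. ad p : {0, 1 :: int}" and v: "d + 2 <= v" "d > 0"
 shows "abs (c1 d v ad X) < 2 ^ tt K d v" "abs (c2 d v ad X) < 2 ^ tt K d v"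
proof -
 let ?A = "Suc (rk d v - 1) * e1 K d v"
 let ?b = "bt K v"
 have v2: "v <= 2 ^ v" "d <= 2 ^ d" by simp_all
 have vv: "v * v <= 2 ^ (2 * v)" using mult_mono[OF v2(1) v2(1)] by (simp add: mult_2 power_add)
 have rk: "0 < rk d v" "rk d v <= v * d" "rk d v <= v * v"
 proof -
  have "d * (d + 1) div 2 <= d * (d + 1)" by (rule div_le_dividend)
  moreover have "d * (d + 1) < d * v" using v by (intro mult_strict_left_mono) simp_all
  ultimately show "0 < rk d v" and le: "rk d v <= v * d" by (simp_all add: rk_def mult.commute)
  have "v * d <= v * v" using v by simp
  thus "rk d v <= v * v" using le by (rule le_trans[rotated])
 qed
 have dl: "abs (dl a b - dl c e) <= (1::int)" for a b c e by (simp add: dl_def)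
 have R: "abs (rr d v ad X p s) <= 2 ^ ?b" for p s
 proof -
  have "abs (X i - X j) <= 2 ^ ?b" for i j using X[of i] X[of j] by linarith
  hence "abs ((X i - X j) * (dl a e - dl c f)) <= 2 ^ ?b * 1" for i j a e c f
   unfolding abs_mult by (intro mult_mono dl) auto
  from this[of "p div v * d + s mod d" "p mod v * d + s mod d"] show ?thesis
   using ad[of p] unfolding rr_def by (elim insertE) (simp_all only: mult_zero_left abs_zero mult_1_left mult_1_right, simp_all)
 qed
 have S: "abs (SUM i<n. f i) <= 2 ^ k * c" if "n <= 2 ^ k" "!!i. i < n ==> abs (f i) <= c" "c >= 0" for n k and f :: "nat => int" and c
 proof -
  have "abs (SUM i<n. f i) <= (SUM i<n. abs (f i))" by (rule sum_abs)
  also have "... <= (SUM i<n. c)" by (rule sum_mono) (use that in auto)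
  also have "... = int n * c" by simp
  also have "int n <= 2 ^ k" using that(1) by (metis of_nat_le_iff of_nat_numeral of_nat_power)
  hence "int n * c <= 2 ^ k * c" using that(3) by (rule mult_right_mono)
  finally show ?thesis .
 qed
 have B: "abs (BB d v ad X p q) <= 2 ^ (v + d + 2 * ?b)" for p q
 proof -
  have "abs (BB d v ad X p q) <= 2 ^ (v + d) * (2 ^ ?b * 2 ^ ?b)"
   unfolding BB_def by (rule S) (use v2 R in "auto simp: power_add abs_mult intro!: mult_mono")
  thus ?thesis by (simp add: power_add mult_2)
 qed
 have e1: "v + d + 2 * ?b + 2 * (2 * v) + 1 = e1 K d v" by (simp add: e1_def)
 note fl = fl_bound[of "{..<v * v}" "BB d v ad X" "v + d + 2 * ?b" "2 * v", unfolded e1]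
 have "abs (c1 d v ad X) <= 2 ^ (?A)"
  unfolding c1_def by (rule fl(2)) (use B vv rk in auto)
 also have "... < 2 ^ tt K d v"
 proof (rule power_strict_increasing)
  have "?A <= v * d * e1 K d v" using rk by (intro mult_le_mono1) simp
  thus "?A < tt K d v" by (simp add: tt_def)
 qed simp
 finally show "abs (c1 d v ad X) < 2 ^ tt K d v" .
 have M: "abs (flM (BB d v ad X) {..<v * v} (rk d v) p q) <= 2 ^ (v * d * e1 K d v)" if "p < v * v" "q < v * v" for p q
 proof -
  have "abs (flM (BB d v ad X) {..<v * v} (rk d v) p q) <= 2 ^ (rk d v * e1 K d v)" by (rule fl(1)) (use B vv rk that in auto)
  also have "... <= 2 ^ (v * d * e1 K d v)" using rk by (intro power_increasing mult_le_mono1) simp_all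
  finally show ?thesis .
 qed
 have om: "abs (om d v ad X p) <= 2 ^ (2 * v) * (2 ^ (v * d * e1 K d v) * 2 ^ ?b)" if "p < v * v" for p
  unfolding om_def
 proof (rule S[OF vv])
  fix q assume "q < v * v"
  have "abs (X (v * d + q) * ad p) <= 2 ^ ?b" using X[of "v * d + q"] ad[of p] by auto
  thus "abs (flM (BB d v ad X) {..<v * v} (rk d v) p q * (X (v * d + q) * ad p)) <= 2 ^ (v * d * e1 K d v) * 2 ^ ?b"
   unfolding abs_mult[of "flM _ _ _ _ _"] using M[OF that \<open>q < v * v\<close>] by (intro mult_mono) auto
 qed simp
 have O: "abs (OM d v ad X u w) <= 2 ^ (4 * v + (v * d * e1 K d v + ?b))" for u w
 proof -
  have "abs (OM d v ad X u w) <= 2 ^ (2 * v) * (2 ^ (2 * v) * (2 ^ (v * d * e1 K d v) * 2 ^ ?b))"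
   unfolding OM_def
  proof (rule S[OF vv])
   fix p assume p: "p < v * v"
   have "abs ((dl u (p div v) - dl u (p mod v)) * (dl w (p div v) - dl w (p mod v))) <= (1::int) * 1"
    unfolding abs_mult by (intro mult_mono dl) auto
   hence "abs (om d v ad X p * ((dl u (p div v) - dl u (p mod v)) * (dl w (p div v) - dl w (p mod v)))) <= abs (om d v ad X p) * 1"
    unfolding abs_mult[of "om _ _ _ _ _"] by (intro mult_left_mono) auto
   thus "abs (om d v ad X p * ((dl u (p div v) - dl u (p mod v)) * (dl w (p div v) - dl w (p mod v)))) <=
     2 ^ (2 * v) * (2 ^ (v * d * e1 K d v) * 2 ^ ?b)" using om[OF p] by linarith
  qed simp
  also have "... = 2 ^ (2 * v + (2 * v + (v * d * e1 K d v + ?b)))" by (simp only: power_add)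
  also have "2 * v + (2 * v + (v * d * e1 K d v + ?b)) = 4 * v + (v * d * e1 K d v + ?b)" by simp
  finally show ?thesis .
 qed
 have e2: "4 * v + (v * d * e1 K d v + ?b) + 2 * v + 1 = e2 K d v" by (simp add: e2_def)
 have "abs (c2 d v ad X) <= 2 ^ (Suc (v - d - 2) * e2 K d v)"
  unfolding c2_def using fl_bound(2)[of "{..<v}" "OM d v ad X" "4 * v + (v * d * e1 K d v + ?b)" v, unfolded e2] O v by auto
 also have "... < 2 ^ tt K d v"
 proof (rule power_strict_increasing)
  have "Suc (v - d - 2) * e2 K d v <= v * e2 K d v" using v by (intro mult_le_mono1) simp
  thus "Suc (v - d - 2) * e2 K d v < tt K d v" by (simp add: tt_def)
 qed simp
 finally show "abs (c2 d v ad X) < 2 ^ tt K d v" .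
qed

lemma index_div: "j < n ==> (i * n + j) div n = i" "j < n ==> (i * n + j) mod n = j" for i j n :: nat
 by simp_all

lemma bij_all: "bij_betw h A B ==> (ALL b:B. P b) <-> (ALL a:A. P (h a))"
 by (auto simp: bij_betw_def)

section \<open>Certificates in terms of frameworks on the given vertices\<close>

text \<open>Certificates are indexed by numbers, frameworks by vertices; \<open>hS\<close>
  translates columns and \<open>hP\<close> ordered pairs. Diagonal pairs occur among the rows but
  are masked, because edges have two elements.\<close>

locale enumerated =
 fixes V :: "'a set" and E vs and \<delta> :: "nat => 'd::finite" and d v
 assumes g: "graph V E" and dv: "distinct vs" "set vs = V" and v: "v = length vs" and d: "d = CARD('d)"
  and \<delta>: "bij_betw \<delta> {..<d} UNIV"
begin

definition hS where "hS s = (vs ! (s div d), \<delta> (s mod d))"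
definition hP where "hP p = (vs ! (p div v), vs ! (p mod v))"
definition D where "D = {(u, w). {u, w} : E}"
definition ad :: "nat => real" where "ad p = of_bool (adjacency_bits vs E ! p)"
definition ix where "ix u = (THE i. i < v & vs ! i = u)"

lemma finV: "finite V" and DV: "D <= V \<times> V" and cardV: "card V = v" and d0: "d > 0"
 using g dv v d distinct_card[of vs] by (auto simp: graph_def D_def)

lemma nth_eq: "i < v ==> j < v ==> vs ! i = vs ! j <-> i = j"
 using dv(1) v by (simp add: nth_eq_iff_index_eq)

lemma ix: "u : V ==> ix u < v & vs ! ix u = u" "i < v ==> ix (vs ! i) = i"
proof -
 assume "u : V"
 then obtain i where "i < v" "vs ! i = u" using dv(2) v by (metis in_set_conv_nth)
 hence "EX! i. i < v & vs ! i = u" using nth_eq by auto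
 thus "ix u < v & vs ! ix u = u" unfolding ix_def by (rule theI')
qed (auto simp: ix_def nth_eq intro!: the_equality)

lemma vsV: "i < v ==> vs ! i : V" using dv(2) v by auto

lemma bij_vs: "bij_betw ((!) vs) {..<v} V"
 by (rule bij_betwI[of _ _ _ ix]) (use ix vsV in auto)

lemma bij_hP: "bij_betw hP {..<v * v} (V \<times> V)"
proof (rule bij_betwI[of _ _ _ "%(u, w). ix u * v + ix w"])
 show "hP : {..<v * v} \<rightarrow> V \<times> V"
 proof
  fix p assume "p : {..<v * v}"
  hence "p div v < v" "p mod v < v" by (cases "v = 0"; simp add: less_mult_imp_div_less)+
  thus "hP p : V \<times> V" by (simp add: hP_def vsV)
 qed
 show "(%(u, w). ix u * v + ix w) : V \<times> V \<rightarrow> {..<v * v}" using ix(1) step_index(1) by auto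
 fix p assume "p : {..<v * v}"
 hence "p div v < v" "p mod v < v" by (cases "v = 0"; simp add: less_mult_imp_div_less)+
 thus "(case hP p of (u, w) => ix u * v + ix w) = p" by (simp add: hP_def ix)
qed (use ix(1) in "auto simp: hP_def index_div")

lemma ad_eq: "p < v * v ==> ad p = of_bool (hP p : D)"
 using nth_adjacency[of p vs E, folded v] by (simp add: ad_def hP_def D_def)

lemma bij_hS: "bij_betw hS {..<v * d} (V \<times> UNIV)"
proof (rule bij_betwI[of _ _ _ "%(u, a). ix u * d + inv_into {..<d} \<delta> a"])
 have \<delta>i: "inv_into {..<d} \<delta> a < d" "\<delta> (inv_into {..<d} \<delta> a) = a" for a
  using bij_betw_imp_surj_on[OF \<delta>] inv_into_into[of a \<delta> "{..<d}"] f_inv_into_f[of a \<delta> "{..<d}"] by auto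
 show "(%(u, a). ix u * d + inv_into {..<d} \<delta> a) : V \<times> UNIV \<rightarrow> {..<v * d}" using ix(1) step_index(1) \<delta>i by auto
 show "hS : {..<v * d} \<rightarrow> V \<times> UNIV" by (auto simp: hS_def vsV less_mult_imp_div_less)
 show "(case hS s of (u, a) => ix u * d + inv_into {..<d} \<delta> a) = s" if "s : {..<v * d}" for s
  using that d0 bij_betw_imp_inj_on[OF \<delta>] by (simp add: hS_def ix less_mult_imp_div_less inv_into_f_f)
 show "hS (case y of (u, a) => ix u * d + inv_into {..<d} \<delta> a) = y" if "y : V \<times> UNIV" for y
  using that ix(1) \<delta>i by (cases y) (simp add: hS_def index_div)
qed

definition fits where "fits x X <-> (ALL s<v * d. X s = x (hS s))"

lemma rr_rrow:
 assumes f: "fits x X" and p: "p < v * v" and s: "s < v * d"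
 shows "rr d v ad X p s = ad p * rrow x (hP p) (hS s)"
proof -
 have i: "p div v < v" "p mod v < v" "s div d < v" "s mod d < d"
  using p s d0 by (cases "v = 0"; simp add: less_mult_imp_div_less)+
 have "X (i * d + s mod d) = x (vs ! i, \<delta> (s mod d))" if "i < v" for i
  using f step_index[OF that i(4)] unfolding fits_def hS_def by simp
 moreover have "dl (s div d) j = (if vs ! (s div d) = vs ! j then 1 else 0 :: real)" if "j < v" for j
  using nth_eq[OF i(3) that] by (simp add: dl_def)
 moreover have "rrow x e j = (x (fst e, snd j) - x (snd e, snd j)) * ((kr (fst j) (fst e)) - (kr (fst j) (snd e)))" for e j
  unfolding rrow_def kap_def by (simp add: mult_if cong: if_cong)
 ultimately show ?thesis using i by (simp add: rr_def hP_def hS_def)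
qed

lemma rr_sum:
 assumes f: "fits x X" and p: "p < v * v"
 shows "(SUM s<v * d. rr d v ad X p s * y (hS s)) = ad p * bb x y (hP p)"
proof -
 have e: "hP p : V \<times> V" using bij_betwE[OF bij_hP] p by auto
 have "(SUM s<v * d. rr d v ad X p s * y (hS s)) = (SUM s<v * d. ad p * (rrow x (hP p) (hS s) * y (hS s)))"
  by (rule sum.cong) (auto simp: rr_rrow[OF f p])
 also have "... = ad p * (SUM j:V \<times> UNIV. rrow x (hP p) j * y j)"
  unfolding sum_left[symmetric] using sum.reindex_bij_betw[OF bij_hS, of "%j. rrow x (hP p) j * y j"] by simp
 finally show ?thesis unfolding rrow_sum[OF finV e] .
qed

lemma rows_inf_rigid:
 "(ALL p:{..<v * v}. ad p * bb x y (hP p) = 0) <-> (ALL e:D. bb x y e = 0)"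
proof -
 have "(ALL e:D. bb x y e = 0) <-> (ALL e:V \<times> V. e : D --> bb x y e = 0)" using DV by blast
 thus ?thesis unfolding bij_all[OF bij_hP] by (simp add: ad_eq)
qed

text \<open>The kernel known in advance consists of the infinitesimal rotations, indexed by
  \<open>Sk\<close>, and the translations; their number is what \<open>rk\<close> subtracts. By
  \<open>trivial_motion\<close> the framework is infinitesimally rigid iff there are no further
  kernel vectors.\<close>

lemma c1_iff:
 assumes f: "fits x X" and sp: "spanning V x" and rk: "0 < rk d v"
 shows "c1 d v ad X ~= 0 <-> inf_rigid V D x"
  and "c1 d v ad X ~= 0 ==> s < v * d ==> (SUM p<v * v. rr d v ad X p s * flM (BB d v ad X) {..<v * v} (rk d v) p q) = 0 | ~ q < v * v"
proof -
 let ?A = "(%p q. SUM s<v * d. rr d v ad X p s * rr d v ad X q s)"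
 define k :: "('d * 'd) + 'd => 'a * 'd => real" where
  "k t = (case t of Inl h => (%(u, a). SU b. x (u, b) * sk (un h) b a) | Inr c => (%(u, a). un c a))" for t
 define S where "S c = (%h'. SUM h:Sk. c (Inl h) * un h h')" for c :: "('d * 'd) + 'd => real"
 define T :: "(('d * 'd) + 'd) set" where "T = Sk <+> UNIV"
 have fT: "finite T" by (simp add: T_def)
 have comb: "(SUM t:T. c t * k t (u, a)) = (SU b. x (u, b) * sk (S c) b a) + c (Inr a)" for c u a
 proof -
  have "(SUM t:T. c t * k t (u, a)) = (SUM h:Sk. c (Inl h) * (SU b. x (u, b) * sk (un h) b a)) + (SU a'. c (Inr a') * un a' a)"
   unfolding T_def by (subst sum.Plus) (simp_all add: k_def)
  also have "(SU a'. c (Inr a') * un a' a) = c (Inr a)" unfolding un_def sum_mult_delta(3)[OF finite] by simp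
  also have "(SUM h:Sk. c (Inl h) * (SU b. x (u, b) * sk (un h) b a)) = (SU b. x (u, b) * sk (S c) b a)"
   unfolding S_def sk_lin sum_left by (subst sum.swap) (simp add: mult_ac)
  finally show ?thesis .
 qed
 have S: "S c h = c (Inl h)" if "h : Sk" for c h unfolding S_def un_def sum_mult_delta(3)[OF finite_Sk] using that by simp
 have flex: "bb x (k t) e = 0" for t e
 proof (cases t)
  case (Inl h)
  thus ?thesis using bb_skew[of x "un h" "%_. 0" e] by (simp add: k_def)
 qed (simp add: k_def bb_def)
 have ker: "(SUM s<v * d. rr d v ad X p s * k t (hS s)) = 0" if "p : {..<v * v}" for t p
  using rr_sum[OF f, of p "k t"] that flex by simp
 have ind: "indep T {..<v * d} (%t s. k t (hS s))"
  unfolding indep_def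
 proof (intro allI impI)
  fix c assume "ALL s:{..<v * d}. (SUM t:T. c t * k t (hS s)) = 0"
  hence "ALL j:V \<times> UNIV. (SUM t:T. c t * k t j) = 0" unfolding bij_all[OF bij_hS] .
  hence 0: "(SU b. x (u, b) * sk (S c) b a) + c (Inr a) = 0" if "u : V" for u a
   using that unfolding comb[symmetric] by blast
  have "sk (S c) b a = 0" for b a
  proof -
   have "(SU b. sk (S c) b a * (x (u, b) - x (w, b))) = 0" if "u : V" "w : V" for u w
    using 0[OF that(1), of a] 0[OF that(2), of a] by (simp add: right_diff_distrib sum_subtractf mult.commute)
   thus ?thesis using sp[unfolded spanning_def, rule_format, of "%b. sk (S c) b a"] by blast
  qed
  hence "c (Inl h) = 0" if "h : Sk" for h using sk_zero[OF _ that, of "S c"] S[OF that] by simp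
  moreover have "V ~= {}" using sp[unfolded spanning_def, rule_format, of "%_. 1"] by auto
  hence "c (Inr a) = 0" for a using 0 \<open>!!b a. sk (S c) b a = 0\<close> by auto
  ultimately show "ALL t:T. c t = 0" by (auto simp: T_def)
 qed
 have m: "Suc (rk d v - 1) + card T = card {..<v * d}"
 using card_Sk[where 'd = 'd] d rk by (auto simp: T_def card_Plus algebra_simps rk_def)
 have B: "c1 d v ad X = flc ?A {..<v * v} (rk d v - 1)"
  "BB d v ad X = ?A"
  by (simp_all add: c1_def BB_def[abs_def])
 note gr = gram_rank[OF finite_lessThan finite_lessThan fT ker ind m]
 have E: "c1 d v ad X ~= 0 <->
   (ALL y. (ALL p:{..<v * v}. (SUM s<v * d. rr d v ad X p s * y s) = 0) --> (EX c. ALL s:{..<v * d}. y s = (SUM t:T. c t * k t (hS s))))"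
  unfolding B(1) by (rule gr(1))
 show "c1 d v ad X ~= 0 <-> inf_rigid V D x"
  unfolding E
 proof
  assume a: "ALL y. (ALL p:{..<v * v}. (SUM s<v * d. rr d v ad X p s * y s) = 0) --> (EX c. ALL s:{..<v * d}. y s = (SUM t:T. c t * k t (hS s)))"
  show "inf_rigid V D x"
   unfolding inf_rigid_def
  proof (intro allI impI ballI)
   fix y e assume "ALL e:D. bb x y e = 0" and e: "e : V \<times> V"
   hence "ALL p:{..<v * v}. (SUM s<v * d. rr d v ad X p s * y (hS s)) = 0"
    using rr_sum[OF f] rows_inf_rigid[of x y] by simp
   from a[rule_format, of "%s. y (hS s)", OF this[rule_format]] obtain c where "ALL s:{..<v * d}. y (hS s) = (SUM t:T. c t * k t (hS s))" by blast
   hence c: "ALL j:V \<times> UNIV. y j = (SUM t:T. c t * k t j)" unfolding bij_all[OF bij_hS] .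
   have "bb x y e = bb x (%(u, a). (SU b. x (u, b) * sk (S c) b a) + c (Inr a)) e"
    using e c unfolding bb_def by (intro sum.cong refl) (auto simp: comb)
   thus "bb x y e = 0" using bb_skew[of x "S c" "%a. c (Inr a)" e] by simp
  qed
 next
  assume r: "inf_rigid V D x"
  show "ALL y. (ALL p:{..<v * v}. (SUM s<v * d. rr d v ad X p s * y s) = 0) --> (EX c. ALL s:{..<v * d}. y s = (SUM t:T. c t * k t (hS s)))"
  proof (intro allI impI)
   fix y assume y: "ALL p:{..<v * v}. (SUM s<v * d. rr d v ad X p s * y s) = 0"
   define Y where "Y j = y (inv_into {..<v * d} hS j)" for j
   have Y: "Y (hS s) = y s" if "s < v * d" for s
    using that bij_betw_imp_inj_on[OF bij_hS] by (simp add: Y_def inv_into_f_f)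
   have "ALL p:{..<v * v}. ad p * bb x Y (hP p) = 0" using y rr_sum[OF f, of _ Y] Y by simp
   hence "bb x Y e = 0" if "e : V \<times> V" for e using r that rows_inf_rigid[of x Y] unfolding inf_rigid_def by blast
   from trivial_motion[OF finV sp this] obtain A c where A: "!!u a. u : V ==> Y (u, a) = (SU b. x (u, b) * sk A b a) + c a" by blast
   define c' where "c' t = (case t of Inl h => A h | Inr a => c a)" for t
   have "sk (S c') b a = sk A b a" for b a using S[of "(b, a)" c'] S[of "(a, b)" c'] by (simp add: sk_def Sk_def c'_def)
   moreover have "c' (Inr a) = c a" for a by (simp add: c'_def)
   ultimately have "Y j = (SUM t:T. c' t * k t j)" if "j : V \<times> UNIV" for j
    using that A by (cases j) (simp add: comb)
   hence "y s = (SUM t:T. c' t * k t (hS s))" if "s < v * d" for s using Y[OF that] bij_betwE[OF bij_hS] that by auto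
   thus "EX c. ALL s:{..<v * d}. y s = (SUM t:T. c t * k t (hS s))" by (intro exI[of _ c']) simp
  qed
 qed
 assume "c1 d v ad X ~= 0" "s < v * d"
 thus "(SUM p<v * v. rr d v ad X p s * flM (BB d v ad X) {..<v * v} (rk d v) p q) = 0 | ~ q < v * v"
  using gr(2)[where q = q and s = s] rk unfolding B by auto
qed

definition om' where "om' X e = om d v ad X (ix (fst e) * v + ix (snd e))"

lemma sf_om:
 "sf D (om' X) y z = (SUM p<v * v. om d v ad X p * ((y (vs ! (p div v)) - y (vs ! (p mod v))) * (z (vs ! (p div v)) - z (vs ! (p mod v)))))"
proof -
 have "sf D (om' X) y z = (SUM e:V \<times> V. (if e : D then om' X e else 0) * ((y (fst e) - y (snd e)) * (z (fst e) - z (snd e))))"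
  unfolding sf_def by (rule sum.mono_neutral_cong_left) (use finV DV in auto)
 also have "... = (SUM p<v * v. (if hP p : D then om' X (hP p) else 0) * ((y (fst (hP p)) - y (snd (hP p))) * (z (fst (hP p)) - z (snd (hP p)))))"
  by (rule sum.reindex_bij_betw[OF bij_hP, symmetric])
 also have "... = (SUM p<v * v. om d v ad X p * ((y (vs ! (p div v)) - y (vs ! (p mod v))) * (z (vs ! (p div v)) - z (vs ! (p mod v)))))"
 proof (rule sum.cong[OF refl])
  fix p assume "p : {..<v * v}"
  hence "p div v < v" "p mod v < v" by (cases "v = 0"; simp add: less_mult_imp_div_less)+
  moreover have "om d v ad X p = 0" if "hP p ~: D" using that \<open>p : {..<v * v}\<close> by (simp add: om_def ad_eq)
  ultimately show "(if hP p : D then om' X (hP p) else 0) * ((y (fst (hP p)) - y (snd (hP p))) * (z (fst (hP p)) - z (snd (hP p)))) =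
    om d v ad X p * ((y (vs ! (p div v)) - y (vs ! (p mod v))) * (z (vs ! (p div v)) - z (vs ! (p mod v))))"
   by (simp add: om'_def hP_def ix)
 qed
 finally show ?thesis .
qed

lemma c1_stress:
 assumes f: "fits x X" and sp: "spanning V x" and rk: "0 < rk d v" and c: "c1 d v ad X ~= 0"
 shows "stress D (om' X) x"
 unfolding stress_def
proof (intro allI)
 fix a z
 have "sf D (om' X) (%u. x (u, a)) (un w) = 0" if w: "w : V" for w
 proof -
  obtain s where s: "s < v * d" "hS s = (w, a)"
  proof -
   have "(w, a) : hS ` {..<v * d}" using bij_betw_imp_surj_on[OF bij_hS] w by simp
   thus thesis using that by force
  qed
  \<comment> \<open>The mask is 0 or 1 and may be repeated; this supplies the mask that
    \<open>om\<close> contains.\<close>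
  have adad: "rr d v ad X p s * ad p = rr d v ad X p s" for p by (simp add: rr_def ad_def)
  have "0 = (SUM q<v * v. (SUM p<v * v. rr d v ad X p s * flM (BB d v ad X) {..<v * v} (rk d v) p q) * X (v * d + q))"
  proof -
   have "(SUM p<v * v. rr d v ad X p s * flM (BB d v ad X) {..<v * v} (rk d v) p q) = 0" if "q < v * v" for q
    using c1_iff(2)[OF f sp rk c s(1), of q] that by blast
   thus ?thesis by simp
  qed
  also have "... = (SUM p<v * v. SUM q<v * v. rr d v ad X p s * flM (BB d v ad X) {..<v * v} (rk d v) p q * X (v * d + q))"
   unfolding sum_right by (rule sum.swap)
  also have "... = (SUM p<v * v. rr d v ad X p s * om d v ad X p)"
   unfolding om_def sum_left by (intro sum.cong refl, subst adad[symmetric]) (simp add: mult_ac)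
  also have "... = (SUM p<v * v. om d v ad X p * ((x (vs ! (p div v), a) - x (vs ! (p mod v), a)) * (un w (vs ! (p div v)) - un w (vs ! (p mod v)))))"
  proof (rule sum.cong[OF refl])
   fix p assume p: "p : {..<v * v}"
   have oa: "om d v ad X p * ad p = om d v ad X p" by (simp add: om_def ad_def)
   have "rrow x (hP p) (w, a) = (x (vs ! (p div v), a) - x (vs ! (p mod v), a)) * (un w (vs ! (p div v)) - un w (vs ! (p mod v)))"
    unfolding rrow_def kap_def hP_def un_def by (auto simp: mult_if cong: if_cong)
   thus "rr d v ad X p s * om d v ad X p = om d v ad X p * ((x (vs ! (p div v), a) - x (vs ! (p mod v), a)) * (un w (vs ! (p div v)) - un w (vs ! (p mod v))))"
    using rr_rrow[OF f _ s(1), of p] p s(2) by (subst oa[symmetric]) (simp add: mult_ac)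
  qed
  finally show ?thesis unfolding sf_om by simp
 qed
 thus "sf D (om' X) (%u. x (u, a)) z = 0" unfolding sf_unit[OF finV DV, of _ _ z] by simp
qed

text \<open>The affine functions are known kernel vectors of the stress matrix, \<open>None\<close>
  standing for the constant and \<open>Some a\<close> for a coordinate; they are independent because
  the framework is spanning.\<close>

lemma c2_iff:
 fixes x :: "'a * 'd => real"
 assumes sp: "spanning V x" and vd: "d + 2 <= v" and st: "stress D (om' X) x"
 shows "c2 d v ad X ~= 0 <-> affine_kernel V D (om' X) x"
proof -
 let ?A = "ALL y. (ALL z. sf D (om' X) y z = 0) --> (EX A b. ALL u:V. y u = b + (SU a. A a * x (u, a)))"
 have O: "OM d v ad X i j = sf D (om' X) (un (vs ! i)) (un (vs ! j))" if "i < v" "j < v" for i j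
 proof -
  have "dl i (p div v) = un (vs ! i) (vs ! (p div v))" "dl i (p mod v) = un (vs ! i) (vs ! (p mod v))"
   "dl j (p div v) = un (vs ! j) (vs ! (p div v))" "dl j (p mod v) = un (vs ! j) (vs ! (p mod v))" if "p < v * v" for p
  proof -
   have "p div v < v" "p mod v < v" using that by (cases "v = 0"; simp add: less_mult_imp_div_less)+
   thus "dl i (p div v) = un (vs ! i) (vs ! (p div v))" "dl i (p mod v) = un (vs ! i) (vs ! (p mod v))"
    "dl j (p div v) = un (vs ! j) (vs ! (p div v))" "dl j (p mod v) = un (vs ! j) (vs ! (p mod v))"
    using nth_eq[OF _ \<open>i < v\<close>] nth_eq[OF _ \<open>j < v\<close>] by (auto simp: dl_def un_def)
  qed
  thus ?thesis unfolding sf_om OM_def by (intro sum.cong refl) simp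
 qed
 have row: "(SUM j<v. OM d v ad X i j * z (vs ! j)) = sf D (om' X) (un (vs ! i)) z" if "i < v" for i z
  unfolding sf_unit[OF finV DV, of _ _ z] using sum.reindex_bij_betw[OF bij_vs, of "%w. z w * sf D (om' X) (un (vs ! i)) (un w)"] O[OF that]
  by (simp add: mult.commute)
 have kerI: "(ALL i:{..<v}. (SUM j<v. OM d v ad X i j * z (vs ! j)) = 0) <-> (ALL y. sf D (om' X) z y = 0)" for z
 proof
  assume a: "ALL i:{..<v}. (SUM j<v. OM d v ad X i j * z (vs ! j)) = 0"
  have "sf D (om' X) (un w) z = 0" if "w : V" for w using a row[of "ix w" z] ix(1)[OF that] by simp
  thus "ALL y. sf D (om' X) z y = 0" using sf_unit[OF finV DV, of "om' X" z] by (simp add: sf_sym[of D _ z])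
 next
  assume "ALL y. sf D (om' X) z y = 0"
  thus "ALL i:{..<v}. (SUM j<v. OM d v ad X i j * z (vs ! j)) = 0" using row[of _ z] by (simp add: sf_sym[of D _ z])
 qed
 define k where "k s u = (case s of None => 1 | Some a => x (u, a))" for s :: "'d option" and u
 have U: "(SU s. f s) = f None + (SU a. f (Some a))" for f :: "'d option => real"
  by (subst UNIV_option_conv, subst sum.insert) (simp_all add: sum.reindex)
 have "(ALL y. sf D (om' X) (k s) y = 0)" for s
  using st unfolding stress_def by (cases s) (auto simp: k_def[abs_def])
 hence ker: "(SUM p<v. OM d v ad X q p * k s (vs ! p)) = 0" if "q : {..<v}" for s q using that kerI[of "k s"] by blast
 have ind: "indep UNIV {..<v} (%s p. k s (vs ! p))"
  unfolding indep_def
 proof (intro allI impI)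
  fix c assume c: "ALL p:{..<v}. (SU s. c s * k s (vs ! p)) = 0"
  have 0: "c None + (SU a. c (Some a) * x (u, a)) = 0" if "u : V" for u
   using c[rule_format, of "ix u"] ix(1)[OF that] by (simp add: U k_def)
  have "(SU a. c (Some a) * (x (u, a) - x (w, a))) = 0" if "u : V" "w : V" for u w
   using 0[OF that(1)] 0[OF that(2)] by (simp add: right_diff_distrib sum_subtractf)
  hence "c (Some a) = 0" for a using sp[unfolded spanning_def, rule_format, of "%a. c (Some a)"] by blast
  moreover have "c None = 0" using 0[OF vsV[of 0]] vd calculation by simp
  ultimately show "ALL s:UNIV. c s = 0" by (metis not_None_eq)
 qed
 have m: "Suc (v - d - 2) + card (UNIV :: 'd option set) = card {..<v}" using vd d by (simp add: card_UNIV_option)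
 have sym: "OM d v ad X p q = OM d v ad X q p" for p q by (simp add: OM_def mult_ac)
 have E: "c2 d v ad X ~= 0 <-> (ALL y. (ALL q:{..<v}. (SUM p<v. OM d v ad X q p * y p) = 0) --> (EX c. ALL p:{..<v}. y p = (SU s. c s * k s (vs ! p))))"
  unfolding c2_def by (rule fl_rank(1)[OF finite_lessThan sym finite ker ind m])
 show ?thesis
  unfolding E affine_kernel_def
 proof
  assume a: "ALL y. (ALL q:{..<v}. (SUM p<v. OM d v ad X q p * y p) = 0) --> (EX c. ALL p:{..<v}. y p = (SU s. c s * k s (vs ! p)))"
  show "?A"
  proof (intro allI impI)
   fix y assume "ALL z. sf D (om' X) y z = 0"
   then obtain c where c: "ALL p:{..<v}. y (vs ! p) = (SU s. c s * k s (vs ! p))"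
    using a[rule_format, of "%p. y (vs ! p)"] kerI[of y] by blast
   have "y u = c None + (SU a. c (Some a) * x (u, a))" if "u : V" for u
    using c[rule_format, of "ix u"] ix(1)[OF that] by (simp add: U k_def)
   thus "EX A b. ALL u:V. y u = b + (SU a. A a * x (u, a))"
    by (intro exI[of _ "%a. c (Some a)"] exI[of _ "c None"]) simp
  qed
 next
  assume a: "?A"
  show "ALL y. (ALL q:{..<v}. (SUM p<v. OM d v ad X q p * y p) = 0) --> (EX c. ALL p:{..<v}. y p = (SU s. c s * k s (vs ! p)))"
  proof (intro allI impI)
   fix y assume y: "ALL q:{..<v}. (SUM p<v. OM d v ad X q p * y p) = 0"
   have "ALL i:{..<v}. (SUM j<v. OM d v ad X i j * y (ix (vs ! j))) = 0" using y by (simp add: ix)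
   then obtain A b where "ALL u:V. y (ix u) = b + (SU a. A a * x (u, a))"
    using a[rule_format, of "%u. y (ix u)"] kerI[of "%u. y (ix u)"] by blast
   hence "y p = (SU s. (case s of None => b | Some a => A a) * k s (vs ! p))" if "p < v" for p
    using vsV[OF that] that by (auto simp: U k_def ix(2))
   thus "EX c. ALL p:{..<v}. y p = (SU s. c s * k s (vs ! p))" by blast
  qed
 qed
qed

text \<open>The given stress itself is used as the edge weights. By \<open>gram_kernel\<close> the
  recursion returns it multiplied by \<open>- c1\<close>, so the kernel is unchanged.\<close>

lemma certificate_complete:
 assumes f: "fits x X" and sp: "spanning V x" and rk: "0 < rk d v" and vd: "d + 2 <= v"
  and r: "inf_rigid V D x" and st: "stress D W x" and ak: "affine_kernel V D W x"
  and X: "!!q. q < v * v ==> X (v * d + q) = ad q * W (hP q)"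
 shows "c1 d v ad X ~= 0" "c2 d v ad X ~= 0"
proof -
 show c: "c1 d v ad X ~= 0" using c1_iff(1)[OF f sp rk] r by simp
 have w: "(SUM q<v * v. rr d v ad X q s * (ad q * W (hP q))) = 0" if s: "s : {..<v * d}" for s
 proof -
  have "(SUM q<v * v. rr d v ad X q s * (ad q * W (hP q))) = (SUM q<v * v. (if hP q : D then W (hP q) * rrow x (hP q) (hS s) else 0))"
   by (rule sum.cong) (use s in "auto simp: rr_rrow[OF f] ad_eq")
  also have "... = (SUM e:V \<times> V. if e : D then W e * rrow x e (hS s) else 0)" by (rule sum.reindex_bij_betw[OF bij_hP])
  also have "... = (SUM e:D. W e * rrow x e (hS s))"
   by (rule sum.mono_neutral_cong_right) (use finV DV in auto)
  also have "... = sf D W (%u. x (u, snd (hS s))) (un (fst (hS s)))"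
   unfolding sf_def rrow_def kap_def un_def
   by (intro sum.cong refl) (auto simp: mult_if cong: if_cong)
  also have "... = 0" using st unfolding stress_def by blast
  finally show ?thesis .
 qed
 have "om d v ad X p = - c1 d v ad X * (ad p * W (hP p))" if p: "p < v * v" for p
 proof -
  have "(SUM q<v * v. flM (BB d v ad X) {..<v * v} (Suc (rk d v - 1)) p q * (ad q * W (hP q))) = - c1 d v ad X * (ad p * W (hP p))"
   unfolding c1_def BB_def[abs_def] by (rule gram_kernel[OF finite_lessThan finite_lessThan]) (use w p in auto)
  moreover have "om d v ad X p = (SUM q<v * v. flM (BB d v ad X) {..<v * v} (rk d v) p q * (ad q * W (hP q))) * ad p"
   unfolding om_def sum_right by (rule sum.cong) (auto simp: X)
  ultimately show ?thesis using rk by (simp add: ad_def)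
 qed
 hence om': "om' X e = - c1 d v ad X * W e" if "e : D" for e
 proof -
  have e: "fst e : V" "snd e : V" using DV that by auto
  note i = step_index[of "ix (fst e)" v "ix (snd e)" v]
  have "hP (ix (fst e) * v + ix (snd e)) = e" using ix(1)[OF e(1)] ix(1)[OF e(2)] i by (simp add: hP_def)
  thus ?thesis
   using that ix(1)[OF e(1)] ix(1)[OF e(2)] i \<open>!!p. p < v * v ==> om d v ad X p = _\<close> by (simp add: om'_def ad_eq)
 qed
 have sfo: "sf D (om' X) y z = - c1 d v ad X * sf D W y z" for y z
  unfolding sf_def sum_left by (intro sum.cong refl) (simp add: om')
 have "affine_kernel V D (om' X) x" using ak c unfolding affine_kernel_def sfo by simp
 moreover have "stress D (om' X) x" using st unfolding stress_def sfo by simp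
 ultimately show "c2 d v ad X ~= 0" using c2_iff[OF sp vd, of X] by blast
qed

lemma generic_framework: "EX r :: 'a => real ^ 'd. r : frameworks V & generic V r"
proof -
 obtain z :: "'a * 'd => real" where z: "Generic \<rat> (V \<times> UNIV) z"
  using Generic_dense[OF countable_rat, of "V \<times> (UNIV :: 'd set)" 1 "%_. 0"] finV by auto
 define r :: "'a => real ^ 'd" where "r u = (if u : V then vec_lambda (%a. z (u, a)) else undefined)" for u
 have "Generic \<rat> (V \<times> UNIV) (%(u, i). r u $ i)"
  by (rule Generic_cong[THEN iffD1, OF _ z]) (auto simp: r_def)
 thus ?thesis using generic_iff_Generic[OF finV, of r] by (intro exI[of _ r]) (auto simp: r_def frameworks_def PiE_def extensional_def)
qed

text \<open>A missing edge makes every generic framework flexible here, by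
  \<open>small_missing_edge_flexible\<close>; for complete graphs equal edge lengths already are
  equal distances.\<close>

lemma ggr_small:
 assumes "v < d + 2"
 shows "ggr TYPE('d) V E <-> (ALL p<v * v. p div v ~= p mod v --> hP p : D)"
proof
 assume ggr: "ggr TYPE('d) V E"
 obtain r :: "'a => real ^ 'd" where r: "r : frameworks V" "generic V r" using generic_framework by blast
 show "ALL p<v * v. p div v ~= p mod v --> hP p : D"
 proof (intro allI impI, rule ccontr)
  fix p assume p: "p < v * v" "p div v ~= p mod v" "hP p ~: D"
  have i: "p div v < v" "p mod v < v" using p(1) by (cases "v = 0"; simp add: less_mult_imp_div_less)+
  have "~ inf_rigid V D (coords r)"
  proof (rule small_missing_edge_flexible[OF finV])
   show "card V <= Suc CARD('d)" using assms cardV d by simp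
   show "Generic \<rat> (V \<times> UNIV) (coords r)" using r(2) generic_iff_Generic[OF finV] unfolding coords_def by blast
   show "fst (hP p) : V" "snd (hP p) : V" "fst (hP p) ~= snd (hP p)" using i p(2) nth_eq[OF i] by (auto simp: hP_def vsV)
   show "(fst (hP p), snd (hP p)) ~: D" "(snd (hP p), fst (hP p)) ~: D" using p(3) by (auto simp: D_def insert_commute)
  qed (rule DV)
  thus False using flexible_not_globally_rigid[OF g r(2)] ggr r unfolding generically_globally_rigid_def D_def by blast
 qed
next
 assume c: "ALL p<v * v. p div v ~= p mod v --> hP p : D"
 have E: "{u, w} : E" if "u : V" "w : V" "u ~= w" for u w
 proof -
  note i = step_index[of "ix u" v "ix w" v]
  have "hP (ix u * v + ix w) = (u, w)" using ix(1)[OF that(1)] ix(1)[OF that(2)] i by (simp add: hP_def)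
  moreover have "ix u ~= ix w" using ix(1) that by metis
  ultimately show ?thesis using c[rule_format, of "ix u * v + ix w"] ix(1)[OF that(1)] ix(1)[OF that(2)] i by (auto simp: D_def)
 qed
 show "ggr TYPE('d) V E"
  unfolding generically_globally_rigid_def globally_rigid_def
 proof (intro allI impI ballI)
  fix r s :: "'a => real ^ 'd" assume "ALL u w. {u, w} : E --> norm (s u - s w) = norm (r u - r w)"
  hence "norm (s u - s w) = norm (r u - r w)" if "u : V" "w : V" for u w using E[OF that] by (cases "u = w") auto
  thus "congruent_frameworks V r s" by (rule congruent_all_pairs[OF finV])
 qed
qed

text \<open>The weights stay at the rational numbers of \<open>z\<close> and only the coordinates
  vary, so both certificates are rational polynomials in the coordinates. Being nonzero at one
  point, they are nonzero at every generic framework.\<close>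

lemma ggr_sound:
 assumes vd: "d + 2 <= v" and rk: "0 < rk d v" and z: "!!j. z j : \<rat>" and c: "c1 d v ad z ~= 0" "c2 d v ad z ~= 0"
 shows "ggr TYPE('d) V E"
 unfolding generically_globally_rigid_def
proof (intro allI impI, elim conjE)
 fix r :: "'a => real ^ 'd" assume r: "generic V r"
 let ?x = "coords r"
 have gx: "Generic \<rat> (V \<times> UNIV) ?x" using r generic_iff_Generic[OF finV] unfolding coords_def by blast
 define X where "X x j = (if j < v * d then x (hS j) else z j)" for x :: "'a * 'd => real" and j
 have X: "(%x. X x j) : polyfun \<rat> (V \<times> UNIV)" for j
  using bij_betwE[OF bij_hS] z by (cases "j < v * d") (auto simp: X_def intro: polyfun_coord polyfun_const)
 have ad: "ad p : \<rat>" for p by (simp add: ad_def)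
 define x0 where "x0 j = z (inv_into {..<v * d} hS j)" for j
 have "X x0 = z" using bij_betw_imp_inj_on[OF bij_hS] by (auto simp: X_def x0_def inv_into_f_f)
 note G = gx[unfolded Generic_def, THEN bspec]
 have "c1 d v ad (X ?x) = 0 --> (ALL x. c1 d v ad (X x) = 0)" "c2 d v ad (X ?x) = 0 --> (ALL x. c2 d v ad (X x) = 0)"
  using G[OF poly_certificate(1)[where F = \<rat> and X = X and ad = ad and d = d and v = v]]
   G[OF poly_certificate(2)[where F = \<rat> and X = X and ad = ad and d = d and v = v]] X ad by auto
 hence nz: "c1 d v ad (X ?x) ~= 0" "c2 d v ad (X ?x) ~= 0" using c \<open>X x0 = z\<close> by auto
 have f: "fits ?x (X ?x)" by (simp add: fits_def X_def)
 have card: "card V >= Suc CARD('d)" using vd cardV d by simp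
 have sp: "spanning V ?x" by (rule Generic_spanning[OF finV card gx])
 note st = c1_stress[OF f sp rk nz(1)]
 show "globally_rigid V E r"
  by (rule affine_kernel_globally_rigid[OF g card r, of "om' (X ?x)", folded D_def])
   (use c1_iff(1)[OF f sp rk] c2_iff[OF sp vd st] nz st in auto)
qed

text \<open>Without infinitesimal rigidity or without a suitable stress some generic framework would
  not be globally rigid. The stress found serves as edge weights; the zeros beyond them are what
  \<open>schwartz_zippel\<close> asks of its witness.\<close>

lemma ggr_complete:
 assumes vd: "d + 2 <= v" and rk: "0 < rk d v" and ggr: "ggr TYPE('d) V E"
 shows "EX X. (ALL j>=v * d + v * v. X j = 0) & c1 d v ad X ~= 0 & c2 d v ad X ~= 0"
proof -
 obtain R :: "'a => real ^ 'd" where R: "R : frameworks V" "generic V R" using generic_framework by blast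
 let ?x = "coords R"
 have gx: "Generic \<rat> (V \<times> UNIV) ?x" using R(2) generic_iff_Generic[OF finV] unfolding coords_def by blast
 have card: "card V >= Suc CARD('d)" using vd cardV d by simp
 have r: "inf_rigid V D ?x"
  using flexible_not_globally_rigid[OF g R(2)] ggr R unfolding generically_globally_rigid_def D_def by blast
 have "EX w. stress D w ?x & affine_kernel V D w ?x"
 proof (rule ccontr)
  assume "~ ?thesis"
  then obtain x' y :: "'a * 'd => real" and e0 where x': "Generic \<rat> (V \<times> UNIV) x'" "ALL e:D. dd y e = dd x' e" "e0 : V \<times> V" "dd y e0 ~= dd x' e0"
   using large_kernels_flip[OF finV DV gx card r] by blast
  define R' :: "'a => real ^ 'd" where "R' u = (if u : V then vec_lambda (%a. x' (u, a)) else undefined)" for u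
  have co: "coords R' (u, a) = x' (u, a)" if "u : V" for u a using that by (simp add: coords_def R'_def)
  have "Generic \<rat> (V \<times> UNIV) (%(u, i). R' u $ i)"
   by (rule Generic_cong[THEN iffD1, OF _ x'(1)]) (auto simp: R'_def)
  hence R': "generic V R'" "R' : frameworks V"
   using generic_iff_Generic[OF finV, of R'] by (auto simp: R'_def frameworks_def PiE_def extensional_def)
  have dd: "dd (coords R') e = dd x' e" if "e : V \<times> V" for e using that co unfolding dd_def by (intro sum.cong refl) auto
  have "~ globally_rigid V E R'"
   by (rule not_globally_rigidI[OF g, folded D_def, of y _ e0]) (use x' dd DV in auto)
  thus False using ggr R' unfolding generically_globally_rigid_def by blast
 qed
 then obtain w where w: "stress D w ?x" "affine_kernel V D w ?x" by blast
 define X where "X j = (if j < v * d then ?x (hS j) else if j < v * d + v * v then ad (j - v * d) * w (hP (j - v * d)) else 0)" for j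
 have "fits ?x X" "!!q. q < v * v ==> X (v * d + q) = ad q * w (hP q)" by (simp_all add: fits_def X_def)
 from certificate_complete[OF this(1) Generic_spanning[OF finV card gx] rk vd r w this(2)]
 moreover have "ALL j>=v * d + v * v. X j = 0" by (simp add: X_def)
 ultimately show ?thesis by blast
qed

end

section \<open>Polynomial time and error probability\<close>

definition poly_bounded :: "(nat => nat) => bool" where "poly_bounded f <-> (EX p :: nat poly. ALL n. f n <= poly p n)"

lemma poly_bounded_const: "poly_bounded (%_. c)"
 unfolding poly_bounded_def by (intro exI[of _ "[:c:]"]) simp

lemma poly_bounded_id: "poly_bounded (%n. n)"
 unfolding poly_bounded_def by (intro exI[of _ "[:0, 1:]"]) simp

lemma poly_bounded_add: "poly_bounded f ==> poly_bounded h ==> poly_bounded (%n. f n + h n)"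
 unfolding poly_bounded_def by (elim exE, rule_tac x = "p + pa" in exI) (simp add: add_mono)

lemma poly_bounded_mult: "poly_bounded f ==> poly_bounded h ==> poly_bounded (%n. f n * h n)"
 unfolding poly_bounded_def by (elim exE, rule_tac x = "p * pa" in exI) (simp add: mult_le_mono)

lemma poly_nat_mono: "x <= y ==> poly p x <= poly p (y :: nat)"
 by (induction p) (auto intro: mult_le_mono)

text \<open>The input length is \<open>v * v\<close>, whereas time is estimated in terms of
  \<open>v\<close>.\<close>

lemma poly_bounded_square: "poly_bounded f ==> EX p. ALL v. f v <= poly p (v * v)"
 unfolding poly_bounded_def by (meson le_square le_trans poly_nat_mono)

context enumerated
begin

definition accepts where
 "accepts K rs <-> (let ad = (%p. of_bool (adjacency_bits vs E ! p) :: int); X = dec (bt K v) rs (nc K d v); N = 2 ^ tt K d v in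
   if d + 2 <= v then ~ N dvd c1 d v ad X & ~ N dvd c2 d v ad X else ALL p<v * v. p div v ~= p mod v --> adjacency_bits vs E ! p)"

lemma main_accepts:
 assumes "nc K d v <= length rs"
 shows "EX t s' r'. exec (main_prog K d) (input_store (adjacency_bits vs E)) rs t s' r' &
  t <= tm K d v * (pw (main_prog K d) * ww K d v) & (s' 0 ~= 0 <-> accepts K rs)"
 using run_main[of "adjacency_bits vs E" v d K rs] length_adjacency[of vs E] v d0 assms unfolding run_def accepts_def Let_def by blast

lemma rk_pos: "d + 2 <= v ==> 0 < rk d v"
proof -
 assume "d + 2 <= v"
 hence "d * (d + 1) < d * v" using d0 by (intro mult_strict_left_mono) simp_all
 moreover have "d * (d + 1) div 2 <= d * (d + 1)" by (rule div_le_dividend)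
 ultimately show ?thesis by (simp add: rk_def mult.commute)
qed

lemma ad_of_int: "ad = (%p. of_int (of_bool (adjacency_bits vs E ! p)))"
 by (simp add: ad_def fun_eq_iff)

lemma small_accepts: "v < d + 2 ==> accepts K rs <-> ggr TYPE('d) V E"
 unfolding ggr_small accepts_def Let_def using nth_adjacency[of _ vs E, folded v] by (simp add: hP_def D_def)

text \<open>A certificate that is nonzero modulo \<open>N\<close> is nonzero, so acceptance is never
  wrong.\<close>

lemma accepts_sound: "accepts K rs ==> ggr TYPE('d) V E"
proof (cases "d + 2 <= v")
 case True
 let ?X = "dec (bt K v) rs (nc K d v)" and ?ad = "%p. of_bool (adjacency_bits vs E ! p) :: int"
 assume "accepts K rs"
 hence "c1 d v ?ad ?X ~= 0" "c2 d v ?ad ?X ~= 0" using True by (auto simp: accepts_def Let_def)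
 thus ?thesis
  using True by (intro ggr_sound[of "%j. of_int (?X j)"] rk_pos) (simp_all only: ad_of_int of_int_certificate, simp_all)
qed (use small_accepts in auto)

text \<open>By \<open>certificate_bound\<close> a rejection means that a certificate vanishes as an
  integer, so the coins hit a zero of the product of both, which is not identically zero.\<close>

lemma accepts_complete:
 assumes ggr: "ggr TYPE('d) V E" and K: "K = 30 * d * d" and n: "nc K d v <= n"
 shows "3 * card {rs. length rs = n & ~ accepts K rs} <= 2 ^ n"
proof (cases "d + 2 <= v")
 case vd: True
 let ?b = "bt K v" and ?n = "v * d + v * v" and ?ad = "%p. of_bool (adjacency_bits vs E ! p) :: int"
  and ?D = "2 * rk d v + (v - d - 1) * (2 * rk d v + 1)"
 define G where "G X = c1 d v ad X * c2 d v ad X" for X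
 define bad where "bad = {r. length r = ?n * ?b & G (%j. of_int (dec ?b r (?n * ?b) j)) = 0}"
 obtain X where X: "ALL j>=?n. X j = 0" "G X ~= 0" using ggr_complete[OF vd rk_pos[OF vd] ggr] by (auto simp: G_def)
 have sz: "card bad * 2 ^ ?b <= ?n * ?D * 2 ^ (?n * ?b)"
  unfolding bad_def by (rule schwartz_zippel[where x = X]) (use X ldeg_certificate[OF rk_pos[OF vd] vd] in "simp_all add: G_def[abs_def]")
 have nc: "nc K d v = ?n * ?b" by (simp add: nc_def)
 have "{rs. length rs = n & ~ accepts K rs} <= (%(r, r'). r @ r') ` (bad \<times> {r. length r = n - ?n * ?b})"
 proof
  fix rs assume "rs : {rs. length rs = n & ~ accepts K rs}"
  hence rs: "length rs = n" "~ accepts K rs" by auto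
  let ?r = "take (?n * ?b) rs"
  have l: "length ?r = ?n * ?b" using rs(1) n nc by simp
  have e: "dec ?b rs (nc K d v) = dec ?b ?r (?n * ?b)" using dec_prefix[of "?n * ?b" ?r ?b "drop (?n * ?b) rs"] l nc by simp
  let ?X = "dec ?b ?r (?n * ?b)"
  have bd: "abs (c1 d v ?ad ?X) < 2 ^ tt K d v" "abs (c2 d v ?ad ?X) < 2 ^ tt K d v"
   by (intro certificate_bound dec_bound[OF l] vd d0; simp)+
  have z: "c = 0" if "(2::int) ^ tt K d v dvd c" "abs c < 2 ^ tt K d v" for c
   using that dvd_imp_le_int[of c "2 ^ tt K d v"] by auto
  have "c1 d v ?ad ?X = 0 | c2 d v ?ad ?X = 0"
   using rs(2) vd z bd unfolding accepts_def Let_def e by auto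
  hence "G (%j. of_int (?X j)) = 0" unfolding G_def ad_of_int of_int_certificate by auto
  hence "?r : bad" using l by (simp add: bad_def)
  moreover have "length (drop (?n * ?b) rs) = n - ?n * ?b" using rs(1) by simp
  ultimately show "rs : (%(r, r'). r @ r') ` (bad \<times> {r. length r = n - ?n * ?b})"
   by (intro image_eqI[of _ _ "(?r, drop (?n * ?b) rs)"]) auto
 qed
 moreover have fb: "finite bad" unfolding bad_def by (rule finite_subset[OF _ finite_lists(1)[of "?n * ?b"]]) auto
 ultimately have "card {rs. length rs = n & ~ accepts K rs} <= card (bad \<times> {r :: bool list. length r = n - ?n * ?b})"
  by (intro surj_card_le finite_cartesian_product finite_lists(1))
 hence c: "card {rs. length rs = n & ~ accepts K rs} <= card bad * 2 ^ (n - ?n * ?b)"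
  by (simp add: card_cartesian_product finite_lists(2))
 \<comment> \<open>The origin of \<open>K\<close>: the left side is at most
   \<open>3 * 2 * 5 * (v * v * d) ^ 2\<close>, while \<open>2 ^ ?b\<close> is a product of powers of
   two exceeding \<open>v * v\<close> twice and \<open>K\<close> once.\<close>
 have small: "3 * (?n * ?D) <= 2 ^ ?b"
 proof -
  have dv: "d <= v" "1 <= d" "1 <= v" using vd d0 by auto
  have r: "rk d v <= v * d" by (simp add: rk_def)
  have "?n <= 2 * (v * v * d)"
   using mult_le_mono[OF dv(3) order_refl[of "v * d"]] mult_le_mono[OF order_refl[of "v * v"] dv(2)] by (simp only: mult.assoc mult_1_left mult_1_right)
  moreover have "?D <= 5 * (v * v * d)"
  proof -
   have "?D <= 2 * (v * d) + v * (2 * (v * d) + 1)" using r by (intro add_mono mult_le_mono) auto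
   moreover have "v * d <= v * v * d" "v <= v * v * d"
    using mult_le_mono[OF dv(3) order_refl[of "v * d"]] mult_le_mono[OF le_square[of v] dv(2)] by (simp_all only: mult.assoc mult_1_left mult_1_right)
   moreover have "v * (2 * (v * d) + 1) = 2 * (v * v * d) + v" by (simp add: algebra_simps)
   ultimately show ?thesis by linarith
  qed
  ultimately have "?n * ?D <= 2 * (v * v * d) * (5 * (v * v * d))" by (rule mult_le_mono)
  hence "3 * (?n * ?D) <= (v * v) * (v * v) * K" by (simp add: K algebra_simps)
  also have "... <= 2 ^ (v * v) * 2 ^ (v * v) * 2 ^ K" by (intro mult_le_mono less_imp_le less_exp)
  also have "... = 2 ^ ?b" by (simp add: bt_def power_add mult_2)
  finally show ?thesis .
 qed
 have "3 * card {rs. length rs = n & ~ accepts K rs} * 2 ^ ?b <= 3 * (card bad * 2 ^ ?b) * 2 ^ (n - ?n * ?b)"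
  using mult_right_mono[OF c, of "3 * 2 ^ ?b"] by (simp add: mult_ac)
 also have "... <= 3 * (?n * ?D * 2 ^ (?n * ?b)) * 2 ^ (n - ?n * ?b)" by (intro mult_le_mono sz order_refl)
 also have "... = 3 * (?n * ?D) * 2 ^ n" using n nc by (simp add: power_add[symmetric] mult.assoc)
 also have "... <= 2 ^ ?b * 2 ^ n" by (intro mult_le_mono small order_refl)
 finally show ?thesis by simp
next
 case False
 thus ?thesis using ggr small_accepts[of K] by simp
qed

end

theorem theorem1p17:
  "\<exists>c. randomized_poly_time_decides c
     (graph_encodings (\<lambda>V E. generically_globally_rigid TYPE('d::finite) V E))
     (graph_encodings (\<lambda>V E. \<not> generically_globally_rigid TYPE('d) V E))"
proof -
 let ?A = "graph_encodings (%V E. ~ ggr TYPE('d) V E)"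
 define d where "d = CARD('d)"
 define K where "K = 30 * d * d"
 let ?c = "main_prog K d"
 \<comment> \<open>Coins and time are added, so that a single polynomial bounds both the tosses
   supplied and the running time.\<close>
 let ?f = "%v. nc K d v + tm K d v * (pw ?c * ww K d v)"
 obtain h :: "nat => 'd" where h: "bij_betw h {..<d} UNIV"
  using ex_bij_betw_nat_finite[of "UNIV :: 'd set"] by (auto simp: d_def atLeast0LessThan)
 have "poly_bounded ?f"
  unfolding nc_def tm_def ww_def tt_def e1_def e2_def bt_def Suc_eq_plus1
  by (intro poly_bounded_add poly_bounded_mult poly_bounded_const poly_bounded_id)
 from poly_bounded_square[OF this] obtain p where p: "!!v. ?f v <= poly p (v * v)" by blast
 have main: "(ALL r:{r. length r = n}. halts_within n ?c x r) &
   (P --> measure_pmf.prob (pmf_of_set {r. length r = n}) {r. answers ?c x r True} >= 2 / 3) &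
   (~ P --> measure_pmf.prob (pmf_of_set {r. length r = n}) {r. answers ?c x r False} >= 2 / 3)"
  if a: "n = poly p (length x)" "x = adjacency_bits vs E" "graph V E" "distinct vs" "set vs = V"
   "P = ggr TYPE('d) V E" for n x vs P and V :: "nat set" and E
 proof -
  define v where "v = length vs"
  interpret enumerated V E vs h d v
   by unfold_locales (use a h in "auto simp: v_def d_def")
  have n: "?f v <= n" using p[of v] by (simp add: a(1,2) length_adjacency v_def)
  have e: "EX t s' r'. exec ?c (input_store x) r t s' r' & t <= n & (s' 0 ~= 0 <-> accepts K r)" if "length r = n" for r
   using main_accepts[of K r] n that unfolding a(2) by (meson add_leE le_trans)
  have ans: "answers ?c x r b <-> (b <-> accepts K r)" if "length r = n" for r b
   using e[OF that] exec_deterministic unfolding answers_def by metis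
  have ne: "{r :: bool list. length r = n} ~= {}" by (auto intro: exI[of _ "replicate n True"])
  have pr: "measure_pmf.prob (pmf_of_set {r. length r = n}) {r. answers ?c x r b} =
    card {r. length r = n & (b <-> accepts K r)} / 2 ^ n" for b
   unfolding measure_pmf_of_set[OF ne finite_lists(1)] finite_lists(2)
   by (auto intro!: arg_cong[of _ _ card] simp: ans)
  have "2 / 3 <= card {r. length r = n & accepts K r} / (2 ^ n :: real)" if P
  proof -
   have "3 * card {r. length r = n & ~ accepts K r} <= 2 ^ n"
    using accepts_complete[OF _ K_def] that a(6) n by simp
   moreover have "card {r. length r = n & accepts K r} + card {r. length r = n & ~ accepts K r} = 2 ^ n"
    unfolding finite_lists(2)[symmetric, of n]
    by (subst card_Un_disjoint[symmetric]) (auto intro: finite_subset[OF _ finite_lists(1)[of n]] arg_cong[of _ _ card])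
   ultimately have "2 * 2 ^ n <= 3 * card {r. length r = n & accepts K r}" by linarith
   hence "real (2 * 2 ^ n) <= real (3 * card {r. length r = n & accepts K r})" by (simp only: of_nat_le_iff)
   thus ?thesis by (simp add: field_simps)
  qed
  moreover have "2 / 3 <= card {r. length r = n & ~ accepts K r} / (2 ^ n :: real)" if "~ P"
  using accepts_sound[of K] that a(6) by (fastforce simp: finite_lists(2))
  moreover have "halts_within n ?c x r" if "length r = n" for r using e[OF that] unfolding halts_within_def by blast
  ultimately show ?thesis unfolding pr by simp
 qed
 have "randomized_poly_time_decides ?c
   (graph_encodings (%V E. ggr TYPE('d::finite) V E))
   (?A)"
  unfolding randomized_poly_time_decides_def Let_def
 proof (intro exI[of _ p] ballI)
  fix x :: "bool list"
  let ?n = "poly p (length x)"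
  let ?Y = "graph_encodings (%V E. ggr TYPE('d) V E)" and ?N = "?A"
  have Y: "(ALL r:{r. length r = ?n}. halts_within ?n ?c x r) & measure_pmf.prob (pmf_of_set {r. length r = ?n}) {r. answers ?c x r True} >= 2 / 3" if "x : ?Y"
   using that unfolding graph_encodings_def by (elim CollectE exE conjE) (drule (3) main[OF refl], use refl in auto)
  have N: "(ALL r:{r. length r = ?n}. halts_within ?n ?c x r) & measure_pmf.prob (pmf_of_set {r. length r = ?n}) {r. answers ?c x r False} >= 2 / 3" if "x : ?N"
   using that unfolding graph_encodings_def by (elim CollectE exE conjE) (drule (3) main[OF refl], use refl in auto)
  assume "x : ?Y Un ?N"
  thus "(ALL r:{r. length r = ?n}. halts_within ?n ?c x r) &
   (x : ?Y --> measure_pmf.prob (pmf_of_set {r. length r = ?n}) {r. answers ?c x r True} >= 2 / 3) &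
   (x : ?N --> measure_pmf.prob (pmf_of_set {r. length r = ?n}) {r. answers ?c x r False} >= 2 / 3)"
   using Y N by blast
 qed
 thus ?thesis by blast
qed

end
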